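(* Let $X,Y$ be complex manifolds of dimensions $n\le p$ and let $f\colon X\to Y$ be a stable finite holomorphic map. Set-theoretically, the singular locus of $D^2(f)$ is $$\{(x,x)\in X^2\mid x\in\widehat\Sigma^2(f)\}.$$
   Context: $\widehat\Sigma^2(f)\subseteq X$ is the set of points $x$ at which $f$ has corank $\ge 2$, i.e. $\dim\ker df_x\ge2$. Stability. A multigerm $f\colon(\mathbb C^n,A)\to(\mathbb C^p,0)$ ($A$ finite) is stable if each of its unfoldings $F(s,x)=(s,f_s(x))$, $s\in(\mathbb C^r,0)$, $f_0=f$, is trivial, i.e. $\Psi\circ F\circ\Phi^{-1}=\mathrm{id}\times f$ for some biholomorphic unfoldings $\Phi,\Psi$ of the identities. A finite map $f\colon X\to Y$ is stable if for every $y\in f(X)$ the multigerm of $f$ at $f^{-1}(y)$ is stable (stability is defined only for finite maps). For a stable map $f$, the double point space $D^2(f)$ is the analytic closure in $X^2$, with the reduced complex structure, of the set of strict double points $\{(x,x')\in X^2\mid x\neq x',\ f(x)=f(x')\}$. *)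

theory Defs
  imports "HOL-Complex_Analysis.Complex_Analysis" "HOL-Library.Function_Algebras"
begin

section \<open>Coordinate spaces and holomorphic maps between them\<close>

text \<open>Dimensions have to be quantified over inside definitions (an unfolding may have any number
  of parameters), so \<open>\<complex>\<^sup>I\<close> for a finite index set \<open>I\<close> is the set of functions supported in \<open>I\<close>,
  with the subspace topology of the product topology. The product \<open>\<complex>\<^sup>I \<times> \<complex>\<^sup>J\<close> is the coordinate
  space of the disjoint union \<open>I <+> J\<close>, and the pair \<open>(s, x)\<close> is \<open>case_sum s x\<close>.\<close>

definition cspace :: "'i set \<Rightarrow> ('i \<Rightarrow> complex) set" where
  "cspace I = {z. \<forall>i. i \<notin> I \<longrightarrow> z i = 0}"

definition copen :: "'i set \<Rightarrow> ('i \<Rightarrow> complex) set \<Rightarrow> bool" where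
  "copen I U \<longleftrightarrow> openin (top_of_set (cspace I)) U"

text \<open>Holomorphy in several variables: continuous and holomorphic in each variable separately.\<close>

definition holo_fun :: "'i set \<Rightarrow> ('i \<Rightarrow> complex) set \<Rightarrow> (('i \<Rightarrow> complex) \<Rightarrow> complex) \<Rightarrow> bool" where
  "holo_fun I U g \<longleftrightarrow> copen I U \<and> continuous_on U g \<and>
     (\<forall>z\<in>U. \<forall>i\<in>I. (\<lambda>t. g (z(i := t))) holomorphic_on {t. z(i := t) \<in> U})"

definition holo_map ::
  "'i set \<Rightarrow> 'j set \<Rightarrow> ('i \<Rightarrow> complex) set \<Rightarrow> (('i \<Rightarrow> complex) \<Rightarrow> 'j \<Rightarrow> complex) \<Rightarrow> bool" where
  "holo_map I J U f \<longleftrightarrow> copen I U \<and> f ` U \<subseteq> cspace J \<and> (\<forall>j\<in>J. holo_fun I U (\<lambda>z. f z j))"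

definition biholo ::
  "'i set \<Rightarrow> 'j set \<Rightarrow> ('i \<Rightarrow> complex) set \<Rightarrow> ('j \<Rightarrow> complex) set
    \<Rightarrow> (('i \<Rightarrow> complex) \<Rightarrow> 'j \<Rightarrow> complex) \<Rightarrow> bool" where
  "biholo I J U V f \<longleftrightarrow>
     bij_betw f U V \<and> holo_map I J U f \<and> holo_map J I V (inv_into U f)"

definition cscale :: "complex \<Rightarrow> ('i \<Rightarrow> complex) \<Rightarrow> 'i \<Rightarrow> complex" where
  "cscale c v = (\<lambda>i. c * v i)"

global_interpretation cvec: vector_space "cscale :: complex \<Rightarrow> ('i \<Rightarrow> complex) \<Rightarrow> 'i \<Rightarrow> complex"
  by unfold_locales (auto simp: cscale_def fun_eq_iff algebra_simps)

definition cdiff ::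
  "'i set \<Rightarrow> (('i \<Rightarrow> complex) \<Rightarrow> 'j \<Rightarrow> complex) \<Rightarrow> ('i \<Rightarrow> complex) \<Rightarrow> ('i \<Rightarrow> complex) \<Rightarrow> 'j \<Rightarrow> complex" where
  "cdiff I f z v = (\<lambda>j. \<Sum>i\<in>I. deriv (\<lambda>t. f (z(i := t)) j) (z i) * v i)"

definition cdiff_kernel ::
  "'i set \<Rightarrow> 'j set \<Rightarrow> (('i \<Rightarrow> complex) \<Rightarrow> 'j \<Rightarrow> complex) \<Rightarrow> ('i \<Rightarrow> complex) \<Rightarrow> ('i \<Rightarrow> complex) set" where
  "cdiff_kernel I J f z = {v \<in> cspace I. \<forall>j\<in>J. cdiff I f z v j = 0}"


section \<open>Complex manifolds\<close>

type_synonym ('a, 'i) chart = "'a set \<times> ('a \<Rightarrow> 'i \<Rightarrow> complex)"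

record ('a, 'i) cmfd =
  mtop :: "'a topology"
  coords :: "'i set"
  atlas :: "('a, 'i) chart set"

abbreviation points :: "('a, 'i) cmfd \<Rightarrow> 'a set" where
  "points M \<equiv> topspace (mtop M)"

definition cdim :: "('a, 'i) cmfd \<Rightarrow> nat" where
  "cdim M = card (coords M)"

definition top_chart :: "'a topology \<Rightarrow> 'i set \<Rightarrow> ('a, 'i) chart \<Rightarrow> bool" where
  "top_chart T I = (\<lambda>(U, \<phi>). openin T U \<and> copen I (\<phi> ` U) \<and>
     homeomorphic_map (subtopology T U) (top_of_set (\<phi> ` U)) \<phi>)"

definition compatible :: "'i set \<Rightarrow> ('a, 'i) chart \<Rightarrow> ('a, 'i) chart \<Rightarrow> bool" where
  "compatible I = (\<lambda>(U, \<phi>) (V, \<psi>).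
     biholo I I (\<phi> ` (U \<inter> V)) (\<psi> ` (U \<inter> V)) (\<psi> \<circ> inv_into U \<phi>))"

definition complex_manifold :: "('a, 'i) cmfd \<Rightarrow> bool" where
  "complex_manifold M \<longleftrightarrow>
     Hausdorff_space (mtop M) \<and> second_countable (mtop M) \<and> finite (coords M) \<and>
     (\<forall>c\<in>atlas M. top_chart (mtop M) (coords M) c) \<and>
     (\<forall>c\<in>atlas M. \<forall>d\<in>atlas M. compatible (coords M) c d) \<and>
     points M = (\<Union>(U, \<phi>)\<in>atlas M. U)"

text \<open>Members of the maximal atlas. Their domain need not be connected, so a finite set of points
  of a manifold lies in the domain of a single one of them.\<close>

definition holo_chart :: "('a, 'i) cmfd \<Rightarrow> ('a, 'i) chart \<Rightarrow> bool" where
  "holo_chart M c \<longleftrightarrow>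
     top_chart (mtop M) (coords M) c \<and> (\<forall>d\<in>atlas M. compatible (coords M) c d)"

definition cmfd_prod :: "('a, 'i) cmfd \<Rightarrow> ('b, 'j) cmfd \<Rightarrow> ('a \<times> 'b, 'i + 'j) cmfd" where
  "cmfd_prod M N =
     \<lparr>mtop = prod_topology (mtop M) (mtop N),
      coords = coords M <+> coords N,
      atlas = {(U \<times> V, \<lambda>(x, y). case_sum (\<phi> x) (\<psi> y)) |U \<phi> V \<psi>.
                 (U, \<phi>) \<in> atlas M \<and> (V, \<psi>) \<in> atlas N}\<rparr>"

definition holomorphic_map :: "('a, 'i) cmfd \<Rightarrow> ('b, 'j) cmfd \<Rightarrow> ('a \<Rightarrow> 'b) \<Rightarrow> bool" where
  "holomorphic_map M N f \<longleftrightarrow> continuous_map (mtop M) (mtop N) f \<and>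
     (\<forall>(U, \<phi>)\<in>atlas M. \<forall>(V, \<psi>)\<in>atlas N.
        holo_map (coords M) (coords N) (\<phi> ` (U \<inter> f -` V)) (\<psi> \<circ> f \<circ> inv_into U \<phi>))"

definition fibre :: "('a, 'i) cmfd \<Rightarrow> ('a \<Rightarrow> 'b) \<Rightarrow> 'b \<Rightarrow> 'a set" where
  "fibre M f y = {x \<in> points M. f x = y}"

definition finite_map :: "('a, 'i) cmfd \<Rightarrow> ('b, 'j) cmfd \<Rightarrow> ('a \<Rightarrow> 'b) \<Rightarrow> bool" where
  "finite_map M N f \<longleftrightarrow>
     proper_map (mtop M) (mtop N) f \<and> (\<forall>y\<in>points N. finite (fibre M f y))"

text \<open>The set of points \<open>x\<close> with \<open>dim ker df\<^sub>x \<ge> k\<close>.\<close>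

definition corank_ge_locus :: "nat \<Rightarrow> ('a, 'i) cmfd \<Rightarrow> ('b, 'j) cmfd \<Rightarrow> ('a \<Rightarrow> 'b) \<Rightarrow> 'a set" where
  "corank_ge_locus k M N f =
     {x \<in> points M. \<exists>(U, \<phi>)\<in>atlas M. \<exists>(V, \<psi>)\<in>atlas N. x \<in> U \<and> f x \<in> V \<and>
        cvec.dim (cdiff_kernel (coords M) (coords N) (\<psi> \<circ> f \<circ> inv_into U \<phi>) (\<phi> x)) \<ge> k}"


section \<open>Analytic subsets\<close>

definition analytic_subset :: "('a, 'i) cmfd \<Rightarrow> 'a set \<Rightarrow> bool" where
  "analytic_subset M Z \<longleftrightarrow> Z \<subseteq> points M \<and>
     (\<forall>x\<in>points M. \<exists>U \<phi> G. holo_chart M (U, \<phi>) \<and> x \<in> U \<and> finite G \<and>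
        (\<forall>g\<in>G. holo_fun (coords M) (\<phi> ` U) g) \<and>
        Z \<inter> U = {u \<in> U. \<forall>g\<in>G. g (\<phi> u) = 0})"

definition analytic_closure :: "('a, 'i) cmfd \<Rightarrow> 'a set \<Rightarrow> 'a set" where
  "analytic_closure M S = \<Inter>{Z. analytic_subset M Z \<and> S \<subseteq> Z}"

text \<open>A point of \<open>Z\<close> is regular if \<open>Z\<close> is near it a complex submanifold (of any dimension), that
  is, a coordinate subspace in a suitable chart.\<close>

definition regular_point :: "('a, 'i) cmfd \<Rightarrow> 'a set \<Rightarrow> 'a \<Rightarrow> bool" where
  "regular_point M Z x \<longleftrightarrow> x \<in> Z \<and>
     (\<exists>U \<phi> K. holo_chart M (U, \<phi>) \<and> x \<in> U \<and> K \<subseteq> coords M \<and>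
        \<phi> ` (Z \<inter> U) = \<phi> ` U \<inter> cspace K)"

definition singular_locus :: "('a, 'i) cmfd \<Rightarrow> 'a set \<Rightarrow> 'a set" where
  "singular_locus M Z = {x \<in> Z. \<not> regular_point M Z x}"


section \<open>Stability\<close>

text \<open>A germ is represented by a total function of which only the values near the base points
  matter.\<close>

definition multigerm ::
  "'i set \<Rightarrow> 'j set \<Rightarrow> ('i \<Rightarrow> complex) set \<Rightarrow> (('i \<Rightarrow> complex) \<Rightarrow> 'j \<Rightarrow> complex) \<Rightarrow> bool" where
  "multigerm I J A f \<longleftrightarrow> finite A \<and> (\<exists>U. A \<subseteq> U \<and> holo_map I J U f) \<and> (\<forall>a\<in>A. f a = 0)"

text \<open>The map \<open>F(s, x) = (s, f\<^sub>s(x))\<close> given by a family \<open>f\<^sub>s\<close>.\<close>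

definition total_map ::
  "(('r \<Rightarrow> complex) \<Rightarrow> ('i \<Rightarrow> complex) \<Rightarrow> 'j \<Rightarrow> complex) \<Rightarrow> ('r + 'i \<Rightarrow> complex) \<Rightarrow> 'r + 'j \<Rightarrow> complex" where
  "total_map fs z = case_sum (z \<circ> Inl) (fs (z \<circ> Inl) (z \<circ> Inr))"

definition unfolding_on ::
  "nat \<Rightarrow> 'i set \<Rightarrow> 'j set \<Rightarrow> ('i \<Rightarrow> complex) set \<Rightarrow> (('i \<Rightarrow> complex) \<Rightarrow> 'j \<Rightarrow> complex)
    \<Rightarrow> (nat + 'i \<Rightarrow> complex) set \<Rightarrow> ((nat \<Rightarrow> complex) \<Rightarrow> ('i \<Rightarrow> complex) \<Rightarrow> 'j \<Rightarrow> complex) \<Rightarrow> bool" where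
  "unfolding_on r I J A f U fs \<longleftrightarrow>
     (\<forall>a\<in>A. case_sum 0 a \<in> U) \<and>
     holo_map ({..<r} <+> I) ({..<r} <+> J) U (total_map fs) \<and>
     (\<forall>x. case_sum 0 x \<in> U \<longrightarrow> fs 0 x = f x)"

text \<open>\<open>\<Psi> \<circ> F \<circ> \<Phi>\<^sup>-\<^sup>1 = id \<times> f\<close> as germs along \<open>{0} \<times> A\<close>, where \<open>\<Phi>\<close>, \<open>\<Psi>\<close> are the total maps of
  \<open>\<phi>\<close>, \<open>\<psi>\<close>. The membership in \<open>W\<close> says that \<open>\<Psi>\<close> is applied within its domain.\<close>

definition trivial_unfolding ::
  "nat \<Rightarrow> 'i set \<Rightarrow> 'j set \<Rightarrow> ('i \<Rightarrow> complex) set \<Rightarrow> (('i \<Rightarrow> complex) \<Rightarrow> 'j \<Rightarrow> complex)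
    \<Rightarrow> ((nat \<Rightarrow> complex) \<Rightarrow> ('i \<Rightarrow> complex) \<Rightarrow> 'j \<Rightarrow> complex) \<Rightarrow> bool" where
  "trivial_unfolding r I J A f fs \<longleftrightarrow>
     (\<exists>\<phi> U U' \<psi> W W' N.
        unfolding_on r I I A id U \<phi> \<and>
        biholo ({..<r} <+> I) ({..<r} <+> I) U U' (total_map \<phi>) \<and>
        unfolding_on r J J {0} id W \<psi> \<and>
        biholo ({..<r} <+> J) ({..<r} <+> J) W W' (total_map \<psi>) \<and>
        copen ({..<r} <+> I) N \<and> (\<forall>a\<in>A. case_sum 0 a \<in> N) \<and> N \<subseteq> U' \<and>
        (\<forall>z\<in>N. total_map fs (inv_into U (total_map \<phi>) z) \<in> W \<and>
           total_map \<psi> (total_map fs (inv_into U (total_map \<phi>) z)) = total_map (\<lambda>_. f) z))"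

definition stable_multigerm ::
  "'i set \<Rightarrow> 'j set \<Rightarrow> ('i \<Rightarrow> complex) set \<Rightarrow> (('i \<Rightarrow> complex) \<Rightarrow> 'j \<Rightarrow> complex) \<Rightarrow> bool" where
  "stable_multigerm I J A f \<longleftrightarrow> multigerm I J A f \<and>
     (\<forall>r fs. (\<exists>U. unfolding_on r I J A f U fs) \<longrightarrow> trivial_unfolding r I J A f fs)"

text \<open>The multigerm of \<open>f\<close> at a fibre becomes a multigerm \<open>(\<complex>\<^sup>n, A) \<rightarrow> (\<complex>\<^sup>p, 0)\<close> through charts
  around the fibre and around \<open>y\<close>; its stability does not depend on their choice. The notion is
  meant for finite holomorphic maps only.\<close>

definition stable_map :: "('a, 'i) cmfd \<Rightarrow> ('b, 'j) cmfd \<Rightarrow> ('a \<Rightarrow> 'b) \<Rightarrow> bool" where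
  "stable_map M N f \<longleftrightarrow>
     (\<forall>y\<in>f ` points M. \<exists>U \<phi> V \<psi>.
        holo_chart M (U, \<phi>) \<and> fibre M f y \<subseteq> U \<and>
        holo_chart N (V, \<psi>) \<and> y \<in> V \<and> \<psi> y = 0 \<and>
        stable_multigerm (coords M) (coords N) (\<phi> ` fibre M f y) (\<psi> \<circ> f \<circ> inv_into U \<phi>))"


section \<open>The double point space\<close>

definition strict_double_points :: "('a, 'i) cmfd \<Rightarrow> ('a \<Rightarrow> 'b) \<Rightarrow> ('a \<times> 'a) set" where
  "strict_double_points M f =
     {(x, x'). x \<in> points M \<and> x' \<in> points M \<and> x \<noteq> x' \<and> f x = f x'}"

text \<open>Only the underlying set of the reduced space is recorded.\<close>

definition double_point_space :: "('a, 'i) cmfd \<Rightarrow> ('a \<Rightarrow> 'b) \<Rightarrow> ('a \<times> 'a) set" where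
  "double_point_space M f = analytic_closure (cmfd_prod M M) (strict_double_points M f)"

end

theory Submission
  imports Defs "Jordan_Normal_Form.Determinant"
begin

text \<open>Stability is used infinitesimally: differentiating a trivialisation of the unfolding that adds
  \<open>s h\<close> to one germ of a multigerm writes \<open>h\<close> as \<open>df(\<eta>) - \<kappa> \<circ> f\<close> there, with \<open>df(\<eta>) = \<kappa> \<circ> f\<close> at the
  other germs. For a pair \<open>x \<noteq> x'\<close> with \<open>f x = f x'\<close>, constant \<open>h\<close> show that \<open>f z - f z'\<close> is a submersion at
  \<open>(x, x')\<close>, so the double point space is smooth there.

  Near \<open>(x, x)\<close> choose coordinates in which some components of \<open>f\<close> are coordinates and all components
  have differential zero in the remaining, kernel, directions. With \<open>w = z - z'\<close> and divided
  differences \<open>M\<close>, the equation \<open>f z = f z'\<close> says that \<open>w\<close> vanishes in the former directions and that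
  \<open>M w = 0\<close> in the latter. Taking for \<open>h\<close> a single linear component shows that the Hessians of \<open>f\<close> are
  so independent that all \<open>w\<^sub>i\<close> and \<open>M\<^sub>j\<^sub>i\<close> belong to one coordinate system of \<open>X \<times> X\<close>. If there
  is one kernel direction, \<open>D\<^sup>2\<close> is therefore given by \<open>M = 0\<close> and is smooth. If there are at
  least two, then \<open>M\<close> has a row because \<open>n \<le> p\<close>, and \<open>D\<^sup>2\<close> contains curves
  \<open>w = 0, M = t E\<close> and \<open>w = t e, M = 0\<close> with \<open>E e \<noteq> 0\<close>, while a smooth space would contain a curve
  tangent to their sum, along which \<open>M w\<close> does not vanish to second order.\<close>

subsection \<open>Holomorphic functions on coordinate spaces\<close>

text \<open>The analytic closure is only given as the intersection of all analytic sets containing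
  the strict double points, so it is squeezed. From above it lies in an explicit analytic set
  \<open>Z\<close>, cut out near the diagonal by f z = f z' and the maximal minors of the full
  matrix of divided differences. Off the diagonal f z = f z' makes these minors vanish, since w is a
  nonzero kernel vector; on the diagonal the matrix is the Jacobian, and they say that the
  differential is not injective. From below, the closure is closed and contains all limits of strict
  double points. In corank one the bounds meet. In higher corank no equations of the closure are
  derived; as a regular point may have any dimension, the contradiction comes from the sum of two
  curves rather than from a dimension count.

  Holomorphy means continuity plus holomorphy in each variable, so calculus in several variables is
  derived from one variable: Cauchy estimates uniform in the other variables replace continuous
  differentiability. Independence of differentials is expressed by dual vectors, the form in which
  stability delivers it and in which functions are completed to coordinates.\<close>

definition polydisc :: "'i set \<Rightarrow> ('i \<Rightarrow> complex) \<Rightarrow> real \<Rightarrow> ('i \<Rightarrow> complex) set" where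
  "polydisc I a r = {z \<in> cspace I. \<forall>i\<in>I. dist (a i) (z i) < r}"

lemma polydisc_mono: "r \<le> s \<Longrightarrow> polydisc I a r \<subseteq> polydisc I a s"
  by (force simp: polydisc_def)

lemma mem_polydisc: "a \<in> cspace I \<Longrightarrow> 0 < r \<Longrightarrow> a \<in> polydisc I a r"
  by (auto simp: polydisc_def)

lemma polydisc_subset_cspace: "polydisc I a r \<subseteq> cspace I"
  by (auto simp: polydisc_def)

lemma copen_polydisc:
  assumes "finite I" shows "copen I (polydisc I a r)"
proof -
  have "open (\<Inter>i\<in>I. (\<lambda>z::'a\<Rightarrow>complex. z i) -` ball (a i) r)"
    using assms by (intro open_INT ballI open_vimage) auto
  moreover have "polydisc I a r = cspace I \<inter> (\<Inter>i\<in>I. (\<lambda>z. z i) -` ball (a i) r)"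
    by (auto simp: polydisc_def)
  ultimately show ?thesis
    unfolding copen_def by (auto simp: openin_open)
qed

text \<open>A basic open set of the product topology constrains finitely many coordinates. The
  radius handles those in \<open>I\<close>; outside \<open>I\<close> the points of the polydisc
  agree with \<open>a\<close> because both vanish there, which is why a centre outside
  \<open>cspace I\<close> is excepted.\<close>

lemma open_contains_polydisc:
  assumes "open T" "a \<in> T" "finite I"
  shows "\<exists>r>0. polydisc I a r \<subseteq> T \<or> a \<notin> cspace I"
proof (cases "a \<in> cspace I")
  case True
  have "openin (product_topology (\<lambda>i. euclidean) UNIV) T"
    using assms by (simp add: open_fun_def)
  from product_topology_open_contains_basis[OF this assms(2)]
  obtain X where X: "a \<in> Pi\<^sub>E UNIV X" "\<And>i. open (X i)" "finite {i. X i \<noteq> UNIV}" "Pi\<^sub>E UNIV X \<subseteq> T"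
    by auto
  have "\<forall>i. \<exists>r>0. ball (a i) r \<subseteq> X i"
    using X(1,2) by (meson PiE_mem UNIV_I open_contains_ball)
  then obtain r where r: "\<And>i. r i > 0" "\<And>i. ball (a i) (r i) \<subseteq> X i" by metis
  define s where "s = Min (insert 1 (r ` I))"
  have s: "s > 0" "\<And>i. i \<in> I \<Longrightarrow> s \<le> r i"
    using assms(3) r(1) by (auto simp: s_def)
  have "z \<in> T" if "z \<in> polydisc I a s" for z
  proof -
    have "z i \<in> X i" for i
    proof (cases "i \<in> I")
      case True
      then show ?thesis using that s(2)[OF True] r(2)[of i] by (force simp: polydisc_def)
    next
      case False
      then have "z i = a i" using that \<open>a \<in> cspace I\<close> by (auto simp: polydisc_def cspace_def)
      then show ?thesis using X(1) by auto
    qed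
    then show ?thesis using X(4) by auto
  qed
  then show ?thesis using s(1) by blast
qed (auto intro: exI[of _ 1])

text \<open>For finite \<open>I\<close> the polydiscs form a neighbourhood basis, so local arguments
  can run with radii instead of the product topology.\<close>

lemma copen_iff:
  assumes "finite I"
  shows "copen I U \<longleftrightarrow> U \<subseteq> cspace I \<and> (\<forall>a\<in>U. \<exists>r>0. polydisc I a r \<subseteq> U)"
proof safe
  fix a assume "copen I U" "a \<in> U"
  then obtain T where T: "open T" "U = cspace I \<inter> T" by (auto simp: copen_def openin_open)
  with open_contains_polydisc[of T a I] \<open>a \<in> U\<close> assms
  obtain r where "r > 0" "polydisc I a r \<subseteq> T" by auto
  then show "\<exists>r>0. polydisc I a r \<subseteq> U" using T polydisc_subset_cspace by blast
next
  fix a assume "copen I U" "a \<in> U"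
  then show "a \<in> cspace I" by (auto simp: copen_def openin_open)
next
  assume U: "U \<subseteq> cspace I" "\<forall>a\<in>U. \<exists>r>0. polydisc I a r \<subseteq> U"
  then obtain r where r: "\<And>a. a \<in> U \<Longrightarrow> r a > 0 \<and> polydisc I a (r a) \<subseteq> U" by metis
  have "U = (\<Union>a\<in>U. polydisc I a (r a))"
    using U r mem_polydisc by fastforce
  moreover have "openin (top_of_set (cspace I)) (\<Union>a\<in>U. polydisc I a (r a))"
    using copen_polydisc[OF assms] unfolding copen_def by (intro openin_Union) auto
  ultimately show "copen I U" unfolding copen_def by metis
qed

lemma copen_subset: "copen I U \<Longrightarrow> U \<subseteq> cspace I"
  by (auto simp: copen_def openin_open)

lemma copen_Int: "copen I U \<Longrightarrow> copen I V \<Longrightarrow> copen I (U \<inter> V)"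
  unfolding copen_def by (rule openin_Int)

lemma copen_Union: "(\<And>U. U \<in> K \<Longrightarrow> copen I U) \<Longrightarrow> copen I (\<Union>K)"
  unfolding copen_def by (rule openin_Union)

lemma copen_cspace: "copen I (cspace I)"
  unfolding copen_def by simp

lemma cspace_upd: "z \<in> cspace I \<Longrightarrow> i \<in> I \<Longrightarrow> z(i := t) \<in> cspace I"
  by (auto simp: cspace_def)

lemma polydisc_upd: "z \<in> polydisc I a r \<Longrightarrow> i \<in> I \<Longrightarrow> dist (a i) t < r \<Longrightarrow> z(i := t) \<in> polydisc I a r"
  by (auto simp: polydisc_def cspace_upd)

section \<open>One-variable slices depending on parameters\<close>

lemma continuous_on_upd:
  "continuous_on UNIV (\<lambda>x::('i \<Rightarrow> 'a::topological_space) \<times> 'a. (fst x)(i := snd x))"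
proof (rule continuous_on_coordinatewise_then_product)
  fix j show "continuous_on UNIV (\<lambda>x::('i \<Rightarrow> 'a) \<times> 'a. ((fst x)(i := snd x)) j)"
    using continuous_on_product_then_coordinatewise[OF continuous_on_fst[OF continuous_on_id], of UNIV j]
      continuous_on_snd[OF continuous_on_id, of UNIV]
    by (cases "j = i") auto
qed

lemma continuous_on_slice:
  assumes "continuous_on U g" "\<And>z t. z \<in> P \<Longrightarrow> t \<in> T \<Longrightarrow> z(i := t) \<in> U"
  shows "continuous_on (P \<times> T) (\<lambda>(z, t). g (z(i := t)))"
proof -
  have "continuous_on (P \<times> T) (\<lambda>x. g ((fst x)(i := snd x)))"
    by (rule continuous_on_compose2[OF assms(1)])
       (use assms(2) in \<open>auto intro: continuous_on_subset[OF continuous_on_upd]\<close>)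
  then show ?thesis by (simp add: case_prod_beta')
qed

lemma open_slice:
  assumes "copen I U" "i \<in> I" "finite I"
  shows "open {t. z(i := t) \<in> U}"
  unfolding open_contains_ball
proof safe
  fix t assume t: "z(i := t) \<in> U"
  then obtain r where r: "r > 0" "polydisc I (z(i := t)) r \<subseteq> U"
    using assms(1) unfolding copen_iff[OF assms(3)] by auto
  have zt: "z(i := t) \<in> cspace I" using t assms(1) copen_subset by blast
  have "z(i := s) \<in> U" if "s \<in> ball t r" for s
  proof -
    have "z(i := s) \<in> cspace I" using cspace_upd[OF zt assms(2), of s] by simp
    then have "z(i := s) \<in> polydisc I (z(i := t)) r" using that r(1) by (auto simp: polydisc_def)
    then show ?thesis using r by blast
  qed
  then show "\<exists>e>0. ball t e \<subseteq> {t. z(i := t) \<in> U}" using r(1) by blast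
qed

text \<open>Compactness of a closed disc around \<open>t0\<close> makes \<open>H p\<close> uniformly
  close to \<open>H p0\<close> for \<open>p\<close> near \<open>p0\<close>; Cauchy's inequality
  passes this on to the derivatives, and the mean value inequality turns it into a difference
  estimate. The result is strict differentiability in \<open>t\<close>, uniform in the parameter,
  although only continuity in the parameter is given.\<close>

lemma strict_partial:
  fixes H :: "'p::topological_space \<Rightarrow> complex \<Rightarrow> complex"
  assumes "open T" and cont: "continuous_on (P \<times> T) (\<lambda>(p, t). H p t)"
    and hol: "\<And>p. p \<in> P \<Longrightarrow> H p holomorphic_on T"
    and p0: "p0 \<in> P" and t0: "t0 \<in> T" and "e > 0"
  obtains X0 d where "open X0" "p0 \<in> X0" "d > 0" "ball t0 d \<subseteq> T"
    "\<And>p t. p \<in> X0 \<inter> P \<Longrightarrow> t \<in> ball t0 d \<Longrightarrow> norm (deriv (H p) t - deriv (H p0) t0) \<le> e"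
    "\<And>p t t'. p \<in> X0 \<inter> P \<Longrightarrow> t \<in> ball t0 d \<Longrightarrow> t' \<in> ball t0 d \<Longrightarrow>
       norm (H p t - H p t' - deriv (H p0) t0 * (t - t')) \<le> e * norm (t - t')"
proof -
  obtain r where r: "r > 0" "cball t0 r \<subseteq> T"
    using \<open>open T\<close> t0 open_contains_cball by blast
  have "continuous_on (P \<times> cball t0 r) (\<lambda>(p, t). H p t)"
    by (rule continuous_on_subset[OF cont]) (use r in auto)
  \<comment> \<open>The bound \<open>e * r / 8\<close> becomes 3/8 of \<open>e\<close>, hence at
    most \<open>e / 2\<close>, after Cauchy's inequality on discs of radius \<open>r / 3\<close>;
    the other half of \<open>e\<close> is spent on the continuity of
    \<open>deriv (H p0)\<close>.\<close>
  then obtain X0 where X0: "p0 \<in> X0" "open X0"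
    "\<forall>p\<in>X0 \<inter> P. \<forall>t\<in>cball t0 r. dist (case (p, t) of (p, t) \<Rightarrow> H p t) (case (p0, t) of (p, t) \<Rightarrow> H p t) \<le> e * r / 8"
    using continuous_on_prod_compactE[of P "cball t0 r" "\<lambda>(p, t). H p t" p0 "e * r / 8"] p0 \<open>e > 0\<close> r(1)
    by (metis compact_cball divide_pos_pos mult_pos_pos zero_less_numeral)
  have "isCont (deriv (H p0)) t0"
    using holomorphic_deriv[OF hol[OF p0] \<open>open T\<close>] t0 \<open>open T\<close>
    using continuous_on_eq_continuous_at holomorphic_on_imp_continuous_on by blast
  then obtain d1 where d1: "d1 > 0" "\<And>t. dist t t0 < d1 \<Longrightarrow> dist (deriv (H p0) t) (deriv (H p0) t0) < e / 2"
    using \<open>e > 0\<close> unfolding continuous_at_eps_delta by (metis half_gt_zero)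
  \<comment> \<open>Points closer than \<open>r / 2\<close> to \<open>t0\<close>, widened by discs
    of radius \<open>r / 3\<close>, stay in the disc of radius \<open>r\<close>.\<close>
  define d where "d = min d1 (r / 2)"
  have d: "d > 0" "d \<le> r / 2" "ball t0 d \<subseteq> T"
    using d1 r by (auto simp: d_def)
  have holr: "H p holomorphic_on ball t0 r" if "p \<in> P" for p
    using hol[OF that] r(2) by (meson ball_subset_cball holomorphic_on_subset subset_trans)
  have dH: "(H p has_field_derivative deriv (H p) t) (at t)" if "p \<in> P" "t \<in> T" for p t
    using hol[OF that(1)] that(2) \<open>open T\<close> by (simp add: holomorphic_derivI)
  have D1: "norm (deriv (H p) t - deriv (H p0) t) \<le> e / 2"
    if p: "p \<in> X0 \<inter> P" and t: "t \<in> ball t0 d" for p t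
  proof -
    have sub: "cball t (r/3) \<subseteq> cball t0 r"
    proof
      fix s assume "s \<in> cball t (r/3)"
      then show "s \<in> cball t0 r" using t d(2) r(1) dist_triangle[of t0 s t] by auto
    qed
    have holp: "(\<lambda>s. H p s - H p0 s) holomorphic_on T"
      using hol p p0 by (intro holomorphic_intros) auto
    have "norm ((deriv ^^ 1) (\<lambda>s. H p s - H p0 s) t) \<le> fact 1 * (e * r / 8) / (r/3) ^ 1"
    proof (rule Cauchy_inequality)
      show "(\<lambda>s. H p s - H p0 s) holomorphic_on ball t (r/3)"
        by (rule holomorphic_on_subset[OF holp]) (use sub r ball_subset_cball in blast)
      show "continuous_on (cball t (r/3)) (\<lambda>s. H p s - H p0 s)"
        by (rule continuous_on_subset[OF holomorphic_on_imp_continuous_on[OF holp]]) (use sub r in blast)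
      fix s assume "norm (t - s) = r/3"
      then have "s \<in> cball t0 r" using sub by (auto simp: dist_norm)
      then show "norm (H p s - H p0 s) \<le> e * r / 8" using X0(3) p by (auto simp: dist_norm)
    qed (use r in auto)
    moreover have "deriv (\<lambda>s. H p s - H p0 s) t = deriv (H p) t - deriv (H p0) t"
      by (rule DERIV_imp_deriv) (use dH p p0 t d(3) in \<open>auto intro!: derivative_intros\<close>)
    ultimately have "norm (deriv (H p) t - deriv (H p0) t) \<le> e * r / 8 / (r / 3)" by simp
    also have "\<dots> \<le> e / 2" using \<open>e > 0\<close> r(1) by (simp add: field_simps)
    finally show ?thesis .
  qed
  have D2: "norm (deriv (H p) t - deriv (H p0) t0) \<le> e"
    if p: "p \<in> X0 \<inter> P" and t: "t \<in> ball t0 d" for p t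
  proof -
    have "norm (deriv (H p) t - deriv (H p0) t0) \<le> norm (deriv (H p) t - deriv (H p0) t) + norm (deriv (H p0) t - deriv (H p0) t0)"
      using norm_triangle_ineq[of "deriv (H p) t - deriv (H p0) t" "deriv (H p0) t - deriv (H p0) t0"] by simp
    moreover have "norm (deriv (H p0) t - deriv (H p0) t0) < e / 2"
      using d1(2)[of t] t by (auto simp: d_def dist_norm norm_minus_commute)
    ultimately show ?thesis using D1[OF that] by linarith
  qed
  have D3: "norm (H p t - H p t' - deriv (H p0) t0 * (t - t')) \<le> e * norm (t - t')"
    if p: "p \<in> X0 \<inter> P" and t: "t \<in> ball t0 d" "t' \<in> ball t0 d" for p t t'
  proof -
    have "norm ((\<lambda>s. H p s - deriv (H p0) t0 * s) t - (\<lambda>s. H p s - deriv (H p0) t0 * s) t') \<le> e * norm (t - t')"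
    proof (rule field_differentiable_bound[of "ball t0 d"])
      fix s assume s: "s \<in> ball t0 d"
      show "((\<lambda>s. H p s - deriv (H p0) t0 * s) has_field_derivative (deriv (H p) s - deriv (H p0) t0)) (at s within ball t0 d)"
        by (rule DERIV_subset[where s=UNIV]) (use dH[of p s] p s d(3) in \<open>auto intro!: derivative_eq_intros\<close>)
      show "norm (deriv (H p) s - deriv (H p0) t0) \<le> e" using D2 p s by blast
    qed (use t in auto)
    then show ?thesis by (simp add: algebra_simps)
  qed
  show thesis using that[OF X0(2,1) d(1,3)] D2 D3 by blast
qed

lemma strict_partial_continuous:
  fixes H :: "'p::topological_space \<Rightarrow> complex \<Rightarrow> complex"
  assumes "open T" and cont: "continuous_on (P \<times> T) (\<lambda>(p, t). H p t)"
    and hol: "\<And>p. p \<in> P \<Longrightarrow> H p holomorphic_on T"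
  shows "continuous_on (P \<times> T) (\<lambda>(p, t). deriv (H p) t)"
  unfolding continuous_on_def
proof (rule ballI, rule tendstoI)
  fix x e assume x: "x \<in> P \<times> T" and "(e::real) > 0"
  obtain p0 t0 where [simp]: "x = (p0, t0)" and pt: "p0 \<in> P" "t0 \<in> T" using x by auto
  obtain X0 d where X: "open X0" "p0 \<in> X0" "d > 0" "ball t0 d \<subseteq> T"
    "\<And>p t. p \<in> X0 \<inter> P \<Longrightarrow> t \<in> ball t0 d \<Longrightarrow> norm (deriv (H p) t - deriv (H p0) t0) \<le> e/2"
    by (rule strict_partial[OF assms pt half_gt_zero[OF \<open>e > 0\<close>]]) auto
  have "open (X0 \<times> ball t0 d)" using X(1) by (intro open_Times) auto
  moreover have "x \<in> X0 \<times> ball t0 d" using X by auto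
  ultimately show "\<forall>\<^sub>F x' in at x within P \<times> T. dist (case x' of (p, t) \<Rightarrow> deriv (H p) t) (case x of (p, t) \<Rightarrow> deriv (H p) t) < e"
    unfolding eventually_at_topological
  proof (intro exI conjI ballI impI)
    fix x' assume "x' \<in> X0 \<times> ball t0 d" "x' \<in> P \<times> T"
    with X(5)[of "fst x'" "snd x'"] \<open>e > 0\<close>
    show "dist (case x' of (p, t) \<Rightarrow> deriv (H p) t) (case x of (p, t) \<Rightarrow> deriv (H p) t) < e"
      by (auto simp: dist_norm)
  qed
qed

section \<open>Partial derivatives and the chain rule\<close>

definition pd :: "'i \<Rightarrow> (('i \<Rightarrow> complex) \<Rightarrow> complex) \<Rightarrow> ('i \<Rightarrow> complex) \<Rightarrow> complex" where
  "pd i g z = deriv (\<lambda>t. g (z(i := t))) (z i)"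

lemma cdiff_pd: "cdiff I f z v j = (\<Sum>i\<in>I. pd i (\<lambda>z. f z j) z * v i)"
  by (simp add: cdiff_def pd_def)

lemma holo_funD:
  assumes "holo_fun I U g"
  shows "copen I U" "continuous_on U g" "U \<subseteq> cspace I"
    "\<And>z i. z \<in> U \<Longrightarrow> i \<in> I \<Longrightarrow> (\<lambda>t. g (z(i := t))) holomorphic_on {t. z(i := t) \<in> U}"
  using assms copen_subset[of I U] by (simp_all add: holo_fun_def)

lemma holo_fun_pd:
  assumes "holo_fun I U g" "finite I" "z \<in> U" "i \<in> I"
  shows "((\<lambda>t. g (z(i := t))) has_field_derivative pd i g z) (at (z i))"
  unfolding pd_def
  by (rule holomorphic_derivI[OF holo_funD(4)[OF assms(1,3,4)] open_slice[OF holo_funD(1)[OF assms(1)] assms(4,2)]])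
     (use assms in auto)

text \<open>A chain rule for a function \<open>D\<close> that follows \<open>k\<close> with slope
  \<open>c\<close>. The error is measured against \<open>k s - k s0\<close> instead of dividing by
  that difference, because it may vanish at points near \<open>s0\<close>.\<close>

lemma has_field_derivative_by_approx:
  fixes D k :: "complex \<Rightarrow> complex"
  assumes k: "(k has_field_derivative d) (at s0)"
    and approx: "\<And>e. e > 0 \<Longrightarrow> \<forall>\<^sub>F s in nhds s0. norm (D s - D s0 - c * (k s - k s0)) \<le> e * norm (k s - k s0)"
  shows "(D has_field_derivative c * d) (at s0)"
proof -
  have 1: "((\<lambda>s. (k s - k s0) / (s - s0)) \<longlongrightarrow> d) (at s0)"
    using k by (simp add: has_field_derivative_iff)
  have "((\<lambda>s. (D s - D s0 - c * (k s - k s0)) / (s - s0)) \<longlongrightarrow> 0) (at s0)"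
  proof (rule tendstoI)
    fix e :: real assume "e > 0"
    \<comment> \<open>The quotient of \<open>k\<close> is eventually below
      \<open>norm d + 1\<close>, so the error is at most \<open>e' * (norm d + 1)\<close>, which is
      below \<open>e\<close>.\<close>
    define e' where "e' = e / (norm d + 2)"
    have ne: "norm d + 2 > 0" by (simp add: add_nonneg_pos)
    have e': "e' > 0" "e' * (norm d + 1) < e" using \<open>e > 0\<close> ne by (auto simp: e'_def field_simps)
    have "\<forall>\<^sub>F s in at s0. norm ((k s - k s0) / (s - s0)) < norm d + 1"
      using tendsto_norm[OF 1] by (rule order_tendstoD) simp
    moreover have "\<forall>\<^sub>F s in at s0. norm (D s - D s0 - c * (k s - k s0)) \<le> e' * norm (k s - k s0)"
      using approx[OF e'(1)] eventually_at_filter eventually_mono by (simp add: eventually_at_filter eventually_mono)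
    ultimately show "\<forall>\<^sub>F s in at s0. dist ((D s - D s0 - c * (k s - k s0)) / (s - s0)) 0 < e"
    proof eventually_elim
      case (elim s)
      have "norm (D s - D s0 - c * (k s - k s0)) / norm (s - s0) \<le> e' * norm (k s - k s0) / norm (s - s0)"
        using elim(2) by (rule divide_right_mono) simp
      also have "\<dots> = e' * norm ((k s - k s0) / (s - s0))" by (simp add: norm_divide)
      also have "\<dots> \<le> e' * (norm d + 1)" using elim(1) e'(1) by (intro mult_left_mono) auto
      finally show ?case using e'(2) by (simp add: norm_divide)
    qed
  qed
  from tendsto_add[OF this tendsto_mult[OF tendsto_const[of c] 1]]
  have "((\<lambda>s. (D s - D s0 - c * (k s - k s0)) / (s - s0) + c * ((k s - k s0) / (s - s0))) \<longlongrightarrow> c * d) (at s0)"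
    by simp
  moreover have "(\<lambda>s. (D s - D s0 - c * (k s - k s0)) / (s - s0) + c * ((k s - k s0) / (s - s0))) = (\<lambda>s. (D s - D s0) / (s - s0))"
    by (simp add: fun_eq_iff diff_divide_distrib right_diff_distrib)
  ultimately show ?thesis by (simp add: has_field_derivative_iff)
qed

lemma eventually_polydisc:
  assumes "finite I" "\<And>i. i \<in> I \<Longrightarrow> isCont (\<lambda>s. \<gamma> s i) s0" "0 < r"
    "\<forall>\<^sub>F s in nhds s0. \<gamma> s \<in> cspace I"
  shows "\<forall>\<^sub>F s in nhds s0. \<gamma> s \<in> polydisc I (\<gamma> s0) r"
proof -
  have "\<forall>\<^sub>F s in nhds s0. \<forall>i\<in>I. dist (\<gamma> s i) (\<gamma> s0 i) < r"
  proof (intro eventually_ball_finite[OF assms(1)] ballI)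
    fix i assume "i \<in> I"
    from assms(2)[OF this] have "((\<lambda>s. \<gamma> s i) \<longlongrightarrow> \<gamma> s0 i) (nhds s0)"
      by (simp add: isCont_def tendsto_nhds_iff)
    then show "\<forall>\<^sub>F s in nhds s0. dist (\<gamma> s i) (\<gamma> s0 i) < r"
      using assms(3) by (rule tendstoD)
  qed
  with assms(4) show ?thesis by eventually_elim (auto simp: polydisc_def dist_commute)
qed

text \<open>Induction on the set \<open>F\<close> of coordinates in which the curve moves. Freezing
  coordinate \<open>k\<close> gives a curve covered by the induction hypothesis. The remaining
  difference changes one coordinate only, but its estimate has to be uniform in the others, which
  move at the same time; this is what \<open>strict_partial\<close> provides.\<close>

lemma chain_rule_aux:
  assumes g: "holo_fun I U g" and fin: "finite I" and "finite F" "F \<subseteq> I"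
    and "\<forall>\<^sub>F s in nhds s0. \<gamma> s \<in> U"
    and "\<And>i. i \<in> F \<Longrightarrow> ((\<lambda>s. \<gamma> s i) has_field_derivative d i) (at s0)"
    and "\<And>i s. i \<notin> F \<Longrightarrow> \<gamma> s i = \<gamma> s0 i"
  shows "((\<lambda>s. g (\<gamma> s)) has_field_derivative (\<Sum>i\<in>F. pd i g (\<gamma> s0) * d i)) (at s0)"
  using assms(3-7)
proof (induction F arbitrary: \<gamma> rule: finite_induct)
  case empty
  have eq: "\<gamma> s = \<gamma> s0" for s by (rule ext) (use empty(4) in blast)
  have c: "(\<lambda>s. g (\<gamma> s)) = (\<lambda>_. g (\<gamma> s0))" by (rule ext) (rule arg_cong[OF eq])
  have "((\<lambda>s. g (\<gamma> s)) has_field_derivative 0) (at s0)" by (subst c) (rule DERIV_const)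
  then show ?case by (simp only: sum.empty)
next
  case (insert k F)
  define a where "a = \<gamma> s0"
  define \<gamma>' where "\<gamma>' = (\<lambda>s. (\<gamma> s)(k := a k))"
  have aU: "a \<in> U" unfolding a_def using eventually_nhds_x_imp_x[OF insert.prems(2)] .
  have kI: "k \<in> I" using insert.prems(1) by auto
  obtain r where r: "r > 0" "polydisc I a r \<subseteq> U"
    using aU holo_funD(1)[OF g] unfolding copen_iff[OF fin] by auto
  have aI: "a \<in> cspace I" using aU holo_funD(3)[OF g] by blast
  have cont: "isCont (\<lambda>s. \<gamma> s i) s0" for i
  proof (cases "i \<in> insert k F")
    case True then show ?thesis using insert.prems(3) DERIV_isCont by blast
  next
    case False
    then have eq: "(\<lambda>s. \<gamma> s i) = (\<lambda>s. \<gamma> s0 i)" using insert.prems(4) by blast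
    show ?thesis by (subst eq) (rule continuous_const)
  qed
  have cont': "isCont (\<lambda>s. \<gamma>' s i) s0" for i using cont[of i] by (cases "i = k") (auto simp: \<gamma>'_def)
  have \<gamma>'0: "\<gamma>' s0 = a" by (simp add: \<gamma>'_def a_def)
  have evI: "\<forall>\<^sub>F s in nhds s0. \<gamma> s \<in> cspace I"
    using insert.prems(2) by eventually_elim (use holo_funD(3)[OF g] in blast)
  have ev: "\<forall>\<^sub>F s in nhds s0. \<gamma> s \<in> polydisc I a \<epsilon>" if "\<epsilon> > 0" for \<epsilon>
    unfolding a_def by (rule eventually_polydisc[OF fin cont that evI])
  have ev': "\<forall>\<^sub>F s in nhds s0. \<gamma>' s \<in> polydisc I a \<epsilon>" if "\<epsilon> > 0" for \<epsilon>
    using ev[OF that] by eventually_elim (use that kI in \<open>auto simp: \<gamma>'_def intro!: polydisc_upd\<close>)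
  have 1: "((\<lambda>s. g (\<gamma>' s)) has_field_derivative (\<Sum>i\<in>F. pd i g (\<gamma>' s0) * d i)) (at s0)"
  proof (rule insert.IH)
    show "F \<subseteq> I" using insert.prems(1) by auto
    show "\<forall>\<^sub>F s in nhds s0. \<gamma>' s \<in> U" using ev'[OF r(1)] by eventually_elim (use r in blast)
    show "((\<lambda>s. \<gamma>' s i) has_field_derivative d i) (at s0)" if "i \<in> F" for i
    proof -
      have "i \<noteq> k" using that insert.hyps(2) by blast
      then have "(\<lambda>s. \<gamma>' s i) = (\<lambda>s. \<gamma> s i)" by (simp add: \<gamma>'_def)
      then show ?thesis using insert.prems(3)[of i] that by simp
    qed
    show "\<gamma>' s i = \<gamma>' s0 i" if "i \<notin> F" for i s
      using that insert.prems(4)[of i s] by (cases "i = k") (auto simp: \<gamma>'_def a_def)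
  qed
  have 2: "((\<lambda>s. g (\<gamma> s) - g (\<gamma>' s)) has_field_derivative pd k g a * d k) (at s0)"
  proof (rule has_field_derivative_by_approx)
    show "((\<lambda>s. \<gamma> s k) has_field_derivative d k) (at s0)" using insert.prems(3) by simp
    fix e :: real assume "e > 0"
    have inU: "z(k := t) \<in> U" if "z \<in> polydisc I a r" "t \<in> ball (a k) r" for z t
      using polydisc_upd[OF that(1) kI, of t] that(2) r by auto
    have slc: "continuous_on (polydisc I a r \<times> ball (a k) r) (\<lambda>(z, t). g (z(k := t)))"
      by (rule continuous_on_slice[OF holo_funD(2)[OF g] inU])
    have slh: "(\<lambda>t. g (p(k := t))) holomorphic_on ball (a k) r" if "p \<in> polydisc I a r" for p
      by (rule holomorphic_on_subset[OF holo_funD(4)[OF g _ kI]]) (use that r inU in auto)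
    obtain X0 \<delta> where X: "open X0" "a \<in> X0" "\<delta> > 0" "ball (a k) \<delta> \<subseteq> ball (a k) r"
      "\<And>p t t'. p \<in> X0 \<inter> polydisc I a r \<Longrightarrow> t \<in> ball (a k) \<delta> \<Longrightarrow> t' \<in> ball (a k) \<delta> \<Longrightarrow>
       norm (g (p(k := t)) - g (p(k := t')) - deriv (\<lambda>t. g (a(k := t))) (a k) * (t - t')) \<le> e * norm (t - t')"
      by (rule strict_partial[OF open_ball slc slh mem_polydisc[OF aI r(1)] _ \<open>e > 0\<close>]) (use r in auto)
    obtain \<epsilon> where \<epsilon>: "\<epsilon> > 0" "polydisc I a \<epsilon> \<subseteq> X0"
      using open_contains_polydisc[OF X(1,2) fin] aI by blast
    have "\<forall>\<^sub>F s in nhds s0. \<gamma> s \<in> polydisc I a (min \<delta> r)" using ev X(3) r(1) by simp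
    moreover have "\<forall>\<^sub>F s in nhds s0. \<gamma>' s \<in> polydisc I a (min \<epsilon> r)" using ev' \<epsilon>(1) r(1) by simp
    ultimately show "\<forall>\<^sub>F s in nhds s0. norm (g (\<gamma> s) - g (\<gamma>' s) - (g (\<gamma> s0) - g (\<gamma>' s0)) - pd k g a * (\<gamma> s k - \<gamma> s0 k))
        \<le> e * norm (\<gamma> s k - \<gamma> s0 k)"
    proof eventually_elim
      case (elim s)
      have p: "\<gamma>' s \<in> X0 \<inter> polydisc I a r" using elim(2) \<epsilon> polydisc_mono[of "min \<epsilon> r" r I a] polydisc_mono[of "min \<epsilon> r" \<epsilon> I a] by auto
      have t: "\<gamma> s k \<in> ball (a k) \<delta>" using elim(1) kI by (auto simp: polydisc_def)
      have t': "a k \<in> ball (a k) \<delta>" using X(3) by simp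
      have "(\<gamma>' s)(k := \<gamma> s k) = \<gamma> s" "(\<gamma>' s)(k := a k) = \<gamma>' s" by (auto simp: \<gamma>'_def)
      with X(5)[OF p t t'] show ?case by (simp add: pd_def a_def \<gamma>'_def)
    qed
  qed
  from DERIV_add[OF 1 2] show ?case
    using insert.hyps by (simp add: \<gamma>'0 a_def add.commute)
qed

lemma chain_rule:
  assumes g: "holo_fun I U g" and fin: "finite I"
    and \<gamma>: "\<forall>\<^sub>F s in nhds s0. \<gamma> s \<in> U"
    and d: "\<And>i. i \<in> I \<Longrightarrow> ((\<lambda>s. \<gamma> s i) has_field_derivative d i) (at s0)"
  shows "((\<lambda>s. g (\<gamma> s)) has_field_derivative (\<Sum>i\<in>I. pd i g (\<gamma> s0) * d i)) (at s0)"
proof -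
  \<comment> \<open>The auxiliary lemma asks for coordinates outside \<open>I\<close> that are
    constant for all \<open>s\<close>, whereas \<gamma> is known to lie in \<open>cspace I\<close>
    only near \<open>s0\<close>.\<close>
  define \<gamma>' where "\<gamma>' = (\<lambda>s i. if i \<in> I then \<gamma> s i else 0)"
  have eq: "\<gamma>' s = \<gamma> s" if "\<gamma> s \<in> U" for s
    using that holo_funD(3)[OF g] by (auto simp: \<gamma>'_def cspace_def fun_eq_iff)
  have ev: "\<forall>\<^sub>F s in nhds s0. \<gamma>' s = \<gamma> s" using \<gamma> by eventually_elim (rule eq)
  then have 0: "\<gamma>' s0 = \<gamma> s0" by (rule eventually_nhds_x_imp_x)
  have "((\<lambda>s. g (\<gamma>' s)) has_field_derivative (\<Sum>i\<in>I. pd i g (\<gamma>' s0) * d i)) (at s0)"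
    by (rule chain_rule_aux[OF g fin fin order_refl])
       (use \<gamma> ev d in \<open>auto simp: \<gamma>'_def elim: eventually_elim2\<close>)
  moreover have "\<forall>\<^sub>F s in nhds s0. g (\<gamma>' s) = g (\<gamma> s)" using ev by eventually_elim simp
  ultimately show ?thesis
    using DERIV_cong_ev[of s0 s0 "\<lambda>s. g (\<gamma>' s)" "\<lambda>s. g (\<gamma> s)"] 0 by auto
qed

section \<open>Criteria and closure properties of holomorphic functions and maps\<close>

lemma holo_funI:
  assumes "copen I U" "continuous_on U g"
    "\<And>z i. z \<in> U \<Longrightarrow> i \<in> I \<Longrightarrow> (\<lambda>t. g (z(i := t))) field_differentiable at (z i)"
  shows "holo_fun I U g"
  unfolding holo_fun_def
proof (intro conjI ballI assms(1,2))
  fix z i assume "z \<in> U" and i: "i \<in> I"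
  show "(\<lambda>t. g (z(i := t))) holomorphic_on {t. z(i := t) \<in> U}"
    unfolding holomorphic_on_def
  proof
    fix t assume "t \<in> {t. z(i := t) \<in> U}"
    then have "(\<lambda>s. g ((z(i := t))(i := s))) field_differentiable at ((z(i := t)) i)"
      by (intro assms(3) i) simp
    then show "(\<lambda>t. g (z(i := t))) field_differentiable at t within {t. z(i := t) \<in> U}"
      by (simp add: field_differentiable_at_within)
  qed
qed

lemma holo_fun_subset: "holo_fun I U g \<Longrightarrow> copen I V \<Longrightarrow> V \<subseteq> U \<Longrightarrow> holo_fun I V g"
  unfolding holo_fun_def
  by (blast intro: continuous_on_subset holomorphic_on_subset)

lemma holo_fun_cong:
  assumes "holo_fun I U g" "\<And>z. z \<in> U \<Longrightarrow> g z = h z"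
  shows "holo_fun I U h"
proof -
  have "continuous_on U h" using assms(2) holo_funD(2)[OF assms(1)] continuous_on_cong by blast
  moreover have "(\<lambda>t. h (z(i := t))) holomorphic_on {t. z(i := t) \<in> U}" if "z \<in> U" "i \<in> I" for z i
    by (rule holomorphic_transform[OF holo_funD(4)[OF assms(1) that]]) (use assms(2) in auto)
  ultimately show ?thesis using assms(1) by (auto simp: holo_fun_def)
qed

text \<open>Each neighbourhood is cut out of \<open>cspace I\<close> by an open set, so limits
  within \<open>U\<close> and within the neighbourhood agree at the point.\<close>

lemma holo_fun_local:
  assumes "\<And>a. a \<in> U \<Longrightarrow> \<exists>V\<subseteq>U. a \<in> V \<and> holo_fun I V g" and fin: "finite I"
  shows "holo_fun I U g"
proof (rule holo_funI)
  obtain V where V: "\<And>a. a \<in> U \<Longrightarrow> V a \<subseteq> U \<and> a \<in> V a \<and> holo_fun I (V a) g"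
    using assms(1) by metis
  have "U = \<Union>(V ` U)" using V by blast
  moreover have "copen I (\<Union>(V ` U))"
    by (rule copen_Union) (use V holo_funD(1) in blast)
  ultimately show U: "copen I U" by simp
  show "continuous_on U g"
    unfolding continuous_on_def
  proof
    fix a assume a: "a \<in> U"
    obtain T where T: "open T" "V a = cspace I \<inter> T"
      using V[OF a] holo_funD(1) by (metis copen_def openin_open)
    have "(g \<longlongrightarrow> g a) (at a within V a)"
      using V[OF a] holo_funD(2) unfolding continuous_on_def by blast
    moreover have "at a within U = at a within V a"
      by (rule at_within_nhd[of a T]) (use T V[OF a] copen_subset[OF U] in auto)
    ultimately show "(g \<longlongrightarrow> g a) (at a within U)" by simp
  qed
  fix z i assume "z \<in> U" "i \<in> I"
  then show "(\<lambda>t. g (z(i := t))) field_differentiable at (z i)"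
    using holo_fun_pd[of I "V z" g z i] V[of z] fin by (auto simp: field_differentiable_def)
qed

lemma holo_fun_const: "copen I U \<Longrightarrow> holo_fun I U (\<lambda>z. c)"
  by (simp add: holo_fun_def)

lemma holo_fun_proj: 
  assumes "copen I U" shows "holo_fun I U (\<lambda>z. z j)"
proof -
  have "(\<lambda>t. (z(i := t)) j) holomorphic_on A" for z i A
    by (cases "i = j") (auto intro: holomorphic_intros)
  then show ?thesis using assms by (auto simp: holo_fun_def continuous_on_product_then_coordinatewise[OF continuous_on_id])
qed

lemma holo_fun_add: "holo_fun I U g \<Longrightarrow> holo_fun I U h \<Longrightarrow> holo_fun I U (\<lambda>z. g z + h z)"
  by (auto simp: holo_fun_def intro!: continuous_intros holomorphic_intros)

lemma holo_fun_mult: "holo_fun I U g \<Longrightarrow> holo_fun I U h \<Longrightarrow> holo_fun I U (\<lambda>z. g z * h z)"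
  by (auto simp: holo_fun_def intro!: continuous_intros holomorphic_intros)

lemma holo_fun_diff: "holo_fun I U g \<Longrightarrow> holo_fun I U h \<Longrightarrow> holo_fun I U (\<lambda>z. g z - h z)"
  by (auto simp: holo_fun_def intro!: continuous_intros holomorphic_intros)

lemma holo_fun_sum:
  assumes "copen I U" "\<And>k. k \<in> K \<Longrightarrow> holo_fun I U (g k)"
  shows "holo_fun I U (\<lambda>z. \<Sum>k\<in>K. g k z)"
  using assms by (induction K rule: infinite_finite_induct) (auto intro: holo_fun_const holo_fun_add)

lemma holo_fun_prod:
  assumes "copen I U" "\<And>k. k \<in> K \<Longrightarrow> holo_fun I U (g k)"
  shows "holo_fun I U (\<lambda>z. \<Prod>k\<in>K. g k z)"
  using assms by (induction K rule: infinite_finite_induct) (auto intro: holo_fun_const holo_fun_mult)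

lemmas holo_fun_intros = holo_fun_const holo_fun_proj holo_fun_add holo_fun_mult holo_fun_diff
  holo_fun_sum holo_fun_prod

lemma holo_mapD:
  assumes "holo_map I J U f"
  shows "copen I U" "U \<subseteq> cspace I" "\<And>j. j \<in> J \<Longrightarrow> holo_fun I U (\<lambda>z. f z j)"
    "\<And>z. z \<in> U \<Longrightarrow> f z \<in> cspace J" "\<And>z j. z \<in> U \<Longrightarrow> j \<notin> J \<Longrightarrow> f z j = 0"
proof -
  show c: "copen I U" and "\<And>j. j \<in> J \<Longrightarrow> holo_fun I U (\<lambda>z. f z j)"
    and d: "\<And>z. z \<in> U \<Longrightarrow> f z \<in> cspace J"
    using assms by (auto simp: holo_map_def)
  show "U \<subseteq> cspace I" using c by (rule copen_subset)
  show "\<And>z j. z \<in> U \<Longrightarrow> j \<notin> J \<Longrightarrow> f z j = 0" using d by (auto simp: cspace_def)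
qed

lemma holo_map_component: 
  assumes "holo_map I J U f" shows "holo_fun I U (\<lambda>z. f z j)"
proof (cases "j \<in> J")
  case False
  show ?thesis
    by (rule holo_fun_cong[OF holo_fun_const[OF holo_mapD(1)[OF assms], of 0]])
       (use holo_mapD(5)[OF assms _ False] in simp)
qed (rule holo_mapD(3)[OF assms])

lemma holo_map_continuous: "holo_map I J U f \<Longrightarrow> continuous_on U f"
  by (rule continuous_on_coordinatewise_then_product) (rule holo_funD(2)[OF holo_map_component])

lemma holo_map_subset: "holo_map I J U f \<Longrightarrow> copen I V \<Longrightarrow> V \<subseteq> U \<Longrightarrow> holo_map I J V f"
  unfolding holo_map_def by (blast intro: holo_fun_subset)

lemma holo_map_cong:
  assumes "holo_map I J U f" "\<And>z. z \<in> U \<Longrightarrow> f z = h z"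
  shows "holo_map I J U h"
  unfolding holo_map_def
proof (intro conjI ballI)
  show "copen I U" by (rule holo_mapD(1)[OF assms(1)])
  show "h ` U \<subseteq> cspace J" using holo_mapD(4)[OF assms(1)] assms(2) by auto
  show "holo_fun I U (\<lambda>z. h z j)" if "j \<in> J" for j
    by (rule holo_fun_cong[OF holo_mapD(3)[OF assms(1) that]]) (simp add: assms(2))
qed

lemma holo_map_id: "copen I U \<Longrightarrow> holo_map I I U (\<lambda>z. z)"
  using copen_subset by (auto simp: holo_map_def intro: holo_fun_proj)

lemma copen_vimage:
  assumes "holo_map I J U f" "copen J V"
  shows "copen I {z \<in> U. f z \<in> V}"
proof -
  obtain T where T: "open T" "V = cspace J \<inter> T" using assms(2) by (auto simp: copen_def openin_open)
  have "{z \<in> U. f z \<in> V} = U \<inter> f -` T" using T(2) holo_mapD(4)[OF assms(1)] by auto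
  moreover have "openin (top_of_set U) (U \<inter> f -` T)"
    by (rule continuous_openin_preimage_gen[OF holo_map_continuous[OF assms(1)] T(1)])
  ultimately show ?thesis
    using holo_mapD(1)[OF assms(1)] unfolding copen_def by (metis openin_trans)
qed

section \<open>Composition and the rules for partial derivatives\<close>

lemma compose_slice_derivative:
  assumes g: "holo_fun J V g" and f: "holo_map I J U f" and "f ` U \<subseteq> V"
    and fin: "finite I" "finite J" and z: "z \<in> U" "i \<in> I"
  shows "((\<lambda>t. g (f (z(i := t)))) has_field_derivative (\<Sum>j\<in>J. pd j g (f z) * pd i (\<lambda>z. f z j) z)) (at (z i))"
proof -
  have "\<forall>\<^sub>F t in nhds (z i). z(i := t) \<in> U"
    using open_slice[OF holo_mapD(1)[OF f] z(2) fin(1), of z] z(1)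
    by (auto simp: eventually_nhds)
  then have "\<forall>\<^sub>F t in nhds (z i). f (z(i := t)) \<in> V"
    by eventually_elim (use assms(3) in blast)
  from chain_rule[OF g fin(2) this, of "\<lambda>j. pd i (\<lambda>z. f z j) z"]
  show ?thesis using holo_fun_pd[OF holo_mapD(3)[OF f] fin(1) z] by simp
qed

lemma holo_fun_compose:
  assumes "holo_fun J V g" "holo_map I J U f" "f ` U \<subseteq> V" "finite I" "finite J"
  shows "holo_fun I U (\<lambda>z. g (f z))"
proof (rule holo_funI)
  show "copen I U" by (rule holo_mapD(1)[OF assms(2)])
  show "continuous_on U (\<lambda>z. g (f z))"
    by (rule continuous_on_compose2[OF holo_funD(2)[OF assms(1)] holo_map_continuous[OF assms(2)] assms(3)])
  show "\<And>z i. z \<in> U \<Longrightarrow> i \<in> I \<Longrightarrow> (\<lambda>t. g (f (z(i := t)))) field_differentiable at (z i)"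
    using compose_slice_derivative[OF assms] by (auto simp: field_differentiable_def)
qed

lemma holo_map_compose:
  assumes "holo_map J K V g" "holo_map I J U f" "f ` U \<subseteq> V" "finite I" "finite J"
  shows "holo_map I K U (\<lambda>z. g (f z))"
  unfolding holo_map_def
proof (intro conjI ballI)
  show "copen I U" by (rule holo_mapD(1)[OF assms(2)])
  show "(\<lambda>z. g (f z)) ` U \<subseteq> cspace K" using holo_mapD(4)[OF assms(1)] assms(3) by auto
  show "\<And>k. k \<in> K \<Longrightarrow> holo_fun I U (\<lambda>z. g (f z) k)"
    by (rule holo_fun_compose[OF holo_mapD(3)[OF assms(1)] assms(2-5)])
qed

lemma pd_compose:
  assumes "holo_fun J V g" "holo_map I J U f" "f ` U \<subseteq> V" "finite I" "finite J" "z \<in> U" "i \<in> I"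
  shows "pd i (\<lambda>z. g (f z)) z = (\<Sum>j\<in>J. pd j g (f z) * pd i (\<lambda>z. f z j) z)"
  using DERIV_imp_deriv[OF compose_slice_derivative[OF assms]] by (simp add: pd_def)

lemma pd_cong:
  assumes "copen I U" "z \<in> U" "i \<in> I" "finite I" "\<And>z. z \<in> U \<Longrightarrow> g z = h z"
  shows "pd i g z = pd i h z"
  unfolding pd_def
proof (rule deriv_cong_ev)
  have "\<forall>\<^sub>F t in nhds (z i). z(i := t) \<in> U"
    using open_slice[OF assms(1,3,4), of z] assms(2) by (auto simp: eventually_nhds)
  then show "\<forall>\<^sub>F t in nhds (z i). g (z(i := t)) = h (z(i := t))"
    by eventually_elim (rule assms(5))
qed simp

lemma pd_proj: "pd i (\<lambda>z. z j) z = (if i = j then 1 else 0)"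
  by (cases "i = j") (auto simp: pd_def)

lemma pd_const: "pd i (\<lambda>z. c) z = 0"
  by (simp add: pd_def)

lemma pd_add:
  assumes "holo_fun I U g" "holo_fun I U h" "finite I" "z \<in> U" "i \<in> I"
  shows "pd i (\<lambda>z. g z + h z) z = pd i g z + pd i h z"
  unfolding pd_def[of i "\<lambda>z. g z + h z"]
  by (rule DERIV_imp_deriv) (intro DERIV_add holo_fun_pd[OF assms(1,3,4,5)] holo_fun_pd[OF assms(2-5)])

lemma pd_diff:
  assumes "holo_fun I U g" "holo_fun I U h" "finite I" "z \<in> U" "i \<in> I"
  shows "pd i (\<lambda>z. g z - h z) z = pd i g z - pd i h z"
  unfolding pd_def[of i "\<lambda>z. g z - h z"]
  by (rule DERIV_imp_deriv) (intro DERIV_diff holo_fun_pd[OF assms(1,3,4,5)] holo_fun_pd[OF assms(2-5)])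

lemma pd_mult:
  assumes "holo_fun I U g" "holo_fun I U h" "finite I" "z \<in> U" "i \<in> I"
  shows "pd i (\<lambda>z. g z * h z) z = pd i g z * h z + g z * pd i h z"
  unfolding pd_def[of i "\<lambda>z. g z * h z"]
proof (rule DERIV_imp_deriv)
  show "((\<lambda>t. g (z(i := t)) * h (z(i := t))) has_field_derivative (pd i g z * h z + g z * pd i h z)) (at (z i))"
    using DERIV_mult[OF holo_fun_pd[OF assms(1,3,4,5)] holo_fun_pd[OF assms(2-5)]] by (simp add: algebra_simps)
qed

lemma pd_sum:
  assumes "copen I U" "\<And>k. k \<in> K \<Longrightarrow> holo_fun I U (g k)" "finite I" "z \<in> U" "i \<in> I"
  shows "pd i (\<lambda>z. \<Sum>k\<in>K. g k z) z = (\<Sum>k\<in>K. pd i (g k) z)"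
  unfolding pd_def[of i "\<lambda>z. \<Sum>k\<in>K. g k z"]
  by (rule DERIV_imp_deriv) (intro DERIV_sum holo_fun_pd[OF assms(2) assms(3-5)])

text \<open>The derivative of a slice is jointly continuous in the base point and the slice
  variable; it is then evaluated at the pair \<open>(z, z i)\<close>.\<close>

lemma continuous_on_pd:
  assumes g: "holo_fun I U g" and fin: "finite I" and i: "i \<in> I"
  shows "continuous_on U (pd i g)"
  unfolding continuous_on_def
proof
  fix a assume a: "a \<in> U"
  obtain r where r: "r > 0" "polydisc I a r \<subseteq> U"
    using a holo_funD(1)[OF g] unfolding copen_iff[OF fin] by auto
  define P where "P = polydisc I a r"
  have inU: "z(i := t) \<in> U" if "z \<in> P" "t \<in> ball (a i) r" for z t
    using polydisc_upd[of z I a r i t] that i r by (auto simp: P_def)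
  have "continuous_on (P \<times> ball (a i) r) (\<lambda>(p, t). deriv (\<lambda>t. g (p(i := t))) t)"
  proof (rule strict_partial_continuous[OF open_ball])
    show "continuous_on (P \<times> ball (a i) r) (\<lambda>(p, t). g (p(i := t)))"
      by (rule continuous_on_slice[OF holo_funD(2)[OF g] inU])
    show "(\<lambda>t. g (p(i := t))) holomorphic_on ball (a i) r" if "p \<in> P" for p
      by (rule holomorphic_on_subset[OF holo_funD(4)[OF g _ i]]) (use that r inU in \<open>auto simp: P_def\<close>)
  qed
  then have "continuous_on P (\<lambda>z. (\<lambda>(p, t). deriv (\<lambda>t. g (p(i := t))) t) (z, z i))"
  proof (rule continuous_on_compose2)
    show "continuous_on P (\<lambda>z. (z, z i))"
      by (intro continuous_on_Pair continuous_on_id continuous_on_product_then_coordinatewise)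
  qed (use i in \<open>auto simp: P_def polydisc_def\<close>)
  then have "continuous_on P (pd i g)" by (simp add: pd_def[abs_def])
  moreover have aP: "a \<in> P" unfolding P_def using a holo_funD(3)[OF g] r(1) by (intro mem_polydisc) auto
  ultimately have "(pd i g \<longlongrightarrow> pd i g a) (at a within P)"
    unfolding continuous_on_def by blast
  moreover obtain T where T: "open T" "P = cspace I \<inter> T"
    using copen_polydisc[OF fin] unfolding P_def copen_def openin_open by metis
  then have "at a within U = at a within P"
    by (intro at_within_nhd[of a T]) (use r aP holo_funD(3)[OF g] in \<open>auto simp: P_def\<close>)
  ultimately show "(pd i g \<longlongrightarrow> pd i g a) (at a within U)" by simp
qed

text \<open>As functions of the coordinate \<open>k\<close>, the difference quotients in direction
  \<open>i\<close> are holomorphic and converge uniformly on a disc. Weierstrass' theorem on such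
  limits then yields two facts: \<open>pd i g\<close> is holomorphic in coordinate \<open>k\<close>,
  and mixed partial derivatives commute.\<close>

lemma pd_difference_quotients:
  assumes g: "holo_fun I U g" and fin: "finite I" and z: "z \<in> U" and i: "i \<in> I" and k: "k \<in> I" "k \<noteq> i"
  obtains r where "r > 0"
    "\<And>s. s \<in> ball (z k) r \<Longrightarrow> z(k := s) \<in> U"
    "\<forall>\<^sub>F h in at 0. \<forall>s\<in>cball (z k) r. z(k := s, i := z i + h) \<in> U"
    "\<forall>\<^sub>F h in at 0. (\<lambda>s. (g (z(k := s, i := z i + h)) - g (z(k := s))) / h) holomorphic_on cball (z k) r"
    "uniform_limit (cball (z k) r) (\<lambda>h s. (g (z(k := s, i := z i + h)) - g (z(k := s))) / h) (\<lambda>s. pd i g (z(k := s))) (at 0)"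
proof -
  obtain r where r: "r > 0" "polydisc I z r \<subseteq> U"
    using z holo_funD(1)[OF g] unfolding copen_iff[OF fin] by auto
  have zc: "z \<in> cspace I" using z holo_funD(3)[OF g] by blast
  define C where "C = cball (z k) (r/2)"
  define H where "H s t = g (z(k := s, i := t))" for s t
  have inP: "z(k := s, i := t) \<in> polydisc I z r" if "s \<in> C" "t \<in> ball (z i) r" for s t
    using that r(1) i k by (intro polydisc_upd mem_polydisc zc) (auto simp: C_def)
  have zi: "z(k := s, i := z i) = z(k := s)" for s using k(2) by auto
  have Hzi: "H s (z i) = g (z(k := s))" for s by (simp add: H_def zi)
  have dH: "(H s has_field_derivative pd i g (z(k := s, i := t))) (at t)" if "s \<in> C" "t \<in> ball (z i) r" for s t
    using holo_fun_pd[OF g fin _ i, of "z(k := s, i := t)"] inP[OF that] r(2)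
    by (auto simp: H_def[abs_def])
  have evr: "\<forall>\<^sub>F h::complex in at 0. h \<in> ball 0 r - {0}"
    using r(1) by (intro eventually_at_in_open) auto
  have 1: "\<forall>\<^sub>F h in at 0. (\<lambda>s. (H s (z i + h) - H s (z i)) / h) holomorphic_on C"
    using evr
  proof eventually_elim
    case (elim h)
    have *: "(\<lambda>s. H s t) holomorphic_on {s. z(k := s, i := t) \<in> U}" if "t \<in> ball (z i) r" for t
    proof -
      have "z(i := t) \<in> U" using polydisc_upd[OF mem_polydisc[OF zc r(1)] i, of t] that r(2) by auto
      from holo_funD(4)[OF g this k(1)] show ?thesis using k(2) by (simp add: H_def[abs_def] fun_upd_twist)
    qed
    have "(\<lambda>s. H s t) holomorphic_on C" if "t \<in> ball (z i) r" for t
      by (rule holomorphic_on_subset[OF *[OF that]]) (use inP[OF _ that] r(2) in auto)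
    then show "(\<lambda>s. (H s (z i + h) - H s (z i)) / h) holomorphic_on C"
      using elim r(1) by (intro holomorphic_intros) (auto simp: dist_norm)
  qed
  have 2: "uniform_limit C (\<lambda>h s. (H s (z i + h) - H s (z i)) / h) (\<lambda>s. pd i g (z(k := s))) (at 0)"
  proof (rule uniform_limitI)
    fix e :: real assume "e > 0"
    have "continuous_on (ball (z i) r \<times> C) (\<lambda>x. pd i g (z(k := snd x, i := fst x)))"
    proof (rule continuous_on_compose2[OF continuous_on_pd[OF g fin i]])
      show "continuous_on (ball (z i) r \<times> C) (\<lambda>x. z(k := snd x, i := fst x))"
      proof (rule continuous_on_coordinatewise_then_product)
        fix j show "continuous_on (ball (z i) r \<times> C) (\<lambda>x. (z(k := snd x, i := fst x)) j)"
          using continuous_on_fst[OF continuous_on_id, of "ball (z i) r \<times> C"]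
            continuous_on_snd[OF continuous_on_id, of "ball (z i) r \<times> C"]
          by (cases "j = i"; cases "j = k") auto
      qed
      show "(\<lambda>x. z(k := snd x, i := fst x)) ` (ball (z i) r \<times> C) \<subseteq> U"
        using inP r(2) by auto
    qed
    \<comment> \<open>Uniformity over the compact disc \<open>C\<close> of values of coordinate
      \<open>k\<close> comes from the joint continuity of \<open>pd i g\<close>.\<close>
    then obtain X0 where X0: "z i \<in> X0" "open X0"
      "\<forall>t\<in>X0 \<inter> ball (z i) r. \<forall>s\<in>C. dist (pd i g (z(k := s, i := t))) (pd i g (z(k := s, i := z i))) \<le> e / 2"
      using continuous_on_prod_compactE[of "ball (z i) r" C "\<lambda>x. pd i g (z(k := snd x, i := fst x))" "z i" "e/2"]
        \<open>e > 0\<close> r(1) by (auto simp: C_def)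
    have "open (X0 \<inter> ball (z i) r)" using X0(2) by auto
    then obtain d where d: "d > 0" "ball (z i) d \<subseteq> X0 \<inter> ball (z i) r"
      using X0(1) r(1) by (meson IntI centre_in_ball open_contains_ball)
    have "\<forall>\<^sub>F h::complex in at 0. h \<in> ball 0 d - {0}"
      using d(1) by (intro eventually_at_in_open) auto
    then show "\<forall>\<^sub>F h in at 0. \<forall>s\<in>C. dist ((H s (z i + h) - H s (z i)) / h) (pd i g (z(k := s))) < e"
    proof eventually_elim
      case (elim h)
      show ?case
      proof
        fix s assume s: "s \<in> C"
        let ?D = "pd i g (z(k := s))"
        have "norm ((\<lambda>t. H s t - ?D * t) (z i + h) - (\<lambda>t. H s t - ?D * t) (z i)) \<le> e/2 * norm (z i + h - z i)"
        proof (rule field_differentiable_bound[of "ball (z i) d"])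
          fix t assume t: "t \<in> ball (z i) d"
          then have t': "t \<in> ball (z i) r" "t \<in> X0 \<inter> ball (z i) r" using d(2) by auto
          show "((\<lambda>t. H s t - ?D * t) has_field_derivative (pd i g (z(k := s, i := t)) - ?D)) (at t within ball (z i) d)"
            by (rule DERIV_subset[where s = UNIV]) (use dH[OF s t'(1)] in \<open>auto intro!: derivative_eq_intros\<close>)
          show "norm (pd i g (z(k := s, i := t)) - ?D) \<le> e/2"
            using bspec[OF bspec[OF X0(3) t'(2)] s] by (simp only: dist_norm zi)
        qed (use elim d(1) in \<open>auto simp: dist_norm\<close>)
        then have "norm (H s (z i + h) - H s (z i) - ?D * h) \<le> e/2 * norm h" by (simp add: algebra_simps)
        also have "\<dots> < e * norm h" using \<open>e > 0\<close> elim by simp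
        finally have "norm (H s (z i + h) - H s (z i) - ?D * h) / norm h < e" using elim by (simp add: field_simps)
        moreover have "(H s (z i + h) - H s (z i)) / h - ?D = (H s (z i + h) - H s (z i) - ?D * h) / h"
          using elim by (simp add: field_simps)
        ultimately show "dist ((H s (z i + h) - H s (z i)) / h) ?D < e" by (simp add: dist_norm norm_divide)
      qed
    qed
  qed
  have 3: "\<forall>\<^sub>F h in at 0. \<forall>s\<in>C. z(k := s, i := z i + h) \<in> U"
    using evr by eventually_elim (use inP r(2) in \<open>auto simp: dist_norm\<close>)
  have 4: "z(k := s) \<in> U" if "s \<in> ball (z k) (r/2)" for s
    using inP[of s "z i"] that r zi by (auto simp: C_def)
  show thesis
    by (rule that[of "r/2"]) (use r(1) 1 2 3 4 in \<open>simp_all only: Hzi C_def[symmetric], simp_all add: H_def\<close>)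
qed

lemma pd_slice_field_differentiable:
  assumes g: "holo_fun I U g" and fin: "finite I" and z: "z \<in> U" and i: "i \<in> I" and k: "k \<in> I" "k \<noteq> i"
  shows "(\<lambda>s. pd i g (z(k := s))) field_differentiable at (z k)"
proof -
  obtain r where r: "r > 0"
    and hol: "\<forall>\<^sub>F h in at 0. (\<lambda>s. (g (z(k := s, i := z i + h)) - g (z(k := s))) / h) holomorphic_on cball (z k) r"
    and lim: "uniform_limit (cball (z k) r) (\<lambda>h s. (g (z(k := s, i := z i + h)) - g (z(k := s))) / h)
      (\<lambda>s. pd i g (z(k := s))) (at 0)"
    by (rule pd_difference_quotients[OF assms]) blast
  have "(\<lambda>s. pd i g (z(k := s))) holomorphic_on ball (z k) r"
  proof (rule holomorphic_uniform_limit[OF _ lim])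
    show "\<forall>\<^sub>F h in at 0. continuous_on (cball (z k) r) (\<lambda>s. (g (z(k := s, i := z i + h)) - g (z(k := s))) / h) \<and>
        (\<lambda>s. (g (z(k := s, i := z i + h)) - g (z(k := s))) / h) holomorphic_on ball (z k) r"
      using hol by eventually_elim
        (meson ball_subset_cball holomorphic_on_imp_continuous_on holomorphic_on_subset)
  qed (simp add: trivial_limit_at)
  then show ?thesis using r by (simp add: holomorphic_on_imp_differentiable_at)
qed

text \<open>In the direction \<open>i\<close> itself this is the one-variable theorem that
  derivatives are holomorphic; in the other directions \<open>pd i g\<close> is a uniform limit of
  holomorphic difference quotients.\<close>

lemma holo_fun_pd_holo:
  assumes g: "holo_fun I U g" and fin: "finite I" and i: "i \<in> I"
  shows "holo_fun I U (pd i g)"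
proof (rule holo_funI[OF holo_funD(1)[OF g] continuous_on_pd[OF assms]])
  fix z k assume z: "z \<in> U" and k: "k \<in> I"
  show "(\<lambda>t. pd i g (z(k := t))) field_differentiable at (z k)"
  proof (cases "k = i")
    case True
    have "deriv (\<lambda>t. g (z(i := t))) holomorphic_on {t. z(i := t) \<in> U}"
      by (rule holomorphic_deriv[OF holo_funD(4)[OF g z i] open_slice[OF holo_funD(1)[OF g] i fin]])
    moreover have "(\<lambda>t. pd i g (z(k := t))) = deriv (\<lambda>t. g (z(i := t)))"
      using True by (simp add: pd_def fun_eq_iff)
    ultimately show ?thesis
      using True z open_slice[OF holo_funD(1)[OF g] i fin, of z] by (simp add: holomorphic_on_imp_differentiable_at)
  qed (rule pd_slice_field_differentiable[OF g fin z i k])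
qed

subsection \<open>Coordinate changes\<close>

lemma biholoI:
  assumes f: "holo_map I J U f" and g: "holo_map J I V g" and "f ` U \<subseteq> V" "g ` V \<subseteq> U"
    and gf: "\<And>z. z \<in> U \<Longrightarrow> g (f z) = z" and fg: "\<And>y. y \<in> V \<Longrightarrow> f (g y) = y"
  shows "biholo I J U V f"
proof -
  have inj: "inj_on f U" by (metis gf inj_onI)
  have im: "f ` U = V"
  proof
    show "V \<subseteq> f ` U"
    proof
      fix y assume "y \<in> V"
      then have "g y \<in> U" "y = f (g y)" using assms(4) fg by auto
      then show "y \<in> f ` U" by blast
    qed
  qed (rule assms(3))
  have inv: "inv_into U f y = g y" if "y \<in> V" for y
    by (rule inv_into_f_eq[OF inj]) (use that assms(4) fg in auto)
  have "holo_map J I V (inv_into U f)"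
    by (rule holo_map_cong[OF g]) (simp add: inv)
  then show ?thesis using f inj im by (simp add: biholo_def bij_betw_def)
qed

lemma biholoD:
  assumes "biholo I J U V f"
  shows "holo_map I J U f" "holo_map J I V (inv_into U f)" "f ` U = V" "inj_on f U"
    "\<And>z. z \<in> U \<Longrightarrow> inv_into U f (f z) = z" "\<And>y. y \<in> V \<Longrightarrow> f (inv_into U f y) = y"
    "\<And>y. y \<in> V \<Longrightarrow> inv_into U f y \<in> U" "copen I U" "copen J V"
proof -
  show m: "holo_map I J U f" "holo_map J I V (inv_into U f)" and im: "f ` U = V" and inj: "inj_on f U"
    using assms by (auto simp: biholo_def bij_betw_def)
  show "\<And>z. z \<in> U \<Longrightarrow> inv_into U f (f z) = z" using inj by simp
  show "\<And>y. y \<in> V \<Longrightarrow> f (inv_into U f y) = y" using im by (simp add: f_inv_into_f)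
  show "\<And>y. y \<in> V \<Longrightarrow> inv_into U f y \<in> U" using im by (simp add: inv_into_into)
  show "copen I U" "copen J V" using m holo_mapD(1) by blast+
qed

lemma biholo_compose:
  assumes f: "biholo I J U V f" and g: "biholo J K V W g" and fin: "finite I" "finite J" "finite K"
  shows "biholo I K U W (\<lambda>z. g (f z))"
proof (rule biholoI)
  note F = biholoD[OF f] and G = biholoD[OF g]
  show "holo_map I K U (\<lambda>z. g (f z))"
    by (rule holo_map_compose[OF G(1) F(1) _ fin(1,2)]) (simp add: F(3))
  show "holo_map K I W (\<lambda>y. inv_into U f (inv_into V g y))"
    by (rule holo_map_compose[OF F(2) G(2) _ fin(3,2)]) (use G(7) in auto)
  show "(\<lambda>z. g (f z)) ` U \<subseteq> W" using F(3) G(3) by auto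
  show "(\<lambda>y. inv_into U f (inv_into V g y)) ` W \<subseteq> U" using F(7) G(7) by auto
  show "\<And>z. z \<in> U \<Longrightarrow> inv_into U f (inv_into V g (g (f z))) = z" using F(3,5) G(5) by auto
  show "\<And>y. y \<in> W \<Longrightarrow> g (f (inv_into U f (inv_into V g y))) = y" using F(6) G(6,7) by auto
qed

lemma biholo_subset:
  assumes f: "biholo I J U V f" and "copen I U'" "U' \<subseteq> U"
  shows "biholo I J U' (f ` U') f"
proof (rule biholoI)
  note F = biholoD[OF f]
  show "holo_map I J U' f" by (rule holo_map_subset[OF F(1) assms(2,3)])
  have "f ` U' = {y \<in> V. inv_into U f y \<in> U'}"
  proof
    show "f ` U' \<subseteq> {y \<in> V. inv_into U f y \<in> U'}" using F(3,5) assms(3) by auto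
    show "{y \<in> V. inv_into U f y \<in> U'} \<subseteq> f ` U'"
    proof clarify
      fix y assume "y \<in> V" "inv_into U f y \<in> U'"
      then show "y \<in> f ` U'" using F(6)[of y] by (metis imageI)
    qed
  qed
  then have "copen J (f ` U')" using copen_vimage[OF F(2) assms(2)] by simp
  then show "holo_map J I (f ` U') (inv_into U f)"
    by (rule holo_map_subset[OF F(2)]) (use F(3) assms(3) in blast)
  show "inv_into U f ` f ` U' \<subseteq> U'" using F(5) assms(3) by auto
  show "\<And>z. z \<in> U' \<Longrightarrow> inv_into U f (f z) = z" using F(5) assms(3) by auto
  show "\<And>y. y \<in> f ` U' \<Longrightarrow> f (inv_into U f y) = y" using F(5) assms(3) by auto
qed simp

lemma biholo_inverse:
  assumes "biholo I J U V f"
  shows "biholo J I V U (inv_into U f)"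
  by (rule biholoI[OF biholoD(2,1)[OF assms]]) (use biholoD(3,5,6,7)[OF assms] in auto)

text \<open>For the increments the hypothesis reads A + c * \<sigma> = o(\<sigma>). As
  \<open>c\<close> is nonzero, it first bounds the increment of \<sigma> by a multiple of that of
  \<open>A\<close>, so that o(\<sigma>) becomes o(A), and the equation can be solved for
  \<sigma>.\<close>

lemma implicit_derivative:
  fixes A \<sigma> :: "complex \<Rightarrow> complex"
  assumes A: "(A has_field_derivative a) (at s0)" and "c \<noteq> 0"
    and ev: "\<And>e. e > 0 \<Longrightarrow> \<forall>\<^sub>F s in nhds s0. norm ((A s - A s0) + c * (\<sigma> s - \<sigma> s0)) \<le> e * norm (\<sigma> s - \<sigma> s0)"
  shows "(\<sigma> has_field_derivative (- 1 / c) * a) (at s0)"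
proof (rule has_field_derivative_by_approx[OF A])
  fix e :: real assume "e > 0"
  define m where "m = norm c"
  have m: "m > 0" using \<open>c \<noteq> 0\<close> by (simp add: m_def)
  \<comment> \<open>The bound \<open>m / 2\<close> absorbs the error into \<open>m * norm x\<close>
    and gives \<open>norm x \<le> 2 * norm y / m\<close>; the bound \<open>e * m\<^sup>2 / 2\<close>
    then makes the remaining error at most \<open>e * norm y\<close>.\<close>
  define e' where "e' = min (m / 2) (e * m\<^sup>2 / 2)"
  have e': "e' > 0" "e' \<le> m / 2" "e' \<le> e * m\<^sup>2 / 2" using m \<open>e > 0\<close> by (auto simp: e'_def)
  from ev[OF e'(1)]
  show "\<forall>\<^sub>F s in nhds s0. norm (\<sigma> s - \<sigma> s0 - - 1 / c * (A s - A s0)) \<le> e * norm (A s - A s0)"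
  proof eventually_elim
    case (elim s)
    define x y where "x = \<sigma> s - \<sigma> s0" and "y = A s - A s0"
    have h: "norm (y + c * x) \<le> e' * norm x" using elim by (simp add: x_def y_def)
    have "m * norm x = norm (c * x)" by (simp add: m_def norm_mult)
    also have "\<dots> \<le> norm (y + c * x) + norm y"
      using norm_triangle_ineq4[of "y + c * x" y] by simp
    also have "\<dots> \<le> m / 2 * norm x + norm y"
      using h mult_right_mono[OF e'(2), of "norm x"] by simp
    finally have x: "norm x \<le> 2 * norm y / m" using m by (simp add: field_simps)
    have "x - - 1 / c * y = (y + c * x) / c" using \<open>c \<noteq> 0\<close> by (simp add: field_simps)
    then have "norm (x - - 1 / c * y) = norm (y + c * x) / m" by (simp add: norm_divide m_def)
    also have "\<dots> \<le> e' * norm x / m" using h m by (simp add: divide_right_mono)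
    also have "\<dots> \<le> (e * m\<^sup>2 / 2) * norm x / m"
      using e'(3) m by (intro divide_right_mono mult_right_mono) auto
    also have "\<dots> = e * (m * norm x) / 2" using m by (simp add: power2_eq_square)
    also have "\<dots> \<le> e * norm y" using x m \<open>e > 0\<close> by (simp add: field_simps)
    finally show ?case by (simp add: x_def y_def)
  qed
qed

lemma slice_strict_partial:
  assumes g: "holo_fun I U g" and fin: "finite I" and a: "a \<in> U" and i: "i \<in> I" and "e > 0"
  obtains r where "r > 0" "polydisc I a r \<subseteq> U"
    "\<And>p t t'. p \<in> polydisc I a r \<Longrightarrow> t \<in> ball (a i) r \<Longrightarrow> t' \<in> ball (a i) r \<Longrightarrow>
       norm (g (p(i := t)) - g (p(i := t')) - pd i g a * (t - t')) \<le> e * norm (t - t')"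
proof -
  have aI: "a \<in> cspace I" using a holo_funD(3)[OF g] by blast
  obtain r where r: "r > 0" "polydisc I a r \<subseteq> U"
    using a holo_funD(1)[OF g] unfolding copen_iff[OF fin] by auto
  have inU: "z(i := t) \<in> U" if "z \<in> polydisc I a r" "t \<in> ball (a i) r" for z t
    using polydisc_upd[OF that(1) i, of t] that(2) r by auto
  have slc: "continuous_on (polydisc I a r \<times> ball (a i) r) (\<lambda>(z, t). g (z(i := t)))"
    by (rule continuous_on_slice[OF holo_funD(2)[OF g] inU])
  have slh: "(\<lambda>t. g (p(i := t))) holomorphic_on ball (a i) r" if "p \<in> polydisc I a r" for p
    by (rule holomorphic_on_subset[OF holo_funD(4)[OF g _ i]]) (use that r inU in auto)
  obtain X0 d where X: "open X0" "a \<in> X0" "d > 0" "ball (a i) d \<subseteq> ball (a i) r"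
    "\<And>p t t'. p \<in> X0 \<inter> polydisc I a r \<Longrightarrow> t \<in> ball (a i) d \<Longrightarrow> t' \<in> ball (a i) d \<Longrightarrow>
       norm (g (p(i := t)) - g (p(i := t')) - deriv (\<lambda>t. g (a(i := t))) (a i) * (t - t')) \<le> e * norm (t - t')"
    by (rule strict_partial[OF open_ball slc slh mem_polydisc[OF aI r(1)] _ \<open>e > 0\<close>]) (use r in auto)
  obtain q where q: "q > 0" "polydisc I a q \<subseteq> X0"
    using open_contains_polydisc[OF X(1,2) fin] aI by blast
  define \<rho> where "\<rho> = min r (min d q)"
  have \<rho>: "\<rho> > 0" "\<rho> \<le> r" "\<rho> \<le> d" "\<rho> \<le> q" using r X(3) q by (auto simp: \<rho>_def)
  show thesis
  proof (rule that[OF \<rho>(1)])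
    show "polydisc I a \<rho> \<subseteq> U" using polydisc_mono[OF \<rho>(2)] r(2) by blast
    fix p t t' assume "p \<in> polydisc I a \<rho>" "t \<in> ball (a i) \<rho>" "t' \<in> ball (a i) \<rho>"
    then show "norm (g (p(i := t)) - g (p(i := t')) - pd i g a * (t - t')) \<le> e * norm (t - t')"
      using X(5)[of p t t'] polydisc_mono[OF \<rho>(2), of I a] polydisc_mono[OF \<rho>(4), of I a] q(2) \<rho>(3)
      by (auto simp: pd_def)
  qed
qed

lemma continuous_at_polydisc:
  assumes g: "continuous_on U g" and "copen I U" "a \<in> U" "finite I" "(e::real) > 0"
  obtains r where "r > 0" "polydisc I a r \<subseteq> U" "\<And>z. z \<in> polydisc I a r \<Longrightarrow> dist (g z) (g a) < e"
proof -
  have "\<exists>A. open A \<and> a \<in> A \<and> (\<forall>y\<in>U. y \<in> A \<longrightarrow> g y \<in> ball (g a) e)"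
    using g assms(3,5) unfolding continuous_on_topological by (metis centre_in_ball open_ball)
  then obtain A where A: "open A" "a \<in> A" "\<And>y. y \<in> U \<Longrightarrow> y \<in> A \<Longrightarrow> g y \<in> ball (g a) e" by blast
  obtain T where T: "open T" "U = cspace I \<inter> T" using assms(2) by (auto simp: copen_def openin_open)
  then obtain r where r: "r > 0" "polydisc I a r \<subseteq> A \<inter> T"
    using open_contains_polydisc[of "A \<inter> T" a I] A assms(3,4) by blast
  show thesis
  proof (rule that[OF r(1)])
    show U: "polydisc I a r \<subseteq> U" using r(2) T(2) polydisc_subset_cspace by blast
    show "\<And>z. z \<in> polydisc I a r \<Longrightarrow> dist (g z) (g a) < e"
      using A(3) U r(2) by (auto simp: dist_commute)
  qed
qed

text \<open>Replacing one coordinate by a function that depends on it strictly is a local change of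
  coordinates; iterating this gives the inverse function theorem in the form needed here.\<close>

lemma elementary_biholo:
  assumes g: "holo_fun I U g" and fin: "finite I" and a: "a \<in> U" and i: "i \<in> I" and nz: "pd i g a \<noteq> 0"
  obtains U' V where "a \<in> U'" "U' \<subseteq> U" "biholo I I U' V (\<lambda>z. z(i := g z))"
proof -
  define c where "c = pd i g a"
  have c: "norm c > 0" using nz by (simp add: c_def)
  \<comment> \<open>With half of \<open>norm c\<close> the strict estimate makes \<open>g\<close>
    injective in coordinate \<open>i\<close>, keeps its derivative there away from zero and gives
    the contraction constant 1/2 below.\<close>
  obtain \<rho> where \<rho>: "\<rho> > 0" "polydisc I a \<rho> \<subseteq> U"
    "\<And>p t t'. p \<in> polydisc I a \<rho> \<Longrightarrow> t \<in> ball (a i) \<rho> \<Longrightarrow> t' \<in> ball (a i) \<rho> \<Longrightarrow>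
       norm (g (p(i := t)) - g (p(i := t')) - c * (t - t')) \<le> norm c / 2 * norm (t - t')"
    by (rule slice_strict_partial[OF g fin a i half_gt_zero[OF c]]) (auto simp: c_def)
  define U' where "U' = polydisc I a \<rho>"
  have U'o: "copen I U'" unfolding U'_def by (rule copen_polydisc[OF fin])
  have U'c: "U' \<subseteq> cspace I" unfolding U'_def by (rule polydisc_subset_cspace)
  have U'U: "U' \<subseteq> U" unfolding U'_def by (rule \<rho>(2))
  have gU': "holo_fun I U' g" by (rule holo_fun_subset[OF g U'o U'U])
  have upd: "z(i := t) \<in> U'" if "z \<in> U'" "t \<in> ball (a i) \<rho>" for z t
    using that polydisc_upd[OF _ i] by (auto simp: U'_def)
  have zi: "z i \<in> ball (a i) \<rho>" if "z \<in> U'" for z using that i by (auto simp: U'_def polydisc_def)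
  have est: "norm (g (p(i := t)) - g (p(i := t')) - c * (t - t')) \<le> norm c / 2 * norm (t - t')"
    if "p \<in> U'" "t \<in> ball (a i) \<rho>" "t' \<in> ball (a i) \<rho>" for p t t' using \<rho>(3) that by (simp add: U'_def)
  define E where "E z = z(i := g z)" for z
  have inj1: "t = t'" if "p \<in> U'" "t \<in> ball (a i) \<rho>" "t' \<in> ball (a i) \<rho>" "g (p(i := t)) = g (p(i := t'))" for p t t'
  proof (rule ccontr)
    assume "t \<noteq> t'"
    have "norm (c * (t - t')) \<le> norm c / 2 * norm (t - t')" using est[OF that(1-3)] that(4) by simp
    moreover have "norm c * norm (t - t') > 0" using c \<open>t \<noteq> t'\<close> by simp
    ultimately show False by (simp add: norm_mult)
  qed
  have Einj: "inj_on E U'"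
  proof (rule inj_onI)
    fix z z' assume z: "z \<in> U'" "z' \<in> U'" and eq: "E z = E z'"
    have z': "z' = z(i := z' i)"
    proof
      fix j show "z' j = (z(i := z' i)) j" using fun_cong[OF eq, of j] by (cases "j = i") (auto simp: E_def)
    qed
    have "g (z(i := z i)) = g (z(i := z' i))" using fun_cong[OF eq, of i] z' by (simp add: E_def)
    then have "z i = z' i" using inj1[OF z(1) zi zi] z by simp
    then show "z = z'" using z' by (metis fun_upd_triv)
  qed
  have pdnz: "pd i g z \<noteq> 0" if z: "z \<in> U'" for z
  proof
    assume "pd i g z = 0"
    have d: "((\<lambda>t. g (z(i := t)) - c * t) has_field_derivative (pd i g z - c)) (at (z i))"
      by (auto intro!: derivative_eq_intros holo_fun_pd[OF gU' fin z i])
    have "((\<lambda>t. ((g (z(i := t)) - c * t) - (g (z(i := z i)) - c * z i)) / (t - z i)) \<longlongrightarrow> pd i g z - c) (at (z i))"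
      using d by (simp add: has_field_derivative_iff)
    then have "norm (pd i g z - c) \<le> norm c / 2"
    proof (rule Lim_norm_ubound[rotated])
      have "\<forall>\<^sub>F t in at (z i). t \<in> ball (a i) \<rho> - {z i}"
        using zi[OF z] by (intro eventually_at_in_open) auto
      then show "\<forall>\<^sub>F t in at (z i). norm (((g (z(i := t)) - c * t) - (g (z(i := z i)) - c * z i)) / (t - z i)) \<le> norm c / 2"
      proof eventually_elim
        case (elim t)
        then have "norm (g (z(i := t)) - g (z(i := z i)) - c * (t - z i)) \<le> norm c / 2 * norm (t - z i)"
          using est[OF z _ zi[OF z]] by auto
        then have "norm (g (z(i := t)) - g (z(i := z i)) - c * (t - z i)) / norm (t - z i) \<le> norm c / 2"
          using elim by (simp add: field_simps)
        then show ?case by (simp add: norm_divide algebra_simps)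
      qed
    qed simp
    then show False using c \<open>pd i g z = 0\<close> by simp
  qed
  \<comment> \<open>Local surjectivity with control of the preimage. The old coordinate is found by
    Newton's iteration with the fixed slope \<open>c\<close>, a contraction of the disc of radius
    \<epsilon>; \<delta> is such that its first step has length at most \<epsilon> / 2. The control
    yields openness of the image and continuity of the inverse, and enters the proof of its
    differentiability.\<close>
  have key: "\<exists>\<delta>>0. \<forall>y\<in>polydisc I (E z0) \<delta>. \<exists>t\<in>cball (z0 i) \<epsilon>. y(i := t) \<in> U' \<and> E (y(i := t)) = y"
    if z0: "z0 \<in> U'" and \<epsilon>: "\<epsilon> > 0" "cball (z0 i) \<epsilon> \<subseteq> ball (a i) \<rho>" for z0 \<epsilon>
  proof -
    have pos: "\<epsilon> * norm c / 4 > 0" using \<epsilon> c by simp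
    obtain \<delta>1 where \<delta>1: "\<delta>1 > 0" "polydisc I z0 \<delta>1 \<subseteq> U'" "\<And>z. z \<in> polydisc I z0 \<delta>1 \<Longrightarrow> dist (g z) (g z0) < \<epsilon> * norm c / 4"
      by (rule continuous_at_polydisc[OF holo_funD(2)[OF gU'] U'o z0 fin pos]) blast
    define \<delta> where "\<delta> = min \<delta>1 (\<epsilon> * norm c / 4)"
    have \<delta>: "\<delta> > 0" "\<delta> \<le> \<delta>1" "\<delta> \<le> \<epsilon> * norm c / 4" using \<delta>1(1) pos by (auto simp: \<delta>_def)
    have "\<exists>t\<in>cball (z0 i) \<epsilon>. y(i := t) \<in> U' \<and> E (y(i := t)) = y" if y: "y \<in> polydisc I (E z0) \<delta>" for y
    proof -
      define p where "p = y(i := z0 i)"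
      have yI: "y \<in> cspace I" using y polydisc_subset_cspace by blast
      have pd: "p \<in> polydisc I z0 \<delta>1"
        using y \<delta>(1,2) cspace_upd[OF yI i] by (fastforce simp: p_def polydisc_def E_def)
      then have pU: "p \<in> U'" using \<delta>1(2) by blast
      have yi: "dist (g z0) (y i) < \<epsilon> * norm c / 4" using y i \<delta>(3) by (force simp: polydisc_def E_def)
      define T where "T t = t - (g (p(i := t)) - y i) / c" for t
      have Lip: "dist (T t) (T t') \<le> 1/2 * dist t t'" if "t \<in> cball (z0 i) \<epsilon>" "t' \<in> cball (z0 i) \<epsilon>" for t t'
      proof -
        have "T t - T t' = - (g (p(i := t)) - g (p(i := t')) - c * (t - t')) / c"
          using c by (simp add: T_def field_simps)
        then have "norm (T t - T t') = norm (g (p(i := t)) - g (p(i := t')) - c * (t - t')) / norm c"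
          by (metis norm_divide norm_minus_cancel)
        also have "\<dots> \<le> (norm c / 2 * norm (t - t')) / norm c"
          by (intro divide_right_mono est[OF pU]) (use that \<epsilon> in auto)
        finally show ?thesis using c by (simp add: dist_norm)
      qed
      have T0: "dist (z0 i) (T (z0 i)) \<le> \<epsilon> / 2"
      proof -
        have "dist (z0 i) (T (z0 i)) = dist (g p) (y i) / norm c"
          by (simp add: T_def dist_norm norm_divide p_def)
        also have "\<dots> \<le> (\<epsilon> * norm c / 2) / norm c"
          using \<delta>1(3)[OF pd] yi dist_triangle[of "g p" "y i" "g z0"] by (intro divide_right_mono) auto
        finally show ?thesis using c by simp
      qed
      have "T ` cball (z0 i) \<epsilon> \<subseteq> cball (z0 i) \<epsilon>"
      proof clarify
        fix t assume t: "t \<in> cball (z0 i) \<epsilon>"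
        have "dist (z0 i) (T t) \<le> dist (z0 i) (T (z0 i)) + dist (T (z0 i)) (T t)" by (rule dist_triangle)
        moreover have "dist (T (z0 i)) (T t) \<le> 1/2 * dist (z0 i) t" by (rule Lip) (use t \<epsilon> in auto)
        ultimately show "T t \<in> cball (z0 i) \<epsilon>" using T0 t by simp
      qed
      then have "\<exists>!t. t \<in> cball (z0 i) \<epsilon> \<and> T t = t"
        by (intro Banach_fix[where c = "1/2"]) (use Lip \<epsilon> in \<open>auto simp: complete_eq_closed\<close>)
      then obtain t where t: "t \<in> cball (z0 i) \<epsilon>" "T t = t" by blast
      have "g (p(i := t)) = y i" using t(2) c by (simp add: T_def)
      moreover have "p(i := t) = y(i := t)" by (simp add: p_def)
      moreover have "y(i := t) \<in> U'" using upd[OF pU, of t] t(1) \<epsilon>(2) by (auto simp: p_def)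
      ultimately show ?thesis using t(1) by (auto simp: E_def)
    qed
    then show ?thesis using \<delta>(1) by blast
  qed
  define V where "V = E ` U'"
  define N where "N = inv_into U' E"
  have NE: "N (E z) = z" if "z \<in> U'" for z using Einj that by (simp add: N_def)
  have EN: "E (N y) = y" and NU: "N y \<in> U'" if "y \<in> V" for y
    using that by (auto simp: V_def N_def f_inv_into_f inv_into_into)
  have Ny: "N y = y(i := N y i)" if "y \<in> V" for y
  proof
    fix j show "N y j = (y(i := N y i)) j" using fun_cong[OF EN[OF that], of j] by (cases "j = i") (auto simp: E_def)
  qed
  have gN: "g (N y) = y i" if "y \<in> V" for y using fun_cong[OF EN[OF that], of i] by (simp add: E_def)
  have Emap: "holo_map I I U' E"
    unfolding holo_map_def
  proof (intro conjI ballI U'o)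
    show "E ` U' \<subseteq> cspace I" using U'c i by (auto simp: E_def intro!: cspace_upd)
    fix j show "holo_fun I U' (\<lambda>z. E z j)"
      by (cases "j = i") (auto simp: E_def gU' intro: holo_fun_proj[OF U'o])
  qed
  have key': "\<exists>\<delta>>0. polydisc I y0 \<delta> \<subseteq> V \<and> (\<forall>y\<in>polydisc I y0 \<delta>. dist (N y0 i) (N y i) \<le> \<epsilon>)"
    if y0: "y0 \<in> V" and "\<epsilon> > 0" for y0 \<epsilon>
  proof -
    have "N y0 i \<in> ball (a i) \<rho>" using zi NU[OF y0] by blast
    then obtain \<epsilon>' where "\<epsilon>' > 0" "cball (N y0 i) \<epsilon>' \<subseteq> ball (a i) \<rho>" using open_contains_cball open_ball by metis
    then have e: "min \<epsilon> \<epsilon>' > 0" "cball (N y0 i) (min \<epsilon> \<epsilon>') \<subseteq> ball (a i) \<rho>" using \<open>\<epsilon> > 0\<close> by auto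
    from key[OF NU[OF y0] e] EN[OF y0]
    obtain \<delta> where \<delta>: "\<delta> > 0" "\<And>y. y \<in> polydisc I y0 \<delta> \<Longrightarrow> \<exists>t\<in>cball (N y0 i) (min \<epsilon> \<epsilon>'). y(i := t) \<in> U' \<and> E (y(i := t)) = y"
      by auto
    have "y \<in> V \<and> dist (N y0 i) (N y i) \<le> \<epsilon>" if y: "y \<in> polydisc I y0 \<delta>" for y
    proof -
      obtain t where t: "t \<in> cball (N y0 i) (min \<epsilon> \<epsilon>')" "y(i := t) \<in> U'" "E (y(i := t)) = y"
        using \<delta>(2)[OF y] by blast
      have "N y = y(i := t)" using NE[OF t(2)] t(3) by simp
      then show ?thesis using t by (auto simp: V_def intro: rev_image_eqI)
    qed
    then show ?thesis using \<delta>(1) by blast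
  qed
  have Vc: "V \<subseteq> cspace I" using holo_mapD(4)[OF Emap] by (auto simp: V_def)
  have Vo: "copen I V"
    unfolding copen_iff[OF fin] using key'[of _ 1] Vc by fastforce
  have \<tau>c: "continuous_on V (\<lambda>y. N y i)"
    unfolding continuous_on_def
  proof (rule ballI, rule tendstoI)
    fix y0 \<epsilon> assume y0: "y0 \<in> V" and "(\<epsilon>::real) > 0"
    obtain \<delta> where \<delta>: "\<delta> > 0" "polydisc I y0 \<delta> \<subseteq> V" "\<And>y. y \<in> polydisc I y0 \<delta> \<Longrightarrow> dist (N y0 i) (N y i) \<le> \<epsilon> / 2"
      using key'[OF y0 half_gt_zero[OF \<open>\<epsilon> > 0\<close>]] by blast
    obtain T where T: "open T" "polydisc I y0 \<delta> = cspace I \<inter> T"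
      using copen_polydisc[OF fin, of y0 \<delta>] by (auto simp: copen_def openin_open)
    have "y0 \<in> T" using mem_polydisc[of y0 I \<delta>] Vc y0 \<delta>(1) T(2) by blast
    moreover have "dist (N y i) (N y0 i) < \<epsilon>" if "y \<in> T" "y \<in> V" for y
      using \<delta>(3)[of y] that T(2) Vc \<open>\<epsilon> > 0\<close> by (auto simp: dist_commute)
    ultimately show "\<forall>\<^sub>F y in at y0 within V. dist (N y i) (N y0 i) < \<epsilon>"
      unfolding eventually_at_topological using T(1) by blast
  qed
  \<comment> \<open>Implicit differentiation of \<open>g (N y) = y i\<close> along the slice in
    coordinate \<open>k\<close>: \<open>A\<close> varies the equation with the old coordinate
    \<open>i\<close> frozen at its value in \<open>z0\<close>, and \<sigma> is the coordinate that
    has to compensate.\<close>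
  have \<tau>d: "(\<lambda>s. N (y0(k := s)) i) field_differentiable at (y0 k)" if y0: "y0 \<in> V" and k: "k \<in> I" for y0 k
  proof -
    define z0 where "z0 = N y0"
    have z0: "z0 \<in> U'" using NU[OF y0] by (simp add: z0_def)
    have z0y: "z0 j = y0 j" if "j \<noteq> i" for j using fun_cong[OF Ny[OF y0], of j] that by (simp add: z0_def)
    define c0 where "c0 = pd i g z0"
    define \<sigma> where "\<sigma> s = N (y0(k := s)) i" for s
    define q where "q s = y0(k := s, i := z0 i)" for s
    define A where "A s = g (q s) - (y0(k := s)) i" for s
    have q0: "q (y0 k) = z0" using z0y by (auto simp: q_def)
    have \<sigma>0: "\<sigma> (y0 k) = z0 i" by (simp add: \<sigma>_def z0_def)
    have evV: "\<forall>\<^sub>F s in nhds (y0 k). y0(k := s) \<in> V"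
      using open_slice[OF Vo k fin, of y0] y0 by (auto simp: eventually_nhds)
    have "\<exists>d. (A has_field_derivative d) (at (y0 k))"
    proof (cases "k = i")
      case True
      have "A = (\<lambda>s. g (y0(i := z0 i)) - s)" using True by (simp add: A_def[abs_def] q_def)
      then show ?thesis by (auto intro!: exI derivative_eq_intros)
    next
      case False
      have "z0(k := s) = q s" for s using z0y False by (auto simp: q_def fun_eq_iff)
      then have "A = (\<lambda>s. g (z0(k := s)) - y0 i)" using False by (simp add: A_def[abs_def])
      moreover have "y0 k = z0 k" using z0y False by simp
      ultimately show ?thesis using holo_fun_pd[OF gU' fin z0 k] by (auto intro!: exI derivative_eq_intros)
    qed
    then obtain d where d: "(A has_field_derivative d) (at (y0 k))" by blast
    have "(\<sigma> has_field_derivative (- 1 / c0) * d) (at (y0 k))"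
    proof (rule implicit_derivative[OF d])
      show "c0 \<noteq> 0" using pdnz[OF z0] by (simp add: c0_def)
      fix e :: real assume "e > 0"
      obtain r where r: "r > 0" "polydisc I z0 r \<subseteq> U'"
        "\<And>p t t'. p \<in> polydisc I z0 r \<Longrightarrow> t \<in> ball (z0 i) r \<Longrightarrow> t' \<in> ball (z0 i) r \<Longrightarrow>
          norm (g (p(i := t)) - g (p(i := t')) - c0 * (t - t')) \<le> e * norm (t - t')"
        by (rule slice_strict_partial[OF gU' fin z0 i \<open>e > 0\<close>]) (auto simp: c0_def)
      obtain \<delta> where \<delta>: "\<delta> > 0" "polydisc I y0 \<delta> \<subseteq> V" "\<And>y. y \<in> polydisc I y0 \<delta> \<Longrightarrow> dist (N y0 i) (N y i) \<le> r / 2"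
        using key'[OF y0 half_gt_zero[OF r(1)]] by blast
      have "\<forall>\<^sub>F s in nhds (y0 k). s \<in> ball (y0 k) (min r \<delta>)"
        using r(1) \<delta>(1) by (intro eventually_nhds_in_open) auto
      then show "\<forall>\<^sub>F s in nhds (y0 k). norm (A s - A (y0 k) + c0 * (\<sigma> s - \<sigma> (y0 k))) \<le> e * norm (\<sigma> s - \<sigma> (y0 k))"
      proof eventually_elim
        case (elim s)
        have "y0(k := s) \<in> polydisc I y0 \<delta>"
          using elim mem_polydisc[of y0 I \<delta>] Vc y0 \<delta>(1) k by (intro polydisc_upd) auto
        then have yV: "y0(k := s) \<in> V" and "dist (z0 i) (\<sigma> s) \<le> r / 2"
          using \<delta>(2,3) by (auto simp: \<sigma>_def z0_def)
        then have \<sigma>r: "\<sigma> s \<in> ball (z0 i) r" using r(1) by auto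
        have z0r: "z0 \<in> polydisc I z0 r" using mem_polydisc z0 U'c r(1) by blast
        have qr: "q s \<in> polydisc I z0 r"
        proof (cases "k = i")
          case True
          then have "q s = z0" using z0y by (auto simp: q_def)
          then show ?thesis using z0r by simp
        next
          case False
          have "q s = z0(k := s)" using z0y False by (auto simp: q_def fun_eq_iff)
          then show ?thesis using polydisc_upd[OF z0r k, of s] elim z0y[OF False] by simp
        qed
        have "(q s)(i := \<sigma> s) = N (y0(k := s))"
          using Ny[OF yV] by (simp add: q_def \<sigma>_def)
        then have 1: "g ((q s)(i := \<sigma> s)) = (y0(k := s)) i" using gN[OF yV] by simp
        have 2: "(q s)(i := \<sigma> (y0 k)) = q s" by (simp add: \<sigma>0 q_def)
        have "A (y0 k) = 0" using q0 gN[OF y0] by (simp add: A_def z0_def)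
        then have "A s - A (y0 k) + c0 * (\<sigma> s - \<sigma> (y0 k))
          = - (g ((q s)(i := \<sigma> s)) - g ((q s)(i := \<sigma> (y0 k))) - c0 * (\<sigma> s - \<sigma> (y0 k)))"
          by (simp add: 1 2 A_def)
        then show ?case
          using r(3)[OF qr \<sigma>r, of "\<sigma> (y0 k)"] r(1) \<sigma>0 by (simp only: norm_minus_cancel) simp
      qed
    qed
    then show ?thesis by (auto simp: field_differentiable_def \<sigma>_def[abs_def])
  qed
  have Nmap: "holo_map I I V N"
    unfolding holo_map_def
  proof (intro conjI ballI Vo)
    show "N ` V \<subseteq> cspace I" using NU U'c by blast
    fix j show "holo_fun I V (\<lambda>z. N z j)"
    proof (cases "j = i")
      case True
      show ?thesis unfolding True by (rule holo_funI[OF Vo \<tau>c]) (rule \<tau>d)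
    next
      case False
      show ?thesis
        by (rule holo_fun_cong[OF holo_fun_proj[OF Vo, of j]]) (metis False Ny fun_upd_other)
    qed
  qed
  have "biholo I I U' V E"
    by (rule biholoI[OF Emap Nmap]) (use NE EN NU in \<open>auto simp: V_def\<close>)
  moreover have "a \<in> U'" unfolding U'_def
    by (rule mem_polydisc) (use a holo_funD(3)[OF g] \<rho>(1) in auto)
  ultimately show thesis using that[of U' V] U'U by (simp add: E_def[abs_def])
qed

text \<open>The functions are inserted one at a time. A vector dual to the new function has zero
  components in the coordinates already taken, so the new function has a nonzero derivative along a
  free coordinate, which it replaces by \<open>elementary_biholo\<close>.\<close>

lemma coordinates_exist:
  assumes "finite L" "finite I" "a \<in> U" "copen I U"
    and "\<And>l. l \<in> L \<Longrightarrow> holo_fun I U (F l)"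
    and "\<And>l. l \<in> L \<Longrightarrow> \<exists>c. (\<Sum>i\<in>I. pd i (F l) a * c i) \<noteq> 0 \<and>
           (\<forall>m\<in>L. m \<noteq> l \<longrightarrow> (\<Sum>i\<in>I. pd i (F m) a * c i) = 0)"
  shows "\<exists>U' V \<Theta> \<sigma>. a \<in> U' \<and> U' \<subseteq> U \<and> biholo I I U' V \<Theta> \<and> inj_on \<sigma> L \<and> \<sigma> ` L \<subseteq> I \<and>
    (\<forall>l\<in>L. \<forall>z\<in>U'. \<Theta> z (\<sigma> l) = F l z)"
  using assms(1,5,6)
proof (induction L rule: finite_induct)
  case empty
  have "biholo I I U U (\<lambda>z. z)"
    by (rule biholoI) (auto intro: holo_map_id assms(4))
  then show ?case using assms(3) by blast
next
  case (insert l0 L)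
  define Q where "Q U' V \<Theta> \<sigma> \<longleftrightarrow> a \<in> U' \<and> U' \<subseteq> U \<and> biholo I I U' V \<Theta> \<and> inj_on \<sigma> L \<and> \<sigma> ` L \<subseteq> I \<and>
    (\<forall>l\<in>L. \<forall>z\<in>U'. \<Theta> z (\<sigma> l) = F l z)" for U' V \<Theta> \<sigma>
  have "\<exists>U' V \<Theta> \<sigma>. Q U' V \<Theta> \<sigma>"
    unfolding Q_def
  proof (rule insert.IH)
    show "holo_fun I U (F l)" if "l \<in> L" for l using insert.prems(1) that by blast
    fix l assume "l \<in> L"
    then show "\<exists>c. (\<Sum>i\<in>I. pd i (F l) a * c i) \<noteq> 0 \<and> (\<forall>m\<in>L. m \<noteq> l \<longrightarrow> (\<Sum>i\<in>I. pd i (F m) a * c i) = 0)"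
      using insert.prems(2)[of l] by blast
  qed
  then obtain U' V \<Theta> \<sigma> where IH: "Q U' V \<Theta> \<sigma>"
    by blast
  then have H: "a \<in> U'" "U' \<subseteq> U" and bi: "biholo I I U' V \<Theta>" and \<sigma>: "inj_on \<sigma> L" "\<sigma> ` L \<subseteq> I"
    by (simp_all add: Q_def)
  have \<Theta>\<sigma>: "\<Theta> z (\<sigma> l) = F l z" if "l \<in> L" "z \<in> U'" for l z using IH that by (simp add: Q_def)
  note B = biholoD[OF bi]
  have fin: "finite I" by (rule assms(2))
  define b where "b = \<Theta> a"
  have b: "b \<in> V" using H(1) B(3) by (auto simp: b_def)
  define G where "G y = F l0 (inv_into U' \<Theta> y)" for y
  have holF: "holo_fun I U' (F m)" if "m \<in> insert l0 L" for m
    using holo_fun_subset[OF insert.prems(1)[OF that] B(8) H(2)] .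
  have G: "holo_fun I V G"
    unfolding G_def by (rule holo_fun_compose[OF holF B(2) _ fin fin]) (use B(7) in auto)
  obtain c where c: "(\<Sum>i\<in>I. pd i (F l0) a * c i) \<noteq> 0"
    and c2: "\<forall>m\<in>insert l0 L. m \<noteq> l0 \<longrightarrow> (\<Sum>i\<in>I. pd i (F m) a * c i) = 0"
    using insert.prems(2)[of l0] by blast
  have c2: "(\<Sum>i\<in>I. pd i (F m) a * c i) = 0" if "m \<in> L" for m using c2 that insert.hyps(2) by auto
  \<comment> \<open>The image of the dual vector under the differential of \<Theta>.\<close>
  define c' where "c' j = (\<Sum>i\<in>I. pd i (\<lambda>z. \<Theta> z j) a * c i)" for j
  have c'0: "c' (\<sigma> m) = 0" if "m \<in> L" for m
  proof -
    have "pd i (\<lambda>z. \<Theta> z (\<sigma> m)) a = pd i (F m) a" if "i \<in> I" for i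
      by (rule pd_cong[OF B(8) H(1) that fin]) (rule \<Theta>\<sigma>[OF \<open>m \<in> L\<close>])
    then show ?thesis using c2[OF that] by (simp add: c'_def)
  qed
  have "(\<Sum>j\<in>I. pd j G b * c' j) = (\<Sum>i\<in>I. pd i (F l0) a * c i)"
  proof -
    have "pd i (F l0) a = (\<Sum>j\<in>I. pd j G b * pd i (\<lambda>z. \<Theta> z j) a)" if "i \<in> I" for i
    proof -
      have "pd i (F l0) a = pd i (\<lambda>z. G (\<Theta> z)) a"
        by (rule pd_cong[OF B(8) H(1) that fin]) (simp add: G_def B(5))
      also have "\<dots> = (\<Sum>j\<in>I. pd j G b * pd i (\<lambda>z. \<Theta> z j) a)"
        unfolding b_def by (rule pd_compose[OF G B(1) _ fin fin H(1) that]) (simp add: B(3))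
      finally show ?thesis .
    qed
    then have "(\<Sum>i\<in>I. pd i (F l0) a * c i) = (\<Sum>i\<in>I. \<Sum>j\<in>I. pd j G b * pd i (\<lambda>z. \<Theta> z j) a * c i)"
      by (simp add: sum_distrib_right)
    also have "\<dots> = (\<Sum>j\<in>I. \<Sum>i\<in>I. pd j G b * pd i (\<lambda>z. \<Theta> z j) a * c i)" by (rule sum.swap)
    also have "\<dots> = (\<Sum>j\<in>I. pd j G b * c' j)" by (simp add: c'_def sum_distrib_left mult.assoc)
    finally show ?thesis by simp
  qed
  then have "(\<Sum>j\<in>I. pd j G b * c' j) \<noteq> 0" using c by simp
  then obtain i where i: "i \<in> I" "pd i G b * c' i \<noteq> 0" by (meson sum.not_neutral_contains_not_neutral)
  then have i\<sigma>: "i \<notin> \<sigma> ` L" using c'0 by auto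
  have "pd i G b \<noteq> 0" using i(2) by auto
  then obtain V1 W where V1: "b \<in> V1" "V1 \<subseteq> V" "biholo I I V1 W (\<lambda>z. z(i := G z))"
    using elementary_biholo[OF G fin b i(1)] by metis
  define U1 where "U1 = inv_into U' \<Theta> ` V1"
  have bi1: "biholo I I V1 U1 (inv_into U' \<Theta>)"
    unfolding U1_def by (rule biholo_subset[OF biholo_inverse[OF bi] biholoD(8)[OF V1(3)] V1(2)])
  have U1: "U1 \<subseteq> U'" "a \<in> U1" "\<Theta> ` U1 = V1"
    using V1(1,2) B(5,6,7) H(1) unfolding U1_def b_def by (force simp: subset_iff image_iff)+
  have "biholo I I U1 (\<Theta> ` U1) \<Theta>"
    by (rule biholo_subset[OF bi biholoD(9)[OF bi1] U1(1)])
  then have bi2: "biholo I I U1 W (\<lambda>z. (\<Theta> z)(i := G (\<Theta> z)))"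
    using biholo_compose[OF _ V1(3) fin fin fin, of U1 \<Theta>] U1(3) by simp
  define \<sigma>' where "\<sigma>' = \<sigma>(l0 := i)"
  have "inj_on \<sigma>' (insert l0 L)"
    using \<sigma>(1) i\<sigma> insert.hyps(2) by (auto simp: \<sigma>'_def inj_on_def)
  moreover have "\<sigma>' ` insert l0 L \<subseteq> I" using \<sigma>(2) i(1) insert.hyps(2) by (auto simp: \<sigma>'_def)
  moreover have "((\<Theta> z)(i := G (\<Theta> z))) (\<sigma>' l) = F l z" if "l \<in> insert l0 L" "z \<in> U1" for l z
  proof (cases "l = l0")
    case True
    then show ?thesis using B(5) that U1(1) by (auto simp: \<sigma>'_def G_def)
  next
    case False
    then have "l \<in> L" "\<sigma> l \<noteq> i" using that i\<sigma> by auto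
    then show ?thesis using \<Theta>\<sigma> that U1(1) False by (auto simp: \<sigma>'_def)
  qed
  ultimately have "a \<in> U1 \<and> U1 \<subseteq> U \<and> biholo I I U1 W (\<lambda>z. (\<Theta> z)(i := G (\<Theta> z))) \<and>
    inj_on \<sigma>' (insert l0 L) \<and> \<sigma>' ` insert l0 L \<subseteq> I \<and>
    (\<forall>l\<in>insert l0 L. \<forall>z\<in>U1. ((\<Theta> z)(i := G (\<Theta> z))) (\<sigma>' l) = F l z)"
    using U1(1,2) H(2) bi2 by blast
  then show ?case by (intro exI)
qed

subsection \<open>Divided differences and minors\<close>

definition cprod :: "('i \<Rightarrow> complex) set \<Rightarrow> ('j \<Rightarrow> complex) set \<Rightarrow> ('i + 'j \<Rightarrow> complex) set" where
  "cprod U V = {p. p \<circ> Inl \<in> U \<and> p \<circ> Inr \<in> V}"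

lemma case_sum_comp [simp]: "case_sum f g \<circ> Inl = f" "case_sum f g \<circ> Inr = g"
  by auto

lemma case_sum_eta: "case_sum (p \<circ> Inl) (p \<circ> Inr) = p"
  by (auto simp: fun_eq_iff split: sum.split)

lemma case_sum_in_cprod [simp]: "case_sum z w \<in> cprod U V \<longleftrightarrow> z \<in> U \<and> w \<in> V"
  by (simp add: cprod_def)

lemma in_cspace_Plus_iff: "p \<in> cspace (I <+> J) \<longleftrightarrow> p \<circ> Inl \<in> cspace I \<and> p \<circ> Inr \<in> cspace J"
proof
  assume "p \<circ> Inl \<in> cspace I \<and> p \<circ> Inr \<in> cspace J"
  then have "p x = 0" if "x \<notin> I <+> J" for x
    using that by (cases x) (auto simp: cspace_def)
  then show "p \<in> cspace (I <+> J)" by (simp add: cspace_def)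
qed (auto simp: cspace_def)

lemma holo_map_Inl:
  assumes "copen (I <+> J) W" shows "holo_map (I <+> J) I W (\<lambda>p. p \<circ> Inl)"
  using holo_fun_proj[OF assms] copen_subset[OF assms] assms
  by (auto simp: holo_map_def in_cspace_Plus_iff)

lemma holo_map_Inr:
  assumes "copen (I <+> J) W" shows "holo_map (I <+> J) J W (\<lambda>p. p \<circ> Inr)"
  using holo_fun_proj[OF assms] copen_subset[OF assms] assms
  by (auto simp: holo_map_def in_cspace_Plus_iff)

lemma copen_cprod:
  assumes "copen I U" "copen J V"
  shows "copen (I <+> J) (cprod U V)"
proof -
  have "copen (I <+> J) ({p \<in> cspace (I <+> J). p \<circ> Inl \<in> U} \<inter> {p \<in> cspace (I <+> J). p \<circ> Inr \<in> V})"
    by (intro copen_Int copen_vimage[OF holo_map_Inl assms(1)] copen_vimage[OF holo_map_Inr assms(2)] copen_cspace)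
  moreover have "cprod U V = {p \<in> cspace (I <+> J). p \<circ> Inl \<in> U} \<inter> {p \<in> cspace (I <+> J). p \<circ> Inr \<in> V}"
    using copen_subset[OF assms(1)] copen_subset[OF assms(2)] by (auto simp: cprod_def in_cspace_Plus_iff)
  ultimately show ?thesis by simp
qed

lemma holo_map_case_sum:
  assumes "holo_map K I W f" "holo_map K J W g"
  shows "holo_map K (I <+> J) W (\<lambda>p. case_sum (f p) (g p))"
  using assms by (auto simp: holo_map_def in_cspace_Plus_iff image_subset_iff)

lemma biholo_cprod:
  assumes f: "biholo I J U V f" and g: "biholo I' J' U' V' g" and fin: "finite I" "finite J" "finite I'" "finite J'"
  shows "biholo (I <+> I') (J <+> J') (cprod U U') (cprod V V') (\<lambda>p. case_sum (f (p \<circ> Inl)) (g (p \<circ> Inr)))"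
proof -
  note F = biholoD[OF f] and G = biholoD[OF g]
  have c: "copen (I <+> I') (cprod U U')" "copen (J <+> J') (cprod V V')"
    by (intro copen_cprod F G)+
  show ?thesis
  proof (rule biholoI)
    show "holo_map (I <+> I') (J <+> J') (cprod U U') (\<lambda>p. case_sum (f (p \<circ> Inl)) (g (p \<circ> Inr)))"
      by (rule holo_map_case_sum; rule holo_map_compose[OF F(1) holo_map_Inl[OF c(1)]]
          holo_map_compose[OF G(1) holo_map_Inr[OF c(1)]]) (use fin in \<open>auto simp: cprod_def\<close>)
    show "holo_map (J <+> J') (I <+> I') (cprod V V') (\<lambda>p. case_sum (inv_into U f (p \<circ> Inl)) (inv_into U' g (p \<circ> Inr)))"
      by (rule holo_map_case_sum; rule holo_map_compose[OF F(2) holo_map_Inl[OF c(2)]]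
          holo_map_compose[OF G(2) holo_map_Inr[OF c(2)]]) (use fin in \<open>auto simp: cprod_def\<close>)
  qed (use F G in \<open>auto simp: cprod_def case_sum_eta\<close>)
qed

lemma pd_case_sum:
  "pd (Inl i) (\<lambda>p. g (p \<circ> Inl)) p = pd i g (p \<circ> Inl)"
  "pd (Inr j) (\<lambda>p. g (p \<circ> Inl)) p = 0"
  "pd (Inr j) (\<lambda>p. h (p \<circ> Inr)) p = pd j h (p \<circ> Inr)"
  "pd (Inl i) (\<lambda>p. h (p \<circ> Inr)) p = 0"
proof -
  have 1: "(p(Inl i := t)) \<circ> Inl = (p \<circ> Inl)(i := t)" "(p(Inl i := t)) \<circ> Inr = p \<circ> Inr"
    "(p(Inr j := t)) \<circ> Inr = (p \<circ> Inr)(j := t)" "(p(Inr j := t)) \<circ> Inl = p \<circ> Inl" for t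
    by (auto simp: fun_eq_iff)
  show "pd (Inl i) (\<lambda>p. g (p \<circ> Inl)) p = pd i g (p \<circ> Inl)"
    "pd (Inr j) (\<lambda>p. g (p \<circ> Inl)) p = 0"
    "pd (Inr j) (\<lambda>p. h (p \<circ> Inr)) p = pd j h (p \<circ> Inr)"
    "pd (Inl i) (\<lambda>p. h (p \<circ> Inr)) p = 0"
    by (simp_all add: pd_def 1)
qed

lemma sum_Plus:
  assumes "finite I" "finite J"
  shows "(\<Sum>x\<in>I <+> J. f x) = (\<Sum>i\<in>I. f (Inl i)) + (\<Sum>j\<in>J. f (Inr j))"
  using assms by (simp add: sum.Plus)

section \<open>Divided differences by integration along segments (Hadamard's lemma)\<close>

definition segm :: "('i + 'i \<Rightarrow> complex) \<Rightarrow> complex \<Rightarrow> 'i \<Rightarrow> complex" where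
  "segm p t = (\<lambda>k. p (Inr k) + t * (p (Inl k) - p (Inr k)))"

lemma segm_polydisc:
  assumes "p \<in> cprod (polydisc I a r) (polydisc I a r)" "t \<in> {0..1}"
  shows "segm p (complex_of_real t) \<in> polydisc I a r"
proof -
  have "dist (a i) (segm p (complex_of_real t) i) < r" if "i \<in> I" for i
  proof -
    have "(1 - t) *\<^sub>R p (Inr i) + t *\<^sub>R p (Inl i) \<in> ball (a i) r"
      by (rule convexD[OF convex_ball]) (use assms that in \<open>auto simp: cprod_def polydisc_def\<close>)
    moreover have "(1 - t) *\<^sub>R p (Inr i) + t *\<^sub>R p (Inl i) = segm p (complex_of_real t) i"
      by (simp add: segm_def scaleR_conv_of_real algebra_simps)
    ultimately show ?thesis by simp
  qed
  moreover have "segm p (complex_of_real t) \<in> cspace I"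
    using assms(1) by (auto simp: cprod_def polydisc_def cspace_def segm_def)
  ultimately show ?thesis by (simp add: polydisc_def)
qed

lemma continuous_on_segm: "continuous_on S (\<lambda>x. segm (fst x) (complex_of_real (snd x)))"
proof (rule continuous_on_coordinatewise_then_product)
  fix k
  have c: "continuous_on S (\<lambda>x. (fst x) y)" for y :: "'a + 'a"
    by (rule continuous_on_product_then_coordinatewise) (rule continuous_on_fst[OF continuous_on_id])
  show "continuous_on S (\<lambda>x. segm (fst x) (complex_of_real (snd x)) k)"
    unfolding segm_def by (intro continuous_intros c)
qed

text \<open>Differentiation under the integral sign, one coordinate \<open>q\<close> of the product
  at a time. The integrand is holomorphic in \<open>q\<close>, and by
  \<open>strict_partial_continuous\<close> its derivative is jointly continuous, which is what the
  Leibniz rule requires. Convexity of the polydisc keeps the segments in \<open>U\<close>.\<close>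

lemma holo_fun_divided_difference:
  assumes g: "holo_fun I U g" and fin: "finite I" and P: "polydisc I a r \<subseteq> U" and i: "i \<in> I"
  shows "holo_fun (I <+> I) (cprod (polydisc I a r) (polydisc I a r))
    (\<lambda>p. integral {0..1} (\<lambda>t. pd i g (segm p (complex_of_real t))))"
proof (rule holo_funI)
  let ?P = "polydisc I a r"
  let ?B = "cprod ?P ?P"
  let ?h = "\<lambda>p t. pd i g (segm p (complex_of_real t))"
  show Bo: "copen (I <+> I) ?B" by (intro copen_cprod copen_polydisc fin)
  have joint: "continuous_on (?B \<times> cbox 0 1) (\<lambda>(p, t). ?h p t)"
  proof -
    have "continuous_on (?B \<times> cbox 0 1) (\<lambda>x. pd i g (segm (fst x) (complex_of_real (snd x))))"
      by (rule continuous_on_compose2[OF continuous_on_pd[OF g fin i] continuous_on_segm])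
         (use segm_polydisc P in fastforce)
    then show ?thesis by (simp add: case_prod_beta')
  qed
  show "continuous_on ?B (\<lambda>p. integral {0..1} (?h p))"
    using integral_continuous_on_param[OF joint] by simp
  have hol: "holo_fun (I <+> I) ?B (\<lambda>p. ?h p t)" if t: "t \<in> {0..1}" for t
  proof (rule holo_fun_compose[OF holo_fun_pd_holo[OF g fin i], where f = "\<lambda>p. segm p (complex_of_real t)"])
    show "holo_map (I <+> I) I ?B (\<lambda>p. segm p (complex_of_real t))"
      unfolding holo_map_def
    proof (intro conjI ballI Bo)
      show "(\<lambda>p. segm p (complex_of_real t)) ` ?B \<subseteq> cspace I"
        using segm_polydisc[OF _ t] polydisc_subset_cspace by blast
      show "holo_fun (I <+> I) ?B (\<lambda>z. segm z (complex_of_real t) j)" for j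
        unfolding segm_def by (intro holo_fun_intros Bo)
    qed
    show "(\<lambda>p. segm p (complex_of_real t)) ` ?B \<subseteq> U" using segm_polydisc[OF _ t] P by blast
  qed (use fin in auto)
  fix p q assume p: "p \<in> ?B" and q: "q \<in> I <+> I"
  have fin2: "finite (I <+> I)" using fin by simp
  have "open {s. p(q := s) \<in> ?B}" by (rule open_slice[OF Bo q fin2])
  moreover have "p q \<in> {s. p(q := s) \<in> ?B}" using p by simp
  ultimately obtain \<rho> where \<rho>: "\<rho> > 0" "ball (p q) \<rho> \<subseteq> {s. p(q := s) \<in> ?B}"
    using open_contains_ball by blast
  define S where "S = ball (p q) \<rho>"
  define H where "H t s = ?h (p(q := s)) t" for t s
  have inB: "p(q := s) \<in> ?B" if "s \<in> S" for s using that \<rho> by (auto simp: S_def)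
  have contH: "continuous_on ({0..1} \<times> S) (\<lambda>(t, s). H t s)"
  proof -
    have "continuous_on ({0..1} \<times> S) (\<lambda>x. (\<lambda>(p, t). ?h p t) (p(q := snd x), fst x))"
    proof (rule continuous_on_compose2[OF joint])
      have "continuous_on ({0..1::real} \<times> S) (\<lambda>x. p(q := snd x))"
      proof (rule continuous_on_coordinatewise_then_product)
        fix j show "continuous_on ({0..1::real} \<times> S) (\<lambda>x. (p(q := snd x)) j)"
          using continuous_on_snd[OF continuous_on_id, of "{0..1::real} \<times> S"] by (cases "j = q") auto
      qed
      moreover have "continuous_on ({0..1::real} \<times> S) (\<lambda>x. fst x)"
        by (intro continuous_intros)
      ultimately show "continuous_on ({0..1::real} \<times> S) (\<lambda>x. (p(q := snd x), fst x))"
        by (rule continuous_on_Pair)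
    qed (use inB in auto)
    then show ?thesis by (simp add: H_def case_prod_beta')
  qed
  have holH: "H t holomorphic_on S" if "t \<in> {0..1}" for t
    using holo_funD(4)[OF hol[OF that] p q] unfolding H_def
    by (rule holomorphic_on_subset) (use inB in auto)
  have cont': "continuous_on ({0..1} \<times> S) (\<lambda>(t, s). deriv (H t) s)"
    by (rule strict_partial_continuous[OF _ contH holH]) (auto simp: S_def)
  have "(\<lambda>s. integral (cbox 0 1) (\<lambda>t. H t s)) holomorphic_on S"
  proof (rule leibniz_rule_holomorphic)
    show "((\<lambda>s. H t s) has_field_derivative deriv (H t) s) (at s within S)" if "s \<in> S" "t \<in> cbox 0 1" for s t
      using holH[of t] that by (simp add: S_def holomorphic_derivI has_field_derivative_at_within)
    show "(\<lambda>t. H t s) integrable_on cbox 0 1" if "s \<in> S" for s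
    proof (rule integrable_continuous)
      have "continuous_on (cbox 0 1) (\<lambda>t. (\<lambda>(t, s). H t s) (t, s))"
        by (rule continuous_on_compose2[OF contH]) (use that in \<open>auto intro!: continuous_intros\<close>)
      then show "continuous_on (cbox 0 1) (\<lambda>t. H t s)" by simp
    qed
    have "continuous_on (S \<times> cbox 0 1) (\<lambda>x. (\<lambda>(t, s). deriv (H t) s) (snd x, fst x))"
      by (rule continuous_on_compose2[OF cont']) (auto intro!: continuous_intros)
    then show "continuous_on (S \<times> cbox 0 1) (\<lambda>(s, t). deriv (H t) s)" by (simp add: case_prod_beta')
  qed (simp add: S_def)
  then have "(\<lambda>s. integral {0..1} (?h (p(q := s)))) holomorphic_on S" by (simp add: H_def)
  then show "(\<lambda>s. integral {0..1} (?h (p(q := s)))) field_differentiable at (p q)"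
    using \<rho>(1) by (simp add: S_def holomorphic_on_imp_differentiable_at)
qed

text \<open>Integrating the derivative of \<open>g\<close> along the segment from
  \<open>p \<circ> Inr\<close> to \<open>p \<circ> Inl\<close> expresses the increment with averaged
  partial derivatives as coefficients. On the diagonal the segment is a point and the average is the
  partial derivative itself. The parameter of \<open>segm\<close> is complex so that the complex
  chain rule applies before the restriction to real values.\<close>

lemma divided_differences:
  assumes g: "holo_fun I U g" and fin: "finite I" and P: "polydisc I a r \<subseteq> U"
  shows "\<exists>M. (\<forall>i\<in>I. holo_fun (I <+> I) (cprod (polydisc I a r) (polydisc I a r)) (M i)) \<and>
    (\<forall>p\<in>cprod (polydisc I a r) (polydisc I a r).
       g (p \<circ> Inl) - g (p \<circ> Inr) = (\<Sum>i\<in>I. M i p * (p (Inl i) - p (Inr i))) \<and>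
       (\<forall>i\<in>I. p \<circ> Inl = p \<circ> Inr \<longrightarrow> M i p = pd i g (p \<circ> Inl)))"
proof (intro exI conjI ballI impI)
  let ?P = "polydisc I a r"
  let ?M = "\<lambda>i p. integral {0..1} (\<lambda>t. pd i g (segm p (complex_of_real t)))"
  show "holo_fun (I <+> I) (cprod ?P ?P) (?M i)" if "i \<in> I" for i
    by (rule holo_fun_divided_difference[OF g fin P that])
  fix p assume p: "p \<in> cprod ?P ?P"
  show "?M i p = pd i g (p \<circ> Inl)" if "p \<circ> Inl = p \<circ> Inr" for i
  proof -
    have "segm p t = p \<circ> Inl" for t
      using fun_cong[OF that] by (auto simp: segm_def fun_eq_iff)
    then show ?thesis by simp
  qed
  have segU: "segm p (complex_of_real t) \<in> U" if "t \<in> {0..1}" for t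
    using segm_polydisc[OF p that] P by blast
  have segc: "segm p s \<in> cspace I" for s
    using p by (auto simp: cprod_def polydisc_def cspace_def segm_def)
  have "((\<lambda>t. \<Sum>i\<in>I. pd i g (segm p (complex_of_real t)) * (p (Inl i) - p (Inr i)))
     has_integral (g (segm p (complex_of_real 1)) - g (segm p (complex_of_real 0)))) {0..1}"
  proof (rule fundamental_theorem_of_calculus)
    fix t :: real assume t: "t \<in> {0..1}"
    have "((\<lambda>s. g (segm p s)) has_field_derivative
       (\<Sum>i\<in>I. pd i g (segm p (complex_of_real t)) * (p (Inl i) - p (Inr i)))) (at (complex_of_real t))"
    proof (rule chain_rule[OF g fin])
      obtain \<rho> where \<rho>: "\<rho> > 0" "polydisc I (segm p (complex_of_real t)) \<rho> \<subseteq> U"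
        using segU[OF t] holo_funD(1)[OF g] unfolding copen_iff[OF fin] by auto
      have "\<forall>\<^sub>F s in nhds (complex_of_real t). segm p s \<in> polydisc I (segm p (complex_of_real t)) \<rho>"
        by (rule eventually_polydisc[OF fin _ \<rho>(1)]) (simp_all add: segc, simp add: segm_def)
      then show "\<forall>\<^sub>F s in nhds (complex_of_real t). segm p s \<in> U"
        by eventually_elim (use \<rho>(2) in blast)
      show "((\<lambda>s. segm p s i) has_field_derivative (p (Inl i) - p (Inr i))) (at (complex_of_real t))" for i
        unfolding segm_def by (auto intro!: derivative_eq_intros)
    qed
    then show "((\<lambda>t. g (segm p (complex_of_real t))) has_vector_derivative
       (\<Sum>i\<in>I. pd i g (segm p (complex_of_real t)) * (p (Inl i) - p (Inr i)))) (at t within {0..1})"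
      by (rule has_vector_derivative_real_field)
  qed simp
  moreover have "((\<lambda>t. \<Sum>i\<in>I. pd i g (segm p (complex_of_real t)) * (p (Inl i) - p (Inr i)))
     has_integral (\<Sum>i\<in>I. ?M i p * (p (Inl i) - p (Inr i)))) {0..1}"
  proof (intro has_integral_sum fin has_integral_mult_left integrable_integral)
    fix i assume i: "i \<in> I"
    have "continuous_on {0..1} (\<lambda>t. segm (fst (p, t)) (complex_of_real (snd (p, t))))"
      by (rule continuous_on_compose2[OF continuous_on_segm[of UNIV]]) (auto intro!: continuous_intros)
    then have "continuous_on {0..1} (\<lambda>t. pd i g (segm p (complex_of_real t)))"
      by (intro continuous_on_compose2[OF continuous_on_pd[OF g fin i]]) (use segU in auto)
    then show "(\<lambda>t. pd i g (segm p (complex_of_real t))) integrable_on {0..1}"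
      by (rule integrable_continuous_interval)
  qed
  ultimately have "g (segm p (complex_of_real 1)) - g (segm p (complex_of_real 0)) = (\<Sum>i\<in>I. ?M i p * (p (Inl i) - p (Inr i)))"
    by (rule has_integral_unique)
  moreover have "segm p (complex_of_real 1) = p \<circ> Inl" "segm p (complex_of_real 0) = p \<circ> Inr"
    by (auto simp: segm_def fun_eq_iff)
  ultimately show "g (p \<circ> Inl) - g (p \<circ> Inr) = (\<Sum>i\<in>I. ?M i p * (p (Inl i) - p (Inr i)))" by simp
qed

section \<open>Row bases, ranks and minors\<close>

definition row_basis :: "'i set \<Rightarrow> 'j set \<Rightarrow> ('j \<Rightarrow> 'i \<Rightarrow> complex) \<Rightarrow> 'j set \<Rightarrow> bool" where
  "row_basis I J A T \<longleftrightarrow> T \<subseteq> J \<and>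
    (\<forall>w. (\<forall>j\<in>T. (\<Sum>i\<in>I. A j i * w i) = 0) \<longrightarrow> (\<forall>j\<in>J. (\<Sum>i\<in>I. A j i * w i) = 0)) \<and>
    (\<forall>j\<in>T. \<exists>w. (\<Sum>i\<in>I. A j i * w i) \<noteq> 0 \<and> (\<forall>j'\<in>T. j' \<noteq> j \<longrightarrow> (\<Sum>i\<in>I. A j' i * w i) = 0))"

lemma row_basisD:
  assumes "row_basis I J A T"
  shows "T \<subseteq> J"
    "\<And>w j. (\<And>j. j \<in> T \<Longrightarrow> (\<Sum>i\<in>I. A j i * w i) = 0) \<Longrightarrow> j \<in> J \<Longrightarrow> (\<Sum>i\<in>I. A j i * w i) = 0"
    "\<And>j. j \<in> T \<Longrightarrow> \<exists>w. (\<Sum>i\<in>I. A j i * w i) \<noteq> 0 \<and> (\<forall>j'\<in>T. j' \<noteq> j \<longrightarrow> (\<Sum>i\<in>I. A j' i * w i) = 0)"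
  using assms unfolding row_basis_def by simp_all

text \<open>A set of rows of least cardinality with the same common kernel works: omitting one of
  its rows enlarges the kernel, and a vector gained in this way is dual to that row.\<close>

lemma row_basis_exists:
  assumes "finite J"
  shows "\<exists>T. row_basis I J A T"
proof -
  define R where "R j w = (\<Sum>i\<in>I. A j i * w i)" for j w
  define P where "P T \<longleftrightarrow> T \<subseteq> J \<and> (\<forall>w. (\<forall>j\<in>T. R j w = 0) \<longrightarrow> (\<forall>j\<in>J. R j w = 0))" for T
  have "P J" by (simp add: P_def)
  then obtain T where T: "P T" "\<And>T'. P T' \<Longrightarrow> card T \<le> card T'"
    using ex_has_least_nat[of P J card] by blast
  have finT: "finite T" using T(1) assms finite_subset by (auto simp: P_def)
  have "\<exists>w. R j w \<noteq> 0 \<and> (\<forall>j'\<in>T. j' \<noteq> j \<longrightarrow> R j' w = 0)" if j: "j \<in> T" for j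
  proof -
    have "\<not> P (T - {j})" using T(2)[of "T - {j}"] finT j by (metis card_Diff1_less not_le)
    then obtain w j'' where w: "\<forall>j'\<in>T - {j}. R j' w = 0" "j'' \<in> J" "R j'' w \<noteq> 0"
      using T(1) by (auto simp: P_def)
    have "R j w \<noteq> 0"
    proof
      assume "R j w = 0"
      then have "\<forall>j'\<in>T. R j' w = 0" using w(1) by auto
      then show False using T(1) w(2,3) by (auto simp: P_def)
    qed
    then show ?thesis using w(1) by auto
  qed
  then have "row_basis I J A T" using T(1) unfolding P_def R_def row_basis_def by simp
  then show ?thesis by blast
qed

lemma pd_linear:
  assumes "finite I" "i \<in> I"
  shows "pd i (\<lambda>z. \<Sum>k\<in>I. c k * z k) z = c i"
proof -
  have eq: "(\<lambda>t. \<Sum>k\<in>I. c k * (z(i := t)) k) = (\<lambda>t. (\<Sum>k\<in>I - {i}. c k * z k) + c i * t)"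
  proof
    fix t show "(\<Sum>k\<in>I. c k * (z(i := t)) k) = (\<Sum>k\<in>I - {i}. c k * z k) + c i * t"
      using assms by (subst sum.remove[of I i]) (auto intro!: sum.cong)
  qed
  have "((\<lambda>t. (\<Sum>k\<in>I - {i}. c k * z k) + c i * t) has_field_derivative c i) (at (z i))"
    by (auto intro!: derivative_eq_intros)
  then show ?thesis unfolding pd_def eq by (rule DERIV_imp_deriv)
qed

text \<open>The rows, viewed as linear functions, become distinct coordinates of
  \<open>cspace I\<close>, and the injection \<sigma> of \<open>coordinates_exist\<close> compares
  the cardinalities.\<close>

lemma card_independent_rows_le:
  fixes A :: "'j \<Rightarrow> 'i \<Rightarrow> complex"
  assumes "finite I" "finite T"
    and dual: "\<And>j. j \<in> T \<Longrightarrow> \<exists>w. (\<Sum>i\<in>I. A j i * w i) \<noteq> 0 \<and> (\<forall>j'\<in>T. j' \<noteq> j \<longrightarrow> (\<Sum>i\<in>I. A j' i * w i) = 0)"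
  shows "card T \<le> card I"
proof -
  define F where "F j z = (\<Sum>i\<in>I. A j i * z i)" for j and z :: "'i \<Rightarrow> complex"
  have F: "holo_fun I (cspace I) (F j)" for j
    unfolding F_def by (intro holo_fun_intros copen_cspace)
  have pdF: "pd i (F j) z = A j i" if "i \<in> I" for i j z
    unfolding F_def by (rule pd_linear[OF assms(1) that])
  have z: "(0::'i \<Rightarrow> complex) \<in> cspace I" by (simp add: cspace_def)
  have d: "\<exists>c. (\<Sum>i\<in>I. pd i (F l) 0 * c i) \<noteq> 0 \<and> (\<forall>m\<in>T. m \<noteq> l \<longrightarrow> (\<Sum>i\<in>I. pd i (F m) 0 * c i) = 0)"
    if "l \<in> T" for l
    using dual[OF that] by (simp add: pdF cong: sum.cong)
  obtain \<sigma> where "inj_on \<sigma> T" "\<sigma> ` T \<subseteq> I"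
    using coordinates_exist[OF assms(2,1) z copen_cspace F d] by blast
  then show ?thesis using card_inj_on_le assms(1) by blast
qed

text \<open>The maximal minor of the matrix \<open>A\<close> on the rows \<open>\<tau> 0, \<dots>, \<tau> (n - 1)\<close> (repetitions allowed), the
  columns being numbered by \<open>e\<close>.\<close>

definition minor :: "nat \<Rightarrow> (nat \<Rightarrow> 'i) \<Rightarrow> (nat \<Rightarrow> 'j) \<Rightarrow> ('j \<Rightarrow> 'i \<Rightarrow> complex) \<Rightarrow> complex" where
  "minor n e \<tau> A = (\<Sum>\<pi> | \<pi> permutes {0..<n}. signof \<pi> * (\<Prod>k = 0..<n. A (\<tau> k) (e (\<pi> k))))"

lemma minor_det: "minor n e \<tau> A = Determinant.det (Matrix.mat n n (\<lambda>(k, l). A (\<tau> k) (e l)))"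
proof -
  have "(\<Prod>k = 0..<n. A (\<tau> k) (e (\<pi> k))) = (\<Prod>k = 0..<n. index_mat (Matrix.mat n n (\<lambda>(k, l). A (\<tau> k) (e l))) (k, \<pi> k))"
    if "\<pi> permutes {0..<n}" for \<pi>
    by (intro prod.cong) (use permutes_in_image[OF that] in auto)
  then show ?thesis by (simp add: minor_def Determinant.det_def)
qed

lemma minor_eq_0_iff:
  assumes e: "bij_betw e {0..<n} I"
  shows "minor n e \<tau> A = 0 \<longleftrightarrow>
    (\<exists>w. (\<exists>i\<in>I. w i \<noteq> 0) \<and> (\<forall>k<n. (\<Sum>i\<in>I. A (\<tau> k) i * w i) = 0))"
proof -
  define B where "B = Matrix.mat n n (\<lambda>(k, l). A (\<tau> k) (e l))"
  have B: "B \<in> carrier_mat n n" by (simp add: B_def)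
  have prod: "vec_index (B *\<^sub>v v) k = (\<Sum>l = 0..<n. A (\<tau> k) (e l) * vec_index v l)"
    if "k < n" "v \<in> carrier_vec n" for k v
    using that by (simp add: B_def scalar_prod_def)
  have sumI: "(\<Sum>i\<in>I. A j i * w i) = (\<Sum>l = 0..<n. A j (e l) * w (e l))" for j w
    using sum.reindex_bij_betw[OF e, of "\<lambda>i. A j i * w i"] by simp
  have "minor n e \<tau> A = 0 \<longleftrightarrow> (\<exists>v. v \<in> carrier_vec n \<and> v \<noteq> 0\<^sub>v n \<and> B *\<^sub>v v = 0\<^sub>v n)"
    unfolding minor_det B_def[symmetric] by (rule det_0_iff_vec_prod_zero[OF B])
  also have "\<dots> \<longleftrightarrow> (\<exists>w. (\<exists>i\<in>I. w i \<noteq> 0) \<and> (\<forall>k<n. (\<Sum>i\<in>I. A (\<tau> k) i * w i) = 0))"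
  proof
    assume "\<exists>v. v \<in> carrier_vec n \<and> v \<noteq> 0\<^sub>v n \<and> B *\<^sub>v v = 0\<^sub>v n"
    then obtain v where v: "v \<in> carrier_vec n" "v \<noteq> 0\<^sub>v n" "B *\<^sub>v v = 0\<^sub>v n" by blast
    define w where "w i = vec_index v (the_inv_into {0..<n} e i)" for i
    have w: "w (e l) = vec_index v l" if "l < n" for l
      using that e by (simp add: w_def the_inv_into_f_f bij_betw_def)
    obtain l where l: "l < n" "vec_index v l \<noteq> 0"
      using v(1,2) by (metis carrier_vecD eq_vecI index_zero_vec(1) index_zero_vec(2))
    have "e l \<in> I" using e l(1) by (auto simp: bij_betw_def)
    moreover have "(\<Sum>i\<in>I. A (\<tau> k) i * w i) = 0" if "k < n" for k
    proof -
      have "(\<Sum>i\<in>I. A (\<tau> k) i * w i) = vec_index (B *\<^sub>v v) k"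
        unfolding sumI prod[OF that v(1)] by (intro sum.cong) (auto simp: w)
      then show ?thesis using v(3) that by simp
    qed
    ultimately show "\<exists>w. (\<exists>i\<in>I. w i \<noteq> 0) \<and> (\<forall>k<n. (\<Sum>i\<in>I. A (\<tau> k) i * w i) = 0)"
      using w[OF l(1)] l(2) by metis
  next
    assume "\<exists>w. (\<exists>i\<in>I. w i \<noteq> 0) \<and> (\<forall>k<n. (\<Sum>i\<in>I. A (\<tau> k) i * w i) = 0)"
    then obtain w i where w: "i \<in> I" "w i \<noteq> 0" "\<And>k. k < n \<Longrightarrow> (\<Sum>i\<in>I. A (\<tau> k) i * w i) = 0" by blast
    define v where "v = Matrix.vec n (\<lambda>l. w (e l))"
    have v: "v \<in> carrier_vec n" by (simp add: v_def)
    obtain l where l: "l < n" "e l = i" using e w(1) by (auto simp: bij_betw_def)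
    have "vec_index v l \<noteq> 0" using l w(2) by (simp add: v_def)
    then have "v \<noteq> 0\<^sub>v n" using l(1) by auto
    moreover have "B *\<^sub>v v = 0\<^sub>v n"
    proof (rule eq_vecI)
      show "dim_vec (B *\<^sub>v v) = dim_vec (0\<^sub>v n)" by (simp add: B_def)
      fix k assume "k < dim_vec (0\<^sub>v n :: complex vec)"
      then have k: "k < n" by simp
      have "vec_index (B *\<^sub>v v) k = (\<Sum>i\<in>I. A (\<tau> k) i * w i)"
        unfolding sumI prod[OF k v] by (intro sum.cong) (auto simp: v_def)
      then show "vec_index (B *\<^sub>v v) k = vec_index (0\<^sub>v n) k" using w(3)[OF k] k by simp
    qed
    ultimately show "\<exists>v. v \<in> carrier_vec n \<and> v \<noteq> 0\<^sub>v n \<and> B *\<^sub>v v = 0\<^sub>v n" using v by blast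
  qed
  finally show ?thesis .
qed

text \<open>Non-injectivity becomes a finite list of polynomial equations in the entries, as an
  analytic set requires. In the backward direction a row basis has at most \<open>n\<close> rows;
  one choice \<tau> runs through all of them, and a kernel vector of this square submatrix is
  annihilated by every row.\<close>

lemma noninjective_iff_minors:
  fixes A :: "'j \<Rightarrow> 'i \<Rightarrow> complex"
  assumes e: "bij_betw e {0..<n} I" and fin: "finite I" "finite J"
  shows "(\<exists>w. (\<exists>i\<in>I. w i \<noteq> 0) \<and> (\<forall>j\<in>J. (\<Sum>i\<in>I. A j i * w i) = 0)) \<longleftrightarrow>
    (\<forall>\<tau>\<in>{0..<n} \<rightarrow>\<^sub>E J. minor n e \<tau> A = 0)"
proof
  assume "\<exists>w. (\<exists>i\<in>I. w i \<noteq> 0) \<and> (\<forall>j\<in>J. (\<Sum>i\<in>I. A j i * w i) = 0)"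
  then show "\<forall>\<tau>\<in>{0..<n} \<rightarrow>\<^sub>E J. minor n e \<tau> A = 0"
    unfolding minor_eq_0_iff[OF e] by (fastforce simp: PiE_iff)
next
  assume R: "\<forall>\<tau>\<in>{0..<n} \<rightarrow>\<^sub>E J. minor n e \<tau> A = 0"
  obtain T where rb: "row_basis I J A T" using row_basis_exists[OF fin(2)] by blast
  note T = row_basisD(1,2)[OF rb] and dual = row_basisD(3)[OF rb]
  have finT: "finite T" using T(1) fin(2) finite_subset by blast
  have cT: "card T \<le> n"
    using card_independent_rows_le[OF fin(1) finT dual] bij_betw_same_card[OF e] by simp
  show "\<exists>w. (\<exists>i\<in>I. w i \<noteq> 0) \<and> (\<forall>j\<in>J. (\<Sum>i\<in>I. A j i * w i) = 0)"
  proof (cases "T = {}")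
    case True
    show ?thesis
    proof (cases "I = {}")
      case True
      \<comment> \<open>The only minor is the empty determinant; its vanishing would give a nonzero
        entry over an empty index set, so this case is contradictory.\<close>
      then have "n = 0" using e by (auto simp: bij_betw_def)
      then have "(\<lambda>k. undefined) \<in> {0..<n} \<rightarrow>\<^sub>E J" by simp
      then have "minor n e (\<lambda>k. undefined) A = 0" using R by blast
      then have "\<exists>w. (\<exists>i\<in>I. w i \<noteq> 0) \<and> (\<forall>k<n. (\<Sum>i\<in>I. A undefined i * w i) = 0)"
        unfolding minor_eq_0_iff[OF e] .
      then show ?thesis using True by blast
    next
      case False
      then obtain i where "i \<in> I" by blast
      then show ?thesis using T(2)[of "\<lambda>_. 1"] \<open>T = {}\<close> by (intro exI[of _ "\<lambda>_. 1"]) auto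
    qed
  next
    case False
    obtain b where b: "bij_betw b {0..<card T} T" using ex_bij_betw_nat_finite[OF finT] by blast
    obtain t0 where t0: "t0 \<in> T" using False by blast
    \<comment> \<open>Positions beyond \<open>card T\<close> repeat the row \<open>t0\<close>, which
      puts no further condition on kernel vectors.\<close>
    define \<tau> where "\<tau> = (\<lambda>k\<in>{0..<n}. if k < card T then b k else t0)"
    have \<tau>: "\<tau> \<in> {0..<n} \<rightarrow>\<^sub>E J" 
    proof -
      have "b x \<in> J" if "x < card T" for x using bij_betwE[OF b] that T(1) by auto
      moreover have "t0 \<in> J" using t0 T(1) by blast
      ultimately show ?thesis by (auto simp: \<tau>_def)
    qed
    have sur: "\<exists>k<n. \<tau> k = j" if "j \<in> T" for j
    proof -
      have "j \<in> b ` {0..<card T}" using that bij_betw_imp_surj_on[OF b] by simp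
      then obtain k where "k < card T" "b k = j" by auto
      then show ?thesis using cT by (intro exI[of _ k]) (auto simp: \<tau>_def)
    qed
    have "minor n e \<tau> A = 0" using R \<tau> by blast
    then obtain w where w: "\<exists>i\<in>I. w i \<noteq> 0" "\<forall>k<n. (\<Sum>i\<in>I. A (\<tau> k) i * w i) = 0"
      unfolding minor_eq_0_iff[OF e] by blast
    have "(\<Sum>i\<in>I. A j i * w i) = 0" if "j \<in> T" for j using sur[OF that] w(2) by blast
    then have "\<forall>j\<in>J. (\<Sum>i\<in>I. A j i * w i) = 0" using T(2)[of w] by simp
    then show ?thesis using w(1) by blast
  qed
qed

lemma holo_map_local:
  assumes "\<And>a. a \<in> U \<Longrightarrow> \<exists>V\<subseteq>U. a \<in> V \<and> holo_map I J V f" and fin: "finite I"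
  shows "holo_map I J U f"
  unfolding holo_map_def
proof (intro conjI ballI)
  obtain V where V: "\<And>a. a \<in> U \<Longrightarrow> V a \<subseteq> U \<and> a \<in> V a \<and> holo_map I J (V a) f"
    using assms(1) by metis
  have "U = \<Union>(V ` U)" using V by blast
  moreover have "copen I (\<Union>(V ` U))"
    by (rule copen_Union) (use V holo_mapD(1) in blast)
  ultimately show "copen I U" by simp
  show "f ` U \<subseteq> cspace J" using V holo_mapD(4) by blast
  show "holo_fun I U (\<lambda>z. f z j)" for j
  proof (rule holo_fun_local[OF _ fin])
    fix a assume "a \<in> U"
    then show "\<exists>V\<subseteq>U. a \<in> V \<and> holo_fun I V (\<lambda>z. f z j)"
      using V[of a] holo_map_component[of I J "V a" f j] by (intro exI[of _ "V a"]) simp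
  qed
qed

section \<open>Directional derivatives\<close>

definition dd :: "'i set \<Rightarrow> (('i \<Rightarrow> complex) \<Rightarrow> complex) \<Rightarrow> ('i \<Rightarrow> complex) \<Rightarrow> ('i \<Rightarrow> complex) \<Rightarrow> complex" where
  "dd I g z v = (\<Sum>i\<in>I. pd i g z * v i)"

lemma cdiff_dd: "cdiff I f z v j = dd I (\<lambda>z. f z j) z v"
  by (simp add: cdiff_pd dd_def)

lemma dd_compose:
  assumes "holo_fun J V g" "holo_map I J U f" "f ` U \<subseteq> V" "finite I" "finite J" "z \<in> U"
  shows "dd I (\<lambda>z. g (f z)) z v = dd J g (f z) (\<lambda>j. dd I (\<lambda>z. f z j) z v)"
proof -
  have "dd I (\<lambda>z. g (f z)) z v = (\<Sum>i\<in>I. \<Sum>j\<in>J. pd j g (f z) * pd i (\<lambda>z. f z j) z * v i)"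
    unfolding dd_def by (intro sum.cong refl) (simp add: pd_compose[OF assms] sum_distrib_right)
  also have "\<dots> = (\<Sum>j\<in>J. \<Sum>i\<in>I. pd j g (f z) * pd i (\<lambda>z. f z j) z * v i)" by (rule sum.swap)
  finally show ?thesis by (simp add: dd_def sum_distrib_left mult.assoc)
qed

lemma dd_cong:
  assumes "copen I U" "z \<in> U" "finite I" "\<And>z. z \<in> U \<Longrightarrow> g z = h z"
  shows "dd I g z v = dd I h z v"
  unfolding dd_def by (intro sum.cong refl arg_cong2[where f = "(*)"] pd_cong[OF assms(1,2) _ assms(3,4)])

lemma dd_proj_cspace: "finite I \<Longrightarrow> v \<in> cspace I \<Longrightarrow> dd I (\<lambda>z. z j) z v = v j"
  by (cases "j \<in> I") (auto simp: dd_def pd_proj cspace_def if_distrib[of "\<lambda>x. x * _"] cong: if_cong)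

lemma dd_linear: "dd I g z (v + w) = dd I g z v + dd I g z w" "dd I g z (cscale c v) = c * dd I g z v"
  by (simp_all add: dd_def cscale_def algebra_simps sum.distrib sum_distrib_left)

lemma dd_zero: "(\<And>i. i \<in> I \<Longrightarrow> v i = 0) \<Longrightarrow> dd I g z v = 0"
  by (simp add: dd_def)

subsection \<open>Dimensions of kernels\<close>

definition unitv :: "'i \<Rightarrow> 'i \<Rightarrow> complex" where
  "unitv i = (\<lambda>k. if k = i then 1 else 0)"

lemma sum_apply: "(\<Sum>k\<in>K. f k) x = (\<Sum>k\<in>K. f k x :: complex)"
  by (induction K rule: infinite_finite_induct) auto

lemma cspace_span: 
  assumes "finite I" shows "cspace I \<subseteq> cvec.span (unitv ` I)"
proof
  fix v :: "'a \<Rightarrow> complex" assume v: "v \<in> cspace I"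
  have "v = (\<Sum>i\<in>I. cscale (v i) (unitv i))"
  proof
    fix k show "v k = (\<Sum>i\<in>I. cscale (v i) (unitv i)) k"
      using v assms by (auto simp: sum_apply cscale_def unitv_def cspace_def if_distrib cong: if_cong)
  qed
  also have "\<dots> \<in> cvec.span (unitv ` I)"
    by (intro cvec.span_sum cvec.span_scale cvec.span_base) auto
  finally show "v \<in> cvec.span (unitv ` I)" .
qed

lemma dim_cspace:
  assumes "finite I" shows "cvec.dim (cspace I) = card I"
proof (rule cvec.dim_unique)
  have inj: "inj_on unitv I" by (rule inj_onI) (metis unitv_def zero_neq_one)
  show "unitv ` I \<subseteq> cspace I" by (auto simp: unitv_def cspace_def)
  show "cspace I \<subseteq> cvec.span (unitv ` I)" by (rule cspace_span[OF assms])
  show "card (unitv ` I) = card I" using inj by (rule card_image)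
  show "cvec.independent (unitv ` I)"
  proof (rule cvec.independent_if_scalars_zero)
    show "finite (unitv ` I)" using assms by simp
    fix f and x :: "'a \<Rightarrow> complex"
    assume s: "(\<Sum>x\<in>unitv ` I. cscale (f x) x) = 0" and "x \<in> unitv ` I"
    then obtain i where i: "i \<in> I" "x = unitv i" by blast
    have "(\<Sum>k\<in>I. cscale (f (unitv k)) (unitv k)) = 0" using s by (simp add: sum.reindex[OF inj])
    then have "(\<Sum>k\<in>I. cscale (f (unitv k)) (unitv k)) i = 0" by simp
    then show "f x = 0"
      using i assms by (simp add: sum_apply cscale_def unitv_def if_distrib cong: if_cong)
  qed
qed

text \<open>The image under \<open>N\<close> of a basis of \<open>S'\<close> spans a space
  containing \<open>S\<close>. The inclusion of \<open>S'\<close> in \<open>cspace I\<close> makes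
  that basis finite, so that its cardinality is a meaningful bound.\<close>

lemma dim_le_image:
  assumes fin: "finite I" and S': "S' \<subseteq> cspace I" and sub: "S \<subseteq> N ` S'"
    and N: "\<And>v w. N (v + w) = N v + N w" "\<And>c v. N (cscale c v) = cscale c (N v)"
  shows "cvec.dim S \<le> cvec.dim S'"
proof -
  obtain B where B: "B \<subseteq> S'" "cvec.independent B" "S' \<subseteq> cvec.span B" "card B = cvec.dim S'"
    by (rule cvec.basis_exists[of S']) blast
  have finB: "finite B"
    using cvec.independent_span_bound[OF _ B(2), of "unitv ` I"] fin B(1) S' cspace_span[OF fin] by auto
  have N0: "N 0 = 0" using N(2)[of 0 0] by (simp add: cscale_def zero_fun_def)
  have "N v \<in> cvec.span (N ` B)" if "v \<in> cvec.span B" for v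
    using that
  proof (rule cvec.span_induct_alt)
    show "N 0 \<in> cvec.span (N ` B)" unfolding N0 by (rule cvec.span_zero)
    fix c x y assume "x \<in> B" "N y \<in> cvec.span (N ` B)"
    then show "N (cscale c x + y) \<in> cvec.span (N ` B)"
      unfolding N by (intro cvec.span_add cvec.span_scale) (auto intro: cvec.span_base)
  qed
  then have "S \<subseteq> cvec.span (N ` B)" using sub B(3) by blast
  then have "cvec.dim S \<le> card (N ` B)" by (rule cvec.dim_le_card) (simp add: finB)
  also have "\<dots> \<le> card B" by (rule card_image_le[OF finB])
  finally show ?thesis using B(4) by simp
qed

subsection \<open>Charts\<close>

lemma top_chartD:
  assumes "top_chart T I (U, \<phi>)"
  shows "openin T U" "copen I (\<phi> ` U)" "inj_on \<phi> U" "U \<subseteq> topspace T"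
    "homeomorphic_map (subtopology T U) (top_of_set (\<phi> ` U)) \<phi>"
    "\<And>x. x \<in> U \<Longrightarrow> inv_into U \<phi> (\<phi> x) = x"
    "\<And>z. z \<in> \<phi> ` U \<Longrightarrow> \<phi> (inv_into U \<phi> z) = z" "\<And>z. z \<in> \<phi> ` U \<Longrightarrow> inv_into U \<phi> z \<in> U"
proof -
  show o: "openin T U" and "copen I (\<phi> ` U)"
    and h: "homeomorphic_map (subtopology T U) (top_of_set (\<phi> ` U)) \<phi>"
    using assms by (auto simp: top_chart_def)
  show sub: "U \<subseteq> topspace T" using o openin_subset by blast
  then have "topspace (subtopology T U) = U" by auto
  then show inj: "inj_on \<phi> U" using h by (simp add: homeomorphic_map_def)
  show "\<And>x. x \<in> U \<Longrightarrow> inv_into U \<phi> (\<phi> x) = x" using inj by simp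
  show "\<And>z. z \<in> \<phi> ` U \<Longrightarrow> \<phi> (inv_into U \<phi> z) = z" by (rule f_inv_into_f)
  show "\<And>z. z \<in> \<phi> ` U \<Longrightarrow> inv_into U \<phi> z \<in> U" by (rule inv_into_into)
qed

lemma top_chart_image:
  assumes c: "top_chart T I (U, \<phi>)" and "openin T U'" "U' \<subseteq> U"
  shows "copen I (\<phi> ` U')"
proof -
  have "openin (subtopology T U) U'" using assms(2,3) by (auto simp: openin_subtopology)
  moreover have "open_map (subtopology T U) (top_of_set (\<phi> ` U)) \<phi>"
    using top_chartD(5)[OF c] homeomorphic_imp_open_map by blast
  ultimately have "openin (top_of_set (\<phi> ` U)) (\<phi> ` U')" by (auto simp: open_map_def)
  then show ?thesis using top_chartD(2)[OF c] unfolding copen_def by (metis openin_trans)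
qed

lemma top_chart_vimage:
  assumes c: "top_chart T I (U, \<phi>)" and W: "copen I W"
  shows "openin T {x \<in> U. \<phi> x \<in> W}"
proof -
  have "continuous_map (subtopology T U) (top_of_set (\<phi> ` U)) \<phi>"
    using top_chartD(5)[OF c] homeomorphic_imp_continuous_map by blast
  moreover obtain S where S: "open S" "W = cspace I \<inter> S" using W by (auto simp: copen_def openin_open)
  have "openin (top_of_set (\<phi> ` U)) (\<phi> ` U \<inter> S)" using S(1) by auto
  ultimately have "openin (subtopology T U) {x \<in> topspace (subtopology T U). \<phi> x \<in> \<phi> ` U \<inter> S}"
    by (rule openin_continuous_map_preimage)
  moreover have "{x \<in> topspace (subtopology T U). \<phi> x \<in> \<phi> ` U \<inter> S} = {x \<in> U. \<phi> x \<in> W}"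
    using S(2) copen_subset[OF top_chartD(2)[OF c]] top_chartD(4)[OF c] by auto
  ultimately show ?thesis using top_chartD(1)[OF c] by (metis openin_trans_full)
qed

lemma top_chart_restrict:
  assumes c: "top_chart T I (U, \<phi>)" and U': "openin T U'" "U' \<subseteq> U"
  shows "top_chart T I (U', \<phi>)"
proof -
  have "homeomorphic_map (subtopology (subtopology T U) U') (subtopology (top_of_set (\<phi> ` U)) (\<phi> ` U')) \<phi>"
    by (rule homeomorphic_map_subtopologies[OF top_chartD(5)[OF c]])
       (use U' top_chartD(4)[OF c] in auto)
  moreover have "U \<inter> U' = U'" "\<phi> ` U \<inter> \<phi> ` U' = \<phi> ` U'" using U'(2) by auto
  ultimately have "homeomorphic_map (subtopology T U') (top_of_set (\<phi> ` U')) \<phi>"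
    by (simp add: subtopology_subtopology)
  then show ?thesis using U' top_chart_image[OF c U'] by (simp add: top_chart_def)
qed

lemma biholo_homeomorphic:
  assumes "biholo I J U V f"
  shows "homeomorphic_map (top_of_set U) (top_of_set V) f"
proof -
  note F = biholoD[OF assms]
  have "homeomorphic_maps (top_of_set U) (top_of_set V) f (inv_into U f)"
    unfolding homeomorphic_maps_def
    using holo_map_continuous[OF F(1)] holo_map_continuous[OF F(2)] F(3,5,6,7)
    by (auto simp: continuous_map_in_subtopology)
  then show ?thesis using homeomorphic_map_maps by blast
qed

lemma top_chart_compose:
  assumes c: "top_chart T I (U, \<phi>)" and b: "biholo I I (\<phi> ` U) V \<Theta>"
  shows "top_chart T I (U, \<lambda>x. \<Theta> (\<phi> x))"
proof -
  have im: "(\<lambda>x. \<Theta> (\<phi> x)) ` U = V" using biholoD(3)[OF b] by auto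
  have "homeomorphic_map (subtopology T U) (top_of_set V) (\<Theta> \<circ> \<phi>)"
    by (rule homeomorphic_map_compose[OF top_chartD(5)[OF c] biholo_homeomorphic[OF b]])
  then show ?thesis
    unfolding top_chart_def using top_chartD(1)[OF c] biholoD(9)[OF b] im by (simp add: o_def)
qed

lemma biholo_cong:
  assumes "biholo I J U V f" "\<And>z. z \<in> U \<Longrightarrow> f z = g z"
  shows "biholo I J U V g"
  by (rule biholoI[OF holo_map_cong[OF biholoD(1)[OF assms(1)] assms(2)] biholoD(2)[OF assms(1)]])
     (use biholoD(3,5,6,7)[OF assms(1)] assms(2) in auto)

lemma holo_chartD:
  assumes "holo_chart M (U, \<phi>)"
  shows "top_chart (mtop M) (coords M) (U, \<phi>)"
    "\<And>V \<psi>. (V, \<psi>) \<in> atlas M \<Longrightarrow> biholo (coords M) (coords M) (\<phi> ` (U \<inter> V)) (\<psi> ` (U \<inter> V)) (\<lambda>z. \<psi> (inv_into U \<phi> z))"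
  using assms by (auto simp: holo_chart_def compatible_def o_def)

lemma holo_chart_atlas: "complex_manifold M \<Longrightarrow> c \<in> atlas M \<Longrightarrow> holo_chart M c"
  by (auto simp: complex_manifold_def holo_chart_def)

lemma holo_chart_restrict:
  assumes c: "holo_chart M (U, \<phi>)" and U': "openin (mtop M) U'" "U' \<subseteq> U"
  shows "holo_chart M (U', \<phi>)"
  unfolding holo_chart_def
proof (intro conjI ballI)
  note C = holo_chartD[OF c] note T = top_chartD[OF C(1)]
  show "top_chart (mtop M) (coords M) (U', \<phi>)" by (rule top_chart_restrict[OF C(1) U'])
  fix d assume "d \<in> atlas M"
  then obtain V \<psi> where d: "d = (V, \<psi>)" "(V, \<psi>) \<in> atlas M" by (cases d) auto
  have sub: "U' \<inter> V \<subseteq> U \<inter> V" using U' by auto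
  have o: "copen (coords M) (\<phi> ` (U' \<inter> V))"
  proof -
    have b: "copen (coords M) (\<phi> ` (U \<inter> V))" using biholoD(8)[OF C(2)[OF d(2)]] .
    have "copen (coords M) (\<phi> ` U')" by (rule top_chart_image[OF C(1) U'])
    moreover have "\<phi> ` (U' \<inter> V) = \<phi> ` U' \<inter> \<phi> ` (U \<inter> V)" using T(3) U'(2) by (auto simp: inj_on_def)
    ultimately show ?thesis using copen_Int b by metis
  qed
  have inv: "inv_into U' \<phi> z = inv_into U \<phi> z" if "z \<in> \<phi> ` U'" for z
    using that T(3) U'(2) by (auto intro!: inv_into_f_eq simp: inj_on_subset)
  have "biholo (coords M) (coords M) (\<phi> ` (U' \<inter> V)) ((\<lambda>z. \<psi> (inv_into U \<phi> z)) ` \<phi> ` (U' \<inter> V)) (\<lambda>z. \<psi> (inv_into U \<phi> z))"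
    by (rule biholo_subset[OF C(2)[OF d(2)] o]) (use sub in blast)
  moreover have "(\<lambda>z. \<psi> (inv_into U \<phi> z)) ` \<phi> ` (U' \<inter> V) = \<psi> ` (U' \<inter> V)"
    unfolding image_image using T(6) U'(2) by (intro image_cong) auto
  ultimately have "biholo (coords M) (coords M) (\<phi> ` (U' \<inter> V)) (\<psi> ` (U' \<inter> V)) (\<lambda>z. \<psi> (inv_into U \<phi> z))"
    by simp
  then have "biholo (coords M) (coords M) (\<phi> ` (U' \<inter> V)) (\<psi> ` (U' \<inter> V)) (\<psi> \<circ> inv_into U' \<phi>)"
    by (rule biholo_cong) (auto simp: inv)
  then show "compatible (coords M) (U', \<phi>) d" by (simp add: compatible_def d(1))
qed

lemma holo_chart_compose:
  assumes c: "holo_chart M (U, \<phi>)" and b: "biholo (coords M) (coords M) (\<phi> ` U) W \<Theta>" and fin: "finite (coords M)"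
  shows "holo_chart M (U, \<lambda>x. \<Theta> (\<phi> x))"
  unfolding holo_chart_def
proof (intro conjI ballI)
  note C = holo_chartD[OF c] note T = top_chartD[OF C(1)]
  show t': "top_chart (mtop M) (coords M) (U, \<lambda>x. \<Theta> (\<phi> x))" by (rule top_chart_compose[OF C(1) b])
  fix d assume "d \<in> atlas M"
  then obtain V \<psi> where d: "d = (V, \<psi>)" "(V, \<psi>) \<in> atlas M" by (cases d) auto
  have b1: "biholo (coords M) (coords M) (\<phi> ` (U \<inter> V)) (\<Theta> ` \<phi> ` (U \<inter> V)) \<Theta>"
    by (rule biholo_subset[OF b biholoD(8)[OF C(2)[OF d(2)]]]) auto
  have "biholo (coords M) (coords M) (\<Theta> ` \<phi> ` (U \<inter> V)) (\<psi> ` (U \<inter> V))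
    (\<lambda>z. \<psi> (inv_into U \<phi> (inv_into (\<phi> ` (U \<inter> V)) \<Theta> z)))"
    by (rule biholo_compose[OF biholo_inverse[OF b1] C(2)[OF d(2)] fin fin fin])
  moreover have "\<psi> (inv_into U \<phi> (inv_into (\<phi> ` (U \<inter> V)) \<Theta> z)) = (\<psi> \<circ> inv_into U (\<lambda>x. \<Theta> (\<phi> x))) z"
    if "z \<in> \<Theta> ` \<phi> ` (U \<inter> V)" for z
  proof -
    obtain x where x: "x \<in> U \<inter> V" "z = \<Theta> (\<phi> x)" using \<open>z \<in> \<Theta> ` \<phi> ` (U \<inter> V)\<close> by blast
    have "inv_into (\<phi> ` (U \<inter> V)) \<Theta> z = \<phi> x" using biholoD(5)[OF b1, of "\<phi> x"] x by simp
    moreover have "inv_into U (\<lambda>x. \<Theta> (\<phi> x)) z = x" using top_chartD(6)[OF t', of x] x by simp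
    ultimately show ?thesis using T(6)[of x] x by simp
  qed
  ultimately have "biholo (coords M) (coords M) (\<Theta> ` \<phi> ` (U \<inter> V)) (\<psi> ` (U \<inter> V)) (\<psi> \<circ> inv_into U (\<lambda>x. \<Theta> (\<phi> x)))"
    by (rule biholo_cong) 
  then show "compatible (coords M) (U, \<lambda>x. \<Theta> (\<phi> x)) d"
    by (simp add: compatible_def d(1) image_image)
qed

text \<open>A common interface for manifolds and their products: the charts cover, and each belongs
  to the maximal atlas. It is what makes transition maps holomorphic, in particular those of the
  product of \<open>X\<close> with itself.\<close>

definition holo_atlas :: "('a, 'i) cmfd \<Rightarrow> bool" where
  "holo_atlas M \<longleftrightarrow> finite (coords M) \<and> points M = (\<Union>(U, \<phi>)\<in>atlas M. U) \<and> (\<forall>c\<in>atlas M. holo_chart M c)"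

lemma complex_manifold_imp_holo_atlas: "complex_manifold M \<Longrightarrow> holo_atlas M"
  using holo_chart_atlas by (auto simp: holo_atlas_def complex_manifold_def)

text \<open>By definition, members of the maximal atlas are compared only with charts of the atlas.
  Near each point the transition is therefore factored through an atlas chart around that point, and
  holomorphy is local.\<close>

lemma holo_chart_transition:
  assumes M: "holo_atlas M" and c: "holo_chart M (U, \<phi>)" and d: "holo_chart M (V, \<psi>)"
  shows "holo_map (coords M) (coords M) (\<phi> ` (U \<inter> V)) (\<lambda>z. \<psi> (inv_into U \<phi> z))"
proof (rule holo_map_local)
  note C = holo_chartD[OF c] note D = holo_chartD[OF d]
  note T = top_chartD[OF C(1)] note S = top_chartD[OF D(1)]
  show fin: "finite (coords M)" using M by (simp add: holo_atlas_def)
  fix a assume "a \<in> \<phi> ` (U \<inter> V)"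
  then obtain x where x: "x \<in> U" "x \<in> V" "a = \<phi> x" by blast
  have "x \<in> points M" using x(1) T(4) by blast
  then obtain W \<kappa> where W: "(W, \<kappa>) \<in> atlas M" "x \<in> W"
    using M unfolding holo_atlas_def by auto
  have "holo_chart M (W, \<kappa>)" using M W(1) by (simp add: holo_atlas_def)
  then have Wo: "openin (mtop M) W" by (rule top_chartD(1)[OF holo_chartD(1)])
  define U0 where "U0 = U \<inter> V \<inter> W"
  have U0: "openin (mtop M) U0" unfolding U0_def using T(1) S(1) Wo by blast
  have o: "copen (coords M) (\<phi> ` U0)" by (rule top_chart_image[OF C(1) U0]) (auto simp: U0_def)
  have 1: "holo_map (coords M) (coords M) (\<phi> ` U0) (\<lambda>z. \<kappa> (inv_into U \<phi> z))"
    by (rule holo_map_subset[OF biholoD(1)[OF C(2)[OF W(1)]] o]) (auto simp: U0_def)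
  let ?t = "\<lambda>z. \<kappa> (inv_into V \<psi> z)"
  have 2: "holo_map (coords M) (coords M) (\<kappa> ` (V \<inter> W)) (inv_into (\<psi> ` (V \<inter> W)) ?t)"
    by (rule biholoD(2)[OF D(2)[OF W(1)]])
  have im: "inv_into U \<phi> z \<in> U0" if "z \<in> \<phi> ` U0" for z using that T(6) by (auto simp: U0_def)
  have "holo_map (coords M) (coords M) (\<phi> ` U0) (\<lambda>z. inv_into (\<psi> ` (V \<inter> W)) ?t (\<kappa> (inv_into U \<phi> z)))"
    by (rule holo_map_compose[OF 2 1 _ fin fin]) (use im in \<open>auto simp: U0_def\<close>)
  moreover have "inv_into (\<psi> ` (V \<inter> W)) ?t (\<kappa> (inv_into U \<phi> z)) = \<psi> (inv_into U \<phi> z)" if "z \<in> \<phi> ` U0" for z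
  proof -
    let ?x = "inv_into U \<phi> z"
    have x0: "?x \<in> V \<inter> W" using im[OF that] by (auto simp: U0_def)
    then have "?t (\<psi> ?x) = \<kappa> ?x" using S(6) by simp
    moreover have "inv_into (\<psi> ` (V \<inter> W)) ?t (?t (\<psi> ?x)) = \<psi> ?x"
      by (rule biholoD(5)[OF D(2)[OF W(1)]]) (use x0 in blast)
    ultimately show ?thesis by simp
  qed
  ultimately have "holo_map (coords M) (coords M) (\<phi> ` U0) (\<lambda>z. \<psi> (inv_into U \<phi> z))"
    by (rule holo_map_cong)
  then show "\<exists>W\<subseteq>\<phi> ` (U \<inter> V). a \<in> W \<and> holo_map (coords M) (coords M) W (\<lambda>z. \<psi> (inv_into U \<phi> z))"
    using x W(2) by (intro exI[of _ "\<phi> ` U0"]) (auto simp: U0_def)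
qed

lemma continuous_on_inv_chart:
  assumes c: "top_chart T I (U, \<phi>)"
  shows "continuous_map (top_of_set (\<phi> ` U)) T (inv_into U \<phi>)"
proof -
  have o: "U = topspace (subtopology T U)" using top_chartD(4)[OF c] by auto
  obtain g where g: "homeomorphic_maps (subtopology T U) (top_of_set (\<phi> ` U)) \<phi> g"
    using top_chartD(5)[OF c] homeomorphic_map_maps by blast
  have "g z = inv_into U \<phi> z" if z: "z \<in> topspace (top_of_set (\<phi> ` U))" for z
  proof -
    obtain x where "x \<in> U" "z = \<phi> x" using z by auto
    then show ?thesis using g o top_chartD(6)[OF c] unfolding homeomorphic_maps_def by fastforce
  qed
  moreover have "continuous_map (top_of_set (\<phi> ` U)) (subtopology T U) g"
    using g by (simp add: homeomorphic_maps_def)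
  ultimately have "continuous_map (top_of_set (\<phi> ` U)) (subtopology T U) (inv_into U \<phi>)"
    by (metis continuous_map_eq)
  then show ?thesis using continuous_map_in_subtopology by blast
qed

text \<open>The atlas of the product consists of products of atlas charts, so each transition to be
  checked is a product of transitions. Continuity into the coordinate space is checked in each
  coordinate, and the inverse is the pair of the inverse charts.\<close>

lemma holo_chart_prod:
  assumes c: "holo_chart M (U, \<phi>)" and d: "holo_chart N (V, \<psi>)"
    and fin: "finite (coords M)" "finite (coords N)"
  shows "holo_chart (cmfd_prod M N) (U \<times> V, \<lambda>(x, y). case_sum (\<phi> x) (\<psi> y))"
  unfolding holo_chart_def
proof (intro conjI ballI)
  note C = holo_chartD[OF c] note D = holo_chartD[OF d]
  note T = top_chartD[OF C(1)] note S = top_chartD[OF D(1)]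
  let ?\<Phi> = "\<lambda>(x, y). case_sum (\<phi> x) (\<psi> y)"
  have im: "?\<Phi> ` (A \<times> B) = cprod (\<phi> ` A) (\<psi> ` B)" for A B
  proof
    show "cprod (\<phi> ` A) (\<psi> ` B) \<subseteq> ?\<Phi> ` (A \<times> B)"
    proof
      fix p assume "p \<in> cprod (\<phi> ` A) (\<psi> ` B)"
      then obtain x y where "x \<in> A" "y \<in> B" "p \<circ> Inl = \<phi> x" "p \<circ> Inr = \<psi> y" by (auto simp: cprod_def)
      then show "p \<in> ?\<Phi> ` (A \<times> B)" using case_sum_eta[of p] by (intro image_eqI[of _ _ "(x, y)"]) auto
    qed
  qed auto
  have inj: "inj_on ?\<Phi> (U \<times> V)"
  proof (rule inj_onI, clarify)
    fix x y x' y' assume "x \<in> U" "y \<in> V" "x' \<in> U" "y' \<in> V" and e: "case_sum (\<phi> x) (\<psi> y) = case_sum (\<phi> x') (\<psi> y')"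
    moreover have "\<phi> x = \<phi> x'" "\<psi> y = \<psi> y'"
      using arg_cong[OF e, of "\<lambda>p. p \<circ> Inl"] arg_cong[OF e, of "\<lambda>p. p \<circ> Inr"] by simp_all
    ultimately show "x = x' \<and> y = y'" using T(3) S(3) by (auto simp: inj_on_def)
  qed
  have inv: "inv_into (U \<times> V) ?\<Phi> p = (inv_into U \<phi> (p \<circ> Inl), inv_into V \<psi> (p \<circ> Inr))"
    if "p \<in> cprod (\<phi> ` U) (\<psi> ` V)" for p
  proof (rule inv_into_f_eq[OF inj])
    show "(inv_into U \<phi> (p \<circ> Inl), inv_into V \<psi> (p \<circ> Inr)) \<in> U \<times> V"
      using that T(8) S(8) by (auto simp: cprod_def)
    show "?\<Phi> (inv_into U \<phi> (p \<circ> Inl), inv_into V \<psi> (p \<circ> Inr)) = p"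
      using that T(7) S(7) by (auto simp: cprod_def case_sum_eta)
  qed
  have "homeomorphic_map (subtopology (prod_topology (mtop M) (mtop N)) (U \<times> V)) (top_of_set (?\<Phi> ` (U \<times> V))) ?\<Phi>"
  proof -
    let ?P = "subtopology (prod_topology (mtop M) (mtop N)) (U \<times> V)"
    let ?C = "top_of_set (?\<Phi> ` (U \<times> V))"
    have top: "topspace ?P = U \<times> V" using T(4) S(4) by auto
    have P: "?P = prod_topology (subtopology (mtop M) U) (subtopology (mtop N) V)" by (rule subtopology_Times)
    have "continuous_map (subtopology (mtop M) U) (top_of_set (\<phi> ` U)) \<phi>"
      by (rule homeomorphic_imp_continuous_map[OF T(5)])
    then have "continuous_map (subtopology (mtop M) U) euclidean \<phi>" using continuous_map_in_subtopology by blast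
    then have c1: "continuous_map ?P euclidean (\<lambda>x. \<phi> (fst x))"
      unfolding P using continuous_map_compose[OF continuous_map_fst] by (fastforce simp: o_def)
    have "continuous_map (subtopology (mtop N) V) (top_of_set (\<psi> ` V)) \<psi>"
      by (rule homeomorphic_imp_continuous_map[OF S(5)])
    then have "continuous_map (subtopology (mtop N) V) euclidean \<psi>" using continuous_map_in_subtopology by blast
    then have c2: "continuous_map ?P euclidean (\<lambda>x. \<psi> (snd x))"
      unfolding P using continuous_map_compose[OF continuous_map_snd] by (fastforce simp: o_def)
    have k1: "continuous_map ?P euclidean (\<lambda>x. \<phi> (fst x) k)" for k
      using c1 unfolding euclidean_product_topology[symmetric] continuous_map_componentwise_UNIV by blast
    have k2: "continuous_map ?P euclidean (\<lambda>x. \<psi> (snd x) k)" for k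
      using c2 unfolding euclidean_product_topology[symmetric] continuous_map_componentwise_UNIV by blast
    have "continuous_map ?P euclidean ?\<Phi>"
      unfolding euclidean_product_topology[symmetric] continuous_map_componentwise_UNIV
    proof
      fix k show "continuous_map ?P euclidean (\<lambda>x. ?\<Phi> x k)"
        using k1 k2 by (cases k) (simp_all add: case_prod_beta')
    qed
    then have "continuous_map ?P ?C ?\<Phi>" using top by (auto simp: continuous_map_in_subtopology)
    moreover have "continuous_map ?C ?P (\<lambda>p. (inv_into U \<phi> (p \<circ> Inl), inv_into V \<psi> (p \<circ> Inr)))"
    proof -
      have oC: "copen (coords M <+> coords N) (cprod (\<phi> ` U) (\<psi> ` V))" by (intro copen_cprod T(2) S(2))
      have "continuous_map ?C (top_of_set (\<phi> ` U)) (\<lambda>p. p \<circ> Inl)"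
        using holo_map_continuous[OF holo_map_Inl[OF oC]] unfolding im
        by (auto simp: continuous_map_in_subtopology cprod_def)
      then have e1: "continuous_map ?C (mtop M) (\<lambda>p. inv_into U \<phi> (p \<circ> Inl))"
        using continuous_map_compose[OF _ continuous_on_inv_chart[OF C(1)], of ?C "\<lambda>p. p \<circ> Inl"] by (simp add: comp_def)
      have "continuous_map ?C (top_of_set (\<psi> ` V)) (\<lambda>p. p \<circ> Inr)"
        using holo_map_continuous[OF holo_map_Inr[OF oC]] unfolding im
        by (auto simp: continuous_map_in_subtopology cprod_def)
      then have e2: "continuous_map ?C (mtop N) (\<lambda>p. inv_into V \<psi> (p \<circ> Inr))"
        using continuous_map_compose[OF _ continuous_on_inv_chart[OF D(1)], of ?C "\<lambda>p. p \<circ> Inr"] by (simp add: comp_def)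
      have "continuous_map ?C (prod_topology (mtop M) (mtop N)) (\<lambda>p. (inv_into U \<phi> (p \<circ> Inl), inv_into V \<psi> (p \<circ> Inr)))"
        by (rule continuous_map_pairedI[OF e1 e2])
      then show ?thesis unfolding im
        using T(8) S(8) by (auto simp: continuous_map_in_subtopology cprod_def)
    qed
    ultimately have "homeomorphic_maps ?P ?C ?\<Phi> (\<lambda>p. (inv_into U \<phi> (p \<circ> Inl), inv_into V \<psi> (p \<circ> Inr)))"
      unfolding homeomorphic_maps_def using top T(6,7) S(6,7) by auto
    then show ?thesis using homeomorphic_map_maps by blast
  qed
  then show "top_chart (mtop (cmfd_prod M N)) (coords (cmfd_prod M N)) (U \<times> V, ?\<Phi>)"
    using T(1,2) S(1,2) copen_cprod by (auto simp: top_chart_def cmfd_prod_def im openin_prod_Times_iff)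
  fix e assume "e \<in> atlas (cmfd_prod M N)"
  then obtain U' \<phi>' V' \<psi>' where e: "e = (U' \<times> V', \<lambda>(x, y). case_sum (\<phi>' x) (\<psi>' y))"
    and a: "(U', \<phi>') \<in> atlas M" "(V', \<psi>') \<in> atlas N"
    by (auto simp: cmfd_prod_def)
  let ?\<Phi>' = "\<lambda>(x, y). case_sum (\<phi>' x) (\<psi>' y)"
  have im': "?\<Phi>' ` (A \<times> B) = cprod (\<phi>' ` A) (\<psi>' ` B)" for A B
  proof
    show "cprod (\<phi>' ` A) (\<psi>' ` B) \<subseteq> ?\<Phi>' ` (A \<times> B)"
    proof
      fix p assume "p \<in> cprod (\<phi>' ` A) (\<psi>' ` B)"
      then obtain x y where "x \<in> A" "y \<in> B" "p \<circ> Inl = \<phi>' x" "p \<circ> Inr = \<psi>' y" by (auto simp: cprod_def)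
      then show "p \<in> ?\<Phi>' ` (A \<times> B)" using case_sum_eta[of p] by (intro image_eqI[of _ _ "(x, y)"]) auto
    qed
  qed auto
  have "biholo (coords M <+> coords N) (coords M <+> coords N)
    (cprod (\<phi> ` (U \<inter> U')) (\<psi> ` (V \<inter> V'))) (cprod (\<phi>' ` (U \<inter> U')) (\<psi>' ` (V \<inter> V')))
    (\<lambda>p. case_sum (\<phi>' (inv_into U \<phi> (p \<circ> Inl))) (\<psi>' (inv_into V \<psi> (p \<circ> Inr))))"
    by (rule biholo_cprod[OF C(2)[OF a(1)] D(2)[OF a(2)] fin(1,1) fin(2,2)])
  then have "biholo (coords M <+> coords N) (coords M <+> coords N)
    (cprod (\<phi> ` (U \<inter> U')) (\<psi> ` (V \<inter> V'))) (cprod (\<phi>' ` (U \<inter> U')) (\<psi>' ` (V \<inter> V')))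
    (?\<Phi>' \<circ> inv_into (U \<times> V) ?\<Phi>)"
  proof (rule biholo_cong)
    fix p assume "p \<in> cprod (\<phi> ` (U \<inter> U')) (\<psi> ` (V \<inter> V'))"
    then have "p \<in> cprod (\<phi> ` U) (\<psi> ` V)" by (auto simp: cprod_def)
    then show "case_sum (\<phi>' (inv_into U \<phi> (p \<circ> Inl))) (\<psi>' (inv_into V \<psi> (p \<circ> Inr))) = (?\<Phi>' \<circ> inv_into (U \<times> V) ?\<Phi>) p"
      by (simp add: inv)
  qed
  then show "compatible (coords (cmfd_prod M N)) (U \<times> V, ?\<Phi>) e"
    by (simp add: compatible_def e cmfd_prod_def Times_Int_Times im im')
qed

lemma holo_atlas_prod:
  assumes "holo_atlas M" "holo_atlas N" shows "holo_atlas (cmfd_prod M N)"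
proof -
  have "holo_chart (cmfd_prod M N) c" if "c \<in> atlas (cmfd_prod M N)" for c
    using that assms holo_chart_prod[of M _ _ N] by (auto simp: cmfd_prod_def holo_atlas_def)
  moreover have "points (cmfd_prod M N) = (\<Union>(U, \<phi>)\<in>atlas (cmfd_prod M N). U)"
  proof -
    have M: "points M = (\<Union>(U, \<phi>)\<in>atlas M. U)" and N: "points N = (\<Union>(U, \<phi>)\<in>atlas N. U)"
      using assms by (simp_all add: holo_atlas_def)
    have "points (cmfd_prod M N) = points M \<times> points N" by (simp add: cmfd_prod_def)
    also have "\<dots> = (\<Union>(U, \<phi>)\<in>atlas (cmfd_prod M N). U)"
    proof (intro equalityI subsetI)
      fix q assume "q \<in> points M \<times> points N"
      then obtain x y where q: "q = (x, y)" "x \<in> points M" "y \<in> points N" by blast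
      obtain U \<phi> where U: "(U, \<phi>) \<in> atlas M" "x \<in> U" using q(2) unfolding M by blast
      obtain V \<psi> where V: "(V, \<psi>) \<in> atlas N" "y \<in> V" using q(3) unfolding N by blast
      have "(U \<times> V, \<lambda>(x, y). case_sum (\<phi> x) (\<psi> y)) \<in> atlas (cmfd_prod M N)"
        using U(1) V(1) by (auto simp: cmfd_prod_def)
      then show "q \<in> (\<Union>(U, \<phi>)\<in>atlas (cmfd_prod M N). U)" using U(2) V(2) q(1) by blast
    next
      fix q assume "q \<in> (\<Union>(U, \<phi>)\<in>atlas (cmfd_prod M N). U)"
      then obtain U \<phi> V \<psi> where "(U, \<phi>) \<in> atlas M" "(V, \<psi>) \<in> atlas N" "q \<in> U \<times> V"
        by (auto simp: cmfd_prod_def)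
      then show "q \<in> points M \<times> points N" unfolding M N by blast
    qed
    finally show ?thesis .
  qed
  ultimately show ?thesis using assms by (simp add: holo_atlas_def cmfd_prod_def)
qed

text \<open>The Jacobian \<open>L\<close> of the change of source charts maps one kernel into the
  other, and \<open>N\<close>, the Jacobian of the reverse change, undoes it; the change of target
  charts only multiplies the differential from the left. Holomorphy of the second representative is
  part of the conclusion so that the lemma can be applied again with the charts exchanged.\<close>

lemma kernel_dim_le:
  assumes X: "complex_manifold X" and Y: "complex_manifold Y" and f: "continuous_map (mtop X) (mtop Y) f"
    and c0: "holo_chart X (U0, \<phi>0)" and c1: "holo_chart X (U1, \<phi>1)"
    and d0: "holo_chart Y (V0, \<psi>0)" and d1: "holo_chart Y (V1, \<psi>1)"
    and x: "x \<in> U0" "x \<in> U1" "f x \<in> V0" "f x \<in> V1"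
    and F0: "holo_map (coords X) (coords Y) W (\<psi>0 \<circ> f \<circ> inv_into U0 \<phi>0)" "\<phi>0 x \<in> W"
  shows "(\<exists>W1. \<phi>1 x \<in> W1 \<and> holo_map (coords X) (coords Y) W1 (\<psi>1 \<circ> f \<circ> inv_into U1 \<phi>1)) \<and>
    cvec.dim (cdiff_kernel (coords X) (coords Y) (\<psi>0 \<circ> f \<circ> inv_into U0 \<phi>0) (\<phi>0 x))
    \<le> cvec.dim (cdiff_kernel (coords X) (coords Y) (\<psi>1 \<circ> f \<circ> inv_into U1 \<phi>1) (\<phi>1 x))"
proof -
  define I J where "I = coords X" and "J = coords Y"
  have fin: "finite I" "finite J" using X Y by (auto simp: complex_manifold_def I_def J_def)
  note C0 = holo_chartD[OF c0] note T0 = top_chartD[OF C0(1)]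
  note C1 = holo_chartD[OF c1] note T1 = top_chartD[OF C1(1)]
  note D0 = holo_chartD[OF d0] note S0 = top_chartD[OF D0(1)]
  note D1 = holo_chartD[OF d1] note S1 = top_chartD[OF D1(1)]
  define G0 G1 where "G0 = \<psi>0 \<circ> f \<circ> inv_into U0 \<phi>0" and "G1 = \<psi>1 \<circ> f \<circ> inv_into U1 \<phi>1"
  have hG0: "holo_map I J W G0" using F0(1) by (simp add: G0_def I_def J_def)
  define O' where "O' = {u \<in> U0 \<inter> U1. f u \<in> V0 \<inter> V1 \<and> \<phi>0 u \<in> W}"
  have "openin (mtop X) {u \<in> points X. f u \<in> V0 \<inter> V1}"
    by (rule openin_continuous_map_preimage[OF f]) (use S0(1) S1(1) in blast)
  moreover have "openin (mtop X) {u \<in> U0. \<phi>0 u \<in> W}"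
    by (rule top_chart_vimage[OF C0(1)]) (use holo_mapD(1)[OF F0(1)] in simp)
  ultimately have "openin (mtop X) ({u \<in> points X. f u \<in> V0 \<inter> V1} \<inter> {u \<in> U0. \<phi>0 u \<in> W} \<inter> U1)"
    using T1(1) by blast
  moreover have "{u \<in> points X. f u \<in> V0 \<inter> V1} \<inter> {u \<in> U0. \<phi>0 u \<in> W} \<inter> U1 = O'"
    using T0(4) by (auto simp: O'_def)
  ultimately have Oo: "openin (mtop X) O'" by simp
  have xO: "x \<in> O'" using x F0(2) by (simp add: O'_def)
  have O0: "O' \<subseteq> U0" "O' \<subseteq> U1" by (auto simp: O'_def)
  have c0': "copen I (\<phi>0 ` O')" unfolding I_def by (rule top_chart_image[OF C0(1) Oo O0(1)])
  have c1': "copen I (\<phi>1 ` O')" unfolding I_def by (rule top_chart_image[OF C1(1) Oo O0(2)])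
  define \<sigma> where "\<sigma> z = \<phi>0 (inv_into U1 \<phi>1 z)" for z
  define \<sigma>' where "\<sigma>' z = \<phi>1 (inv_into U0 \<phi>0 z)" for z
  define \<tau> where "\<tau> y = \<psi>1 (inv_into V0 \<psi>0 y)" for y
  have h\<sigma>: "holo_map I I (\<phi>1 ` O') \<sigma>"
    unfolding \<sigma>_def I_def
    by (rule holo_map_subset[OF holo_chart_transition[OF complex_manifold_imp_holo_atlas[OF X] c1 c0]]) (use c1' I_def O0 in auto)
  have h\<sigma>': "holo_map I I (\<phi>0 ` O') \<sigma>'"
    unfolding \<sigma>'_def I_def
    by (rule holo_map_subset[OF holo_chart_transition[OF complex_manifold_imp_holo_atlas[OF X] c0 c1]]) (use c0' I_def O0 in auto)
  have h\<tau>: "holo_map J J (\<psi>0 ` (V0 \<inter> V1)) \<tau>"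
    unfolding \<tau>_def J_def by (rule holo_chart_transition[OF complex_manifold_imp_holo_atlas[OF Y] d0 d1])
  have \<sigma>e: "\<sigma> (\<phi>1 u) = \<phi>0 u" "\<sigma>' (\<phi>0 u) = \<phi>1 u" if "u \<in> O'" for u
    using that O0 T0(6) T1(6) by (auto simp: \<sigma>_def \<sigma>'_def)
  have Ge: "G0 (\<phi>0 u) = \<psi>0 (f u)" "G1 (\<phi>1 u) = \<psi>1 (f u)" if "u \<in> O'" for u
    using that O0 T0(6) T1(6) by (auto simp: G0_def G1_def)
  have \<tau>e: "\<tau> (\<psi>0 (f u)) = \<psi>1 (f u)" if "u \<in> O'" for u
    using that S0(6) by (auto simp: \<tau>_def O'_def)
  have hG0': "holo_map I J (\<phi>0 ` O') G0"
    by (rule holo_map_subset[OF hG0 c0']) (auto simp: O'_def)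
  have G0im: "G0 ` \<phi>0 ` O' \<subseteq> \<psi>0 ` (V0 \<inter> V1)" using Ge(1) by (auto simp: O'_def)
  have h1: "holo_map I J (\<phi>1 ` O') (\<lambda>z. G0 (\<sigma> z))"
    by (rule holo_map_compose[OF hG0' h\<sigma> _ fin(1,1)]) (use \<sigma>e in auto)
  have "holo_map I J (\<phi>1 ` O') (\<lambda>z. \<tau> (G0 (\<sigma> z)))"
    by (rule holo_map_compose[OF h\<tau> h1 _ fin]) (use \<sigma>e G0im in auto)
  then have hG1: "holo_map I J (\<phi>1 ` O') G1"
    by (rule holo_map_cong) (use \<sigma>e Ge \<tau>e in auto)
  define a b where "a = \<phi>0 x" and "b = \<phi>1 x"
  have a: "a \<in> \<phi>0 ` O'" "b \<in> \<phi>1 ` O'" "\<sigma> b = a" "\<sigma>' a = b" using xO \<sigma>e by (auto simp: a_def b_def)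
  define L where "L v = (\<lambda>i. dd I (\<lambda>z. \<sigma>' z i) a v)" for v
  define N where "N v = (\<lambda>i. dd I (\<lambda>z. \<sigma> z i) b v)" for v
  have Lc: "L v \<in> cspace I" for v
  proof -
    have "L v i = 0" if "i \<notin> I" for i
    proof -
      have "dd I (\<lambda>z. \<sigma>' z i) a v = dd I (\<lambda>z. 0) a v"
        by (rule dd_cong[OF c0' a(1) fin(1)]) (use holo_mapD(5)[OF h\<sigma>' _ that] in blast)
      then show ?thesis by (simp add: L_def dd_def pd_const)
    qed
    then show ?thesis by (simp add: cspace_def)
  qed
  have NL: "N (L v) = v" if v: "v \<in> cspace I" for v
  proof
    fix i
    have "dd I (\<lambda>z. \<sigma> (\<sigma>' z) i) a v = dd I (\<lambda>z. \<sigma> z i) (\<sigma>' a) (\<lambda>k. dd I (\<lambda>z. \<sigma>' z k) a v)"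
      by (rule dd_compose[OF holo_map_component[OF h\<sigma>] h\<sigma>' _ fin(1,1) a(1)]) (use \<sigma>e in auto)
    moreover have "dd I (\<lambda>z. \<sigma> (\<sigma>' z) i) a v = dd I (\<lambda>z. z i) a v"
      by (rule dd_cong[OF c0' a(1) fin(1)]) (use \<sigma>e in auto)
    ultimately show "N (L v) i = v i" using dd_proj_cspace[OF fin(1) v] a(4) by (simp add: N_def L_def)
  qed
  have LK: "L v \<in> cdiff_kernel I J G1 b" if v: "v \<in> cdiff_kernel I J G0 a" for v
  proof -
    have "dd I (\<lambda>z. G1 z j) b (L v) = 0" if "j \<in> J" for j
    proof -
      have "dd I (\<lambda>z. G1 (\<sigma>' z) j) a v = dd I (\<lambda>z. G1 z j) (\<sigma>' a) (\<lambda>k. dd I (\<lambda>z. \<sigma>' z k) a v)"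
        by (rule dd_compose[OF holo_map_component[OF hG1] h\<sigma>' _ fin(1,1) a(1)]) (use \<sigma>e in auto)
      moreover have "dd I (\<lambda>z. G1 (\<sigma>' z) j) a v = dd I (\<lambda>z. \<tau> (G0 z) j) a v"
        by (rule dd_cong[OF c0' a(1) fin(1)]) (use \<sigma>e Ge \<tau>e in auto)
      moreover have "dd I (\<lambda>z. \<tau> (G0 z) j) a v = dd J (\<lambda>y. \<tau> y j) (G0 a) (\<lambda>k. dd I (\<lambda>z. G0 z k) a v)"
        by (rule dd_compose[OF holo_map_component[OF h\<tau>] hG0' G0im fin a(1)])
      moreover have "dd J (\<lambda>y. \<tau> y j) (G0 a) (\<lambda>k. dd I (\<lambda>z. G0 z k) a v) = 0"
        by (rule dd_zero) (use v in \<open>auto simp: cdiff_kernel_def cdiff_dd\<close>)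
      ultimately show ?thesis using a(4) by (simp add: L_def)
    qed
    then show ?thesis using Lc by (simp add: cdiff_kernel_def cdiff_dd)
  qed
  have "cvec.dim (cdiff_kernel I J G0 a) \<le> cvec.dim (cdiff_kernel I J G1 b)"
  proof (rule dim_le_image[OF fin(1)])
    show "cdiff_kernel I J G1 b \<subseteq> cspace I" by (auto simp: cdiff_kernel_def)
    show "cdiff_kernel I J G0 a \<subseteq> N ` cdiff_kernel I J G1 b"
    proof
      fix v assume v: "v \<in> cdiff_kernel I J G0 a"
      then have "v = N (L v)" using NL by (simp add: cdiff_kernel_def)
      then show "v \<in> N ` cdiff_kernel I J G1 b" using LK[OF v] by blast
    qed
  qed (simp_all add: N_def dd_linear fun_eq_iff, simp add: cscale_def)
  then show ?thesis using hG1 a(2) by (auto simp: I_def J_def G0_def G1_def a_def b_def)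
qed

subsection \<open>Infinitesimal stability\<close>

text \<open>As the difference quotients in direction \<open>i\<close> converge uniformly, their
  derivatives in \<open>k\<close> converge to the derivative of the limit. These derivatives are the
  difference quotients of \<open>pd k g\<close>, whose limit is the other mixed derivative.\<close>

lemma pd_commute:
  assumes g: "holo_fun I U g" and fin: "finite I" and z: "z \<in> U" and i: "i \<in> I" and k: "k \<in> I"
  shows "pd k (pd i g) z = pd i (pd k g) z"
proof (cases "k = i")
  case False
  obtain r where r: "r > 0"
    "\<And>s. s \<in> ball (z k) r \<Longrightarrow> z(k := s) \<in> U"
    "\<forall>\<^sub>F h in at 0. \<forall>s\<in>cball (z k) r. z(k := s, i := z i + h) \<in> U"
    "\<forall>\<^sub>F h in at 0. (\<lambda>s. (g (z(k := s, i := z i + h)) - g (z(k := s))) / h) holomorphic_on cball (z k) r"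
    "uniform_limit (cball (z k) r) (\<lambda>h s. (g (z(k := s, i := z i + h)) - g (z(k := s))) / h) (\<lambda>s. pd i g (z(k := s))) (at 0)"
    by (rule pd_difference_quotients[OF g fin z i k False]) blast
  define f where "f h s = (g (z(k := s, i := z i + h)) - g (z(k := s))) / h" for h s
  define f' where "f' h s = (pd k g (z(k := s, i := z i + h)) - pd k g (z(k := s))) / h" for h s
  have D: "\<forall>\<^sub>F h in at 0. continuous_on (cball (z k) r) (f h) \<and>
     (\<forall>w\<in>ball (z k) r. (f h has_field_derivative f' h w) (at w))"
    using r(3,4)
  proof eventually_elim
    case (elim h)
    have "(f h has_field_derivative f' h w) (at w)" if w: "w \<in> ball (z k) r" for w
    proof -
      have 1: "((\<lambda>s. g (z(k := s, i := z i + h))) has_field_derivative pd k g (z(k := w, i := z i + h))) (at w)"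
        using holo_fun_pd[OF g fin, of "z(k := w, i := z i + h)" k] elim(1) w k False
        by (auto simp: fun_upd_twist)
      have 2: "((\<lambda>s. g (z(k := s))) has_field_derivative pd k g (z(k := w))) (at w)"
        using holo_fun_pd[OF g fin, of "z(k := w)" k] r(2)[OF w] k by simp
      show ?thesis unfolding f_def f'_def by (rule DERIV_cdivide[OF DERIV_diff[OF 1 2]])
    qed
    moreover have "continuous_on (cball (z k) r) (f h)"
      using elim(2) unfolding f_def by (rule holomorphic_on_imp_continuous_on)
    ultimately show ?case by blast
  qed
  have L: "uniform_limit (cball (z k) r) f (\<lambda>s. pd i g (z(k := s))) (at 0)"
    using r(5) by (simp add: f_def[abs_def])
  obtain g' where g': "\<And>w. w \<in> ball (z k) r \<Longrightarrow>
      ((\<lambda>s. pd i g (z(k := s))) has_field_derivative g' w) (at w) \<and> ((\<lambda>h. f' h w) \<longlongrightarrow> g' w) (at 0)"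
    by (rule has_complex_derivative_uniform_limit[OF D L trivial_limit_at r(1)]) blast
  have zk: "z k \<in> ball (z k) r" using r(1) by simp
  have "pd k (pd i g) z = g' (z k)"
    unfolding pd_def[of k "pd i g"] by (rule DERIV_imp_deriv) (use g'[OF zk] in blast)
  moreover have "((\<lambda>h. (pd k g (z(i := z i + h)) - pd k g z) / h) \<longlongrightarrow> pd i (pd k g) z) (at 0)"
    using holo_fun_pd[OF holo_fun_pd_holo[OF g fin k] fin z i] by (simp add: DERIV_def)
  then have "((\<lambda>h. f' h (z k)) \<longlongrightarrow> pd i (pd k g) z) (at 0)" by (simp add: f'_def)
  ultimately show ?thesis using g'[OF zk] tendsto_unique[of "at (0::complex)"] by auto
qed simp

lemma total_map_apply [simp]:
  "total_map fs z (Inl k) = z (Inl k)" "total_map fs z (Inr j) = fs (z \<circ> Inl) (z \<circ> Inr) j"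
  by (simp_all add: total_map_def)

lemma holo_map_case_sum_zero:
  assumes "copen J W" "0 \<in> cspace K"
  shows "holo_map J (K <+> J) W (\<lambda>y. case_sum 0 y)"
proof (rule holo_map_case_sum[OF _ holo_map_id[OF assms(1)]])
  show "holo_map J K W (\<lambda>y. 0)"
    using assms by (auto simp: holo_map_def intro: holo_fun_const)
qed

text \<open>The relation between \<Psi>, the unfolding and \<Phi> is differentiated by the parameter
  \<open>s\<close> at s = 0, where \<Psi> and \<Phi> are the identity. One side gives \<kappa>
  \<circ> f plus the perturbation, the other the differential of \<open>f\<close> applied to \<eta>;
  here \<kappa> and \<eta> are the velocities of \<Psi> and \<Phi> at s = 0. The result holds on
  full neighbourhoods with holomorphic \<kappa> and \<eta>, so that it can be differentiated once
  more.\<close>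

lemma stable_infinitesimal:
  assumes stab: "stable_multigerm I J A f" and fin: "finite I" "finite J"
    and a: "a \<in> A" and h: "holo_map I J P h" "a \<in> P"
  obtains \<kappa> W \<eta> U1 Q where "holo_map J J W \<kappa>" "0 \<in> W" "holo_map I I U1 \<eta>" "A \<subseteq> U1"
    "holo_map I J U1 f" "f ` U1 \<subseteq> W" "copen I Q" "Q \<inter> A = {a}"
    "\<And>x j. x \<in> U1 \<Longrightarrow> j \<in> J \<Longrightarrow>
      \<kappa> (f x) j + (if x \<in> Q then h x j else 0) = dd I (\<lambda>z. f z j) x (\<eta> x)"
proof -
  obtain U where finA: "finite A" and U: "A \<subseteq> U" "holo_map I J U f" and f0: "\<And>a. a \<in> A \<Longrightarrow> f a = 0"
    using stab by (auto simp: stable_multigerm_def multigerm_def)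
  have AI: "A \<subseteq> cspace I" using U holo_mapD(2) by blast
  have "\<exists>i\<in>I. a i \<noteq> b i" if "b \<in> A - {a}" for b
  proof (rule ccontr)
    assume "\<not> ?thesis"
    then have "a = b" using that a AI by (auto simp: cspace_def fun_eq_iff subset_iff) metis
    then show False using that by simp
  qed
  then obtain \<iota> where \<iota>: "\<And>b. b \<in> A - {a} \<Longrightarrow> \<iota> b \<in> I \<and> a (\<iota> b) \<noteq> b (\<iota> b)" by metis
  \<comment> \<open>At most half the distance of \<open>a\<close> from each other base point,
    measured in a coordinate that separates them, so that polydiscs of this radius around
    \<open>a\<close> and around the others are disjoint; the 1 covers the case of no other base
    point.\<close>
  define \<delta> where "\<delta> = Min (insert 1 ((\<lambda>b. dist (a (\<iota> b)) (b (\<iota> b)) / 2) ` (A - {a})))"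
  have \<delta>1: "\<delta> > 0" using finA \<iota> by (auto simp: \<delta>_def)
  have \<delta>2: "\<delta> \<le> dist (a (\<iota> b)) (b (\<iota> b)) / 2" if "b \<in> A - {a}" for b
    unfolding \<delta>_def by (rule Min_le) (use finA that in auto)
  note \<delta> = \<delta>1 \<delta>2
  define Q where "Q = P \<inter> U \<inter> polydisc I a \<delta>"
  define R where "R = U \<inter> (\<Union>b\<in>A - {a}. polydisc I b \<delta>)"
  have Uo: "copen I U" using holo_mapD(1)[OF U(2)] .
  have Qo: "copen I Q" unfolding Q_def by (intro copen_Int copen_polydisc fin Uo holo_mapD(1)[OF h(1)])
  have Ro: "copen I R" unfolding R_def by (intro copen_Int copen_Union Uo) (auto intro: copen_polydisc fin)
  have disj: "Q \<inter> R = {}"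
  proof (rule ccontr)
    assume "Q \<inter> R \<noteq> {}"
    then obtain x b where x: "x \<in> polydisc I a \<delta>" "x \<in> polydisc I b \<delta>" "b \<in> A - {a}"
      by (auto simp: Q_def R_def)
    have "dist (a (\<iota> b)) (x (\<iota> b)) < \<delta>" "dist (b (\<iota> b)) (x (\<iota> b)) < \<delta>"
      using x \<iota>[OF x(3)] by (auto simp: polydisc_def)
    then show False using \<delta>(2)[OF x(3)] dist_triangle2[of "a (\<iota> b)" "b (\<iota> b)" "x (\<iota> b)"] by linarith
  qed
  have aQ: "a \<in> Q" using a U(1) h(2) AI \<delta>(1) by (auto simp: Q_def intro: mem_polydisc)
  have AR: "A - {a} \<subseteq> R" using U(1) AI \<delta>(1) by (auto simp: R_def intro!: mem_polydisc)
  have QA: "Q \<inter> A = {a}" using aQ AR disj a by blast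
  define U2 where "U2 = Q \<union> R"
  have U2o: "copen I U2" unfolding U2_def using copen_Union[of "{Q, R}"] Qo Ro by auto
  have AU2: "A \<subseteq> U2" using aQ AR by (auto simp: U2_def)
  have U2U: "U2 \<subseteq> U" by (auto simp: U2_def Q_def R_def)
  have fU2: "holo_map I J U2 f" by (rule holo_map_subset[OF U(2) U2o U2U])
  \<comment> \<open>Holomorphic although defined by cases, because \<open>Q\<close> and
    \<open>R\<close> are disjoint open sets covering \<open>U2\<close>.\<close>
  define H where "H x = (if x \<in> Q then h x else 0)" for x
  have HU2: "holo_map I J U2 H"
  proof (rule holo_map_local[OF _ fin(1)])
    fix x assume x: "x \<in> U2"
    have "holo_map I J Q h" by (rule holo_map_subset[OF h(1) Qo]) (auto simp: Q_def)
    then have 1: "holo_map I J Q H" by (rule holo_map_cong) (simp add: H_def)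
    have "holo_map I J R (\<lambda>x. 0)" using Ro by (auto simp: holo_map_def cspace_def intro: holo_fun_const)
    then have 2: "holo_map I J R H" by (rule holo_map_cong) (use disj in \<open>auto simp: H_def\<close>)
    show "\<exists>V\<subseteq>U2. x \<in> V \<and> holo_map I J V H" using x 1 2 by (auto simp: U2_def)
  qed
  define K where "K = {..<1::nat}"
  have K: "finite K" "0 \<in> K" "K = {0}" by (auto simp: K_def)
  have K0: "(0 :: nat \<Rightarrow> complex) \<in> cspace K" by (simp add: cspace_def)
  have finK: "finite (K <+> I)" "finite (K <+> J)" using K fin by auto
  define fs where "fs s x = (\<lambda>j. f x j + s (0::nat) * H x j)" for s x
  define Uu where "Uu = cprod (cspace K) U2"
  have Uuo: "copen (K <+> I) Uu" unfolding Uu_def by (intro copen_cprod copen_cspace U2o)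
  have Inr2: "holo_map (K <+> I) I Uu (\<lambda>p. p \<circ> Inr)" by (rule holo_map_Inr[OF Uuo])
  have InrU2: "(\<lambda>p. p \<circ> Inr) ` Uu \<subseteq> U2" by (auto simp: Uu_def cprod_def)
  have F: "holo_map (K <+> I) (K <+> J) Uu (total_map fs)"
  proof -
    have "holo_map (K <+> I) J Uu (\<lambda>p. fs (p \<circ> Inl) (p \<circ> Inr))"
      unfolding holo_map_def
    proof (intro conjI ballI Uuo)
      show "(\<lambda>p. fs (p \<circ> Inl) (p \<circ> Inr)) ` Uu \<subseteq> cspace J"
        using InrU2 holo_mapD(5)[OF fU2] holo_mapD(5)[OF HU2] by (auto simp: fs_def cspace_def)
      fix j
      have "holo_fun (K <+> I) Uu (\<lambda>p. f (p \<circ> Inr) j + p (Inl 0) * H (p \<circ> Inr) j)"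
        by (intro holo_fun_add holo_fun_mult holo_fun_proj Uuo
            holo_fun_compose[OF holo_map_component[OF fU2] Inr2 InrU2 finK(1) fin(1)]
            holo_fun_compose[OF holo_map_component[OF HU2] Inr2 InrU2 finK(1) fin(1)])
      then show "holo_fun (K <+> I) Uu (\<lambda>p. fs (p \<circ> Inl) (p \<circ> Inr) j)" by (simp add: fs_def)
    qed
    then show ?thesis unfolding total_map_def[abs_def]
      by (rule holo_map_case_sum[OF holo_map_Inl[OF Uuo]])
  qed
  have "unfolding_on 1 I J A f Uu fs"
    unfolding unfolding_on_def K_def[symmetric] using F AU2 K0
    by (auto simp: Uu_def fs_def)
  then have "trivial_unfolding 1 I J A f fs"
    using stab by (auto simp: stable_multigerm_def)
  then obtain \<phi> U\<phi> U' \<psi> W W' N where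
    \<phi>: "unfolding_on 1 I I A id U\<phi> \<phi>" "biholo (K <+> I) (K <+> I) U\<phi> U' (total_map \<phi>)" and
    \<psi>: "unfolding_on 1 J J {0} id W \<psi>" and
    N: "copen (K <+> I) N" "\<And>a. a \<in> A \<Longrightarrow> case_sum 0 a \<in> N" "N \<subseteq> U'"
      "\<And>z. z \<in> N \<Longrightarrow> total_map fs (inv_into U\<phi> (total_map \<phi>) z) \<in> W \<and>
           total_map \<psi> (total_map fs (inv_into U\<phi> (total_map \<phi>) z)) = total_map (\<lambda>_. f) z"
    unfolding trivial_unfolding_def K_def[symmetric] by blast
  define \<Phi> \<Psi> where "\<Phi> = total_map \<phi>" and "\<Psi> = total_map \<psi>"
  note B = biholoD[OF \<phi>(2), folded \<Phi>_def]
  have \<Psi>: "holo_map (K <+> J) (K <+> J) W \<Psi>"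
    using \<psi> by (simp add: unfolding_on_def K_def \<Psi>_def)
  have W0: "case_sum 0 0 \<in> W" using \<psi> by (simp add: unfolding_on_def)
  have \<phi>0: "\<phi> 0 x = x" if "case_sum 0 x \<in> U\<phi>" for x using \<phi>(1) that by (simp add: unfolding_on_def)
  have \<psi>0: "\<psi> 0 y = y" if "case_sum 0 y \<in> W" for y using \<psi> that by (simp add: unfolding_on_def)
  have \<Phi>0: "\<Phi> (case_sum 0 x) = case_sum 0 x" if "case_sum 0 x \<in> U\<phi>" for x
    using \<phi>0[OF that] by (simp add: \<Phi>_def total_map_def)
  have A\<phi>: "case_sum 0 b \<in> U\<phi>" if "b \<in> A" for b using \<phi>(1) that by (simp add: unfolding_on_def)
  \<comment> \<open>Triviality is stated on the target side of \<Phi>. On this neighbourhood it is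
    pulled back to the source side, so that the relation no longer contains the inverse of
    \<Phi>.\<close>
  define N1 where "N1 = {p \<in> U\<phi>. \<Phi> p \<in> N \<inter> Uu} \<inter> Uu"
  have N1o: "copen (K <+> I) N1"
    unfolding N1_def by (intro copen_Int copen_vimage[OF B(1)] N(1) Uuo)
  have AN1: "case_sum 0 b \<in> N1" if "b \<in> A" for b
    using that A\<phi>[OF that] N(2)[OF that] \<Phi>0[OF A\<phi>[OF that]] AU2 K0 by (auto simp: N1_def Uu_def)
  have N1sub: "N1 \<subseteq> U\<phi>" "N1 \<subseteq> Uu" by (auto simp: N1_def)
  have rel: "total_map fs p \<in> W \<and> \<Psi> (total_map fs p) = total_map (\<lambda>_. f) (\<Phi> p)" if "p \<in> N1" for p
  proof -
    have "\<Phi> p \<in> N" "inv_into U\<phi> \<Phi> (\<Phi> p) = p" using that B(5) by (auto simp: N1_def)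
    then show ?thesis using N(4)[of "\<Phi> p"] by (simp add: \<Phi>_def \<Psi>_def)
  qed
  define W1 where "W1 = {y \<in> cspace J. case_sum (0 :: nat \<Rightarrow> complex) y \<in> W}"
  define U1 where "U1 = {x \<in> U2. case_sum (0 :: nat \<Rightarrow> complex) x \<in> N1}"
  have W1o: "copen J W1" unfolding W1_def
    by (rule copen_vimage[OF holo_map_case_sum_zero[OF copen_cspace K0] holo_mapD(1)[OF \<Psi>]])
  have U1o: "copen I U1" unfolding U1_def
    by (rule copen_vimage[OF holo_map_case_sum_zero[OF U2o K0] N1o])
  \<comment> \<open>Derivative by the parameter at s = 0, set to zero outside \<open>J\<close> so
    that the values lie in \<open>cspace J\<close>.\<close>
  define \<kappa> where "\<kappa> y j = (if j \<in> J then pd (Inl 0) (\<lambda>q. \<Psi> q (Inr j)) (case_sum 0 y) else 0)" for y j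
  define \<eta> where "\<eta> x i = (if i \<in> I then pd (Inl 0) (\<lambda>p. \<Phi> p (Inr i)) (case_sum 0 x) else 0)" for x i
  have h\<kappa>: "holo_map J J W1 \<kappa>"
    unfolding holo_map_def
  proof (intro conjI ballI W1o)
    show "\<kappa> ` W1 \<subseteq> cspace J" by (auto simp: \<kappa>_def cspace_def)
    fix j assume j: "j \<in> J"
    have "holo_fun J W1 (\<lambda>y. pd (Inl 0) (\<lambda>q. \<Psi> q (Inr j)) (case_sum 0 y))"
      by (rule holo_fun_compose[OF holo_fun_pd_holo[OF holo_map_component[OF \<Psi>] finK(2)]
            holo_map_case_sum_zero[OF W1o K0] _ fin(2) finK(2)])
         (use K(2) in \<open>auto simp: W1_def\<close>)
    then show "holo_fun J W1 (\<lambda>y. \<kappa> y j)" using j by (simp add: \<kappa>_def)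
  qed
  have h\<eta>: "holo_map I I U1 \<eta>"
    unfolding holo_map_def
  proof (intro conjI ballI U1o)
    show "\<eta> ` U1 \<subseteq> cspace I" by (auto simp: \<eta>_def cspace_def)
    fix i assume i: "i \<in> I"
    have "holo_fun I U1 (\<lambda>x. pd (Inl 0) (\<lambda>p. \<Phi> p (Inr i)) (case_sum 0 x))"
      by (rule holo_fun_compose[OF holo_fun_pd_holo[OF holo_map_component[OF B(1)] finK(1)]
            holo_map_case_sum_zero[OF U1o K0] _ fin(1) finK(1)])
         (use K(2) N1sub in \<open>auto simp: U1_def\<close>)
    then show "holo_fun I U1 (\<lambda>x. \<eta> x i)" using i by (simp add: \<eta>_def)
  qed
  have f1: "f x \<in> W1" if x: "x \<in> U1" for x
  proof -
    have "total_map fs (case_sum 0 x) = case_sum 0 (f x)" by (simp add: total_map_def fs_def)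
    then have "case_sum 0 (f x) \<in> W" using rel[of "case_sum 0 x"] x by (simp add: U1_def)
    moreover have "f x \<in> cspace J" using x holo_mapD(4)[OF fU2] by (simp add: U1_def)
    ultimately show ?thesis by (simp add: W1_def)
  qed
  have main: "\<kappa> (f x) j + H x j = dd I (\<lambda>z. f z j) x (\<eta> x)" if x: "x \<in> U1" and j: "j \<in> J" for x j
  proof -
    define p0 where "p0 = case_sum (0 :: nat \<Rightarrow> complex) x"
    have p0: "p0 \<in> N1" "p0 \<in> U\<phi>" using x N1sub by (auto simp: U1_def p0_def)
    have FN1: "holo_map (K <+> I) (K <+> J) N1 (total_map fs)"
      by (rule holo_map_subset[OF F N1o N1sub(2)])
    have \<Phi>N1: "holo_map (K <+> I) (K <+> I) N1 \<Phi>" by (rule holo_map_subset[OF B(1) N1o N1sub(1)])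
    have I0: "Inl 0 \<in> K <+> I" using K by auto
    have Fp0: "total_map fs p0 = case_sum 0 (f x)" by (simp add: total_map_def fs_def p0_def)
    have d1: "pd (Inl 0) (\<lambda>p. total_map fs p (Inl 0)) p0 = 1" by (simp add: pd_proj)
    have d2: "pd (Inl 0) (\<lambda>p. total_map fs p (Inr k)) p0 = H x k" for k
    proof -
      have "(p0(Inl 0 := t)) \<circ> Inr = x" for t by (auto simp: p0_def fun_eq_iff)
      then have "(\<lambda>t. total_map fs (p0(Inl 0 := t)) (Inr k)) = (\<lambda>t. f x k + t * H x k)"
        by (simp add: fs_def)
      moreover have "((\<lambda>t. f x k + t * H x k) has_field_derivative H x k) (at (p0 (Inl 0)))"
        by (auto intro!: derivative_eq_intros)
      ultimately show ?thesis unfolding pd_def by (metis DERIV_imp_deriv)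
    qed
    \<comment> \<open>At s = 0 the map \<Psi> is the identity in the target variables, so its
      Jacobian in these is the unit matrix; of the chain rule only \<kappa> and the velocity of the
      unfolding survive.\<close>
    have d3: "pd (Inr k) (\<lambda>q. \<Psi> q (Inr j)) (case_sum 0 (f x)) = (if k = j then 1 else 0)" if k: "k \<in> J" for k
    proof -
      have W: "case_sum 0 (f x) \<in> W" using f1[OF x] by (simp add: W1_def)
      have upd: "(case_sum 0 (f x))(Inr k := t) = case_sum (0 :: nat \<Rightarrow> complex) ((f x)(k := t))" for t
        by (auto simp: fun_eq_iff split: sum.split)
      have "open {t. (case_sum 0 (f x))(Inr k := t) \<in> W}"
        by (rule open_slice[OF holo_mapD(1)[OF \<Psi>] _ finK(2)]) (use k in auto)
      moreover have "f x k \<in> {t. (case_sum 0 (f x))(Inr k := t) \<in> W}" using W by (simp add: upd)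
      ultimately have "\<forall>\<^sub>F t in nhds (f x k). t \<in> {t. (case_sum 0 (f x))(Inr k := t) \<in> W}"
        by (rule eventually_nhds_in_open)
      then have "\<forall>\<^sub>F t in nhds (f x k). \<Psi> ((case_sum 0 (f x))(Inr k := t)) (Inr j) = ((f x)(k := t)) j"
        by eventually_elim (simp add: upd \<Psi>_def \<psi>0)
      then have "deriv (\<lambda>t. \<Psi> ((case_sum 0 (f x))(Inr k := t)) (Inr j)) (f x k) = deriv (\<lambda>t. ((f x)(k := t)) j) (f x k)"
        by (rule deriv_cong_ev) simp
      then show ?thesis using pd_proj[of k j "f x"] by (simp add: pd_def)
    qed
    have "pd (Inl 0) (\<lambda>p. \<Psi> (total_map fs p) (Inr j)) p0
      = (\<Sum>q\<in>K <+> J. pd q (\<lambda>q. \<Psi> q (Inr j)) (total_map fs p0) * pd (Inl 0) (\<lambda>p. total_map fs p q) p0)"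
      by (rule pd_compose[OF holo_map_component[OF \<Psi>] FN1 _ finK p0(1) I0]) (use rel in auto)
    also have "\<dots> = \<kappa> (f x) j + (\<Sum>k\<in>J. (if k = j then 1 else 0) * H x k)"
      using d1 d2 d3 j unfolding Fp0 sum_Plus[OF K(1) fin(2)] by (simp add: K(3) \<kappa>_def cong: sum.cong)
    also have "\<dots> = \<kappa> (f x) j + H x j" using j fin(2) by (simp add: if_distrib[of "\<lambda>u. u * _"] cong: if_cong)
    finally have L: "pd (Inl 0) (\<lambda>p. \<Psi> (total_map fs p) (Inr j)) p0 = \<kappa> (f x) j + H x j" .
    have "holo_map (K <+> I) I N1 (\<lambda>p. \<Phi> p \<circ> Inr)"
      unfolding holo_map_def
      using N1o holo_map_component[OF \<Phi>N1] holo_mapD(4)[OF \<Phi>N1] by (auto simp: in_cspace_Plus_iff)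
    then have "pd (Inl 0) (\<lambda>p. f (\<Phi> p \<circ> Inr) j) p0
      = (\<Sum>i\<in>I. pd i (\<lambda>z. f z j) (\<Phi> p0 \<circ> Inr) * pd (Inl 0) (\<lambda>p. (\<Phi> p \<circ> Inr) i) p0)"
      by (rule pd_compose[OF holo_map_component[OF fU2] _ _ finK(1) fin(1) p0(1) I0])
         (auto simp: N1_def Uu_def cprod_def)
    also have "\<dots> = dd I (\<lambda>z. f z j) x (\<eta> x)"
      using \<Phi>0[of x] p0(2) by (simp add: dd_def \<eta>_def p0_def)
    finally have R: "pd (Inl 0) (\<lambda>p. f (\<Phi> p \<circ> Inr) j) p0 = dd I (\<lambda>z. f z j) x (\<eta> x)" .
    have "pd (Inl 0) (\<lambda>p. \<Psi> (total_map fs p) (Inr j)) p0 = pd (Inl 0) (\<lambda>p. f (\<Phi> p \<circ> Inr) j) p0"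
      by (rule pd_cong[OF N1o p0(1) I0 finK(1)]) (use rel in simp)
    then show ?thesis using L R by simp
  qed
  show thesis
  proof (rule that[OF h\<kappa> _ h\<eta> _ _ _ Qo QA])
    show "0 \<in> W1" using W0 by (auto simp: W1_def cspace_def)
    show "A \<subseteq> U1" using AU2 AN1 by (auto simp: U1_def)
    show "holo_map I J U1 f" by (rule holo_map_subset[OF fU2 U1o]) (auto simp: U1_def)
    show "f ` U1 \<subseteq> W1" using f1 by blast
    show "\<kappa> (f x) j + (if x \<in> Q then h x j else 0) = dd I (\<lambda>z. f z j) x (\<eta> x)" if "x \<in> U1" "j \<in> J" for x j
      using main[OF that] by (auto simp: H_def)
  qed
qed

text \<open>The last condition is linear independence of second derivatives, in the form of dual vectors.\<close>

definition normal_germ ::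
  "'i set \<Rightarrow> 'j set \<Rightarrow> ('j \<Rightarrow> 'i) \<Rightarrow> 'j set \<Rightarrow> ('i \<Rightarrow> complex) set \<Rightarrow> (('i \<Rightarrow> complex) \<Rightarrow> 'j \<Rightarrow> complex)
    \<Rightarrow> ('i \<Rightarrow> complex) \<Rightarrow> bool" where
  "normal_germ I J \<sigma> J0 V g b \<longleftrightarrow>
     holo_map I J V g \<and> b \<in> V \<and> J0 \<subseteq> J \<and> inj_on \<sigma> J0 \<and> \<sigma> ` J0 \<subseteq> I \<and>
     (\<forall>y\<in>V. \<forall>j\<in>J0. g y j = y (\<sigma> j)) \<and>
     (\<forall>i\<in>I - \<sigma> ` J0. \<forall>j\<in>J. pd i (\<lambda>y. g y j) b = 0) \<and>
     (\<forall>l\<in>(J - J0) \<times> (I - \<sigma> ` J0). \<exists>c\<in>cspace I. \<forall>m\<in>(J - J0) \<times> (I - \<sigma> ` J0).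
        dd I (pd (snd m) (\<lambda>y. g y (fst m))) b c = (if m = l then 1 else 0))"

lemma normal_germD:
  assumes "normal_germ I J \<sigma> J0 V g b"
  shows "holo_map I J V g" "b \<in> V" "J0 \<subseteq> J" "inj_on \<sigma> J0" "\<sigma> ` J0 \<subseteq> I"
    "\<And>y j. y \<in> V \<Longrightarrow> j \<in> J0 \<Longrightarrow> g y j = y (\<sigma> j)"
    "\<And>i j. i \<in> I - \<sigma> ` J0 \<Longrightarrow> j \<in> J \<Longrightarrow> pd i (\<lambda>y. g y j) b = 0"
    "\<And>l. l \<in> (J - J0) \<times> (I - \<sigma> ` J0) \<Longrightarrow> \<exists>c\<in>cspace I. \<forall>m\<in>(J - J0) \<times> (I - \<sigma> ` J0).
        dd I (pd (snd m) (\<lambda>y. g y (fst m))) b c = (if m = l then 1 else 0)"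
proof -
  note A = assms[unfolded normal_germ_def]
  show "holo_map I J V g" "b \<in> V" "J0 \<subseteq> J" "inj_on \<sigma> J0" "\<sigma> ` J0 \<subseteq> I"
    "\<And>y j. y \<in> V \<Longrightarrow> j \<in> J0 \<Longrightarrow> g y j = y (\<sigma> j)"
    "\<And>i j. i \<in> I - \<sigma> ` J0 \<Longrightarrow> j \<in> J \<Longrightarrow> pd i (\<lambda>y. g y j) b = 0"
    using A by simp_all
  show "\<And>l. l \<in> (J - J0) \<times> (I - \<sigma> ` J0) \<Longrightarrow> \<exists>c\<in>cspace I. \<forall>m\<in>(J - J0) \<times> (I - \<sigma> ` J0).
        dd I (pd (snd m) (\<lambda>y. g y (fst m))) b c = (if m = l then 1 else 0)"
    by (rule bspec[OF A[THEN conjunct2, THEN conjunct2, THEN conjunct2, THEN conjunct2, THEN conjunct2, THEN conjunct2, THEN conjunct2]])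
qed

lemma dd_unitv: "finite I \<Longrightarrow> i \<in> I \<Longrightarrow> dd I g z (unitv i) = pd i g z"
  by (simp add: dd_def unitv_def if_distrib[of "\<lambda>u. _ * u"] cong: if_cong)

lemma dd_proj: "finite I \<Longrightarrow> j \<in> I \<Longrightarrow> dd I (\<lambda>z. z j) z v = v j"
  by (simp add: dd_def pd_proj if_distrib[of "\<lambda>u. u * _"] cong: if_cong)

lemma dd_cong_vec: "(\<And>i. i \<in> I \<Longrightarrow> v i = w i) \<Longrightarrow> dd I g z v = dd I g z w"
  by (simp add: dd_def)

text \<open>The relation \<kappa> \<circ> g + h' = dg(\<eta>') is differentiated at \<open>b\<close>
  in a kernel direction \<open>i\<close>. All terms with first derivatives of \<open>g\<close> drop
  out, and what remains pairs the second derivatives of \<open>g\<close> with the value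
  \<open>c\<close> of \<eta>' at \<open>b\<close>. So the vector supplied by stability is itself
  dual to the Hessian entry \<open>(j0, i0)\<close> that the perturbation singles out.\<close>

lemma stable_normal_hessian:
  assumes stab: "stable_multigerm I J A f" and fin: "finite I" "finite J" and a: "a \<in> A"
    and bi: "biholo I I U' V \<Theta>" and aU': "a \<in> U'" and b: "b = \<Theta> a"
    and g: "g = (\<lambda>y. f (inv_into U' \<Theta> y))" and hg: "holo_map I J V g"
    and J0: "J0 \<subseteq> J" "\<sigma> ` J0 \<subseteq> I"
    and g0: "\<And>y j. y \<in> V \<Longrightarrow> j \<in> J0 \<Longrightarrow> g y j = y (\<sigma> j)"
    and g1: "\<And>i j. i \<in> I - \<sigma> ` J0 \<Longrightarrow> j \<in> J \<Longrightarrow> pd i (\<lambda>y. g y j) b = 0"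
    and j0: "j0 \<in> J - J0" and i0: "i0 \<in> I - \<sigma> ` J0"
  shows "\<exists>c\<in>cspace I. \<forall>j\<in>J - J0. \<forall>i\<in>I - \<sigma> ` J0.
    dd I (pd i (\<lambda>y. g y j)) b c = (if j = j0 \<and> i = i0 then 1 else 0)"
proof -
  note B = biholoD[OF bi]
  define S where "S y = inv_into U' \<Theta> y" for y
  have Sb: "S b = a" using B(5)[OF aU'] by (simp add: S_def b)
  have bV: "b \<in> V" using B(3) aU' by (auto simp: b)
  have hS: "holo_map I I V S" using B(2) by (simp add: S_def[abs_def])
  have SV: "S y \<in> U'" "\<Theta> (S y) = y" if "y \<in> V" for y using B(6,7)[OF that] by (simp_all add: S_def)
  define h where "h x j = (if j = j0 then \<Theta> x i0 - b i0 else 0)" for x j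
  have hh: "holo_map I J U' h"
    unfolding holo_map_def
  proof (intro conjI ballI B(8))
    show "h ` U' \<subseteq> cspace J" using j0 by (auto simp: h_def cspace_def)
    fix j
    show "holo_fun I U' (\<lambda>x. h x j)"
      by (cases "j = j0") (simp_all add: h_def holo_fun_intros B(8) holo_map_component[OF B(1)])
  qed
  obtain \<kappa> W \<eta> U1 Q where \<kappa>: "holo_map J J W \<kappa>" "0 \<in> W" and \<eta>: "holo_map I I U1 \<eta>" and U1: "A \<subseteq> U1"
    "holo_map I J U1 f" "f ` U1 \<subseteq> W" and Q: "copen I Q" "Q \<inter> A = {a}" and
    rel: "\<And>x j. x \<in> U1 \<Longrightarrow> j \<in> J \<Longrightarrow> \<kappa> (f x) j + (if x \<in> Q then h x j else 0) = dd I (\<lambda>z. f z j) x (\<eta> x)"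
    by (rule stable_infinitesimal[OF stab fin a hh aU']) blast
  define V1 where "V1 = {y \<in> V. S y \<in> U1 \<inter> Q}"
  have V1o: "copen I V1" unfolding V1_def
    by (rule copen_vimage[OF hS]) (intro copen_Int Q(1) holo_mapD(1)[OF U1(2)])
  have V1V: "V1 \<subseteq> V" by (auto simp: V1_def)
  have bV1: "b \<in> V1" using bV Sb U1(1) a Q(2) by (auto simp: V1_def)
  have hg1: "holo_map I J V1 g" by (rule holo_map_subset[OF hg V1o V1V])
  have hS1: "holo_map I I V1 S" by (rule holo_map_subset[OF hS V1o V1V])
  have gW: "g ` V1 \<subseteq> W" using U1(3) by (auto simp: V1_def g S_def)
  \<comment> \<open>The vector field \<eta> carried over to the coordinates given by
    \<Theta>.\<close>
  define \<eta>' where "\<eta>' y k = (\<Sum>i\<in>I. pd i (\<lambda>x. \<Theta> x k) (S y) * \<eta> (S y) i)" for y k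
  have h\<eta>': "holo_fun I V1 (\<lambda>y. \<eta>' y k)" for k
    unfolding \<eta>'_def
  proof (intro holo_fun_sum holo_fun_mult V1o)
    fix i assume i: "i \<in> I"
    show "holo_fun I V1 (\<lambda>y. pd i (\<lambda>x. \<Theta> x k) (S y))"
      by (rule holo_fun_compose[OF holo_fun_pd_holo[OF holo_map_component[OF B(1)] fin(1) i] hS1 _ fin(1,1)])
         (use SV V1V in blast)
    show "holo_fun I V1 (\<lambda>y. \<eta> (S y) i)"
      by (rule holo_fun_compose[OF holo_map_component[OF \<eta>] hS1 _ fin(1,1)]) (auto simp: V1_def)
  qed
  have h\<kappa>g: "holo_fun I V1 (\<lambda>y. \<kappa> (g y) j)" for j
    by (rule holo_fun_compose[OF holo_map_component[OF \<kappa>(1)] hg1 gW fin])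
  define h' where "h' j y = (if j = j0 then y i0 - b i0 else 0)" for j and y :: "'a \<Rightarrow> complex"
  have hh': "holo_fun I V1 (h' j)" for j
    by (cases "j = j0") (simp_all add: h'_def[abs_def] holo_fun_intros V1o)
  have rel': "\<kappa> (g y) j + h' j y = dd I (\<lambda>y. g y j) y (\<eta>' y)" if y: "y \<in> V1" and j: "j \<in> J" for y j
  proof -
    have x: "S y \<in> U1" "S y \<in> Q" "S y \<in> U'" "\<Theta> (S y) = y" using y SV V1V by (auto simp: V1_def)
    have "\<kappa> (f (S y)) j + h (S y) j = dd I (\<lambda>z. f z j) (S y) (\<eta> (S y))" using rel[OF x(1) j] x(2) by simp
    also have "dd I (\<lambda>z. f z j) (S y) (\<eta> (S y)) = dd I (\<lambda>z. g (\<Theta> z) j) (S y) (\<eta> (S y))"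
      by (rule dd_cong[OF B(8) x(3) fin(1)]) (simp add: g B(5))
    also have "\<dots> = dd I (\<lambda>y. g y j) (\<Theta> (S y)) (\<lambda>k. dd I (\<lambda>z. \<Theta> z k) (S y) (\<eta> (S y)))"
      by (rule dd_compose[OF holo_map_component[OF hg] B(1) _ fin(1,1) x(3)]) (simp add: B(3))
    also have "\<dots> = dd I (\<lambda>y. g y j) y (\<eta>' y)" by (simp add: x(4) dd_def \<eta>'_def)
    finally have "\<kappa> (f (S y)) j + h (S y) j = dd I (\<lambda>y. g y j) y (\<eta>' y)" .
    moreover have "g y = f (S y)" by (simp add: g S_def)
    moreover have "h (S y) j = h' j y" by (simp add: h_def h'_def x(4))
    ultimately show ?thesis by simp
  qed
  have pd\<kappa>: "pd i (\<lambda>y. \<kappa> (g y) j) b = 0" if "i \<in> I - \<sigma> ` J0" for i j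
  proof -
    have "pd i (\<lambda>y. \<kappa> (g y) j) b = (\<Sum>k\<in>J. pd k (\<lambda>w. \<kappa> w j) (g b) * pd i (\<lambda>y. g y k) b)"
      by (rule pd_compose[OF holo_map_component[OF \<kappa>(1)] hg1 gW fin bV1]) (use that in blast)
    then show ?thesis using g1[OF that] by simp
  qed
  define c where "c k = (if k \<in> I then \<eta>' b k else 0)" for k
  have "dd I (pd i (\<lambda>y. g y j)) b c = (if j = j0 \<and> i = i0 then 1 else 0)"
    if j: "j \<in> J - J0" and i: "i \<in> I - \<sigma> ` J0" for j i
  proof -
    have iI: "i \<in> I" using i by blast
    have hgj: "holo_fun I V1 (\<lambda>y. g y j)" by (rule holo_map_component[OF hg1])
    have hpd: "holo_fun I V1 (pd k (\<lambda>y. g y j))" if "k \<in> I" for k by (rule holo_fun_pd_holo[OF hgj fin(1) that])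
    have "pd i (\<lambda>y. \<kappa> (g y) j + h' j y) b = pd i (\<lambda>y. \<Sum>k\<in>I. pd k (\<lambda>y. g y j) y * \<eta>' y k) b"
      by (rule pd_cong[OF V1o bV1 iI fin(1)]) (use rel' j in \<open>auto simp: dd_def\<close>)
    moreover have "pd i (\<lambda>y. \<kappa> (g y) j + h' j y) b = pd i (h' j) b"
      using pd_add[OF h\<kappa>g hh' fin(1) bV1 iI, of j j] pd\<kappa>[OF i, of j] by simp
    moreover have "pd i (h' j) b = (if j = j0 \<and> i = i0 then 1 else 0)"
    proof (cases "j = j0")
      case True
      have "pd i (\<lambda>y. y i0 - b i0) b = pd i (\<lambda>y. y i0) b - pd i (\<lambda>y. b i0) b"
        by (rule pd_diff[OF holo_fun_proj[OF V1o] holo_fun_const[OF V1o] fin(1) bV1 iI])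
      then show ?thesis using True by (simp add: h'_def[abs_def] pd_proj pd_const)
    qed (simp add: h'_def[abs_def] pd_const)
    moreover have "pd i (\<lambda>y. \<Sum>k\<in>I. pd k (\<lambda>y. g y j) y * \<eta>' y k) b = (\<Sum>k\<in>I. pd k (pd i (\<lambda>y. g y j)) b * c k)"
    proof -
      have "pd i (\<lambda>y. \<Sum>k\<in>I. pd k (\<lambda>y. g y j) y * \<eta>' y k) b = (\<Sum>k\<in>I. pd i (\<lambda>y. pd k (\<lambda>y. g y j) y * \<eta>' y k) b)"
        by (rule pd_sum[OF V1o _ fin(1) bV1 iI]) (intro holo_fun_mult hpd h\<eta>')
      also have "\<dots> = (\<Sum>k\<in>I. pd k (pd i (\<lambda>y. g y j)) b * c k)"
      proof (rule sum.cong[OF refl])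
        fix k assume k: "k \<in> I"
        \<comment> \<open>The product rule leaves a term with a derivative of \<eta>'. For kernel
          directions \<open>k\<close> its factor from \<open>g\<close> vanishes. For k = \<sigma> l
          the component \<open>l\<close> of the relation identifies component \<open>k\<close> of
          \<eta>' with component \<open>l\<close> of \<kappa> \<circ> g, whose derivative in a
          kernel direction is zero.\<close>
        have "pd k (\<lambda>y. g y j) b * pd i (\<lambda>y. \<eta>' y k) b = 0"
        proof (cases "k \<in> \<sigma> ` J0")
          case True
          then obtain l where l: "l \<in> J0" "k = \<sigma> l" by blast
          then have lJ: "l \<in> J" "l \<noteq> j0" using J0(1) j0 by auto
          have "\<eta>' y k = \<kappa> (g y) l" if y: "y \<in> V1" for y
          proof -
            have "dd I (\<lambda>y. g y l) y (\<eta>' y) = dd I (\<lambda>y. y k) y (\<eta>' y)"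
              by (rule dd_cong[OF V1o y fin(1)]) (use g0 l V1V in auto)
            then show ?thesis using rel'[OF y lJ(1)] lJ(2) dd_proj[OF fin(1) k] by (simp add: h'_def)
          qed
          then have "pd i (\<lambda>y. \<eta>' y k) b = pd i (\<lambda>y. \<kappa> (g y) l) b"
            by (rule pd_cong[OF V1o bV1 iI fin(1)])
          then show ?thesis using pd\<kappa>[OF i] by simp
        next
          case False
          then show ?thesis using g1 k j by simp
        qed
        moreover have "pd i (\<lambda>y. pd k (\<lambda>y. g y j) y * \<eta>' y k) b
          = pd i (pd k (\<lambda>y. g y j)) b * \<eta>' b k + pd k (\<lambda>y. g y j) b * pd i (\<lambda>y. \<eta>' y k) b"
          by (rule pd_mult[OF hpd[OF k] h\<eta>' fin(1) bV1 iI])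
        moreover have "pd i (pd k (\<lambda>y. g y j)) b = pd k (pd i (\<lambda>y. g y j)) b"
          by (rule pd_commute[OF hgj fin(1) bV1 k iI])
        ultimately show "pd i (\<lambda>y. pd k (\<lambda>y. g y j) y * \<eta>' y k) b = pd k (pd i (\<lambda>y. g y j)) b * c k"
          using k by (simp add: c_def)
      qed
      finally show ?thesis .
    qed
    ultimately show ?thesis by (simp add: dd_def)
  qed
  moreover have "c \<in> cspace I" by (simp add: c_def cspace_def)
  ultimately show ?thesis by blast
qed

text \<open>\<open>J0\<close> is a row basis of the Jacobian of \<open>f\<close> at
  \<open>a\<close>, and its components become coordinates. In a remaining direction these components
  have derivative zero, and then all components do, because the rows in \<open>J0\<close> have the
  same common kernel as all rows.\<close>

lemma normal_germ_exists:
  assumes stab: "stable_multigerm I J A f" and fin: "finite I" "finite J" and a: "a \<in> A"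
    and O': "copen I O'" "a \<in> O'"
  shows "\<exists>U' V \<Theta> \<sigma> J0. a \<in> U' \<and> U' \<subseteq> O' \<and> biholo I I U' V \<Theta> \<and>
    normal_germ I J \<sigma> J0 V (\<lambda>y. f (inv_into U' \<Theta> y)) (\<Theta> a)"
proof -
  obtain U where U: "A \<subseteq> U" "holo_map I J U f"
    using stab by (auto simp: stable_multigerm_def multigerm_def)
  define O1 where "O1 = O' \<inter> U"
  have O1: "copen I O1" "a \<in> O1" unfolding O1_def using O' U a holo_mapD(1)[OF U(2)] by (auto intro: copen_Int)
  have fO1: "holo_map I J O1 f" by (rule holo_map_subset[OF U(2) O1(1)]) (auto simp: O1_def)
  obtain J0 where rb: "row_basis I J (\<lambda>j i. pd i (\<lambda>z. f z j) a) J0" using row_basis_exists[OF fin(2)] by blast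
  note R = row_basisD[OF rb]
  have finJ0: "finite J0" using R(1) fin(2) finite_subset by blast
  define Q where "Q U' V \<Theta> \<sigma> \<longleftrightarrow> a \<in> U' \<and> U' \<subseteq> O1 \<and> biholo I I U' V \<Theta> \<and> inj_on \<sigma> J0 \<and> \<sigma> ` J0 \<subseteq> I \<and>
    (\<forall>l\<in>J0. \<forall>z\<in>U'. \<Theta> z (\<sigma> l) = f z l)" for U' V \<Theta> \<sigma>
  have "\<exists>U' V \<Theta> \<sigma>. Q U' V \<Theta> \<sigma>"
    unfolding Q_def by (rule coordinates_exist[OF finJ0 fin(1) O1(2,1) holo_map_component[OF fO1] R(3)])
  then obtain U' V \<Theta> \<sigma> where H: "Q U' V \<Theta> \<sigma>" by blast
  have aU': "a \<in> U'" and U'O: "U' \<subseteq> O1" and bi: "biholo I I U' V \<Theta>" and \<sigma>: "inj_on \<sigma> J0" "\<sigma> ` J0 \<subseteq> I"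
    using H by (simp_all add: Q_def)
  have \<Theta>\<sigma>: "\<Theta> z (\<sigma> l) = f z l" if "l \<in> J0" "z \<in> U'" for l z using H that by (simp add: Q_def)
  note B = biholoD[OF bi]
  define g where "g = (\<lambda>y. f (inv_into U' \<Theta> y))"
  define b where "b = \<Theta> a"
  have bV: "b \<in> V" using aU' B(3) by (auto simp: b_def)
  have ab: "inv_into U' \<Theta> b = a" using B(5)[OF aU'] by (simp add: b_def)
  have imO: "inv_into U' \<Theta> ` V \<subseteq> O1" using B(7) U'O by blast
  have hg: "holo_map I J V g"
    unfolding g_def by (rule holo_map_compose[OF fO1 B(2) imO fin(1,1)])
  have g0: "g y j = y (\<sigma> j)" if "y \<in> V" "j \<in> J0" for y j
    using \<Theta>\<sigma>[OF that(2) B(7)[OF that(1)]] B(6)[OF that(1)] by (simp add: g_def)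
  have g1: "pd i (\<lambda>y. g y j) b = 0" if i: "i \<in> I - \<sigma> ` J0" and j: "j \<in> J" for i j
  proof -
    \<comment> \<open>The unit vector \<open>i\<close> carried back to the original coordinates by
      the differential of the inverse of \<Theta>.\<close>
    define w where "w k = dd I (\<lambda>y. inv_into U' \<Theta> y k) b (unitv i)" for k
    have pdw: "pd i (\<lambda>y. g y j) b = (\<Sum>k\<in>I. pd k (\<lambda>z. f z j) a * w k)" for j
    proof -
      have "pd i (\<lambda>y. g y j) b = dd I (\<lambda>y. g y j) b (unitv i)" using dd_unitv[OF fin(1)] i by simp
      also have "\<dots> = dd I (\<lambda>z. f z j) (inv_into U' \<Theta> b) w"
        unfolding g_def w_def by (rule dd_compose[OF holo_map_component[OF fO1] B(2) imO fin(1,1) bV])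
      finally show ?thesis by (simp add: dd_def ab)
    qed
    have "(\<Sum>k\<in>I. pd k (\<lambda>z. f z j) a * w k) = 0" if "j \<in> J0" for j
    proof -
      have "pd i (\<lambda>y. g y j) b = pd i (\<lambda>y. y (\<sigma> j)) b"
        by (rule pd_cong[OF holo_mapD(1)[OF hg] bV _ fin(1)]) (use i g0 that in auto)
      then show ?thesis using pdw[of j] i that by (auto simp: pd_proj)
    qed
    then show ?thesis using R(2)[OF _ j] pdw[of j] by simp
  qed
  have g2: "\<exists>c\<in>cspace I. \<forall>m\<in>(J - J0) \<times> (I - \<sigma> ` J0).
        dd I (pd (snd m) (\<lambda>y. g y (fst m))) b c = (if m = l then 1 else 0)"
    if l: "l \<in> (J - J0) \<times> (I - \<sigma> ` J0)" for l
  proof -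
    obtain j0 i0 where ji: "l = (j0, i0)" "j0 \<in> J - J0" "i0 \<in> I - \<sigma> ` J0" using l by auto
    obtain c where c: "c \<in> cspace I" "\<forall>j\<in>J - J0. \<forall>i\<in>I - \<sigma> ` J0.
      dd I (pd i (\<lambda>y. g y j)) b c = (if j = j0 \<and> i = i0 then 1 else 0)"
      using stable_normal_hessian[OF stab fin a bi aU' b_def g_def hg R(1) \<sigma>(2) g0 g1 ji(2,3)] by blast
    show ?thesis
    proof (intro bexI[OF _ c(1)] ballI)
      fix m assume m: "m \<in> (J - J0) \<times> (I - \<sigma> ` J0)"
      then have "fst m \<in> J - J0" "snd m \<in> I - \<sigma> ` J0" by auto
      with c(2) have "dd I (pd (snd m) (\<lambda>y. g y (fst m))) b c = (if fst m = j0 \<and> snd m = i0 then 1 else 0)" by blast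
      then show "dd I (pd (snd m) (\<lambda>y. g y (fst m))) b c = (if m = l then 1 else 0)"
        by (simp add: ji(1) prod_eq_iff)
    qed
  qed
  have "normal_germ I J \<sigma> J0 V g b"
    unfolding normal_germ_def using hg bV R(1) \<sigma> g0 g1 g2 by simp
  moreover have "U' \<subseteq> O'" using U'O by (auto simp: O1_def)
  ultimately show ?thesis using aU' bi unfolding g_def b_def by blast
qed

section \<open>Divided differences of a normal germ as coordinates of the product\<close>

definition divdiff ::
  "'i set \<Rightarrow> 'j set \<Rightarrow> ('i + 'i \<Rightarrow> complex) set \<Rightarrow> (('i \<Rightarrow> complex) \<Rightarrow> 'j \<Rightarrow> complex)
    \<Rightarrow> ('j \<Rightarrow> 'i \<Rightarrow> ('i + 'i \<Rightarrow> complex) \<Rightarrow> complex) \<Rightarrow> bool" where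
  "divdiff I J B g M \<longleftrightarrow> (\<forall>j\<in>J. \<forall>i\<in>I. holo_fun (I <+> I) B (M j i)) \<and>
     (\<forall>j\<in>J. \<forall>p\<in>B. g (p \<circ> Inl) j - g (p \<circ> Inr) j = (\<Sum>i\<in>I. M j i p * (p (Inl i) - p (Inr i))) \<and>
        (\<forall>i\<in>I. p \<circ> Inl = p \<circ> Inr \<longrightarrow> M j i p = pd i (\<lambda>z. g z j) (p \<circ> Inl)))"

lemma divdiffD:
  assumes "divdiff I J B g M" "j \<in> J"
  shows "\<And>i. i \<in> I \<Longrightarrow> holo_fun (I <+> I) B (M j i)"
    "\<And>p. p \<in> B \<Longrightarrow> g (p \<circ> Inl) j - g (p \<circ> Inr) j = (\<Sum>i\<in>I. M j i p * (p (Inl i) - p (Inr i)))"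
    "\<And>p i. p \<in> B \<Longrightarrow> i \<in> I \<Longrightarrow> p \<circ> Inl = p \<circ> Inr \<Longrightarrow> M j i p = pd i (\<lambda>z. g z j) (p \<circ> Inl)"
  using assms unfolding divdiff_def by simp_all

lemma divdiff_exists:
  assumes "holo_map I J U g" "finite I" "polydisc I a r \<subseteq> U"
  shows "\<exists>M. divdiff I J (cprod (polydisc I a r) (polydisc I a r)) g M"
proof -
  have "\<forall>j. \<exists>M. (\<forall>i\<in>I. holo_fun (I <+> I) (cprod (polydisc I a r) (polydisc I a r)) (M i)) \<and>
    (\<forall>p\<in>cprod (polydisc I a r) (polydisc I a r).
       g (p \<circ> Inl) j - g (p \<circ> Inr) j = (\<Sum>i\<in>I. M i p * (p (Inl i) - p (Inr i))) \<and>
       (\<forall>i\<in>I. p \<circ> Inl = p \<circ> Inr \<longrightarrow> M i p = pd i (\<lambda>z. g z j) (p \<circ> Inl)))"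
    using divided_differences[OF holo_map_component[OF assms(1)] assms(2,3)] by blast
  then show ?thesis unfolding divdiff_def by (rule choice[THEN exE]) blast
qed

text \<open>The components in \<open>J0\<close> are coordinates, so their equality makes the
  corresponding differences zero; in the other components the sum over \<open>I\<close> then loses
  these terms.\<close>

lemma normal_fibre_iff:
  assumes ng: "normal_germ I J \<sigma> J0 V g b" and fin: "finite I" 
    and M: "divdiff I J B g M" and p: "p \<in> B" "p \<circ> Inl \<in> V" "p \<circ> Inr \<in> V"
  shows "(\<forall>j\<in>J. g (p \<circ> Inl) j = g (p \<circ> Inr) j) \<longleftrightarrow>
    (\<forall>i\<in>\<sigma> ` J0. p (Inl i) - p (Inr i) = 0) \<and>
    (\<forall>j\<in>J - J0. (\<Sum>i\<in>I - \<sigma> ` J0. M j i p * (p (Inl i) - p (Inr i))) = 0)"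
    (is "?L \<longleftrightarrow> ?R1 \<and> ?R2")
proof -
  note N = normal_germD[OF ng]
  have 1: "(\<forall>j\<in>J0. g (p \<circ> Inl) j = g (p \<circ> Inr) j) \<longleftrightarrow> ?R1"
    using N(6)[OF p(2)] N(6)[OF p(3)] by auto
  have 2: "(\<forall>j\<in>J - J0. g (p \<circ> Inl) j = g (p \<circ> Inr) j) \<longleftrightarrow> ?R2" if r: ?R1
  proof (intro ball_cong refl)
    fix j assume j: "j \<in> J - J0"
    have "(\<Sum>i\<in>I. M j i p * (p (Inl i) - p (Inr i))) = (\<Sum>i\<in>I - \<sigma> ` J0. M j i p * (p (Inl i) - p (Inr i)))"
      by (rule sum.mono_neutral_right) (use fin r in auto)
    then show "(g (p \<circ> Inl) j = g (p \<circ> Inr) j) = ((\<Sum>i\<in>I - \<sigma> ` J0. M j i p * (p (Inl i) - p (Inr i))) = 0)"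
      using divdiffD(2)[OF M _ p(1), of j] j by auto
  qed
  have "?L \<longleftrightarrow> (\<forall>j\<in>J0. g (p \<circ> Inl) j = g (p \<circ> Inr) j) \<and> (\<forall>j\<in>J - J0. g (p \<circ> Inl) j = g (p \<circ> Inr) j)"
    using N(3) by blast
  then show ?thesis using 1 2 by blast
qed

lemma dd_lincomb:
  "dd I g z (\<lambda>q. e q - (\<Sum>m\<in>S. D m * C m q)) = dd I g z e - (\<Sum>m\<in>S. D m * dd I g z (C m))"
proof -
  have "(\<Sum>i\<in>I. \<Sum>m\<in>S. pd i g z * (D m * C m i)) = (\<Sum>m\<in>S. \<Sum>i\<in>I. pd i g z * (D m * C m i))"
    by (rule sum.swap)
  then show ?thesis
    by (simp add: dd_def right_diff_distrib sum_subtractf sum_distrib_left mult.left_commute)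
qed

text \<open>Dual vectors are exhibited at the diagonal point. A diagonal vector (c, c) is invisible
  to all differences w; since M consists of partial derivatives on the diagonal, the vector acts on
  M through the Hessian, and the vectors from \<open>normal_germ\<close> serve the entries of M. For
  w a unit vector in the first factor is corrected by such diagonal vectors until no entry of M sees
  it.\<close>

lemma normal_germ_product:
  assumes ng: "normal_germ I J \<sigma> J0 V g b" and fin: "finite I" "finite J"
    and r: "r > 0" "polydisc I b r \<subseteq> V" and M: "divdiff I J (cprod (polydisc I b r) (polydisc I b r)) g M"
  shows "\<exists>U' V' \<Theta> \<tau>. case_sum b b \<in> U' \<and> U' \<subseteq> cprod (polydisc I b r) (polydisc I b r) \<and>
    biholo (I <+> I) (I <+> I) U' V' \<Theta> \<and> inj_on \<tau> (I <+> (J - J0) \<times> (I - \<sigma> ` J0)) \<and>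
    \<tau> ` (I <+> (J - J0) \<times> (I - \<sigma> ` J0)) \<subseteq> I <+> I \<and>
    (\<forall>p\<in>U'. (\<forall>i\<in>I. \<Theta> p (\<tau> (Inl i)) = p (Inl i) - p (Inr i)) \<and>
       (\<forall>j\<in>J - J0. \<forall>i\<in>I - \<sigma> ` J0. \<Theta> p (\<tau> (Inr (j, i))) = M j i p))"
proof -
  note N = normal_germD[OF ng]
  define I1 J1 where "I1 = I - \<sigma> ` J0" and "J1 = J - J0"
  define P B where "P = polydisc I b r" and "B = cprod P P"
  define d where "d = case_sum b b"
  have Po: "copen I P" unfolding P_def by (rule copen_polydisc[OF fin(1)])
  have Bo: "copen (I <+> I) B" unfolding B_def by (intro copen_cprod Po)
  have bP: "b \<in> P" using N(2) holo_mapD(2)[OF N(1)] r(1) by (auto simp: P_def intro: mem_polydisc)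
  have dB: "d \<in> B" using bP by (simp add: d_def B_def)
  have finI: "finite (I <+> I)" using fin by simp
  define L where "L = I <+> J1 \<times> I1"
  have finL: "finite L" using fin by (simp add: L_def I1_def J1_def)
  have finJI: "finite (J1 \<times> I1)" using fin by (simp add: I1_def J1_def)
  define F where "F l = (case l of Inl i \<Rightarrow> (\<lambda>p. p (Inl i) - p (Inr i)) | Inr m \<Rightarrow> M (fst m) (snd m))" for l
  have MB: "divdiff I J B g M" using M by (simp add: B_def P_def)
  have hF: "holo_fun (I <+> I) B (F l)" if "l \<in> L" for l
  proof (cases l)
    case (Inl i)
    then show ?thesis by (simp add: F_def holo_fun_intros Bo)
  next
    case (Inr m)
    then have "fst m \<in> J" "snd m \<in> I" using that by (auto simp: L_def I1_def J1_def)
    then show ?thesis using divdiffD(1)[OF MB] Inr by (simp add: F_def)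
  qed
  have ddw: "dd (I <+> I) (F (Inl i)) d v = v (Inl i) - v (Inr i)" if "i \<in> I" for i v
  proof -
    have "pd q (\<lambda>p. p (Inl i) - p (Inr i)) d = (if q = Inl i then 1 else 0) - (if q = Inr i then 1 else 0)"
      if "q \<in> I <+> I" for q
      using pd_diff[OF holo_fun_proj[OF Bo] holo_fun_proj[OF Bo] finI dB that, of "Inl i" "Inr i"] by (simp add: pd_proj)
    then have "dd (I <+> I) (F (Inl i)) d v = (\<Sum>q\<in>I <+> I. (if q = Inl i then v q else 0) - (if q = Inr i then v q else 0))"
      unfolding dd_def F_def by (intro sum.cong) (auto simp: left_diff_distrib)
    also have "\<dots> = v (Inl i) - v (Inr i)" using that finI by (simp add: sum_subtractf InlI InrI)
    finally show ?thesis .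
  qed
  have ddM: "dd (I <+> I) (F (Inr m)) d (case_sum c c) = dd I (pd (snd m) (\<lambda>y. g y (fst m))) b c"
    if m: "m \<in> J1 \<times> I1" and c: "c \<in> cspace I" for m c
  proof -
    have mm: "fst m \<in> J" "snd m \<in> I" using m by (auto simp: I1_def J1_def)
    have diag: "holo_map I (I <+> I) P (\<lambda>z. case_sum z z)" by (intro holo_map_case_sum holo_map_id Po)
    have "dd I (pd (snd m) (\<lambda>y. g y (fst m))) b c = dd I (\<lambda>z. F (Inr m) (case_sum z z)) b c"
      by (rule dd_cong[OF Po bP fin(1)]) (use divdiffD(3)[OF MB mm(1) _ mm(2)] in \<open>simp add: F_def B_def\<close>)
    also have "\<dots> = dd (I <+> I) (F (Inr m)) (case_sum b b) (\<lambda>q. dd I (\<lambda>z. case_sum z z q) b c)"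
      by (rule dd_compose[OF hF diag _ fin(1) finI bP]) (use m in \<open>auto simp: L_def B_def\<close>)
    also have "\<dots> = dd (I <+> I) (F (Inr m)) d (case_sum c c)"
      unfolding d_def by (rule dd_cong_vec) (auto simp: dd_proj_cspace[OF fin(1) c])
    finally show ?thesis by simp
  qed
  obtain c where c: "\<And>l. l \<in> J1 \<times> I1 \<Longrightarrow> c l \<in> cspace I"
    "\<And>l m. l \<in> J1 \<times> I1 \<Longrightarrow> m \<in> J1 \<times> I1 \<Longrightarrow>
        dd I (pd (snd m) (\<lambda>y. g y (fst m))) b (c l) = (if m = l then 1 else 0)"
  proof -
    have "\<forall>l\<in>J1 \<times> I1. \<exists>c. c \<in> cspace I \<and> (\<forall>m\<in>J1 \<times> I1.
        dd I (pd (snd m) (\<lambda>y. g y (fst m))) b c = (if m = l then 1 else 0))"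
      using N(8) unfolding I1_def J1_def by blast
    then have "\<exists>c. \<forall>l\<in>J1 \<times> I1. c l \<in> cspace I \<and> (\<forall>m\<in>J1 \<times> I1.
        dd I (pd (snd m) (\<lambda>y. g y (fst m))) b (c l) = (if m = l then 1 else 0))"
      by (rule bchoice)
    then obtain c where c: "\<forall>l\<in>J1 \<times> I1. c l \<in> cspace I \<and> (\<forall>m\<in>J1 \<times> I1.
        dd I (pd (snd m) (\<lambda>y. g y (fst m))) b (c l) = (if m = l then 1 else 0))"
      by blast
    show thesis
    proof (rule that[of c])
      show "c l \<in> cspace I" if "l \<in> J1 \<times> I1" for l using c that by blast
      show "dd I (pd (snd m) (\<lambda>y. g y (fst m))) b (c l) = (if m = l then 1 else 0)"
        if "l \<in> J1 \<times> I1" "m \<in> J1 \<times> I1" for l m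
        using bspec[OF c that(1)] that(2) by blast
    qed
  qed
  have dual: "\<exists>v. (\<Sum>q\<in>I <+> I. pd q (F l) d * v q) \<noteq> 0 \<and>
      (\<forall>m\<in>L. m \<noteq> l \<longrightarrow> (\<Sum>q\<in>I <+> I. pd q (F m) d * v q) = 0)" if l: "l \<in> L" for l
    unfolding dd_def[symmetric]
  proof (cases l)
    case (Inr l')
    have l': "l' \<in> J1 \<times> I1" using l Inr by (auto simp: L_def)
    show "\<exists>v. dd (I <+> I) (F l) d v \<noteq> 0 \<and> (\<forall>m\<in>L. m \<noteq> l \<longrightarrow> dd (I <+> I) (F m) d v = 0)"
    proof (intro exI[of _ "case_sum (c l') (c l')"] conjI ballI impI)
      show "dd (I <+> I) (F l) d (case_sum (c l') (c l')) \<noteq> 0"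
        using ddM[OF l' c(1)[OF l']] c(2)[OF l' l'] Inr by simp
      fix m assume "m \<in> L" "m \<noteq> l"
      then show "dd (I <+> I) (F m) d (case_sum (c l') (c l')) = 0"
        using ddM[OF _ c(1)[OF l']] c(2)[OF l'] ddw Inr by (cases m) (auto simp: L_def)
    qed
  next
    case (Inl i0)
    have i0: "i0 \<in> I" using l Inl by (auto simp: L_def)
    \<comment> \<open>Moving only the first factor changes w in direction \<open>i0\<close> alone;
      the diagonal vectors subtracted in \<open>v\<close> do not disturb this.\<close>
    define e where "e = case_sum (unitv i0) (0 :: 'a \<Rightarrow> complex)"
    define D where "D m = dd (I <+> I) (F (Inr m)) d e" for m
    define v where "v q = e q - (\<Sum>m\<in>J1 \<times> I1. D m * case_sum (c m) (c m) q)" for q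
    have v1: "dd (I <+> I) (F (Inl i)) d v = (if i = i0 then 1 else 0)" if "i \<in> I" for i
      using that by (simp add: ddw v_def e_def unitv_def)
    have v2: "dd (I <+> I) (F (Inr m)) d v = 0" if m: "m \<in> J1 \<times> I1" for m
    proof -
      have "dd (I <+> I) (F (Inr m)) d v = D m - (\<Sum>m'\<in>J1 \<times> I1. D m' * dd (I <+> I) (F (Inr m)) d (case_sum (c m') (c m')))"
        unfolding v_def dd_lincomb D_def ..
      also have "(\<Sum>m'\<in>J1 \<times> I1. D m' * dd (I <+> I) (F (Inr m)) d (case_sum (c m') (c m'))) = (\<Sum>m'\<in>J1 \<times> I1. if m' = m then D m' else 0)"
      proof (rule sum.cong[OF refl])
        fix m' assume m': "m' \<in> J1 \<times> I1"
        show "D m' * dd (I <+> I) (F (Inr m)) d (case_sum (c m') (c m')) = (if m' = m then D m' else 0)"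
          using ddM[OF m c(1)[OF m']] c(2)[OF m' m] by simp
      qed
      also have "\<dots> = D m" using m finJI by simp
      finally show ?thesis by simp
    qed
    show "\<exists>v. dd (I <+> I) (F l) d v \<noteq> 0 \<and> (\<forall>m\<in>L. m \<noteq> l \<longrightarrow> dd (I <+> I) (F m) d v = 0)"
    proof (intro exI[of _ v] conjI ballI impI)
      show "dd (I <+> I) (F l) d v \<noteq> 0" using v1[OF i0] Inl by simp
      fix m assume "m \<in> L" "m \<noteq> l"
      then show "dd (I <+> I) (F m) d v = 0" using v1 v2 Inl by (cases m) (auto simp: L_def)
    qed
  qed
  define Q where "Q U' V' \<Theta> \<tau> \<longleftrightarrow> d \<in> U' \<and> U' \<subseteq> B \<and> biholo (I <+> I) (I <+> I) U' V' \<Theta> \<and> inj_on \<tau> L \<and>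
    \<tau> ` L \<subseteq> I <+> I \<and> (\<forall>l\<in>L. \<forall>p\<in>U'. \<Theta> p (\<tau> l) = F l p)" for U' V' \<Theta> \<tau>
  have "\<exists>U' V' \<Theta> \<tau>. Q U' V' \<Theta> \<tau>"
    unfolding Q_def by (rule coordinates_exist[OF finL finI dB Bo hF dual])
  then obtain U' V' \<Theta> \<tau> where H: "Q U' V' \<Theta> \<tau>" by blast
  have HL: "\<Theta> p (\<tau> l) = F l p" if "l \<in> L" "p \<in> U'" for l p
    using H that unfolding Q_def by blast
  have "case_sum b b \<in> U' \<and> U' \<subseteq> cprod (polydisc I b r) (polydisc I b r) \<and>
    biholo (I <+> I) (I <+> I) U' V' \<Theta> \<and> inj_on \<tau> (I <+> (J - J0) \<times> (I - \<sigma> ` J0)) \<and>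
    \<tau> ` (I <+> (J - J0) \<times> (I - \<sigma> ` J0)) \<subseteq> I <+> I"
    using H by (simp only: Q_def d_def B_def P_def L_def I1_def J1_def)
  moreover have "\<Theta> p (\<tau> (Inl i)) = p (Inl i) - p (Inr i)" if "p \<in> U'" "i \<in> I" for p i
    using HL[of "Inl i" p] that by (simp add: F_def L_def InlI)
  moreover have "\<Theta> p (\<tau> (Inr (j, i))) = M j i p" if "p \<in> U'" "j \<in> J - J0" "i \<in> I - \<sigma> ` J0" for p i j
    using HL[of "Inr (j, i)" p] that by (simp add: F_def L_def I1_def J1_def InrI)
  ultimately show ?thesis by (intro exI[of _ U'] exI[of _ V'] exI[of _ \<Theta>] exI[of _ \<tau>]) simp
qed

section \<open>Closedness of analytic sets and kernels of normal germs\<close>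

lemma holo_fun_vimage:
  assumes "holo_fun I U g" "open T"
  shows "copen I {z \<in> U. g z \<in> T}"
proof -
  have "openin (top_of_set U) (U \<inter> g -` T)"
    by (rule continuous_openin_preimage_gen[OF holo_funD(2)[OF assms(1)] assms(2)])
  moreover have "{z \<in> U. g z \<in> T} = U \<inter> g -` T" by auto
  ultimately show ?thesis using holo_funD(1)[OF assms(1)] unfolding copen_def by (metis openin_trans)
qed

text \<open>At a point outside the set some local equation is nonzero, and by continuity it stays
  nonzero nearby.\<close>

lemma analytic_subset_closedin:
  assumes "analytic_subset M Z"
  shows "closedin (mtop M) Z"
proof -
  have sub: "Z \<subseteq> points M" using assms by (simp add: analytic_subset_def)
  have "\<exists>T. openin (mtop M) T \<and> x \<in> T \<and> T \<subseteq> points M - Z" if x: "x \<in> points M - Z" for x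
  proof -
    define Q where "Q U \<phi> G \<longleftrightarrow> holo_chart M (U, \<phi>) \<and> x \<in> U \<and> finite G \<and>
      (\<forall>g\<in>G. holo_fun (coords M) (\<phi> ` U) g) \<and> Z \<inter> U = {u \<in> U. \<forall>g\<in>G. g (\<phi> u) = 0}" for U \<phi> G
    have "\<exists>U \<phi> G. Q U \<phi> G" using assms x unfolding analytic_subset_def Q_def by simp
    then obtain U \<phi> G where H: "Q U \<phi> G" by blast
    have c: "holo_chart M (U, \<phi>)" and G: "x \<in> U" "finite G"
        "\<And>g. g \<in> G \<Longrightarrow> holo_fun (coords M) (\<phi> ` U) g" "Z \<inter> U = {u \<in> U. \<forall>g\<in>G. g (\<phi> u) = 0}"
      using H unfolding Q_def by blast+
    note T = top_chartD[OF holo_chartD(1)[OF c]]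
    obtain g where g: "g \<in> G" "g (\<phi> x) \<noteq> 0" using G(1,4) x by blast
    define T where "T = {u \<in> U. \<phi> u \<in> {z \<in> \<phi> ` U. g z \<in> - {0}}}"
    have "openin (mtop M) T"
      unfolding T_def by (rule top_chart_vimage[OF holo_chartD(1)[OF c]], rule holo_fun_vimage[OF G(3)[OF g(1)]]) auto
    moreover have "x \<in> T" using g(2) G(1) by (simp add: T_def)
    moreover have "T \<subseteq> points M - Z" using G(4) g(1) T(4) by (auto simp: T_def)
    ultimately show ?thesis by blast
  qed
  then have "openin (mtop M) (points M - Z)" by (subst openin_subopen) blast
  then show ?thesis using sub by (simp add: closedin_def)
qed

lemma normal_germ_cong:
  assumes ng: "normal_germ I J \<sigma> J0 V g b" and fin: "finite I" and eq: "\<And>y. y \<in> V \<Longrightarrow> g y = g' y"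
  shows "normal_germ I J \<sigma> J0 V g' b"
proof -
  note N = normal_germD[OF ng]
  have Vo: "copen I V" by (rule holo_mapD(1)[OF N(1)])
  have pd: "pd i (\<lambda>y. g' y j) y = pd i (\<lambda>y. g y j) y" if "i \<in> I" "y \<in> V" for i j y
    by (rule pd_cong[OF Vo that(2,1) fin]) (simp add: eq)
  have dd: "dd I (pd i (\<lambda>y. g' y j)) b c = dd I (pd i (\<lambda>y. g y j)) b c" if "i \<in> I" for i j c
    by (rule dd_cong[OF Vo N(2) fin]) (rule pd[OF that])
  have h: "holo_map I J V g'" by (rule holo_map_cong[OF N(1) eq])
  have 8: "\<exists>c\<in>cspace I. \<forall>m\<in>(J - J0) \<times> (I - \<sigma> ` J0).
        dd I (pd (snd m) (\<lambda>y. g' y (fst m))) b c = (if m = l then 1 else 0)"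
    if l: "l \<in> (J - J0) \<times> (I - \<sigma> ` J0)" for l
  proof -
    obtain c where c: "c \<in> cspace I" "\<forall>m\<in>(J - J0) \<times> (I - \<sigma> ` J0).
        dd I (pd (snd m) (\<lambda>y. g y (fst m))) b c = (if m = l then 1 else 0)" using N(8)[OF l] by blast
    show ?thesis
    proof (intro bexI[OF _ c(1)] ballI)
      fix m assume m: "m \<in> (J - J0) \<times> (I - \<sigma> ` J0)"
      then have "snd m \<in> I" by auto
      then show "dd I (pd (snd m) (\<lambda>y. g' y (fst m))) b c = (if m = l then 1 else 0)"
        using bspec[OF c(2) m] dd by simp
    qed
  qed
  have 6: "\<forall>y\<in>V. \<forall>j\<in>J0. g' y j = y (\<sigma> j)" using N(6) eq by metis
  have 7: "\<forall>i\<in>I - \<sigma> ` J0. \<forall>j\<in>J. pd i (\<lambda>y. g' y j) b = 0" using N(7) pd N(2) by simp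
  show ?thesis unfolding normal_germ_def using h N(2-5) 6 7 8 by simp
qed

text \<open>Quantifying over arbitrary functions \<open>w\<close> matches the form of
  \<open>noninjective_iff_minors\<close>; a function is turned into a kernel vector by cutting it
  off outside \<open>I\<close>.\<close>

lemma kernel_nontrivial_iff:
  assumes "finite I"
  shows "1 \<le> cvec.dim (cdiff_kernel I J F z) \<longleftrightarrow>
    (\<exists>w. (\<exists>i\<in>I. w i \<noteq> 0) \<and> (\<forall>j\<in>J. (\<Sum>i\<in>I. pd i (\<lambda>z. F z j) z * w i) = 0))"
proof
  let ?K = "cdiff_kernel I J F z"
  have K: "v \<in> ?K \<longleftrightarrow> v \<in> cspace I \<and> (\<forall>j\<in>J. (\<Sum>i\<in>I. pd i (\<lambda>z. F z j) z * v i) = 0)" for v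
    by (simp add: cdiff_kernel_def cdiff_pd)
  {
    assume d: "1 \<le> cvec.dim ?K"
    have "\<not> ?K \<subseteq> cvec.span {}"
    proof
      assume "?K \<subseteq> cvec.span {}"
      then have "cvec.dim ?K \<le> card ({} :: ('a \<Rightarrow> complex) set)" by (rule cvec.dim_le_card) simp
      then show False using d by simp
    qed
    then obtain v where v: "v \<in> ?K" "v \<noteq> 0" by auto
    then have "\<exists>i\<in>I. v i \<noteq> 0" using K by (auto simp: cspace_def fun_eq_iff)
    then show "\<exists>w. (\<exists>i\<in>I. w i \<noteq> 0) \<and> (\<forall>j\<in>J. (\<Sum>i\<in>I. pd i (\<lambda>z. F z j) z * w i) = 0)"
      using v(1) K by blast
  }
  {
    assume "\<exists>w. (\<exists>i\<in>I. w i \<noteq> 0) \<and> (\<forall>j\<in>J. (\<Sum>i\<in>I. pd i (\<lambda>z. F z j) z * w i) = 0)"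
    then obtain w i0 where w: "i0 \<in> I" "w i0 \<noteq> 0" "\<And>j. j \<in> J \<Longrightarrow> (\<Sum>i\<in>I. pd i (\<lambda>z. F z j) z * w i) = 0" by blast
    define v where "v i = (if i \<in> I then w i else 0)" for i
    have v: "v \<in> ?K" unfolding K using w(3) by (simp add: v_def cspace_def)
    have v0: "v i0 \<noteq> 0" using w by (simp add: v_def)
    obtain B where B: "B \<subseteq> ?K" "cvec.independent B" "?K \<subseteq> cvec.span B" "card B = cvec.dim ?K"
      by (rule cvec.basis_exists[of ?K]) blast
    \<comment> \<open>The basis must be finite for its cardinality to be positive.\<close>
    have "B \<subseteq> cvec.span (unitv ` I)" using B(1) K cspace_span[OF assms] by blast
    then have finB: "finite B" using cvec.independent_span_bound[OF _ B(2)] assms by blast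
    have "B \<noteq> {}"
    proof
      assume "B = {}"
      then have "v = 0" using B(3) v by auto
      then show False using v0 by simp
    qed
    then show "1 \<le> cvec.dim ?K" using finB B(4) by (metis One_nat_def Suc_leI card_gt_0_iff)
  }
qed

lemma normal_germ_kernel:
  assumes ng: "normal_germ I J \<sigma> J0 V g b" and fin: "finite I"
  shows "cdiff_kernel I J g b = cspace (I - \<sigma> ` J0)"
proof -
  note N = normal_germD[OF ng]
  have Vo: "copen I V" by (rule holo_mapD(1)[OF N(1)])
  have d0: "dd I (\<lambda>y. g y j) b v = v (\<sigma> j)" if "j \<in> J0" for j v
  proof -
    have "dd I (\<lambda>y. g y j) b v = dd I (\<lambda>y. y (\<sigma> j)) b v"
      by (rule dd_cong[OF Vo N(2) fin]) (rule N(6)[OF _ that])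
    then show ?thesis using dd_proj[OF fin] N(5) that by auto
  qed
  show ?thesis
  proof (intro equalityI subsetI)
    fix v assume "v \<in> cdiff_kernel I J g b"
    then have v: "v \<in> cspace I" "\<And>j. j \<in> J \<Longrightarrow> dd I (\<lambda>y. g y j) b v = 0"
      by (simp_all add: cdiff_kernel_def cdiff_dd)
    have "v (\<sigma> j) = 0" if "j \<in> J0" for j
      using d0[OF that, of v] v(2)[OF subsetD[OF N(3) that]] by simp
    then show "v \<in> cspace (I - \<sigma> ` J0)" using v(1) by (auto simp: cspace_def)
  next
    fix v assume v: "v \<in> cspace (I - \<sigma> ` J0)"
    then have "v \<in> cspace I" by (auto simp: cspace_def)
    moreover have "dd I (\<lambda>y. g y j) b v = 0" if "j \<in> J" for j
      unfolding dd_def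
    proof (rule sum.neutral, rule ballI)
      fix i assume "i \<in> I"
      then show "pd i (\<lambda>y. g y j) b * v i = 0"
        using N(7)[of i j] v that by (cases "i \<in> \<sigma> ` J0") (auto simp: cspace_def)
    qed
    ultimately show "v \<in> cdiff_kernel I J g b" by (simp add: cdiff_kernel_def cdiff_dd)
  qed
qed

subsection \<open>The double point space\<close>

locale stable_finite_map =
  fixes X :: "('a, 'i) cmfd" and Y :: "('b, 'j) cmfd" and f :: "'a \<Rightarrow> 'b"
  assumes X: "complex_manifold X" and Y: "complex_manifold Y"
    and dims: "cdim X \<le> cdim Y"
    and cont: "continuous_map (mtop X) (mtop Y) f"
    and stab: "stable_map X Y f"
begin

abbreviation I where "I \<equiv> coords X"
abbreviation J where "J \<equiv> coords Y"
abbreviation XX where "XX \<equiv> cmfd_prod X X"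
abbreviation S where "S \<equiv> strict_double_points X f"
abbreviation D2 where "D2 \<equiv> double_point_space X f"
abbreviation \<Sigma> where "\<Sigma> k \<equiv> corank_ge_locus k X Y f"

lemma fin: "finite I" "finite J"
  using X Y by (auto simp: complex_manifold_def)

lemma coords_XX: "coords XX = I <+> I" and points_XX: "points XX = points X \<times> points X"
  and mtop_XX: "mtop XX = prod_topology (mtop X) (mtop X)"
  by (simp_all add: cmfd_prod_def)

lemma f_points: "x \<in> points X \<Longrightarrow> f x \<in> points Y"
  using cont by (auto simp: continuous_map_def)

lemma open_vimage_f: "openin (mtop Y) V \<Longrightarrow> openin (mtop X) {u \<in> points X. f u \<in> V}"
  by (rule openin_continuous_map_preimage[OF cont])

text \<open>The corank locus is defined by the existence of suitable atlas charts. Comparing kernels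
  in both directions by \<open>kernel_dim_le\<close> shows that the dimension is the same in every
  chart of the maximal atlas.\<close>

lemma corank_iff:
  assumes c: "holo_chart X (U, \<phi>)" and d: "holo_chart Y (V, \<psi>)" and u: "u \<in> U" "f u \<in> V"
    and F: "holo_map I J W (\<psi> \<circ> f \<circ> inv_into U \<phi>)" "\<phi> u \<in> W"
  shows "u \<in> \<Sigma> k \<longleftrightarrow> k \<le> cvec.dim (cdiff_kernel I J (\<psi> \<circ> f \<circ> inv_into U \<phi>) (\<phi> u))"
proof -
  have up: "u \<in> points X" using top_chartD(4)[OF holo_chartD(1)[OF c]] u(1) by blast
  have eq: "cvec.dim (cdiff_kernel I J (\<psi>' \<circ> f \<circ> inv_into U' \<phi>') (\<phi>' u))
    = cvec.dim (cdiff_kernel I J (\<psi> \<circ> f \<circ> inv_into U \<phi>) (\<phi> u))"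
    if a: "(U', \<phi>') \<in> atlas X" "(V', \<psi>') \<in> atlas Y" "u \<in> U'" "f u \<in> V'" for U' \<phi>' V' \<psi>'
  proof -
    note c' = holo_chart_atlas[OF X a(1)] and d' = holo_chart_atlas[OF Y a(2)]
    note k = kernel_dim_le[OF X Y cont c c' d d' u(1) a(3) u(2) a(4) F]
    then obtain W1 where W1: "\<phi>' u \<in> W1" "holo_map I J W1 (\<psi>' \<circ> f \<circ> inv_into U' \<phi>')" by blast
    show ?thesis
      using k kernel_dim_le[OF X Y cont c' c d' d a(3) u(1) a(4) u(2) W1(2,1)] by simp
  qed
  obtain U' \<phi>' where a: "(U', \<phi>') \<in> atlas X" "u \<in> U'"
    using X up unfolding complex_manifold_def by auto
  obtain V' \<psi>' where a': "(V', \<psi>') \<in> atlas Y" "f u \<in> V'"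
    using Y f_points[OF up] unfolding complex_manifold_def by auto
  show ?thesis
  proof
    assume "u \<in> \<Sigma> k"
    then obtain U' \<phi>' V' \<psi>' where "(U', \<phi>') \<in> atlas X" "(V', \<psi>') \<in> atlas Y" "u \<in> U'" "f u \<in> V'"
      "k \<le> cvec.dim (cdiff_kernel I J (\<psi>' \<circ> f \<circ> inv_into U' \<phi>') (\<phi>' u))"
      by (auto simp: corank_ge_locus_def)
    then show "k \<le> cvec.dim (cdiff_kernel I J (\<psi> \<circ> f \<circ> inv_into U \<phi>) (\<phi> u))" using eq by metis
  next
    assume k: "k \<le> cvec.dim (cdiff_kernel I J (\<psi> \<circ> f \<circ> inv_into U \<phi>) (\<phi> u))"
    have "\<exists>(V, \<psi>)\<in>atlas Y. u \<in> U' \<and> f u \<in> V \<and> k \<le> cvec.dim (cdiff_kernel I J (\<psi> \<circ> f \<circ> inv_into U' \<phi>') (\<phi>' u))"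
      by (rule bexI[OF _ a'(1)]) (use a(2) a'(2) eq[OF a(1) a'(1) a(2) a'(2)] k in simp)
    then have "\<exists>(U, \<phi>)\<in>atlas X. \<exists>(V, \<psi>)\<in>atlas Y. u \<in> U \<and> f u \<in> V \<and>
        k \<le> cvec.dim (cdiff_kernel I J (\<psi> \<circ> f \<circ> inv_into U \<phi>) (\<phi> u))"
      by (intro bexI[OF _ a(1)]) simp
    then show "u \<in> \<Sigma> k" unfolding corank_ge_locus_def using up by simp
  qed
qed

lemma stable_chart:
  assumes "x \<in> points X"
  shows "\<exists>U \<phi> V \<psi>. holo_chart X (U, \<phi>) \<and> fibre X f (f x) \<subseteq> U \<and> holo_chart Y (V, \<psi>) \<and> f x \<in> V \<and>
    stable_multigerm I J (\<phi> ` fibre X f (f x)) (\<psi> \<circ> f \<circ> inv_into U \<phi>)"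
  using stab assms unfolding stable_map_def by blast

text \<open>A chart pair around \<open>x\<close> in which \<open>f\<close> has the form \<open>normal_germ\<close>: the coordinates \<open>\<sigma> ` J0\<close> are
  components of \<open>f\<close> and the remaining ones span the kernel of the differential at \<open>x\<close>.\<close>

definition normal_chart where
  "normal_chart x U \<phi> V \<psi> \<sigma> J0 \<longleftrightarrow> holo_chart X (U, \<phi>) \<and> x \<in> U \<and> holo_chart Y (V, \<psi>) \<and> f ` U \<subseteq> V \<and>
     normal_germ I J \<sigma> J0 (\<phi> ` U) (\<psi> \<circ> f \<circ> inv_into U \<phi>) (\<phi> x)"

text \<open>The multigerm lives in a chart around the whole fibre. This chart is cut down to a
  neighbourhood of \<open>x\<close> that \<open>f\<close> maps into the target chart, and the
  coordinate change of \<open>normal_germ_exists\<close> is absorbed into it.\<close>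

lemma normal_chart_exists:
  assumes x: "x \<in> points X"
  shows "\<exists>U \<phi> V \<psi> \<sigma> J0. normal_chart x U \<phi> V \<psi> \<sigma> J0"
proof -
  obtain U \<phi> V \<psi> where c: "holo_chart X (U, \<phi>)" "fibre X f (f x) \<subseteq> U" and d: "holo_chart Y (V, \<psi>)" "f x \<in> V"
    and st: "stable_multigerm I J (\<phi> ` fibre X f (f x)) (\<psi> \<circ> f \<circ> inv_into U \<phi>)"
    using stable_chart[OF x] by blast
  note T = top_chartD[OF holo_chartD(1)[OF c(1)]]
  have xf: "x \<in> fibre X f (f x)" using x by (simp add: fibre_def)
  have xU: "x \<in> U" using xf c(2) by blast
  define U0 where "U0 = U \<inter> {u \<in> points X. f u \<in> V}"
  have U0: "openin (mtop X) U0" "U0 \<subseteq> U"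
    unfolding U0_def using T(1) open_vimage_f top_chartD(1)[OF holo_chartD(1)[OF d(1)]] by blast+
  define O' where "O' = \<phi> ` U0"
  have O': "copen I O'" "\<phi> x \<in> O'"
    unfolding O'_def using top_chart_image[OF holo_chartD(1)[OF c(1)] U0] xU x d(2) by (auto simp: U0_def)
  define Q where "Q U' V' \<Theta> \<sigma> J0 \<longleftrightarrow> \<phi> x \<in> U' \<and> U' \<subseteq> O' \<and> biholo I I U' V' \<Theta> \<and>
    normal_germ I J \<sigma> J0 V' (\<lambda>y. (\<psi> \<circ> f \<circ> inv_into U \<phi>) (inv_into U' \<Theta> y)) (\<Theta> (\<phi> x))" for U' V' \<Theta> \<sigma> J0
  have "\<exists>U' V' \<Theta> \<sigma> J0. Q U' V' \<Theta> \<sigma> J0"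
    unfolding Q_def by (rule normal_germ_exists[OF st fin imageI[OF xf] O'])
  then obtain U' V' \<Theta> \<sigma> J0 where H: "Q U' V' \<Theta> \<sigma> J0" by blast
  have U': "\<phi> x \<in> U'" "U' \<subseteq> O'" and bi: "biholo I I U' V' \<Theta>"
    and ng: "normal_germ I J \<sigma> J0 V' (\<lambda>y. (\<psi> \<circ> f \<circ> inv_into U \<phi>) (inv_into U' \<Theta> y)) (\<Theta> (\<phi> x))"
    using H by (simp_all add: Q_def)
  define U1 where "U1 = {u \<in> U. \<phi> u \<in> U'}"
  have U1: "openin (mtop X) U1" "U1 \<subseteq> U"
    unfolding U1_def by (rule top_chart_vimage[OF holo_chartD(1)[OF c(1)] biholoD(8)[OF bi]]) auto
  have im: "\<phi> ` U1 = U'" using U'(2) U0(2) by (auto simp: U1_def O'_def)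
  have c1: "holo_chart X (U1, \<phi>)" by (rule holo_chart_restrict[OF c(1) U1])
  have c2: "holo_chart X (U1, \<lambda>x. \<Theta> (\<phi> x))"
    by (rule holo_chart_compose[OF c1 _ fin(1)]) (use bi im in simp)
  have im2: "(\<lambda>x. \<Theta> (\<phi> x)) ` U1 = V'" using biholoD(3)[OF bi] im by (metis image_image)
  have xU1: "x \<in> U1" using xU U'(1) by (simp add: U1_def)
  have "f ` U1 \<subseteq> V"
  proof
    fix y assume "y \<in> f ` U1"
    then obtain u where u: "u \<in> U1" "y = f u" by blast
    then have "\<phi> u \<in> \<phi> ` U0" using U'(2) by (auto simp: U1_def O'_def)
    then have "u \<in> U0" using T(3) U0(2) U1(2) u(1) by (auto simp: inj_on_def)
    then show "y \<in> V" using u(2) by (simp add: U0_def)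
  qed
  moreover have "normal_germ I J \<sigma> J0 ((\<lambda>x. \<Theta> (\<phi> x)) ` U1) (\<psi> \<circ> f \<circ> inv_into U1 (\<lambda>x. \<Theta> (\<phi> x))) (\<Theta> (\<phi> x))"
    unfolding im2
  proof (rule normal_germ_cong[OF ng fin(1)])
    fix y assume "y \<in> V'"
    then obtain u where u: "u \<in> U1" "y = \<Theta> (\<phi> u)" using im2 by blast
    have "inv_into U1 (\<lambda>x. \<Theta> (\<phi> x)) y = u" using top_chartD(6)[OF holo_chartD(1)[OF c2] u(1)] u(2) by simp
    moreover have "inv_into U' \<Theta> y = \<phi> u" using biholoD(5)[OF bi, of "\<phi> u"] u im by auto
    moreover have "inv_into U \<phi> (\<phi> u) = u" using T(6) u(1) U1(2) by blast
    ultimately show "(\<psi> \<circ> f \<circ> inv_into U \<phi>) (inv_into U' \<Theta> y) = (\<psi> \<circ> f \<circ> inv_into U1 (\<lambda>x. \<Theta> (\<phi> x))) y" by simp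
  qed
  ultimately have "normal_chart x U1 (\<lambda>x. \<Theta> (\<phi> x)) V \<psi> \<sigma> J0"
    unfolding normal_chart_def using c2 xU1 d(1) by simp
  then show ?thesis by blast
qed

lemma chart_pair:
  assumes c: "holo_chart X (U1, \<phi>1)" and d: "holo_chart X (U2, \<phi>2)"
  shows "holo_chart XX (U1 \<times> U2, \<lambda>(u, u'). case_sum (\<phi>1 u) (\<phi>2 u'))"
    "(\<lambda>(u, u'). case_sum (\<phi>1 u) (\<phi>2 u')) ` (U1 \<times> U2) = cprod (\<phi>1 ` U1) (\<phi>2 ` U2)"
proof -
  show "holo_chart XX (U1 \<times> U2, \<lambda>(u, u'). case_sum (\<phi>1 u) (\<phi>2 u'))"
    by (rule holo_chart_prod[OF c d fin(1,1)])
  show "(\<lambda>(u, u'). case_sum (\<phi>1 u) (\<phi>2 u')) ` (U1 \<times> U2) = cprod (\<phi>1 ` U1) (\<phi>2 ` U2)"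
  proof
    show "cprod (\<phi>1 ` U1) (\<phi>2 ` U2) \<subseteq> (\<lambda>(u, u'). case_sum (\<phi>1 u) (\<phi>2 u')) ` (U1 \<times> U2)"
    proof
      fix p assume "p \<in> cprod (\<phi>1 ` U1) (\<phi>2 ` U2)"
      then obtain x y where "x \<in> U1" "y \<in> U2" "p \<circ> Inl = \<phi>1 x" "p \<circ> Inr = \<phi>2 y" by (auto simp: cprod_def)
      then show "p \<in> (\<lambda>(u, u'). case_sum (\<phi>1 u) (\<phi>2 u')) ` (U1 \<times> U2)"
        using case_sum_eta[of p] by (intro image_eqI[of _ _ "(x, y)"]) auto
    qed
  qed auto
qed

text \<open>A single coordinate map covers both points, because the multigerm at the fibre lives in
  one coordinate space; its restrictions to the disjoint sets \<open>U1\<close> and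
  \<open>U2\<close> give coordinates of the two factors of the product.\<close>

definition separated_charts where
  "separated_charts x x' U \<phi> V \<psi> U1 U2 \<longleftrightarrow> holo_chart X (U, \<phi>) \<and> holo_chart Y (V, \<psi>) \<and>
    openin (mtop X) U1 \<and> openin (mtop X) U2 \<and>
    U1 \<subseteq> U \<and> U2 \<subseteq> U \<and> x \<in> U1 \<and> x' \<in> U2 \<and> U1 \<inter> U2 = {} \<and> f ` U1 \<subseteq> V \<and> f ` U2 \<subseteq> V \<and>
    holo_map I J (\<phi> ` U1) (\<psi> \<circ> f \<circ> inv_into U \<phi>) \<and> holo_map I J (\<phi> ` U2) (\<psi> \<circ> f \<circ> inv_into U \<phi>) \<and>
    stable_multigerm I J (\<phi> ` fibre X f (f x)) (\<psi> \<circ> f \<circ> inv_into U \<phi>)"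

lemma separated_chartsD:
  assumes "separated_charts x x' U \<phi> V \<psi> U1 U2"
  shows "holo_chart X (U, \<phi>)" "holo_chart Y (V, \<psi>)" "openin (mtop X) U1" "openin (mtop X) U2"
    "U1 \<subseteq> U" "U2 \<subseteq> U" "x \<in> U1" "x' \<in> U2" "U1 \<inter> U2 = {}" "f ` U1 \<subseteq> V" "f ` U2 \<subseteq> V"
    "holo_map I J (\<phi> ` U1) (\<psi> \<circ> f \<circ> inv_into U \<phi>)" "holo_map I J (\<phi> ` U2) (\<psi> \<circ> f \<circ> inv_into U \<phi>)"
    "stable_multigerm I J (\<phi> ` fibre X f (f x)) (\<psi> \<circ> f \<circ> inv_into U \<phi>)"
  using assms by (simp_all add: separated_charts_def)

lemma separated_charts_exist:
  assumes x: "x \<in> points X" "x' \<in> points X" "x \<noteq> x'" and fx: "f x = f x'"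
  shows "\<exists>U \<phi> V \<psi> U1 U2. separated_charts x x' U \<phi> V \<psi> U1 U2"
proof -
  obtain U \<phi> V \<psi> where c: "holo_chart X (U, \<phi>)" "fibre X f (f x) \<subseteq> U" and d: "holo_chart Y (V, \<psi>)" "f x \<in> V"
    and st: "stable_multigerm I J (\<phi> ` fibre X f (f x)) (\<psi> \<circ> f \<circ> inv_into U \<phi>)"
    using stable_chart[OF x(1)] by blast
  note T = top_chartD[OF holo_chartD(1)[OF c(1)]]
  have xf: "x \<in> fibre X f (f x)" "x' \<in> fibre X f (f x)" using x fx by (simp_all add: fibre_def)
  obtain W where W: "\<phi> ` fibre X f (f x) \<subseteq> W" "holo_map I J W (\<psi> \<circ> f \<circ> inv_into U \<phi>)"
    using st by (auto simp: stable_multigerm_def multigerm_def)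
  have "Hausdorff_space (mtop X)" using X by (simp add: complex_manifold_def)
  then obtain A B where AB: "openin (mtop X) A" "openin (mtop X) B" "x \<in> A" "x' \<in> B" "disjnt A B"
    using x unfolding Hausdorff_space_def by blast
  define O' where "O' = {u \<in> U. \<phi> u \<in> W} \<inter> {u \<in> points X. f u \<in> V}"
  have O': "openin (mtop X) O'"
    unfolding O'_def
    by (intro openin_Int top_chart_vimage[OF holo_chartD(1)[OF c(1)]] open_vimage_f
        holo_mapD(1)[OF W(2)] top_chartD(1)[OF holo_chartD(1)[OF d(1)]])
  have xO: "x \<in> O'" "x' \<in> O'" using xf c(2) W(1) x d(2) fx by (auto simp: O'_def)
  define U1 U2 where "U1 = A \<inter> O'" and "U2 = B \<inter> O'"
  have U12: "openin (mtop X) U1" "openin (mtop X) U2" "U1 \<subseteq> U" "U2 \<subseteq> U" "x \<in> U1" "x' \<in> U2" "U1 \<inter> U2 = {}"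
    "f ` U1 \<subseteq> V" "f ` U2 \<subseteq> V"
    using AB xO O' by (auto simp: U1_def U2_def O'_def disjnt_def)
  have h1: "holo_map I J (\<phi> ` U1) (\<psi> \<circ> f \<circ> inv_into U \<phi>)"
    by (rule holo_map_subset[OF W(2) top_chart_image[OF holo_chartD(1)[OF c(1)] U12(1,3)]]) (auto simp: U1_def O'_def)
  have h2: "holo_map I J (\<phi> ` U2) (\<psi> \<circ> f \<circ> inv_into U \<phi>)"
    by (rule holo_map_subset[OF W(2) top_chart_image[OF holo_chartD(1)[OF c(1)] U12(2,4)]]) (auto simp: U2_def O'_def)
  have "separated_charts x x' U \<phi> V \<psi> U1 U2"
    unfolding separated_charts_def by (intro conjI c d U12 h1 h2 st)
  then show ?thesis by blast
qed

end

context stable_finite_map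
begin

section \<open>An analytic set containing the strict double points\<close>

lemma target_eq_iff:
  assumes "holo_chart Y (V, \<psi>)" "y \<in> V" "y' \<in> V"
  shows "(\<forall>j\<in>J. \<psi> y j = \<psi> y' j) \<longleftrightarrow> y = y'"
proof
  note T = top_chartD[OF holo_chartD(1)[OF assms(1)]]
  assume eq: "\<forall>j\<in>J. \<psi> y j = \<psi> y' j"
  have "\<psi> y \<in> cspace J" "\<psi> y' \<in> cspace J" using copen_subset[OF T(2)] assms(2,3) by auto
  then have "\<psi> y = \<psi> y'" using eq by (auto simp: cspace_def fun_eq_iff)
  then show "y = y'" using T(3) assms(2,3) by (auto simp: inj_on_def)
qed simp

lemma source_eq_iff:
  assumes "holo_chart X (U, \<phi>)" "u \<in> U" "u' \<in> U"
  shows "(\<forall>i\<in>I. \<phi> u i - \<phi> u' i = 0) \<longleftrightarrow> u = u'"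
proof
  note T = top_chartD[OF holo_chartD(1)[OF assms(1)]]
  assume eq: "\<forall>i\<in>I. \<phi> u i - \<phi> u' i = 0"
  have "\<phi> u \<in> cspace I" "\<phi> u' \<in> cspace I" using copen_subset[OF T(2)] assms(2,3) by auto
  then have "\<phi> u = \<phi> u'" using eq by (auto simp: cspace_def fun_eq_iff)
  then show "u = u'" using T(3) assms(2,3) by (auto simp: inj_on_def)
qed simp

text \<open>An analytic set containing the strict double points; its equations on the diagonal are the
  maximal minors of the divided differences.\<close>

definition Z where
  "Z = {(x, x'). x \<in> points X \<and> x' \<in> points X \<and> f x = f x' \<and> (x \<noteq> x' \<or> x \<in> \<Sigma> 1)}"

definition analytic_near where
  "analytic_near q \<longleftrightarrow> (\<exists>U \<phi> G. holo_chart XX (U, \<phi>) \<and> q \<in> U \<and> finite G \<and>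
        (\<forall>g\<in>G. holo_fun (coords XX) (\<phi> ` U) g) \<and> Z \<inter> U = {u \<in> U. \<forall>g\<in>G. g (\<phi> u) = 0})"

lemma analytic_near_outside:
  assumes x: "x \<in> points X" "x' \<in> points X" and neq: "f x \<noteq> f x'"
  shows "analytic_near (x, x')"
proof -
  have "Hausdorff_space (mtop Y)" using Y by (simp add: complex_manifold_def)
  then obtain A B where AB: "openin (mtop Y) A" "openin (mtop Y) B" "f x \<in> A" "f x' \<in> B" "disjnt A B"
    using f_points[OF x(1)] f_points[OF x(2)] neq unfolding Hausdorff_space_def by blast
  obtain U1 \<phi>1 where a1: "(U1, \<phi>1) \<in> atlas X" "x \<in> U1"
    using X x(1) unfolding complex_manifold_def by auto
  obtain U2 \<phi>2 where a2: "(U2, \<phi>2) \<in> atlas X" "x' \<in> U2"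
    using X x(2) unfolding complex_manifold_def by auto
  note c1 = holo_chart_atlas[OF X a1(1)] and c2 = holo_chart_atlas[OF X a2(1)]
  define W1 where "W1 = U1 \<inter> {u \<in> points X. f u \<in> A}"
  define W2 where "W2 = U2 \<inter> {u \<in> points X. f u \<in> B}"
  have o1: "openin (mtop X) W1" unfolding W1_def
    by (intro openin_Int open_vimage_f AB(1) top_chartD(1)[OF holo_chartD(1)[OF c1]])
  have o2: "openin (mtop X) W2" unfolding W2_def
    by (intro openin_Int open_vimage_f AB(2) top_chartD(1)[OF holo_chartD(1)[OF c2]])
  have h1: "holo_chart X (W1, \<phi>1)" by (rule holo_chart_restrict[OF c1 o1]) (simp add: W1_def)
  have h2: "holo_chart X (W2, \<phi>2)" by (rule holo_chart_restrict[OF c2 o2]) (simp add: W2_def)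
  note h = chart_pair(1)[OF h1 h2]
  \<comment> \<open>Both sides are empty: the images of \<open>W1\<close> and \<open>W2\<close>
    under \<open>f\<close> are disjoint, and the constant 1 has no zero.\<close>
  have "Z \<inter> W1 \<times> W2 = {u \<in> W1 \<times> W2. \<forall>g\<in>{\<lambda>_. 1 :: complex}. g ((\<lambda>(u, u'). case_sum (\<phi>1 u) (\<phi>2 u')) u) = 0}"
    using AB(5) by (auto simp: Z_def W1_def W2_def disjnt_def)
  moreover have "\<forall>g\<in>{\<lambda>_. 1 :: complex}. holo_fun (coords XX) ((\<lambda>(u, u'). case_sum (\<phi>1 u) (\<phi>2 u')) ` (W1 \<times> W2)) g"
    using holo_fun_const[OF top_chartD(2)[OF holo_chartD(1)[OF h]]] by simp
  moreover have "(x, x') \<in> W1 \<times> W2" using a1(2) a2(2) AB(3,4) x by (simp add: W1_def W2_def)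
  ultimately show ?thesis unfolding analytic_near_def using h finite.intros by blast
qed

lemma separated_equations:
  assumes sc: "separated_charts x x' U \<phi> V \<psi> U1 U2"
  defines "F \<equiv> \<psi> \<circ> f \<circ> inv_into U \<phi>"
  defines "g \<equiv> \<lambda>j p. F (p \<circ> Inl) j - F (p \<circ> Inr) j"
  shows "holo_chart XX (U1 \<times> U2, \<lambda>(u, u'). case_sum (\<phi> u) (\<phi> u'))"
    "(\<lambda>(u, u'). case_sum (\<phi> u) (\<phi> u')) ` (U1 \<times> U2) = cprod (\<phi> ` U1) (\<phi> ` U2)"
    "\<And>j. holo_fun (I <+> I) (cprod (\<phi> ` U1) (\<phi> ` U2)) (g j)"
    "\<And>u u'. u \<in> U1 \<Longrightarrow> u' \<in> U2 \<Longrightarrow> f u = f u' \<longleftrightarrow> (\<forall>j\<in>J. g j (case_sum (\<phi> u) (\<phi> u')) = 0)"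
proof -
  note c = separated_chartsD(1)[OF sc] and d = separated_chartsD(2)[OF sc]
    and U = separated_chartsD(3-11)[OF sc] and h = separated_chartsD(12,13)[OF sc]
  note T = top_chartD[OF holo_chartD(1)[OF c]]
  have F: "F (\<phi> u) = \<psi> (f u)" if "u \<in> U" for u using T(6)[OF that] by (simp add: F_def)
  have h1: "holo_chart X (U1, \<phi>)" by (rule holo_chart_restrict[OF c U(1,3)])
  have h2: "holo_chart X (U2, \<phi>)" by (rule holo_chart_restrict[OF c U(2,4)])
  note hh = chart_pair[OF h1 h2]
  show "holo_chart XX (U1 \<times> U2, \<lambda>(u, u'). case_sum (\<phi> u) (\<phi> u'))"
    "(\<lambda>(u, u'). case_sum (\<phi> u) (\<phi> u')) ` (U1 \<times> U2) = cprod (\<phi> ` U1) (\<phi> ` U2)" by (rule hh)+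
  have o: "copen (I <+> I) (cprod (\<phi> ` U1) (\<phi> ` U2))"
    using top_chartD(2)[OF holo_chartD(1)[OF hh(1)]] by (simp add: coords_XX hh(2))
  show "holo_fun (I <+> I) (cprod (\<phi> ` U1) (\<phi> ` U2)) (g j)" for j
    unfolding g_def
  proof (rule holo_fun_diff)
    show "holo_fun (I <+> I) (cprod (\<phi> ` U1) (\<phi> ` U2)) (\<lambda>p. F (p \<circ> Inl) j)"
      by (rule holo_fun_compose[OF holo_map_component[OF h(1), folded F_def] holo_map_Inl[OF o]])
         (use fin in \<open>auto simp: cprod_def\<close>)
    show "holo_fun (I <+> I) (cprod (\<phi> ` U1) (\<phi> ` U2)) (\<lambda>p. F (p \<circ> Inr) j)"
      by (rule holo_fun_compose[OF holo_map_component[OF h(2), folded F_def] holo_map_Inr[OF o]])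
         (use fin in \<open>auto simp: cprod_def\<close>)
  qed
  show "f u = f u' \<longleftrightarrow> (\<forall>j\<in>J. g j (case_sum (\<phi> u) (\<phi> u')) = 0)" if u: "u \<in> U1" "u' \<in> U2" for u u'
  proof -
    have "f u \<in> V" "f u' \<in> V" using u U(8,9) by blast+
    note te = target_eq_iff[OF d this]
    have "g j (case_sum (\<phi> u) (\<phi> u')) = \<psi> (f u) j - \<psi> (f u') j" for j
      using F[OF subsetD[OF U(3) u(1)]] F[OF subsetD[OF U(4) u(2)]] by (simp add: g_def)
    then show ?thesis using te by simp
  qed
qed

text \<open>As \<open>U1\<close> and \<open>U2\<close> are disjoint, membership in \<open>Z\<close>
  reduces to f u = f u', and the components of the difference serve as equations.\<close>

lemma analytic_near_off_diagonal:
  assumes x: "x \<in> points X" "x' \<in> points X" and neq: "x \<noteq> x'" and fx: "f x = f x'"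
  shows "analytic_near (x, x')"
proof -
  obtain U \<phi> V \<psi> U1 U2 where sc: "separated_charts x x' U \<phi> V \<psi> U1 U2"
    using separated_charts_exist[OF x neq fx] by blast
  note U = separated_chartsD(3-11)[OF sc]
  note T = top_chartD[OF holo_chartD(1)[OF separated_chartsD(1)[OF sc]]]
  define F where "F = \<psi> \<circ> f \<circ> inv_into U \<phi>"
  define g where "g j p = F (p \<circ> Inl) j - F (p \<circ> Inr) j" for j and p :: "'i + 'i \<Rightarrow> complex"
  note E = separated_equations[OF sc, folded F_def, folded g_def]
  let ?\<Phi> = "\<lambda>(u, u'). case_sum (\<phi> u) (\<phi> u')"
  have "Z \<inter> U1 \<times> U2 = {q \<in> U1 \<times> U2. \<forall>k\<in>g ` J. k (?\<Phi> q) = 0}"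
  proof -
    have "(u, u') \<in> Z \<longleftrightarrow> (\<forall>j\<in>J. g j (case_sum (\<phi> u) (\<phi> u')) = 0)" if u: "u \<in> U1" "u' \<in> U2" for u u'
    proof -
      have "u \<noteq> u'" using U(7) u by blast
      moreover have "u \<in> points X" "u' \<in> points X" using u U(3,4) T(4) by blast+
      ultimately show ?thesis using E(4)[OF u] by (simp add: Z_def)
    qed
    then show ?thesis by auto
  qed
  moreover have "finite (g ` J)" using fin by simp
  moreover have "\<forall>k\<in>g ` J. holo_fun (coords XX) (?\<Phi> ` (U1 \<times> U2)) k" using E(3) by (simp add: coords_XX E(2))
  moreover have "(x, x') \<in> U1 \<times> U2" using U by simp
  ultimately show ?thesis unfolding analytic_near_def using E(1) by blast
qed

lemma normal_chartD:
  assumes "normal_chart x U \<phi> V \<psi> \<sigma> J0"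
  shows "holo_chart X (U, \<phi>)" "x \<in> U" "holo_chart Y (V, \<psi>)" "f ` U \<subseteq> V"
    "normal_germ I J \<sigma> J0 (\<phi> ` U) (\<psi> \<circ> f \<circ> inv_into U \<phi>) (\<phi> x)"
    "\<And>u k. u \<in> U \<Longrightarrow> u \<in> \<Sigma> k \<longleftrightarrow> k \<le> cvec.dim (cdiff_kernel I J (\<psi> \<circ> f \<circ> inv_into U \<phi>) (\<phi> u))"
    "\<And>u. u \<in> U \<Longrightarrow> (\<psi> \<circ> f \<circ> inv_into U \<phi>) (\<phi> u) = \<psi> (f u)"
proof -
  show c: "holo_chart X (U, \<phi>)" "x \<in> U" "holo_chart Y (V, \<psi>)" "f ` U \<subseteq> V"
    and ng: "normal_germ I J \<sigma> J0 (\<phi> ` U) (\<psi> \<circ> f \<circ> inv_into U \<phi>) (\<phi> x)"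
    using assms by (simp_all add: normal_chart_def)
  show "u \<in> \<Sigma> k \<longleftrightarrow> k \<le> cvec.dim (cdiff_kernel I J (\<psi> \<circ> f \<circ> inv_into U \<phi>) (\<phi> u))" if "u \<in> U" for u k
    by (rule corank_iff[OF c(1,3) that _ normal_germD(1)[OF ng]]) (use that c(4) in auto)
  show "(\<psi> \<circ> f \<circ> inv_into U \<phi>) (\<phi> u) = \<psi> (f u)" if "u \<in> U" for u
    using top_chartD(6)[OF holo_chartD(1)[OF c(1)] that] by simp
qed

lemma analytic_near_diagonal:
  assumes x: "x \<in> points X"
  shows "analytic_near (x, x)"
proof -
  obtain U \<phi> V \<psi> \<sigma> J0 where nc: "normal_chart x U \<phi> V \<psi> \<sigma> J0"
    using normal_chart_exists[OF x] by blast
  note N = normal_chartD[OF nc]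
  note T = top_chartD[OF holo_chartD(1)[OF N(1)]]
  define F where "F = \<psi> \<circ> f \<circ> inv_into U \<phi>"
  have hF: "holo_map I J (\<phi> ` U) F" using normal_germD(1)[OF N(5)] by (simp add: F_def)
  have "\<phi> x \<in> \<phi> ` U" using N(2) by simp
  then obtain r where r: "r > 0" "polydisc I (\<phi> x) r \<subseteq> \<phi> ` U"
    using T(2) unfolding copen_iff[OF fin(1)] by blast
  define P where "P = polydisc I (\<phi> x) r"
  have Po: "copen I P" unfolding P_def by (rule copen_polydisc[OF fin(1)])
  obtain M where M: "divdiff I J (cprod P P) F M"
    using divdiff_exists[OF hF fin(1) r(2)] unfolding P_def by blast
  define U0 where "U0 = {u \<in> U. \<phi> u \<in> P}"
  have U0: "openin (mtop X) U0" "U0 \<subseteq> U"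
    unfolding U0_def by (rule top_chart_vimage[OF holo_chartD(1)[OF N(1)] Po]) auto
  have im: "\<phi> ` U0 = P" using r(2) by (auto simp: U0_def P_def)
  have xU0: "x \<in> U0" using N(2) mem_polydisc[OF _ r(1)] copen_subset[OF T(2)] by (auto simp: U0_def P_def)
  have h1: "holo_chart X (U0, \<phi>)" by (rule holo_chart_restrict[OF N(1) U0])
  note hh = chart_pair[OF h1 h1, unfolded im]
  let ?\<Phi> = "\<lambda>(u, u'). case_sum (\<phi> u) (\<phi> u')"
  obtain e where e: "bij_betw e {0..<card I} I" using ex_bij_betw_nat_finite[OF fin(1)] by blast
  define g where "g j p = (\<Sum>i\<in>I. M j i p * (p (Inl i) - p (Inr i)))" for j p
  define m where "m \<tau> p = minor (card I) e \<tau> (\<lambda>j i. M j i p)" for \<tau> p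
  \<comment> \<open>Vanishing of the functions \<open>g j\<close> expresses equality of the values
    of \<open>f\<close>; vanishing of the minors expresses a nonzero kernel vector of the matrix of
    divided differences.\<close>
  define G where "G = g ` J \<union> m ` ({0..<card I} \<rightarrow>\<^sub>E J)"
  have Bo: "copen (I <+> I) (cprod P P)" by (intro copen_cprod Po)
  have eI: "e k \<in> I" if "k < card I" for k using bij_betwE[OF e] that by simp
  have hg: "holo_fun (I <+> I) (cprod P P) (g j)" if "j \<in> J" for j
    unfolding g_def by (intro holo_fun_sum holo_fun_mult holo_fun_diff holo_fun_proj Bo divdiffD(1)[OF M that])
  have hm: "holo_fun (I <+> I) (cprod P P) (m \<tau>)" if \<tau>: "\<tau> \<in> {0..<card I} \<rightarrow>\<^sub>E J" for \<tau>
    unfolding m_def minor_def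
  proof (intro holo_fun_sum holo_fun_mult holo_fun_const holo_fun_prod Bo)
    fix \<pi> k assume "\<pi> \<in> {\<pi>. \<pi> permutes {0..<card I}}" and k: "k \<in> {0..<card I}"
    then have "\<pi> k \<in> {0..<card I}" using permutes_in_image by fastforce
    then show "holo_fun (I <+> I) (cprod P P) (\<lambda>p. M (\<tau> k) (e (\<pi> k)) p)"
      using divdiffD(1)[OF M, of "\<tau> k" "e (\<pi> k)"] eI \<tau> k by (auto simp: PiE_iff)
  qed
  have "(u, u') \<in> Z \<longleftrightarrow> (\<forall>k\<in>G. k (case_sum (\<phi> u) (\<phi> u')) = 0)" if u: "u \<in> U0" "u' \<in> U0" for u u'
  proof -
    have uU: "u \<in> U" "u' \<in> U" using u U0(2) by auto
    define p where "p = case_sum (\<phi> u) (\<phi> u')"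
    have pB: "p \<in> cprod P P" using u im by (auto simp: p_def)
    have "f u \<in> V" "f u' \<in> V" using uU N(4) by blast+
    note te = target_eq_iff[OF N(3) this]
    have gp: "g j p = \<psi> (f u) j - \<psi> (f u') j" if "j \<in> J" for j
      using divdiffD(2)[OF M that pB] N(7)[OF uU(1)] N(7)[OF uU(2)] by (simp add: g_def p_def F_def)
    have f_iff: "(\<forall>k\<in>g ` J. k p = 0) \<longleftrightarrow> f u = f u'" using te gp by auto
    have m_iff: "(\<forall>k\<in>m ` ({0..<card I} \<rightarrow>\<^sub>E J). k p = 0) \<longleftrightarrow>
      (\<exists>w. (\<exists>i\<in>I. w i \<noteq> 0) \<and> (\<forall>j\<in>J. (\<Sum>i\<in>I. M j i p * w i) = 0))"
      using noninjective_iff_minors[OF e fin, of "\<lambda>j i. M j i p"] by (simp add: m_def)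
    have "(u \<noteq> u' \<or> u \<in> \<Sigma> 1) \<longleftrightarrow> (\<exists>w. (\<exists>i\<in>I. w i \<noteq> 0) \<and> (\<forall>j\<in>J. (\<Sum>i\<in>I. M j i p * w i) = 0))"
      if feq: "f u = f u'"
    proof (cases "u = u'")
      case True
      have "M j i p = pd i (\<lambda>z. F z j) (\<phi> u)" if "j \<in> J" "i \<in> I" for i j
        using divdiffD(3)[OF M that(1) pB that(2)] True by (simp add: p_def)
      then have "(\<exists>w. (\<exists>i\<in>I. w i \<noteq> 0) \<and> (\<forall>j\<in>J. (\<Sum>i\<in>I. M j i p * w i) = 0)) \<longleftrightarrow>
        (\<exists>w. (\<exists>i\<in>I. w i \<noteq> 0) \<and> (\<forall>j\<in>J. (\<Sum>i\<in>I. pd i (\<lambda>z. F z j) (\<phi> u) * w i) = 0))"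
        by (simp cong: sum.cong)
      then show ?thesis using True N(6)[OF uU(1), of 1] kernel_nontrivial_iff[OF fin(1), of J F "\<phi> u"]
        by (simp add: F_def)
    next
      case False
      then obtain i where "i \<in> I" "\<phi> u i - \<phi> u' i \<noteq> 0" using source_eq_iff[OF N(1) uU] by blast
      moreover have "(\<Sum>i\<in>I. M j i p * (\<phi> u i - \<phi> u' i)) = 0" if "j \<in> J" for j
        using gp[OF that] feq by (simp add: g_def p_def)
      ultimately have "\<exists>w. (\<exists>i\<in>I. w i \<noteq> 0) \<and> (\<forall>j\<in>J. (\<Sum>i\<in>I. M j i p * w i) = 0)"
        by (intro exI[of _ "\<lambda>i. \<phi> u i - \<phi> u' i"]) auto
      then show ?thesis using False by simp
    qed
    moreover have "u \<in> points X" "u' \<in> points X" using uU T(4) by blast+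
    ultimately show ?thesis unfolding G_def ball_Un using f_iff m_iff by (auto simp: Z_def p_def)
  qed
  then have "Z \<inter> U0 \<times> U0 = {q \<in> U0 \<times> U0. \<forall>k\<in>G. k (?\<Phi> q) = 0}" by auto
  moreover have "finite G" using fin by (simp add: G_def finite_PiE)
  moreover have "\<forall>k\<in>G. holo_fun (coords XX) (?\<Phi> ` (U0 \<times> U0)) k"
    using hg hm unfolding hh(2) coords_XX G_def by blast
  moreover have "(x, x) \<in> U0 \<times> U0" using xU0 by simp
  ultimately show ?thesis unfolding analytic_near_def using hh(1) by blast
qed

lemma analytic_Z: "analytic_subset XX Z"
  unfolding analytic_subset_def
proof (intro conjI ballI)
  show "Z \<subseteq> points XX" by (auto simp: Z_def points_XX)
  fix q assume "q \<in> points XX"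
  then obtain x x' where q: "q = (x, x')" "x \<in> points X" "x' \<in> points X" by (auto simp: points_XX)
  have "analytic_near q"
    using analytic_near_outside analytic_near_off_diagonal analytic_near_diagonal q by (cases "f x = f x'"; cases "x = x'") auto
  then show "\<exists>U \<phi> G. holo_chart XX (U, \<phi>) \<and> q \<in> U \<and> finite G \<and>
        (\<forall>g\<in>G. holo_fun (coords XX) (\<phi> ` U) g) \<and> Z \<inter> U = {u \<in> U. \<forall>g\<in>G. g (\<phi> u) = 0}"
    by (simp add: analytic_near_def)
qed

section \<open>Bounds for the double point space\<close>

lemma S_subset_D2: "S \<subseteq> D2"
  by (auto simp: double_point_space_def analytic_closure_def)

lemma D2_subset_Z: "D2 \<subseteq> Z"
proof -
  have "S \<subseteq> Z" by (auto simp: strict_double_points_def Z_def)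
  then show ?thesis using analytic_Z by (auto simp: double_point_space_def analytic_closure_def)
qed

lemma D2_closed: "closedin (mtop XX) D2"
  unfolding double_point_space_def analytic_closure_def
proof (rule closedin_Inter)
  have "S \<subseteq> Z" by (auto simp: strict_double_points_def Z_def)
  then show "{Z. analytic_subset XX Z \<and> S \<subseteq> Z} \<noteq> {}" using analytic_Z by blast
qed (use analytic_subset_closedin in blast)

text \<open>If \<open>q\<close> were outside the closed set \<open>D2\<close>, a polydisc around it
  would miss \<open>D2\<close>; yet it contains a point shifted in coordinate \<open>k\<close>,
  which is a strict double point.\<close>

lemma D2_limit:
  assumes c: "holo_chart XX (O', \<Phi>)" and q: "q \<in> O'" and k: "k \<in> I <+> I"
    and lim: "\<And>s. s \<noteq> 0 \<Longrightarrow> (\<Phi> q)(k := \<Phi> q k + s) \<in> \<Phi> ` O' \<Longrightarrow> inv_into O' \<Phi> ((\<Phi> q)(k := \<Phi> q k + s)) \<in> S"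
  shows "q \<in> D2"
proof (rule ccontr)
  assume nq: "q \<notin> D2"
  note T = top_chartD[OF holo_chartD(1)[OF c]]
  have "openin (mtop XX) (O' - D2)" using T(1) D2_closed by (rule openin_diff)
  then have o: "copen (I <+> I) (\<Phi> ` (O' - D2))"
    using top_chart_image[OF holo_chartD(1)[OF c], of "O' - D2"] by (simp add: coords_XX)
  have "\<Phi> q \<in> \<Phi> ` (O' - D2)" using q nq by blast
  then obtain r where r: "r > 0" "polydisc (I <+> I) (\<Phi> q) r \<subseteq> \<Phi> ` (O' - D2)"
    using o unfolding copen_iff[OF finite_Plus[OF fin(1,1)]] by blast
  define s where "s = complex_of_real (r / 2)"
  have "\<Phi> q \<in> cspace (I <+> I)" using copen_subset[OF T(2)] q by (auto simp: coords_XX)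
  then have "(\<Phi> q)(k := \<Phi> q k + s) \<in> polydisc (I <+> I) (\<Phi> q) r"
    using r(1) by (intro polydisc_upd mem_polydisc k) (auto simp: s_def dist_norm)
  then obtain q' where q': "q' \<in> O' - D2" "(\<Phi> q)(k := \<Phi> q k + s) = \<Phi> q'" using r(2) by blast
  have "s \<noteq> 0" using r(1) by (simp add: s_def)
  then have "inv_into O' \<Phi> (\<Phi> q') \<in> S" using lim[of s] q' by (metis DiffD1 imageI)
  then show False using q'(1) T(6)[of q'] S_subset_D2 by auto
qed

text \<open>Coordinates of \<open>X \<times> X\<close> near a diagonal point among which are all \<open>w\<^sub>i = z\<^sub>i - z'\<^sub>i\<close> and the
  divided differences \<open>M\<^sub>j\<^sub>i\<close> of the components \<open>j \<notin> J0\<close> in the directions \<open>i \<notin> \<sigma> ` J0\<close>: there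
  \<open>f z = f z'\<close> becomes \<open>w\<^sub>i = 0\<close> for \<open>i \<in> \<sigma> ` J0\<close> and \<open>M w = 0\<close>.\<close>

definition adapted_chart where
  "adapted_chart x O' \<Phi> \<sigma> J0 \<tau> \<longleftrightarrow> holo_chart XX (O', \<Phi>) \<and> (x, x) \<in> O' \<and>
     J0 \<subseteq> J \<and> inj_on \<sigma> J0 \<and> \<sigma> ` J0 \<subseteq> I \<and>
     inj_on \<tau> (I <+> (J - J0) \<times> (I - \<sigma> ` J0)) \<and> \<tau> ` (I <+> (J - J0) \<times> (I - \<sigma> ` J0)) \<subseteq> I <+> I \<and>
     (\<forall>u u'. (u, u') \<in> O' \<longrightarrow>
        (f u = f u' \<longleftrightarrow> (\<forall>i\<in>\<sigma> ` J0. \<Phi> (u, u') (\<tau> (Inl i)) = 0) \<and>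
           (\<forall>j\<in>J - J0. (\<Sum>i\<in>I - \<sigma> ` J0. \<Phi> (u, u') (\<tau> (Inr (j, i))) * \<Phi> (u, u') (\<tau> (Inl i))) = 0)) \<and>
        (u = u' \<longleftrightarrow> (\<forall>i\<in>I. \<Phi> (u, u') (\<tau> (Inl i)) = 0))) \<and>
     (\<forall>u i1 j. (u, u) \<in> O' \<longrightarrow> u \<in> \<Sigma> 1 \<longrightarrow> I - \<sigma> ` J0 = {i1} \<longrightarrow> j \<in> J - J0 \<longrightarrow> \<Phi> (u, u) (\<tau> (Inr (j, i1))) = 0) \<and>
     (\<forall>l\<in>I <+> (J - J0) \<times> (I - \<sigma> ` J0). \<Phi> (x, x) (\<tau> l) = 0) \<and>
     (\<forall>k. x \<in> \<Sigma> k \<longleftrightarrow> k \<le> card (I - \<sigma> ` J0))"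

text \<open>The coordinates of \<open>normal_germ_product\<close> are composed with the product of a
  normal chart with itself, and the facts about germs are translated into statements about points of
  \<open>X\<close>. Afterwards a single chart of the product carries all the information.\<close>

lemma adapted_chart_exists:
  assumes x: "x \<in> points X"
  shows "\<exists>O' \<Phi> \<sigma> J0 \<tau>. adapted_chart x O' \<Phi> \<sigma> J0 \<tau>"
proof -
  obtain U \<phi> V \<psi> \<sigma> J0 where nc: "normal_chart x U \<phi> V \<psi> \<sigma> J0"
    using normal_chart_exists[OF x] by blast
  note N = normal_chartD[OF nc] note G = normal_germD[OF N(5)]
  note T = top_chartD[OF holo_chartD(1)[OF N(1)]]
  define F where "F = \<psi> \<circ> f \<circ> inv_into U \<phi>"
  have hF: "holo_map I J (\<phi> ` U) F" using G(1) by (simp add: F_def)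
  have "\<phi> x \<in> \<phi> ` U" using N(2) by simp
  then obtain r where r: "r > 0" "polydisc I (\<phi> x) r \<subseteq> \<phi> ` U"
    using T(2) unfolding copen_iff[OF fin(1)] by blast
  define P where "P = polydisc I (\<phi> x) r"
  have Po: "copen I P" unfolding P_def by (rule copen_polydisc[OF fin(1)])
  obtain M where M: "divdiff I J (cprod P P) F M"
    using divdiff_exists[OF hF fin(1) r(2)] unfolding P_def by blast
  define L where "L = I <+> (J - J0) \<times> (I - \<sigma> ` J0)"
  define Q where "Q U' V' \<Theta> \<tau> \<longleftrightarrow> case_sum (\<phi> x) (\<phi> x) \<in> U' \<and> U' \<subseteq> cprod P P \<and>
    biholo (I <+> I) (I <+> I) U' V' \<Theta> \<and> inj_on \<tau> L \<and> \<tau> ` L \<subseteq> I <+> I \<and>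
    (\<forall>p\<in>U'. (\<forall>i\<in>I. \<Theta> p (\<tau> (Inl i)) = p (Inl i) - p (Inr i)) \<and>
       (\<forall>j\<in>J - J0. \<forall>i\<in>I - \<sigma> ` J0. \<Theta> p (\<tau> (Inr (j, i))) = M j i p))" for U' V' \<Theta> \<tau>
  have "\<exists>U' V' \<Theta> \<tau>. Q U' V' \<Theta> \<tau>"
    unfolding Q_def L_def P_def
    by (rule normal_germ_product[OF N(5) fin r M[unfolded P_def F_def]])
  then obtain U' V' \<Theta> \<tau> where H: "Q U' V' \<Theta> \<tau>" by blast
  have U': "case_sum (\<phi> x) (\<phi> x) \<in> U'" "U' \<subseteq> cprod P P" and bi: "biholo (I <+> I) (I <+> I) U' V' \<Theta>"
    and \<tau>: "inj_on \<tau> L" "\<tau> ` L \<subseteq> I <+> I" using H by (simp_all add: Q_def)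
  have \<Theta>w: "\<Theta> p (\<tau> (Inl i)) = p (Inl i) - p (Inr i)" if "p \<in> U'" "i \<in> I" for p i
    using H that unfolding Q_def by blast
  have \<Theta>M: "\<Theta> p (\<tau> (Inr (j, i))) = M j i p" if "p \<in> U'" "j \<in> J - J0" "i \<in> I - \<sigma> ` J0" for p j i
    using H that unfolding Q_def by blast
  define B where "B = (\<lambda>(u, u'). case_sum (\<phi> u) (\<phi> u'))"
  note cB = chart_pair[OF N(1) N(1), folded B_def]
  note TB = top_chartD[OF holo_chartD(1)[OF cB(1)]]
  define O' where "O' = {q \<in> U \<times> U. B q \<in> U'}"
  have O': "openin (mtop XX) O'" "O' \<subseteq> U \<times> U"
    unfolding O'_def
    by (rule top_chart_vimage[OF holo_chartD(1)[OF cB(1)]]) (use biholoD(8)[OF bi] in \<open>auto simp: coords_XX\<close>)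
  have "U' \<subseteq> cprod (\<phi> ` U) (\<phi> ` U)" using U'(2) r(2) by (auto simp: cprod_def P_def)
  then have im: "B ` O' = U'" unfolding O'_def using cB(2) by auto
  have c1: "holo_chart XX (O', B)" by (rule holo_chart_restrict[OF cB(1) O'])
  define \<Phi> where "\<Phi> q = \<Theta> (B q)" for q
  have c2: "holo_chart XX (O', \<Phi>)"
    unfolding \<Phi>_def by (rule holo_chart_compose[OF c1]) (use bi im fin in \<open>auto simp: coords_XX\<close>)
  have xO: "(x, x) \<in> O'" using N(2) U'(1) by (simp add: O'_def B_def)
  have BU': "B q \<in> U'" if "q \<in> O'" for q using that by (simp add: O'_def)
  have w: "\<Phi> (u, u') (\<tau> (Inl i)) = \<phi> u i - \<phi> u' i" if "(u, u') \<in> O'" "i \<in> I" for u u' i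
    using \<Theta>w[OF BU'[OF that(1)] that(2)] by (simp add: \<Phi>_def B_def)
  have m: "\<Phi> q (\<tau> (Inr (j, i))) = M j i (B q)" if "q \<in> O'" "j \<in> J - J0" "i \<in> I - \<sigma> ` J0" for q i j
    using \<Theta>M[OF BU'[OF that(1)] that(2,3)] by (simp add: \<Phi>_def)
  have E1: "f u = f u' \<longleftrightarrow> (\<forall>i\<in>\<sigma> ` J0. \<Phi> (u, u') (\<tau> (Inl i)) = 0) \<and>
           (\<forall>j\<in>J - J0. (\<Sum>i\<in>I - \<sigma> ` J0. \<Phi> (u, u') (\<tau> (Inr (j, i))) * \<Phi> (u, u') (\<tau> (Inl i))) = 0)"
    if q: "(u, u') \<in> O'" for u u'
  proof -
    have uU: "u \<in> U" "u' \<in> U" using q O'(2) by auto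
    define p where "p = B (u, u')"
    have p: "p \<in> cprod P P" "p \<circ> Inl = \<phi> u" "p \<circ> Inr = \<phi> u'" using BU'[OF q] U'(2) by (auto simp: p_def B_def)
    have pw: "p (Inl i) - p (Inr i) = \<Phi> (u, u') (\<tau> (Inl i))" if "i \<in> I" for i
      using w[OF q that] by (simp add: p_def B_def)
    have "f u \<in> V" "f u' \<in> V" using uU N(4) by blast+
    then have "f u = f u' \<longleftrightarrow> (\<forall>j\<in>J. F (p \<circ> Inl) j = F (p \<circ> Inr) j)"
      using target_eq_iff[OF N(3)] N(7)[OF uU(1)] N(7)[OF uU(2)] unfolding p(2,3) F_def by simp
    also have "\<dots> \<longleftrightarrow> (\<forall>i\<in>\<sigma> ` J0. p (Inl i) - p (Inr i) = 0) \<and>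
       (\<forall>j\<in>J - J0. (\<Sum>i\<in>I - \<sigma> ` J0. M j i p * (p (Inl i) - p (Inr i))) = 0)"
      by (rule normal_fibre_iff[OF N(5)[folded F_def] fin(1) M p(1)]) (use p(2,3) uU in auto)
    also have "(\<forall>i\<in>\<sigma> ` J0. p (Inl i) - p (Inr i) = 0) \<longleftrightarrow> (\<forall>i\<in>\<sigma> ` J0. \<Phi> (u, u') (\<tau> (Inl i)) = 0)"
    proof (intro ball_cong refl)
      fix i assume "i \<in> \<sigma> ` J0"
      then have "i \<in> I" using G(5) by blast
      then show "(p (Inl i) - p (Inr i) = 0) = (\<Phi> (u, u') (\<tau> (Inl i)) = 0)" by (simp only: pw)
    qed
    also have "(\<forall>j\<in>J - J0. (\<Sum>i\<in>I - \<sigma> ` J0. M j i p * (p (Inl i) - p (Inr i))) = 0) \<longleftrightarrow>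
      (\<forall>j\<in>J - J0. (\<Sum>i\<in>I - \<sigma> ` J0. \<Phi> (u, u') (\<tau> (Inr (j, i))) * \<Phi> (u, u') (\<tau> (Inl i))) = 0)"
    proof (intro ball_cong refl)
      fix j assume j: "j \<in> J - J0"
      have "(\<Sum>i\<in>I - \<sigma> ` J0. M j i p * (p (Inl i) - p (Inr i))) =
        (\<Sum>i\<in>I - \<sigma> ` J0. \<Phi> (u, u') (\<tau> (Inr (j, i))) * \<Phi> (u, u') (\<tau> (Inl i)))"
        using pw m[OF q j] by (intro sum.cong refl) (simp add: p_def)
      then show "((\<Sum>i\<in>I - \<sigma> ` J0. M j i p * (p (Inl i) - p (Inr i))) = 0) =
        ((\<Sum>i\<in>I - \<sigma> ` J0. \<Phi> (u, u') (\<tau> (Inr (j, i))) * \<Phi> (u, u') (\<tau> (Inl i))) = 0)" by simp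
    qed
    finally show ?thesis .
  qed
  have E2: "u = u' \<longleftrightarrow> (\<forall>i\<in>I. \<Phi> (u, u') (\<tau> (Inl i)) = 0)" if q: "(u, u') \<in> O'" for u u'
  proof -
    have "u \<in> U" "u' \<in> U" using q O'(2) by auto
    then show ?thesis using source_eq_iff[OF N(1)] w[OF q] by simp
  qed
  \<comment> \<open>On the diagonal the divided differences are partial derivatives.\<close>
  have diag: "\<Phi> (u, u) (\<tau> (Inr (j, i))) = pd i (\<lambda>z. F z j) (\<phi> u)"
    if "(u, u) \<in> O'" "j \<in> J - J0" "i \<in> I - \<sigma> ` J0" for u i j
  proof -
    have "B (u, u) \<in> cprod P P" using BU'[OF that(1)] U'(2) by blast
    then show ?thesis using m[OF that] divdiffD(3)[OF M, of j "B (u, u)" i] that by (simp add: B_def)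
  qed
  \<comment> \<open>A kernel vector at \<open>u\<close> has zero components in the directions where
    components of \<open>f\<close> are coordinates. With one remaining direction \<open>i1\<close>
    it is a multiple of that unit vector, so every component of \<open>F\<close> has derivative zero
    along \<open>i1\<close>.\<close>
  have E3: "\<Phi> (u, u) (\<tau> (Inr (j, i1))) = 0"
    if q: "(u, u) \<in> O'" and u1: "u \<in> \<Sigma> 1" and i1: "I - \<sigma> ` J0 = {i1}" and j: "j \<in> J - J0" for u i1 j
  proof -
    have uU: "u \<in> U" using q O'(2) by auto
    then have "1 \<le> cvec.dim (cdiff_kernel I J F (\<phi> u))" using N(6) u1 by (simp add: F_def)
    then have "\<exists>w. (\<exists>i\<in>I. w i \<noteq> 0) \<and> (\<forall>j\<in>J. (\<Sum>i\<in>I. pd i (\<lambda>z. F z j) (\<phi> u) * w i) = 0)"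
      by (rule iffD1[OF kernel_nontrivial_iff[OF fin(1)]])
    then obtain v where vv: "(\<exists>i\<in>I. v i \<noteq> 0) \<and> (\<forall>j\<in>J. (\<Sum>i\<in>I. pd i (\<lambda>z. F z j) (\<phi> u) * v i) = 0)" by blast
    have v: "dd I (\<lambda>z. F z j) (\<phi> u) v = 0" if "j \<in> J" for j using vv that by (simp add: dd_def)
    have v0: "v i = 0" if "i \<in> \<sigma> ` J0" for i
    proof -
      obtain l where l: "l \<in> J0" "i = \<sigma> l" using \<open>i \<in> \<sigma> ` J0\<close> by blast
      have "dd I (\<lambda>z. F z l) (\<phi> u) v = dd I (\<lambda>z. z i) (\<phi> u) v"
        by (rule dd_cong[OF T(2) _ fin(1)]) (use uU G(6) l in \<open>auto simp: F_def\<close>)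
      moreover have "l \<in> J" "i \<in> I" using l G(3,5) by blast+
      ultimately show ?thesis using v[of l] dd_proj[OF fin(1), of i "\<phi> u" v] by simp
    qed
    obtain i where "i \<in> I" "v i \<noteq> 0" using vv by blast
    then have "i \<in> I - \<sigma> ` J0" using v0 by blast
    then have vi: "v i1 \<noteq> 0" using i1 \<open>v i \<noteq> 0\<close> by simp
    have iI: "i1 \<in> I" using i1 by blast
    have "dd I (\<lambda>z. F z j) (\<phi> u) v = pd i1 (\<lambda>z. F z j) (\<phi> u) * v i1"
    proof -
      have "(\<Sum>i\<in>I. pd i (\<lambda>z. F z j) (\<phi> u) * v i) = (\<Sum>i\<in>{i1}. pd i (\<lambda>z. F z j) (\<phi> u) * v i)"
        by (rule sum.mono_neutral_right[OF fin(1)]) (use iI v0 i1 in auto)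
      then show ?thesis by (simp add: dd_def)
    qed
    then have "pd i1 (\<lambda>z. F z j) (\<phi> u) = 0" using v[of j] vi j by auto
    then show ?thesis using diag[OF q j, of i1] i1 by auto
  qed
  have E4: "\<Phi> (x, x) (\<tau> l) = 0" if l: "l \<in> L" for l
  proof (cases l)
    case (Inl i)
    then show ?thesis using w[OF xO, of i] l by (auto simp: L_def)
  next
    case (Inr m)
    then have m: "fst m \<in> J - J0" "snd m \<in> I - \<sigma> ` J0" using l by (auto simp: L_def)
    have "pd (snd m) (\<lambda>z. F z (fst m)) (\<phi> x) = 0" using G(7)[OF m(2), of "fst m"] m(1) by (simp add: F_def)
    then show ?thesis using diag[OF xO m] Inr by simp
  qed
  \<comment> \<open>The kernel at \<open>x\<close> is the coordinate subspace of the remaining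
    directions, so its dimension counts them.\<close>
  have E5: "x \<in> \<Sigma> k \<longleftrightarrow> k \<le> card (I - \<sigma> ` J0)" for k
    using N(6)[OF N(2), of k] normal_germ_kernel[OF N(5) fin(1)] dim_cspace[of "I - \<sigma> ` J0"] fin(1) by simp
  have "adapted_chart x O' \<Phi> \<sigma> J0 \<tau>"
    unfolding adapted_chart_def L_def[symmetric]
    using c2 xO G(3-5) \<tau> E1 E2 E3 E4 E5 by (intro conjI) simp_all
  then show ?thesis by blast
qed

end

section \<open>Regular and singular points of the double point space\<close>

lemma regular_pointI_coords:
  assumes c: "holo_chart M (U, \<Phi>)" and q: "q \<in> U" "q \<in> D" and T: "T \<subseteq> coords M"
    and eq: "\<And>u. u \<in> U \<Longrightarrow> u \<in> D \<longleftrightarrow> (\<forall>t\<in>T. \<Phi> u t = 0)"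
  shows "regular_point M D q"
proof -
  have "\<Phi> ` U \<subseteq> cspace (coords M)" using top_chartD(2)[OF holo_chartD(1)[OF c]] copen_subset by blast
  \<comment> \<open>\<open>regular_point\<close> names the coordinates that stay free, so the
    complement of the vanishing ones is taken.\<close>
  then have "\<Phi> u \<in> cspace (coords M - T) \<longleftrightarrow> (\<forall>t\<in>T. \<Phi> u t = 0)" if "u \<in> U" for u
    using that T by (auto simp: cspace_def)
  then have "\<Phi> ` (D \<inter> U) = \<Phi> ` U \<inter> cspace (coords M - T)" using eq by auto
  then show ?thesis unfolding regular_point_def using c q by blast
qed

lemma dd_pair:
  assumes g: "holo_fun (I <+> I') B (\<lambda>p. g (p \<circ> Inl))" and h: "holo_fun (I <+> I') B (\<lambda>p. h (p \<circ> Inr))"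
    and fin: "finite I" "finite I'" and p: "p \<in> B"
  shows "dd (I <+> I') (\<lambda>p. g (p \<circ> Inl) - h (p \<circ> Inr)) p (case_sum v w) = dd I g (p \<circ> Inl) v - dd I' h (p \<circ> Inr) w"
proof -
  have fin2: "finite (I <+> I')" using fin by simp
  have 1: "pd q (\<lambda>p. g (p \<circ> Inl) - h (p \<circ> Inr)) p = pd q (\<lambda>p. g (p \<circ> Inl)) p - pd q (\<lambda>p. h (p \<circ> Inr)) p"
    if "q \<in> I <+> I'" for q by (rule pd_diff[OF g h fin2 p that])
  show ?thesis
    unfolding dd_def sum_Plus[OF fin]
    by (simp add: 1 InlI InrI pd_case_sum sum_negf cong: sum.cong)
qed

context stable_finite_map
begin

lemma off_diagonal_regular:
  assumes q: "(x, x') \<in> D2" and neq: "x \<noteq> x'"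
  shows "regular_point XX D2 (x, x')"
proof -
  have x: "x \<in> points X" "x' \<in> points X" "f x = f x'" using q D2_subset_Z by (auto simp: Z_def)
  obtain U \<phi> V \<psi> U1 U2 where sc: "separated_charts x x' U \<phi> V \<psi> U1 U2"
    using separated_charts_exist[OF x(1,2) neq x(3)] by blast
  note U = separated_chartsD(3-11)[OF sc]
  note T = top_chartD[OF holo_chartD(1)[OF separated_chartsD(1)[OF sc]]]
  define F where "F = \<psi> \<circ> f \<circ> inv_into U \<phi>"
  define g where "g j p = F (p \<circ> Inl) j - F (p \<circ> Inr) j" for j and p :: "'i + 'i \<Rightarrow> complex"
  note E = separated_equations[OF sc, folded F_def, folded g_def]
  note h = separated_chartsD(12,13)[OF sc, folded F_def] and st = separated_chartsD(14)[OF sc, folded F_def]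
  define A where "A = \<phi> ` fibre X f (f x)"
  define C where "C = cprod (\<phi> ` U1) (\<phi> ` U2)"
  define a a' where "a = \<phi> x" and "a' = \<phi> x'"
  have aA: "a \<in> A" "a' \<in> A" using x by (auto simp: A_def a_def a'_def fibre_def)
  have ne: "a \<noteq> a'" using T(3) neq U(3-6) by (auto simp: a_def a'_def inj_on_def subset_iff)
  have xU: "x \<in> U" "x' \<in> U" using U(3-6) by blast+
  have Feq: "F a = F a'" using T(6)[OF xU(1)] T(6)[OF xU(2)] x(3) by (simp add: F_def a_def a'_def)
  have aI: "a \<in> cspace I" using copen_subset[OF T(2)] xU(1) by (auto simp: a_def)
  have Co: "copen (I <+> I) C"
    using top_chartD(2)[OF holo_chartD(1)[OF E(1)]] unfolding E(2) by (simp add: coords_XX C_def)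
  have dC: "case_sum a a' \<in> C" using U by (simp add: C_def a_def a'_def)
  have finI: "finite (I <+> I)" using fin by simp
  have dual: "\<exists>c. (\<Sum>i\<in>I <+> I. pd i (g j0) (case_sum a a') * c i) \<noteq> 0 \<and>
     (\<forall>j\<in>J. j \<noteq> j0 \<longrightarrow> (\<Sum>i\<in>I <+> I. pd i (g j) (case_sum a a') * c i) = 0)" if j0: "j0 \<in> J" for j0
  proof -
    \<comment> \<open>The constant perturbation in direction \<open>j0\<close>, which
      \<open>stable_infinitesimal\<close> adds to the germ at \<open>a\<close> only.\<close>
    define k where "k = (\<lambda>(x :: 'i \<Rightarrow> complex) j. if j = j0 then 1 else 0 :: complex)"
    have k: "holo_map I J (cspace I) k"
      unfolding holo_map_def
    proof (intro conjI ballI copen_cspace)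
      show "k ` cspace I \<subseteq> cspace J" using j0 by (auto simp: k_def cspace_def)
      show "holo_fun I (cspace I) (\<lambda>z. k z j)" for j
        unfolding k_def by (rule holo_fun_const[OF copen_cspace])
    qed
    obtain \<kappa> W \<eta> V1 Q where V1: "A \<subseteq> V1" "Q \<inter> A = {a}" and
      rel: "\<And>x j. x \<in> V1 \<Longrightarrow> j \<in> J \<Longrightarrow> \<kappa> (F x) j + (if x \<in> Q then k x j else 0) = dd I (\<lambda>z. F z j) x (\<eta> x)"
      by (rule stable_infinitesimal[OF st[folded A_def] fin aA(1) k aI]) blast
    have aQ: "a \<in> Q" "a' \<notin> Q" using V1(2) aA ne by auto
    have "dd (I <+> I) (g j) (case_sum a a') (case_sum (\<eta> a) (\<eta> a')) = (if j = j0 then 1 else 0)" if j: "j \<in> J" for j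
    proof -
      have "dd (I <+> I) (g j) (case_sum a a') (case_sum (\<eta> a) (\<eta> a')) =
        dd I (\<lambda>z. F z j) (case_sum a a' \<circ> Inl) (\<eta> a) - dd I (\<lambda>z. F z j) (case_sum a a' \<circ> Inr) (\<eta> a')"
        unfolding g_def
      proof (rule dd_pair[OF _ _ fin(1,1) dC])
        show "holo_fun (I <+> I) C (\<lambda>p. F (p \<circ> Inl) j)"
          by (rule holo_fun_compose[OF holo_map_component[OF h(1)] holo_map_Inl[OF Co]])
             (use fin in \<open>auto simp: cprod_def C_def\<close>)
        show "holo_fun (I <+> I) C (\<lambda>p. F (p \<circ> Inr) j)"
          by (rule holo_fun_compose[OF holo_map_component[OF h(2)] holo_map_Inr[OF Co]])
             (use fin in \<open>auto simp: cprod_def C_def\<close>)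
      qed
      \<comment> \<open>The same \<kappa> serves all germs of the multigerm, so its contribution
        cancels by \<open>Feq\<close>; only the perturbation at \<open>a\<close> survives.\<close>
      also have "\<dots> = (\<kappa> (F a) j + k a j) - \<kappa> (F a') j"
        using rel[of a j] rel[of a' j] V1(1) aA aQ j by (auto simp: subset_iff)
      also have "\<dots> = (if j = j0 then 1 else 0)" by (simp add: Feq k_def)
      finally show ?thesis .
    qed
    then show ?thesis unfolding dd_def[symmetric] using j0
      by (intro exI[of _ "case_sum (\<eta> a) (\<eta> a')"]) simp
  qed
  define Q where "Q U' V' \<Theta> \<tau> \<longleftrightarrow> case_sum a a' \<in> U' \<and> U' \<subseteq> C \<and> biholo (I <+> I) (I <+> I) U' V' \<Theta> \<and>
    inj_on \<tau> J \<and> \<tau> ` J \<subseteq> I <+> I \<and> (\<forall>j\<in>J. \<forall>p\<in>U'. \<Theta> p (\<tau> j) = g j p)" for U' V' \<Theta> \<tau>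
  have "\<exists>U' V' \<Theta> \<tau>. Q U' V' \<Theta> \<tau>"
    unfolding Q_def by (rule coordinates_exist[OF fin(2) finI dC Co E(3)[folded C_def] dual])
  then obtain U' V' \<Theta> \<tau> where H: "Q U' V' \<Theta> \<tau>" by blast
  have U': "case_sum a a' \<in> U'" "U' \<subseteq> C" and bi: "biholo (I <+> I) (I <+> I) U' V' \<Theta>"
    and \<tau>: "\<tau> ` J \<subseteq> I <+> I" using H by (simp_all add: Q_def)
  have \<Theta>: "\<Theta> p (\<tau> j) = g j p" if "j \<in> J" "p \<in> U'" for j p using H that by (simp add: Q_def)
  define B where "B = (\<lambda>(u, u'). case_sum (\<phi> u) (\<phi> u'))"
  note cB = E(1,2)[folded B_def C_def]
  define O' where "O' = {q \<in> U1 \<times> U2. B q \<in> U'}"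
  have O': "openin (mtop XX) O'" "O' \<subseteq> U1 \<times> U2"
    unfolding O'_def
    by (rule top_chart_vimage[OF holo_chartD(1)[OF cB(1)]]) (use biholoD(8)[OF bi] in \<open>auto simp: coords_XX\<close>)
  have im: "B ` O' = U'" unfolding O'_def using cB(2) U'(2) by auto
  have c1: "holo_chart XX (O', B)" by (rule holo_chart_restrict[OF cB(1) O'])
  have c2: "holo_chart XX (O', \<lambda>q. \<Theta> (B q))"
    by (rule holo_chart_compose[OF c1]) (use bi im fin in \<open>auto simp: coords_XX\<close>)
  show ?thesis
  proof (rule regular_pointI_coords[OF c2 _ q])
    show "(x, x') \<in> O'" using U U'(1) by (simp add: O'_def B_def a_def a'_def)
    show "\<tau> ` J \<subseteq> coords XX" using \<tau> by (simp add: coords_XX)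
    fix s assume s: "s \<in> O'"
    obtain u u' where su: "s = (u, u')" "u \<in> U1" "u' \<in> U2" using s O'(2) by auto
    have ne: "u \<noteq> u'" using su U(7) by auto
    have p: "u \<in> points X" "u' \<in> points X" using su U(3,4) T(4) by blast+
    \<comment> \<open>Away from the diagonal every pair with equal values is a strict double point,
      so the bounds for \<open>D2\<close> coincide.\<close>
    have "s \<in> D2 \<longleftrightarrow> f u = f u'"
    proof
      show "s \<in> D2 \<Longrightarrow> f u = f u'" using D2_subset_Z su(1) by (auto simp: Z_def)
      show "f u = f u' \<Longrightarrow> s \<in> D2" using S_subset_D2 ne p su(1) by (auto simp: strict_double_points_def)
    qed
    also have "\<dots> \<longleftrightarrow> (\<forall>j\<in>J. g j (B s) = 0)" using E(4)[OF su(2,3)] by (simp add: su(1) B_def)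
    also have "\<dots> \<longleftrightarrow> (\<forall>t\<in>\<tau> ` J. \<Theta> (B s) t = 0)" using \<Theta> s by (auto simp: O'_def)
    finally show "s \<in> D2 \<longleftrightarrow> (\<forall>t\<in>\<tau> ` J. \<Theta> (B s) t = 0)" .
  qed
qed

lemma adapted_chartD:
  assumes "adapted_chart x O' \<Phi> \<sigma> J0 \<tau>"
  shows "holo_chart XX (O', \<Phi>)" "(x, x) \<in> O'" "J0 \<subseteq> J" "inj_on \<sigma> J0" "\<sigma> ` J0 \<subseteq> I"
    "inj_on \<tau> (I <+> (J - J0) \<times> (I - \<sigma> ` J0))" "\<tau> ` (I <+> (J - J0) \<times> (I - \<sigma> ` J0)) \<subseteq> I <+> I"
    "\<And>u u'. (u, u') \<in> O' \<Longrightarrow> f u = f u' \<longleftrightarrow> (\<forall>i\<in>\<sigma> ` J0. \<Phi> (u, u') (\<tau> (Inl i)) = 0) \<and>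
           (\<forall>j\<in>J - J0. (\<Sum>i\<in>I - \<sigma> ` J0. \<Phi> (u, u') (\<tau> (Inr (j, i))) * \<Phi> (u, u') (\<tau> (Inl i))) = 0)"
    "\<And>u u'. (u, u') \<in> O' \<Longrightarrow> u = u' \<longleftrightarrow> (\<forall>i\<in>I. \<Phi> (u, u') (\<tau> (Inl i)) = 0)"
    "\<And>u i1 j. (u, u) \<in> O' \<Longrightarrow> u \<in> \<Sigma> 1 \<Longrightarrow> I - \<sigma> ` J0 = {i1} \<Longrightarrow> j \<in> J - J0 \<Longrightarrow> \<Phi> (u, u) (\<tau> (Inr (j, i1))) = 0"
    "\<And>l. l \<in> I <+> (J - J0) \<times> (I - \<sigma> ` J0) \<Longrightarrow> \<Phi> (x, x) (\<tau> l) = 0"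
    "\<And>k. x \<in> \<Sigma> k \<longleftrightarrow> k \<le> card (I - \<sigma> ` J0)"
proof -
  note A = assms[unfolded adapted_chart_def]
  note B = A[THEN conjunct2, THEN conjunct2, THEN conjunct2, THEN conjunct2, THEN conjunct2, THEN conjunct2, THEN conjunct2]
  show "holo_chart XX (O', \<Phi>)" by (rule A[THEN conjunct1])
  show "(x, x) \<in> O'" by (rule A[THEN conjunct2, THEN conjunct1])
  show "J0 \<subseteq> J" by (rule A[THEN conjunct2, THEN conjunct2, THEN conjunct1])
  show "inj_on \<sigma> J0" by (rule A[THEN conjunct2, THEN conjunct2, THEN conjunct2, THEN conjunct1])
  show "\<sigma> ` J0 \<subseteq> I" by (rule A[THEN conjunct2, THEN conjunct2, THEN conjunct2, THEN conjunct2, THEN conjunct1])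
  show "inj_on \<tau> (I <+> (J - J0) \<times> (I - \<sigma> ` J0))"
    by (rule A[THEN conjunct2, THEN conjunct2, THEN conjunct2, THEN conjunct2, THEN conjunct2, THEN conjunct1])
  show "\<tau> ` (I <+> (J - J0) \<times> (I - \<sigma> ` J0)) \<subseteq> I <+> I"
    by (rule A[THEN conjunct2, THEN conjunct2, THEN conjunct2, THEN conjunct2, THEN conjunct2, THEN conjunct2, THEN conjunct1])
  show "\<And>u u'. (u, u') \<in> O' \<Longrightarrow> f u = f u' \<longleftrightarrow> (\<forall>i\<in>\<sigma> ` J0. \<Phi> (u, u') (\<tau> (Inl i)) = 0) \<and>
           (\<forall>j\<in>J - J0. (\<Sum>i\<in>I - \<sigma> ` J0. \<Phi> (u, u') (\<tau> (Inr (j, i))) * \<Phi> (u, u') (\<tau> (Inl i))) = 0)"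
    by (rule B[THEN conjunct1, rule_format, THEN conjunct1])
  show "\<And>u u'. (u, u') \<in> O' \<Longrightarrow> u = u' \<longleftrightarrow> (\<forall>i\<in>I. \<Phi> (u, u') (\<tau> (Inl i)) = 0)"
    by (rule B[THEN conjunct1, rule_format, THEN conjunct2])
  show "\<And>u i1 j. (u, u) \<in> O' \<Longrightarrow> u \<in> \<Sigma> 1 \<Longrightarrow> I - \<sigma> ` J0 = {i1} \<Longrightarrow> j \<in> J - J0 \<Longrightarrow> \<Phi> (u, u) (\<tau> (Inr (j, i1))) = 0"
    by (rule B[THEN conjunct2, THEN conjunct1, rule_format])
  show "\<And>l. l \<in> I <+> (J - J0) \<times> (I - \<sigma> ` J0) \<Longrightarrow> \<Phi> (x, x) (\<tau> l) = 0"
    by (rule B[THEN conjunct2, THEN conjunct2, THEN conjunct1, rule_format])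
  show "\<And>k. x \<in> \<Sigma> k \<longleftrightarrow> k \<le> card (I - \<sigma> ` J0)"
    by (rule B[THEN conjunct2, THEN conjunct2, THEN conjunct2, rule_format])
qed

text \<open>A point of an adapted chart at which \<open>M\<close> vanishes on the coordinate direction \<open>i1\<close> and the
  other \<open>w\<^sub>i\<close> vanish is a limit of strict double points: move it in the direction \<open>w\<^sub>i\<^sub>1\<close>.\<close>

lemma adapted_limit:
  assumes ac: "adapted_chart x O' \<Phi> \<sigma> J0 \<tau>" and q: "q \<in> O'" and i1: "i1 \<in> I - \<sigma> ` J0"
    and w: "\<And>i. i \<in> I \<Longrightarrow> i \<noteq> i1 \<Longrightarrow> \<Phi> q (\<tau> (Inl i)) = 0"
    and M: "\<And>j. j \<in> J - J0 \<Longrightarrow> \<Phi> q (\<tau> (Inr (j, i1))) = 0"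
  shows "q \<in> D2"
proof -
  note A = adapted_chartD[OF ac] note T = top_chartD[OF holo_chartD(1)[OF A(1)]]
  define L where "L = I <+> (J - J0) \<times> (I - \<sigma> ` J0)"
  note inj = A(6)[folded L_def]
  have i1I: "i1 \<in> I" using i1 by blast
  have iL: "Inl i \<in> L" if "i \<in> I" for i using that by (simp add: L_def InlI)
  \<comment> \<open>Each term of the sum M w has a vanishing factor, namely M for the index
    \<open>i1\<close> and w for the other indices, while the nonzero component of w keeps the two
    points apart.\<close>
  have strict: "u \<in> S" if u: "u \<in> O'" and wu: "\<And>i. i \<in> I \<Longrightarrow> i \<noteq> i1 \<Longrightarrow> \<Phi> u (\<tau> (Inl i)) = 0"
    and Mu: "\<And>j. j \<in> J - J0 \<Longrightarrow> \<Phi> u (\<tau> (Inr (j, i1))) = 0" and w1: "\<Phi> u (\<tau> (Inl i1)) \<noteq> 0" for u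
  proof -
    obtain y y' where y: "u = (y, y')" by (cases u)
    have "y \<noteq> y'" using A(9)[of y y'] u w1 i1I y by blast
    moreover have "f y = f y'"
    proof -
      have "\<forall>i\<in>\<sigma> ` J0. \<Phi> (y, y') (\<tau> (Inl i)) = 0"
      proof
        fix i assume "i \<in> \<sigma> ` J0"
        then have "i \<in> I" "i \<noteq> i1" using A(5) i1 by auto
        then show "\<Phi> (y, y') (\<tau> (Inl i)) = 0" using wu y by simp
      qed
      moreover have "\<forall>j\<in>J - J0. (\<Sum>i\<in>I - \<sigma> ` J0. \<Phi> (y, y') (\<tau> (Inr (j, i))) * \<Phi> (y, y') (\<tau> (Inl i))) = 0"
      proof
        fix j assume j: "j \<in> J - J0"
        show "(\<Sum>i\<in>I - \<sigma> ` J0. \<Phi> (y, y') (\<tau> (Inr (j, i))) * \<Phi> (y, y') (\<tau> (Inl i))) = 0"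
        proof (rule sum.neutral, rule ballI)
          fix i assume "i \<in> I - \<sigma> ` J0"
          then show "\<Phi> (y, y') (\<tau> (Inr (j, i))) * \<Phi> (y, y') (\<tau> (Inl i)) = 0"
            using wu[of i] Mu[OF j] y by (cases "i = i1") auto
        qed
      qed
      ultimately show ?thesis using A(8)[of y y'] u y by blast
    qed
    moreover have "y \<in> points X" "y' \<in> points X" using T(4) u y by (auto simp: points_XX)
    ultimately show ?thesis by (simp add: strict_double_points_def y)
  qed
  show ?thesis
  proof (cases "\<Phi> q (\<tau> (Inl i1)) = 0")
    \<comment> \<open>The point itself is already a strict double point.\<close>
    case False
    then show ?thesis using strict[OF q w M] S_subset_D2 by blast
  next
    case True
    show ?thesis
    proof (rule D2_limit[OF A(1) q])
      show "\<tau> (Inl i1) \<in> I <+> I" using A(7) iL[OF i1I] by (auto simp: L_def)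
      fix s :: complex
      let ?p = "(\<Phi> q)(\<tau> (Inl i1) := \<Phi> q (\<tau> (Inl i1)) + s)"
      assume s: "s \<noteq> 0" and p: "?p \<in> \<Phi> ` O'"
      define u where "u = inv_into O' \<Phi> ?p"
      have u: "u \<in> O'" "\<Phi> u = ?p" using T(7,8)[OF p] by (simp_all add: u_def)
      have ne: "\<tau> l \<noteq> \<tau> (Inl i1)" if "l \<in> L" "l \<noteq> Inl i1" for l
        using inj that iL[OF i1I] by (auto simp: inj_on_def)
      have "u \<in> S"
      proof (rule strict[OF u(1)])
        show "\<Phi> u (\<tau> (Inl i)) = 0" if "i \<in> I" "i \<noteq> i1" for i
          using ne[OF iL[OF that(1)]] that w u(2) by simp
        show "\<Phi> u (\<tau> (Inr (j, i1))) = 0" if j: "j \<in> J - J0" for j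
        proof -
          have "Inr (j, i1) \<in> L" using j i1 by (auto simp: L_def)
          then show ?thesis using ne[of "Inr (j, i1)"] M[OF j] u(2) by simp
        qed
        show "\<Phi> u (\<tau> (Inl i1)) \<noteq> 0" using True s u(2) by simp
      qed
      then show "inv_into O' \<Phi> ?p \<in> S" by (simp add: u_def)
    qed
  qed
qed

text \<open>Points of \<open>D2\<close> on the diagonal lie in \<Sigma> 1, so excluding \<Sigma> 2
  leaves exactly one kernel direction \<open>i1\<close>. Near such a point \<open>D2\<close> is
  given by w = 0 outside \<open>i1\<close> together with the vanishing of column \<open>i1\<close>
  of M: \<open>Z\<close> forces these equations, and \<open>adapted_limit\<close> shows that they
  suffice.\<close>

lemma diagonal_regular:
  assumes q: "(x, x) \<in> D2" and cr: "x \<notin> \<Sigma> 2"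
  shows "regular_point XX D2 (x, x)"
proof -
  have x: "x \<in> points X" "x \<in> \<Sigma> 1" using q D2_subset_Z by (auto simp: Z_def)
  obtain O' \<Phi> \<sigma> J0 \<tau> where ac: "adapted_chart x O' \<Phi> \<sigma> J0 \<tau>" using adapted_chart_exists[OF x(1)] by blast
  note A = adapted_chartD[OF ac]
  have "card (I - \<sigma> ` J0) = 1" using A(12)[of 1] A(12)[of 2] x(2) cr by simp
  then obtain i1 where i1: "I - \<sigma> ` J0 = {i1}" by (auto simp: card_1_singleton_iff)
  have i1I: "i1 \<in> I" "i1 \<in> I - \<sigma> ` J0" using i1 by blast+
  define L1 where "L1 = Inl ` (\<sigma> ` J0) \<union> Inr ` ((J - J0) \<times> {i1})"
  have L1: "L1 \<subseteq> I <+> (J - J0) \<times> (I - \<sigma> ` J0)" using A(5) i1 by (auto simp: L1_def)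
  show ?thesis
  proof (rule regular_pointI_coords[OF A(1,2) q])
    show "\<tau> ` L1 \<subseteq> coords XX" using L1 A(7) by (auto simp: coords_XX)
    fix s assume s: "s \<in> O'"
    obtain u u' where su: "s = (u, u')" by (cases s)
    show "s \<in> D2 \<longleftrightarrow> (\<forall>t\<in>\<tau> ` L1. \<Phi> s t = 0)"
    proof
      assume "s \<in> D2"
      then have sZ: "f u = f u'" "u \<noteq> u' \<or> u \<in> \<Sigma> 1" using D2_subset_Z su by (auto simp: Z_def)
      have E: "\<And>i. i \<in> \<sigma> ` J0 \<Longrightarrow> \<Phi> s (\<tau> (Inl i)) = 0"
        "\<And>j. j \<in> J - J0 \<Longrightarrow> \<Phi> s (\<tau> (Inr (j, i1))) * \<Phi> s (\<tau> (Inl i1)) = 0"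
        using A(8)[of u u'] sZ(1) s unfolding su i1 by auto
      \<comment> \<open>Only the product of M and w in direction \<open>i1\<close> is known to
        vanish. Off the diagonal w is nonzero there and can be cancelled; on the diagonal the
        product says nothing, and the condition \<Sigma> 1 built into \<open>Z\<close> takes
        over.\<close>
      have "\<Phi> s (\<tau> (Inr (j, i1))) = 0" if j: "j \<in> J - J0" for j
      proof (cases "u = u'")
        case True
        then show ?thesis using A(10)[OF _ _ i1 j, of u] s su sZ(2) by simp
      next
        case False
        then obtain i where "i \<in> I" "\<Phi> s (\<tau> (Inl i)) \<noteq> 0" using A(9)[of u u'] s su by blast
        moreover from this have "i = i1" using E(1) i1 by blast
        ultimately show ?thesis using E(2)[OF j] by simp
      qed
      then show "\<forall>t\<in>\<tau> ` L1. \<Phi> s t = 0" using E(1) by (auto simp: L1_def)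
    next
      assume R: "\<forall>t\<in>\<tau> ` L1. \<Phi> s t = 0"
      show "s \<in> D2"
      proof (rule adapted_limit[OF ac s i1I(2)])
        show "\<Phi> s (\<tau> (Inl i)) = 0" if "i \<in> I" "i \<noteq> i1" for i
        proof -
          have "i \<in> \<sigma> ` J0" using that i1 by blast
          then show ?thesis using R by (simp add: L1_def)
        qed
        show "\<Phi> s (\<tau> (Inr (j, i1))) = 0" if "j \<in> J - J0" for j
          using R that by (simp add: L1_def)
      qed
    qed
  qed
qed

text \<open>In a chart straightening \<open>D2\<close>, the sum of two curves in \<open>D2\<close> is again a curve in \<open>D2\<close>. On the sum
  of \<open>w = 0, M = t E\<close> and \<open>w = t e, M = 0\<close> one has \<open>M w = t\<^sup>2 E e + o(t\<^sup>2)\<close>, which does not vanish.\<close>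

lemma diagonal_singular:
  assumes x2: "x \<in> \<Sigma> 2"
  shows "(x, x) \<in> D2" "\<not> regular_point XX D2 (x, x)"
proof -
  have x: "x \<in> points X" using x2 by (simp add: corank_ge_locus_def)
  obtain O' \<Phi> \<sigma> J0 \<tau> where ac: "adapted_chart x O' \<Phi> \<sigma> J0 \<tau>" using adapted_chart_exists[OF x] by blast
  note A = adapted_chartD[OF ac] note T = top_chartD[OF holo_chartD(1)[OF A(1)]]
  define I1 J1 where "I1 = I - \<sigma> ` J0" and "J1 = J - J0"
  define L where "L = I <+> J1 \<times> I1"
  have "card I1 \<ge> 2" using A(12)[of 2] x2 by (simp add: I1_def)
  \<comment> \<open>Both curves use the direction \<open>i0\<close>. Along the curve that changes M,
    the second direction \<open>i1\<close> stays in the kernel of M, and moving w along it exhibits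
    the points of the curve as limits of strict double points.\<close>
  then obtain i0 i1 where i01: "i0 \<in> I1" "i1 \<in> I1" "i0 \<noteq> i1"
    by (metis One_nat_def card_le_Suc0_iff_eq card.infinite not_less_eq_eq numeral_2_eq_2 zero_le)
  have finJ0: "finite J0" using A(3) fin(2) finite_subset by blast
  \<comment> \<open>Otherwise \<sigma> embeds \<open>J\<close> into \<open>I\<close> and misses
    \<open>i0\<close>, against the inequality of dimensions.\<close>
  have "J1 \<noteq> {}"
  proof
    assume "J1 = {}"
    then have "J0 = J" using A(3) by (auto simp: J1_def)
    then have "card J = card (\<sigma> ` J0)" using A(4) by (simp add: card_image)
    moreover have "card (\<sigma> ` J0) < card I"
      by (rule psubset_card_mono[OF fin(1)]) (use A(5) i01(1) in \<open>auto simp: I1_def\<close>)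
    ultimately show False using dims by (simp add: cdim_def)
  qed
  then obtain j0 where j0: "j0 \<in> J1" by blast
  have iI: "i0 \<in> I" "i1 \<in> I" using i01 by (auto simp: I1_def)
  note inj = A(6)[folded I1_def J1_def, folded L_def] and \<tau>L = A(7)[folded I1_def J1_def, folded L_def]
    and E4 = A(11)[folded I1_def J1_def, folded L_def]
  have wL: "Inl i \<in> L" if "i \<in> I" for i using that by (simp add: L_def InlI)
  have mL: "Inr (j, i) \<in> L" if "j \<in> J1" "i \<in> I1" for i j using that by (simp add: L_def InrI)
  show xxD: "(x, x) \<in> D2"
  proof (rule adapted_limit[OF ac A(2)])
    show "i1 \<in> I - \<sigma> ` J0" using i01(2) by (simp add: I1_def)
    show "\<Phi> (x, x) (\<tau> (Inl i)) = 0" if "i \<in> I" for i by (rule E4[OF wL[OF that]])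
    show "\<Phi> (x, x) (\<tau> (Inr (j, i1))) = 0" if "j \<in> J - J0" for j
      by (rule E4[OF mL[OF _ i01(2)]]) (use that in \<open>simp add: J1_def\<close>)
  qed
  show "\<not> regular_point XX D2 (x, x)"
  proof
    assume "regular_point XX D2 (x, x)"
    then obtain U \<kappa> K where c: "holo_chart XX (U, \<kappa>)" and xU: "(x, x) \<in> U"
      and K: "K \<subseteq> coords XX" "\<kappa> ` (D2 \<inter> U) = \<kappa> ` U \<inter> cspace K"
      unfolding regular_point_def by blast
    note TU = top_chartD[OF holo_chartD(1)[OF c]]
    define II where "II = I <+> I"
    have finII: "finite II" using fin by (simp add: II_def)
    have coII: "coords XX = II" by (simp add: coords_XX II_def)
    have hXX: "holo_atlas XX" using holo_atlas_prod complex_manifold_imp_holo_atlas[OF X] by blast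
    define y0 where "y0 = \<Phi> (x, x)"
    define z0 where "z0 = \<kappa> (x, x)"
    have y0c: "y0 \<in> cspace II" using copen_subset[OF T(2)] A(2) by (auto simp: y0_def coII)
    \<comment> \<open>\<open>H\<close> and \<open>R\<close> are the transition maps between the
      adapted chart \<Phi> and the chart \<kappa> that straightens \<open>D2\<close>, inverse to
      each other near (x, x).\<close>
    define H where "H y = \<kappa> (inv_into O' \<Phi> y)" for y
    define R where "R z = \<Phi> (inv_into U \<kappa> z)" for z
    have hH: "holo_map II II (\<Phi> ` (O' \<inter> U)) H"
      unfolding H_def coII[symmetric] by (rule holo_chart_transition[OF hXX A(1) c])
    have hR: "holo_map II II (\<kappa> ` (U \<inter> O')) R"
      unfolding R_def coII[symmetric] by (rule holo_chart_transition[OF hXX c A(1)])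
    have RH: "R (H y) = y" "H y \<in> \<kappa> ` (U \<inter> O')" if "y \<in> \<Phi> ` (O' \<inter> U)" for y
      using that T(6) TU(6) by (auto simp: H_def R_def)
    have y0: "y0 \<in> \<Phi> ` (O' \<inter> U)" "H y0 = z0" using A(2) xU T(6)[OF A(2)] by (auto simp: y0_def z0_def H_def)
    have z0: "z0 \<in> \<kappa> ` (U \<inter> O')" "R z0 = y0" using A(2) xU TU(6)[OF xU] by (auto simp: y0_def z0_def R_def)
    have l0: "y0 (\<tau> l) = 0" if "l \<in> L" for l using E4[OF that] by (simp add: y0_def)
    \<comment> \<open>The two curves are coordinate axes of the adapted chart: one moves the entry
      \<open>(j0, i0)\<close> of M, the other moves w in direction \<open>i0\<close>.\<close>
    define lM lw where "lM = (Inr (j0, i0) :: 'i + 'j \<times> 'i)" and "lw = (Inl i0 :: 'i + 'j \<times> 'i)"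
    have lL: "lM \<in> L" "lw \<in> L" using mL[OF j0 i01(1)] wL[OF iI(1)] by (simp_all add: lM_def lw_def)
    define curve where "curve l t = y0(\<tau> l := t)" for l and t :: complex
    have curve0: "curve l 0 = y0" if "l \<in> L" for l using l0[OF that] by (auto simp: curve_def)
    have curve\<tau>: "curve l t (\<tau> m) = (if m = l then t else 0)" if "l \<in> L" "m \<in> L" for l m t
      using inj l0[OF that(2)] that by (auto simp: curve_def inj_on_def)
    have ev_curve: "\<forall>\<^sub>F t in nhds 0. curve l t \<in> \<Phi> ` (O' \<inter> U)" if l: "l \<in> L" for l
    proof -
      have "\<tau> l \<in> II" using \<tau>L l by (auto simp: II_def)
      then have "open {t. y0(\<tau> l := t) \<in> \<Phi> ` (O' \<inter> U)}"
        by (rule open_slice[OF holo_mapD(1)[OF hH] _ finII])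
      moreover have "0 \<in> {t. y0(\<tau> l := t) \<in> \<Phi> ` (O' \<inter> U)}" using curve0[OF l] y0(1) by (simp add: curve_def)
      ultimately have "\<forall>\<^sub>F t in nhds 0. t \<in> {t. y0(\<tau> l := t) \<in> \<Phi> ` (O' \<inter> U)}" by (rule eventually_nhds_in_open)
      then show ?thesis by (simp add: curve_def)
    qed
    have inD: "inv_into O' \<Phi> (curve l t) \<in> D2"
      if l: "l = lM \<or> l = lw" and t: "curve l t \<in> \<Phi> ` (O' \<inter> U)" for l t
    proof -
      define u where "u = inv_into O' \<Phi> (curve l t)"
      have u: "u \<in> O'" "\<Phi> u = curve l t" using t T(7)[of "curve l t"] T(8)[of "curve l t"] by (auto simp: u_def)
      have lL': "l \<in> L" using l lL by blast
      have val: "\<Phi> u (\<tau> m) = (if m = l then t else 0)" if "m \<in> L" for m using curve\<tau>[OF lL' that] u(2) by simp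
      show ?thesis unfolding u_def[symmetric]
      proof (cases "l = lM")
        case True
        show "u \<in> D2"
        proof (rule adapted_limit[OF ac u(1)])
          show "i1 \<in> I - \<sigma> ` J0" using i01(2) by (simp add: I1_def)
          show "\<Phi> u (\<tau> (Inl i)) = 0" if "i \<in> I" for i using val[OF wL[OF that]] True by (simp add: lM_def)
          show "\<Phi> u (\<tau> (Inr (j, i1))) = 0" if "j \<in> J - J0" for j
            using val[OF mL[OF _ i01(2)]] that True i01(3) by (simp add: lM_def J1_def)
        qed
      next
        case False
        then have lw: "l = lw" using l by blast
        show "u \<in> D2"
        proof (rule adapted_limit[OF ac u(1)])
          show "i0 \<in> I - \<sigma> ` J0" using i01(1) by (simp add: I1_def)
          show "\<Phi> u (\<tau> (Inl i)) = 0" if "i \<in> I" "i \<noteq> i0" for i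
            using val[OF wL[OF that(1)]] lw that(2) by (simp add: lw_def)
          show "\<Phi> u (\<tau> (Inr (j, i0))) = 0" if "j \<in> J - J0" for j
            using val[OF mL[OF _ i01(1)]] that lw by (simp add: lw_def J1_def)
        qed
      qed
    qed
    have inK: "H (curve l t) \<in> cspace K" if l: "l = lM \<or> l = lw" and t: "curve l t \<in> \<Phi> ` (O' \<inter> U)" for l t
    proof -
      have "inv_into O' \<Phi> (curve l t) \<in> D2 \<inter> U" using inD[OF that] t T(6) by auto
      then show ?thesis using K(2) by (auto simp: H_def)
    qed
    have dcurve: "((\<lambda>t. curve l t i) has_field_derivative (if i = \<tau> l then 1 else 0)) (at 0)" for l i
      by (cases "i = \<tau> l") (auto simp: curve_def intro!: derivative_eq_intros)
    define dH where "dH l q = (\<Sum>i\<in>II. pd i (\<lambda>y. H y q) y0 * (if i = \<tau> l then 1 else 0))" for l q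
    have dHc: "((\<lambda>t. H (curve l t) q) has_field_derivative dH l q) (at 0)" if l: "l \<in> L" for l q
      using chain_rule[OF holo_map_component[OF hH] finII ev_curve[OF l] dcurve] by (simp add: dH_def curve0[OF l])
    \<comment> \<open>The base point \<open>z0\<close> is subtracted so that the curve starts there;
      it lies in \<open>cspace K\<close> as both summands do, hence so does the combination.\<close>
    define \<gamma> where "\<gamma> t = (\<lambda>q. H (curve lM t) q + H (curve lw t) q - z0 q)" for t
    have \<gamma>0: "\<gamma> 0 = z0" using curve0[OF lL(1)] curve0[OF lL(2)] y0(2) by (simp add: \<gamma>_def)
    have d\<gamma>: "((\<lambda>t. \<gamma> t q) has_field_derivative (dH lM q + dH lw q)) (at 0)" for q
      unfolding \<gamma>_def by (auto intro!: derivative_eq_intros dHc lL)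
    have ev2: "\<forall>\<^sub>F t in nhds 0. curve lM t \<in> \<Phi> ` (O' \<inter> U) \<and> curve lw t \<in> \<Phi> ` (O' \<inter> U)"
      using ev_curve[OF lL(1)] ev_curve[OF lL(2)] by (rule eventually_conj)
    have z0K: "z0 \<in> cspace K" using inK[of lM 0] curve0[OF lL(1)] y0 by simp
    have \<gamma>K: "\<forall>\<^sub>F t in nhds 0. \<gamma> t \<in> cspace K"
      using ev2
    proof eventually_elim
      case (elim t)
      then show ?case using inK[of lM t] inK[of lw t] z0K by (simp add: \<gamma>_def cspace_def)
    qed
    have "\<forall>\<^sub>F t in nhds 0. \<gamma> t \<in> cspace II"
      using \<gamma>K by eventually_elim (use K(1) coII in \<open>auto simp: cspace_def\<close>)
    moreover obtain r where r: "r > 0" "polydisc II z0 r \<subseteq> \<kappa> ` (U \<inter> O')"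
      using z0(1) holo_mapD(1)[OF hR] unfolding copen_iff[OF finII] by blast
    moreover have "isCont (\<lambda>t. \<gamma> t q) 0" for q by (rule DERIV_isCont[OF d\<gamma>])
    ultimately have "\<forall>\<^sub>F t in nhds 0. \<gamma> t \<in> polydisc II (\<gamma> 0) r"
      by (intro eventually_polydisc finII) simp_all
    then have \<gamma>W: "\<forall>\<^sub>F t in nhds 0. \<gamma> t \<in> \<kappa> ` (U \<inter> O')"
      unfolding \<gamma>0 by eventually_elim (use r(2) in blast)
    define G where "G l t = R (\<gamma> t) (\<tau> l)" for l t
    have G0: "G l 0 = 0" if "l \<in> L" for l using \<gamma>0 z0(2) l0[OF that] by (simp add: G_def)
    \<comment> \<open>The differential of \<open>R\<close> undoes that of \<open>H\<close>, so the
      velocities of the two axes are recovered without computing either Jacobian.\<close>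
    have dR: "(\<Sum>q\<in>II. pd q (\<lambda>z. R z (\<tau> m)) z0 * dH l q) = (if m = l then 1 else 0)" if l: "l \<in> L" and m: "m \<in> L" for l m
    proof -
      have "\<forall>\<^sub>F t in nhds 0. H (curve l t) \<in> \<kappa> ` (U \<inter> O')"
        by (rule eventually_mono[OF ev_curve[OF l]]) (simp add: RH(2))
      from chain_rule[OF holo_map_component[OF hR] finII this dHc[OF l]]
      have "((\<lambda>t. R (H (curve l t)) (\<tau> m)) has_field_derivative
         (\<Sum>q\<in>II. pd q (\<lambda>z. R z (\<tau> m)) z0 * dH l q)) (at 0)" by (simp add: curve0[OF l] y0(2))
      moreover have "((\<lambda>t. R (H (curve l t)) (\<tau> m)) has_field_derivative (if \<tau> m = \<tau> l then 1 else 0)) (at 0)"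
      proof -
        have "\<forall>\<^sub>F t in nhds 0. R (H (curve l t)) (\<tau> m) = curve l t (\<tau> m)"
          by (rule eventually_mono[OF ev_curve[OF l]]) (simp add: RH(1))
        from DERIV_cong_ev[OF refl this refl] dcurve[of l "\<tau> m"] show ?thesis by simp
      qed
      moreover have "\<tau> m = \<tau> l \<longleftrightarrow> m = l" using inj l m by (auto simp: inj_on_def)
      ultimately show ?thesis using DERIV_unique by fastforce
    qed
    have dG: "(G l has_field_derivative (if l = lM then 1 else 0) + (if l = lw then 1 else 0)) (at 0)" if l: "l \<in> L" for l
    proof -
      from chain_rule[OF holo_map_component[OF hR] finII \<gamma>W d\<gamma>]
      have "(G l has_field_derivative (\<Sum>q\<in>II. pd q (\<lambda>z. R z (\<tau> l)) z0 * (dH lM q + dH lw q))) (at 0)"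
        unfolding G_def \<gamma>0 .
      then show ?thesis using dR[OF lL(1) l] dR[OF lL(2) l] by (simp add: distrib_left sum.distrib)
    qed
    \<comment> \<open>Near t = 0 the curve runs in \<open>D2\<close>, whose points satisfy f u = f
      u' by the bound \<open>Z\<close>; the row \<open>j0\<close> of M w = 0 follows.\<close>
    have zero: "\<forall>\<^sub>F t in nhds 0. (\<Sum>i\<in>I1. G (Inr (j0, i)) t * G (Inl i) t) = 0"
      using \<gamma>K \<gamma>W
    proof eventually_elim
      case (elim t)
      then have "\<gamma> t \<in> \<kappa> ` (D2 \<inter> U)" using K(2) by auto
      then obtain q where q: "q \<in> D2 \<inter> U" "\<gamma> t = \<kappa> q" by blast
      have "q \<in> O'" using elim(2) q TU(3) by (auto simp: inj_on_def)
      obtain u u' where qu: "q = (u, u')" by (cases q)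
      have "f u = f u'" using q(1) D2_subset_Z qu by (auto simp: Z_def)
      then have "(\<Sum>i\<in>I1. \<Phi> q (\<tau> (Inr (j0, i))) * \<Phi> q (\<tau> (Inl i))) = 0"
        using A(8)[of u u'] \<open>q \<in> O'\<close> qu j0 by (simp add: I1_def J1_def)
      moreover have "R (\<gamma> t) = \<Phi> q" using TU(6) q by (simp add: R_def)
      ultimately show ?case by (simp add: G_def)
    qed
    have lim: "((\<lambda>t. G l t / t) \<longlongrightarrow> (if l = lM then 1 else 0) + (if l = lw then 1 else 0)) (at 0)" if "l \<in> L" for l
      using dG[OF that] G0[OF that] by (simp add: has_field_derivative_iff)
    \<comment> \<open>Every factor vanishes at t = 0, so each product is divided by the square of
      \<open>t\<close>. In the limit only the product at \<open>i0\<close> survives, where M and w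
      both move with velocity 1.\<close>
    have "((\<lambda>t. \<Sum>i\<in>I1. (G (Inr (j0, i)) t / t) * (G (Inl i) t / t)) \<longlongrightarrow>
      (\<Sum>i\<in>I1. ((if Inr (j0, i) = lM then 1 else 0) + (if Inr (j0, i) = lw then 1 else 0)) *
        ((if Inl i = lM then 1 else 0) + (if Inl i = lw then 1 else 0)))) (at 0)"
    proof (intro tendsto_sum tendsto_mult lim)
      show "\<And>i. i \<in> I1 \<Longrightarrow> Inr (j0, i) \<in> L" by (rule mL[OF j0])
      show "\<And>i. i \<in> I1 \<Longrightarrow> Inl i \<in> L" by (rule wL) (simp add: I1_def)
    qed
    moreover have "(\<Sum>i\<in>I1. ((if Inr (j0, i) = lM then 1 else 0) + (if Inr (j0, i) = lw then 1 else 0)) *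
        ((if Inl i = lM then 1 else 0) + (if Inl i = lw then 1 else 0))) = (1 :: complex)"
    proof -
      have "(\<Sum>i\<in>I1. ((if Inr (j0, i) = lM then 1 else 0) + (if Inr (j0, i) = lw then 1 else 0)) *
        ((if Inl i = lM then 1 else 0) + (if Inl i = lw then 1 else 0))) = (\<Sum>i\<in>I1. if i = i0 then 1 else (0 :: complex))"
        by (rule sum.cong) (auto simp: lM_def lw_def)
      also have "\<dots> = 1" using i01(1) fin(1) by (simp add: I1_def)
      finally show ?thesis .
    qed
    ultimately have "((\<lambda>t. \<Sum>i\<in>I1. (G (Inr (j0, i)) t / t) * (G (Inl i) t / t)) \<longlongrightarrow> 1) (at 0)" by simp
    moreover have "((\<lambda>t. \<Sum>i\<in>I1. (G (Inr (j0, i)) t / t) * (G (Inl i) t / t)) \<longlongrightarrow> 0) (at 0)"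
    proof (rule tendsto_eventually)
      have "\<forall>\<^sub>F t in at 0. (\<Sum>i\<in>I1. G (Inr (j0, i)) t * G (Inl i) t) = 0"
        using zero by (simp add: eventually_at_filter eventually_mono)
      then show "\<forall>\<^sub>F t in at 0. (\<Sum>i\<in>I1. (G (Inr (j0, i)) t / t) * (G (Inl i) t / t)) = 0"
      proof eventually_elim
        case (elim t)
        have "(\<Sum>i\<in>I1. (G (Inr (j0, i)) t / t) * (G (Inl i) t / t)) = (\<Sum>i\<in>I1. G (Inr (j0, i)) t * G (Inl i) t) / (t * t)"
          by (simp add: sum_divide_distrib)
        then show ?case using elim by simp
      qed
    qed
    ultimately show False using tendsto_unique[of "at (0 :: complex)"] by fastforce
  qed
qed

lemma singular_locus_D2: "singular_locus XX D2 = {(x, x) |x. x \<in> \<Sigma> 2}"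
proof (intro equalityI subsetI)
  fix q assume "q \<in> singular_locus XX D2"
  then have q: "q \<in> D2" "\<not> regular_point XX D2 q" by (simp_all add: singular_locus_def)
  obtain x x' where xx: "q = (x, x')" by (cases q)
  have "x = x'" using off_diagonal_regular q xx by blast
  then show "q \<in> {(x, x) |x. x \<in> \<Sigma> 2}" using diagonal_regular q xx by blast
next
  fix q assume "q \<in> {(x, x) |x. x \<in> \<Sigma> 2}"
  then show "q \<in> singular_locus XX D2" using diagonal_singular by (auto simp: singular_locus_def)
qed

end

theorem proposition5p3:
  fixes X :: "('a, 'i) cmfd" and Y :: "('b, 'j) cmfd" and f :: "'a \<Rightarrow> 'b" and n p :: nat
  assumes "complex_manifold X" and "cdim X = n"
    and "complex_manifold Y" and "cdim Y = p"
    and "n \<le> p"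
    and "holomorphic_map X Y f" and "finite_map X Y f" and "stable_map X Y f"
  shows "singular_locus (cmfd_prod X X) (double_point_space X f) =
    {(x, x) |x. x \<in> corank_ge_locus 2 X Y f}"
proof -
  interpret stable_finite_map X Y f
    by unfold_locales (use assms in \<open>auto simp: holomorphic_map_def\<close>)
  show ?thesis by (rule singular_locus_D2)
qed

end
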